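(* Let $\mathcal{O}$ be a maximal order in a definite quaternion algebra $A$ over $\mathbb{Q}$ with reduced discriminant $D_A$. Then $$\mathrm{Vol}(\mathrm{PSL}_2(\mathcal{O})\backslash\mathbb{H}^5_\mathbb{R})=\frac{\zeta(3)\prod_{p\mid D_A}(p^3-1)(p-1)}{11520},$$ where $p$ ranges over primes.
   Context: $\mathbb{H}$ is Hamilton's real quaternion algebra with conjugation $\overline{x}$, reduced norm $\mathrm{n}(x)=x\overline{x}$ and reduced trace $\mathrm{tr}(x)=x+\overline{x}$. $A$ is a quaternion algebra over $\mathbb{Q}$ with $A\otimes_\mathbb{Q}\mathbb{R}\cong\mathbb{H}$, viewed inside $\mathbb{H}$; $D_A$ is the product of primes $p$ with $A\otimes\mathbb{Q}_p$ a division algebra. An order is a unitary subring which is a finitely generated $\mathbb{Z}$-module spanning $A$ over $\mathbb{Q}$. $\mathrm{SL}_2(\mathbb{H})$ is the group of $2\times2$ quaternionic matrices of Dieudonné determinant $1$, where $\mathrm{Det}\begin{pmatrix}\alpha&\beta\\ \gamma&\delta\end{pmatrix}^2=\mathrm{n}(\alpha\delta)+\mathrm{n}(\beta\gamma)-\mathrm{tr}(\alpha\overline{\gamma}\delta\overline{\beta})$; $\mathrm{SL}_2(\mathcal{O})=\mathrm{SL}_2(\mathbb{H})\cap M_2(\mathcal{O})$ and $\mathrm{PSL}_2(\mathcal{O})=\mathrm{SL}_2(\mathcal{O})/\{\pm\mathrm{id}\}$. $\mathbb{H}^5_\mathbb{R}$ is the upper half space $\mathbb{H}\times\,]0,+\infty[$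 with Riemannian metric $(ds^2_\mathbb{H}+dr^2)/r^2$ (constant curvature $-1$), on which $\mathrm{SL}_2(\mathbb{H})$ acts isometrically by $\begin{pmatrix}\alpha&\beta\\ \gamma&\delta\end{pmatrix}\cdot(z,r)=\Big(\frac{(\alpha z+\beta)\overline{(\gamma z+\delta)}+\alpha\overline{\gamma}r^2}{\mathrm{n}(\gamma z+\delta)+r^2\mathrm{n}(\gamma)},\frac{r}{\mathrm{n}(\gamma z+\delta)+r^2\mathrm{n}(\gamma)}\Big)$; the volume is the Riemannian volume of the quotient. $\zeta$ is the Riemann zeta function. *)

theory Defs
  imports "HOL-Analysis.Analysis"
begin

section \<open>Hamilton quaternions, modelled on real^4 (coordinates 1, i, j, k at indices 0,1,2,3)\<close>

type_synonym quat = "real^4"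

definition mkq :: "real \<Rightarrow> real \<Rightarrow> real \<Rightarrow> real \<Rightarrow> quat" where
  "mkq a b c d = (\<chi> i. if i = 0 then a else if i = 1 then b else if i = 2 then c else d)"

definition qmul :: "quat \<Rightarrow> quat \<Rightarrow> quat" where
  "qmul x y = mkq
     (x$0 * y$0 - x$1 * y$1 - x$2 * y$2 - x$3 * y$3)
     (x$0 * y$1 + x$1 * y$0 + x$2 * y$3 - x$3 * y$2)
     (x$0 * y$2 - x$1 * y$3 + x$2 * y$0 + x$3 * y$1)
     (x$0 * y$3 + x$1 * y$2 - x$2 * y$1 + x$3 * y$0)"

definition qcnj :: "quat \<Rightarrow> quat" where
  "qcnj x = mkq (x$0) (- x$1) (- x$2) (- x$3)"

definition qone :: quat where "qone = mkq 1 0 0 0"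

definition qn :: "quat \<Rightarrow> real" where
  "qn x = (x$0)^2 + (x$1)^2 + (x$2)^2 + (x$3)^2"

definition qtr :: "quat \<Rightarrow> real" where
  "qtr x = 2 * x$0"

text \<open>A is a Q-subalgebra of H (containing 1, closed under + and *) having a Q-basis
  of 4 elements which is R-linearly independent, i.e. A \<otimes> R = H.\<close>
definition definite_quat_alg :: "quat set \<Rightarrow> bool" where
  "definite_quat_alg A \<longleftrightarrow>
     (\<exists>e :: nat \<Rightarrow> quat.
        (\<forall>c :: nat \<Rightarrow> real. (\<Sum>i<4. c i *\<^sub>R e i) = 0 \<longrightarrow> (\<forall>i<4. c i = 0)) \<and>
        A = {x. \<exists>c :: nat \<Rightarrow> real. (\<forall>i<4. c i \<in> \<rat>) \<and> x = (\<Sum>i<4. c i *\<^sub>R e i)}) \<and>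
     qone \<in> A \<and> (\<forall>x\<in>A. \<forall>y\<in>A. qmul x y \<in> A)"

definition is_order :: "quat set \<Rightarrow> quat set \<Rightarrow> bool" where
  "is_order A Oo \<longleftrightarrow>
     Oo \<subseteq> A \<and> qone \<in> Oo \<and> 0 \<in> Oo \<and>
     (\<forall>x\<in>Oo. \<forall>y\<in>Oo. x + y \<in> Oo \<and> x - y \<in> Oo \<and> qmul x y \<in> Oo) \<and>
     (\<exists>S. finite S \<and> S \<subseteq> Oo \<and>
          Oo = {x. \<exists>c :: quat \<Rightarrow> int. x = (\<Sum>s\<in>S. of_int (c s) *\<^sub>R s)}) \<and>
     A = {x. \<exists>S c. finite S \<and> S \<subseteq> Oo \<and> (\<forall>s\<in>S. c s \<in> \<rat>) \<and> x = (\<Sum>s\<in>S. c s *\<^sub>R s)}"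

definition is_maximal_order :: "quat set \<Rightarrow> quat set \<Rightarrow> bool" where
  "is_maximal_order A Oo \<longleftrightarrow>
     is_order A Oo \<and> (\<forall>Oo'. is_order A Oo' \<and> Oo \<subseteq> Oo' \<longrightarrow> Oo' = Oo)"

text \<open>Points of Oo \<otimes> Z_p are encoded as p-adically convergent sequences in Oo
  (x (Suc k) - x k \<in> p^(k+1) Oo).  A \<otimes> Q_p is a division algebra iff there is no
  nonzero element of reduced norm 0; after scaling, such an element can be taken
  in Oo \<otimes> Z_p and not in p (Oo \<otimes> Z_p).  Its norm is 0 iff n(x k) \<equiv> 0 mod p^k for all k.\<close>
definition padic_isotropic :: "quat set \<Rightarrow> nat \<Rightarrow> bool" where
  "padic_isotropic Oo p \<longleftrightarrow>
     (\<exists>x :: nat \<Rightarrow> quat.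
        (\<forall>k. x k \<in> Oo) \<and>
        (\<forall>k. \<exists>y\<in>Oo. x (Suc k) - x k = (real p ^ Suc k) *\<^sub>R y) \<and>
        x 0 \<notin> (\<lambda>y. real p *\<^sub>R y) ` Oo \<and>
        (\<forall>k. \<exists>m :: int. qn (x k) = real p ^ k * of_int m))"

definition ramified :: "quat set \<Rightarrow> nat \<Rightarrow> bool" where
  "ramified A p \<longleftrightarrow> (\<exists>Oo. is_order A Oo \<and> \<not> padic_isotropic Oo p)"

type_synonym qmat = "quat \<times> quat \<times> quat \<times> quat"

definition Det_sq :: "qmat \<Rightarrow> real" where
  "Det_sq M = (case M of (a, b, c, d) \<Rightarrow>
      qn (qmul a d) + qn (qmul b c) - qtr (qmul (qmul (qmul a (qcnj c)) d) (qcnj b)))"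

definition SL2 :: "quat set \<Rightarrow> qmat set" where
  "SL2 Oo = {(a, b, c, d). a \<in> Oo \<and> b \<in> Oo \<and> c \<in> Oo \<and> d \<in> Oo \<and> Det_sq (a, b, c, d) = 1}"

definition qmat_id :: qmat where "qmat_id = (qone, 0, 0, qone)"

definition qmat_neg :: "qmat \<Rightarrow> qmat" where
  "qmat_neg M = (case M of (a, b, c, d) \<Rightarrow> (- a, - b, - c, - d))"

definition H5 :: "(quat \<times> real) set" where
  "H5 = {(z, r). r > 0}"

definition act :: "qmat \<Rightarrow> quat \<times> real \<Rightarrow> quat \<times> real" where
  "act M p = (case M of (a, b, c, d) \<Rightarrow> case p of (z, r) \<Rightarrow>
     let den = qn (qmul c z + d) + r^2 * qn c in
     ((1 / den) *\<^sub>R (qmul (qmul a z + b) (qcnj (qmul c z + d)) + (r^2) *\<^sub>R qmul a (qcnj c)),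
      r / den))"

text \<open>Hyperbolic volume measure (ds_H^2 + dr^2)/r^2 : density r^(-5) w.r.t. Lebesgue measure.\<close>
definition hyp_measure :: "(quat \<times> real) measure" where
  "hyp_measure = density lborel (\<lambda>(z, r). if r > 0 then ennreal (1 / r ^ 5) else 0)"

text \<open>Measurable fundamental domain for the action of SL2(Oo) (kernel \<plusminus>id, i.e. PSL2(Oo)).\<close>
definition fund_domain :: "qmat set \<Rightarrow> (quat \<times> real) set \<Rightarrow> bool" where
  "fund_domain G F \<longleftrightarrow>
     F \<in> sets lborel \<and> F \<subseteq> H5 \<and>
     (\<forall>p\<in>H5. \<exists>M\<in>G. act M p \<in> F) \<and>
     (\<forall>M\<in>G. M \<noteq> qmat_id \<and> M \<noteq> qmat_neg qmat_id \<longrightarrow>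
        emeasure hyp_measure (F \<inter> act M ` F) = 0)"

definition zeta3 :: real where
  "zeta3 = (\<Sum>n. 1 / (real (Suc n)) ^ 3)"

end

(*
  The volume is obtained by counting integral rows in two ways. A point w = (z, r) defines the
  quadratic form Q_w(c, d) = (n(c z + d) + r^2 n(c)) / r on O^2, and G = SL_2(O) acts compatibly on
  points and rows. On the one hand, the number of nonzero rows with Q_w <= T is asymptotic to
  (pi^4 / 24) T^4 / covol(O)^2, with a domination which allows one to integrate over a fundamental
  domain. On the other hand, the direct sum of two right ideals K, I is always free (Schanuel's lemma
  changes the pair by ideals of prime norm, and Minkowski's theorem shows that every ideal norm is the
  norm of an element of A). Hence the G-orbits of rows are indexed by the integral right ideal I
  generated by the two entries and by the class of the complementary ideal K, and unfolding the orbits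
  yields covol(O) T^4 / 2 times (sum over classes K of 1 / |Aut K|) (sum over I of N(I)^-4).
  The number of integral right ideals of norm n is the sum of the divisors of n which are prime to the
  discriminant D. This evaluates the sum over I as zeta(4) zeta(3) prod_{p | D} (1 - p^-3); comparing
  it with the number of lattice points in the ideal classes gives prod_{p | D} (p - 1) / 24 for the sum
  over K. Finally covol(O) = D / 4 and zeta(4) = pi^4 / 90.
*)
theory Submission
  imports Defs "HOL-Real_Asymp.Real_Asymp"
begin

section \<open>Quaternions\<close>

text \<open>The obstacle is that \<open>Oo\<close> need not be principal: an integral row need not
  be a multiple of a unimodular one. Admitting every right ideal I as the span of a row, together
  with every complement K, keeps all rows in play, and the resulting double sum separates into a
  zeta factor over I and a mass factor over the classes of K. Neither adeles nor completions are
  used. At a prime p, an ideal I is replaced by x O with x in I and n(x)/N(I) prime to p; it has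
  index prime to p in I, and a global identity follows from its validity at every p. Maximality of
  the order enters through one criterion, \<open>O_maximal\<close>: an element with integral norm
  and integral traces against the order belongs to it. Finiteness of the volume is not assumed but
  comes out of Fatou's lemma. The two factors pi^4, one from the unit ball of R^8 and one from
  zeta(4), cancel.\<close>

notation qmul (infixl "*." 70)
notation scaleR (infixr "*R" 75)

abbreviation nnint :: "'a measure => ('a => ennreal) => ennreal" where "nnint == nn_integral"
abbreviation csum :: "'a set => ('a => ennreal) => ennreal" where "csum S == nn_integral (count_space S)"

lemma four_distinct: "(0::4) ~= 1" "(0::4) ~= 2" "(0::4) ~= 3" "(1::4) ~= 2" "(1::4) ~= 3" "(2::4) ~= 3"
 by (simp_all)

lemma UNIV_four: "(UNIV :: 4 set) = {0, 1, 2, 3}"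
proof -
 have "(4::4) = 0" by simp
 then show ?thesis using UNIV_4 by (metis insert_commute)
qed

lemma forall_four: "(ALL i::4. P i) \<longleftrightarrow> P 0 & P 1 & P 2 & P 3"
 using UNIV_four by (metis UNIV_I empty_iff insert_iff)

lemma sum_four: "(SUM i:(UNIV::4 set). f i) = f 0+f 1+f 2+f 3"
 unfolding UNIV_four using four_distinct by (simp add: add.assoc)

lemma quat_eq_iff: "(x::quat) = y \<longleftrightarrow> x$0 = y$0 & x$1 = y$1 & x$2 = y$2 & x$3 = y$3"
 unfolding vec_eq_iff forall_four ..

lemma mkq_nth [simp]: "mkq a b c d $ 0 = a" "mkq a b c d $ 1 = b" "mkq a b c d $ 2 = c" "mkq a b c d $ 3 = d"
 unfolding mkq_def by (auto)

lemma qmul_nth: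
 "(x*.y) $ 0 = x$0*y$0-x$1*y$1-x$2*y$2-x$3*y$3"
 "(x*.y) $ 1 = x$0*y$1+x$1*y$0+x$2*y$3-x$3*y$2"
 "(x*.y) $ 2 = x$0*y$2-x$1*y$3+x$2*y$0+x$3*y$1"
 "(x*.y) $ 3 = x$0*y$3+x$1*y$2-x$2*y$1+x$3*y$0"
 unfolding qmul_def by simp_all

lemma qcnj_nth: "qcnj x $ 0 = x$0" "qcnj x $ 1 = - x$1" "qcnj x $ 2 = - x$2" "qcnj x $ 3 = - x$3"
 unfolding qcnj_def by simp_all

lemma qone_nth: "qone $ 0 = 1" "qone $ 1 = 0" "qone $ 2 = 0" "qone $ 3 = 0"
 unfolding qone_def by simp_all

lemmas qcoords = quat_eq_iff qmul_nth qcnj_nth qone_nth qn_def qtr_def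

lemma qmul_assoc: "x*.y*.z = x*.(y*.z)"
 by (simp add: qcoords algebra_simps)

lemma qmul_add: "(x+y)*.z = x*.z+y*.z" "x*.(y+z) = x*.y+x*.z"
 by (simp_all add: qcoords algebra_simps)

lemma qmul_diff: "(x-y)*.z = x*.z-y*.z" "x*.(y-z) = x*.y-x*.z"
 by (simp_all add: qcoords algebra_simps)

lemma qmul_minus [simp]: "(- x)*.z = - (x*.z)" "x*.(- z) = - (x*.z)"
 by (simp_all add: qcoords algebra_simps)

lemma qmul_scaleR [simp]: "(a*R x)*.z = a*R (x*.z)" "x*.(a*R z) = a*R (x*.z)"
 by (simp_all add: qcoords algebra_simps)

lemma qmul_zero [simp]: "0*.x = 0" "x*.0 = 0"
 by (simp_all add: qcoords)

lemma qmul_one [simp]: "qone*.x = x" "x*.qone = x"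
 by (simp_all add: qcoords)

lemma qmul_sum: "sum f S*.x = (SUM s:S. f s*.x)" "x*.sum f S = (SUM s:S. x*.f s)"
 by (induction S rule: infinite_finite_induct) (simp_all add: qmul_add)

lemma qcnj_add: "qcnj (x+y) = qcnj x+qcnj y"
 and qcnj_diff: "qcnj (x-y) = qcnj x-qcnj y"
 and qcnj_minus [simp]: "qcnj (- x) = - qcnj x"
 and qcnj_scaleR [simp]: "qcnj (a*R x) = a*R qcnj x"
 and qcnj_qcnj [simp]: "qcnj (qcnj x) = x"
 and qcnj_qmul: "qcnj (x*.y) = qcnj y*.qcnj x"
 and qcnj_one [simp]: "qcnj qone = qone"
 and qcnj_zero [simp]: "qcnj 0 = 0"
 by (simp_all add: qcoords algebra_simps)

lemmas qring = qmul_assoc qmul_add qmul_diff qcnj_add qcnj_diff qcnj_qmul scaleR_add_right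
 scaleR_diff_right scaleR_add_left scaleR_diff_left

lemma qn_qmul: "qn (x*.y) = qn x*qn y"
 by (simp add: qcoords power2_eq_square algebra_simps)

lemma qn_simps [simp]: "qn (qcnj x) = qn x" "qn (- x) = qn x" "qn (a*R x) = a^2*qn x"
 "qn qone = 1" "qn 0 = 0"
 by (simp_all add: qcoords power_mult_distrib algebra_simps)

lemma qn_norm: "qn x = (norm x)^2"
 unfolding norm_vec_def L2_set_def sum_four qn_def
 by (subst real_sqrt_pow2) (auto intro: add_nonneg_nonneg)

lemma qn_nonneg [simp]: "qn x >= 0"
 by (simp add: qn_norm)

lemma qn_eq_0 [simp]: "qn x = 0 \<longleftrightarrow> x = 0"
 by (simp add: qn_norm)

lemma qn_pos [simp]: "qn x > 0 \<longleftrightarrow> x ~= 0"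
 by (simp add: qn_norm)

lemma qmul_eq_0 [simp]: "x*.y = 0 \<longleftrightarrow> x = 0 | y = 0"
 by (metis mult_eq_0_iff qn_eq_0 qn_qmul)

lemma qone_neq_0 [simp]: "qone ~= 0" "0 ~= qone"
 by (simp_all add: qcoords)

lemma qmul_qcnj: "x*.qcnj x = qn x*R qone" "qcnj x*.x = qn x*R qone"
 by (simp_all add: qcoords power2_eq_square algebra_simps)

lemma qmul_qcnj_left: "x*.(qcnj x*.y) = qn x*R y" "qcnj x*.(x*.y) = qn x*R y"
 by (simp_all add: qmul_assoc[symmetric] qmul_qcnj)

lemma qtr_simps [simp]: "qtr (- x) = - qtr x" "qtr (a*R x) = a*qtr x" "qtr (qcnj x) = qtr x"
 "qtr 0 = 0" "qtr qone = 2"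
 and qtr_add: "qtr (x+y) = qtr x+qtr y"
 and qtr_diff: "qtr (x-y) = qtr x-qtr y"
 by (simp_all add: qcoords algebra_simps)

lemma qtr_commute: "qtr (x*.y) = qtr (y*.x)"
 by (simp add: qcoords algebra_simps)

lemma qtr_cyclic: "qtr (x*.(y*.z)) = qtr (y*.(z*.x))"
 by (metis qtr_commute qmul_assoc)

lemma qtr_cnj_swap: "qtr (x*.qcnj y) = qtr (y*.qcnj x)"
 by (metis qcnj_qcnj qcnj_qmul qtr_simps(3))

lemma qcnj_eq: "qcnj x = qtr x*R qone-x"
 by (simp add: qcoords)

lemma qtr_qone: "x+qcnj x = qtr x*R qone"
 by (simp add: qcoords)

lemma qtr_inner: "qtr (x*.qcnj y) = 2*(x \<bullet> y)"
 by (simp add: inner_vec_def sum_four qcoords)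

lemma qn_add: "qn (x+y) = qn x+qn y+qtr (x*.qcnj y)"
 by (simp add: qcoords power2_eq_square algebra_simps)

lemma qn_diff: "qn (x-y) = qn x+qn y-qtr (x*.qcnj y)"
 by (simp add: qcoords power2_eq_square algebra_simps)

text \<open>Cayley-Hamilton for \<open>u*.y\<close> with \<open>u\<close> cancelled on the left. A
  word with two factors \<open>y\<close> becomes linear in \<open>y\<close>; this closes O + O y O
  under products, and it shows that e x e is a scalar multiple of e modulo p when p divides
  n(e).\<close>

lemma qmul_sandwich: "y*.u*.y = qtr (u*.y)*R y-qn y*R qcnj u"
 by (simp add: qcoords power2_eq_square algebra_simps)

lemma qmul_square: "y*.y = qtr y*R y-qn y*R qone"
 using qmul_sandwich[of y qone] by simp

lemma central_quat:
 assumes "!!z. a*.z = z*.a"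
 shows "EX t. a = t*R qone"
proof -
 have "a*.mkq 0 1 0 0 = mkq 0 1 0 0*.a" "a*.mkq 0 0 1 0 = mkq 0 0 1 0*.a" using assms by auto
 then have "a$1 = 0" "a$2 = 0" "a$3 = 0" by (auto simp: qcoords)
 then have "a = a$0*R qone" by (simp add: qcoords)
 then show ?thesis ..
qed

section \<open>Inverses, continuity and measurability of the quaternion operations\<close>

definition qinv :: "quat => quat" where
 "qinv x = (1/qn x)*R qcnj x"

lemma qinv_right [simp]: "x ~= 0 ==> x*.qinv x = qone"
 and qinv_left [simp]: "x ~= 0 ==> qinv x*.x = qone"
 by (simp_all add: qinv_def qmul_qcnj)

lemma qinv_right_left [simp]: "x ~= 0 ==> x*.(qinv x*.y) = y"
 and qinv_left_left [simp]: "x ~= 0 ==> qinv x*.(x*.y) = y"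
 by (simp_all add: qmul_assoc[symmetric])

lemma qn_qinv [simp]: "qn (qinv x) = 1/qn x"
 by (cases "x = 0") (simp_all add: qinv_def power2_eq_square)

lemma qinv_eq_0 [simp]: "qinv x = 0 \<longleftrightarrow> x = 0"
 by (metis qn_eq_0 qn_qinv divide_eq_0_iff zero_neq_one)

lemma qmul_left_cancel: "x ~= 0 ==> x*.y = x*.z \<longleftrightarrow> y = z"
 by (metis qinv_left_left)

lemma qmul_right_cancel: "x ~= 0 ==> y*.x = z*.x \<longleftrightarrow> y = z"
 by (metis qinv_right qmul_assoc qmul_one(2))

lemma norm_qmul: "norm (x*.y) = norm x*norm y"
proof -
 have "(norm (x*.y))\<^sup>2 = (norm x*norm y)\<^sup>2"
  using qn_qmul[of x y] by (simp add: qn_norm power_mult_distrib)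
 then show ?thesis by (simp add: power2_eq_iff_nonneg)
qed

lemma bounded_bilinear_qmul: "bounded_bilinear qmul"
 by unfold_locales (auto simp: qmul_add norm_qmul intro!: exI[of _ 1])

lemma bounded_linear_qcnj: "bounded_linear qcnj"
 by (intro linear_conv_bounded_linear[THEN iffD1] linearI) (simp_all add: qcnj_add)

lemma continuous_on_qmul [continuous_intros]:
 "continuous_on S f ==> continuous_on S g ==> continuous_on S (%x. f x*.g x)"
 by (rule bounded_bilinear.continuous_on[OF bounded_bilinear_qmul])

lemma continuous_on_qcnj [continuous_intros]:
 "continuous_on S f ==> continuous_on S (%x. qcnj (f x))"
 by (rule bounded_linear.continuous_on[OF bounded_linear_qcnj])

lemma continuous_on_qn [continuous_intros]:
 "continuous_on S f ==> continuous_on S (%x. qn (f x))"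
 unfolding qn_norm by (intro continuous_intros)

lemma measurable_qmul [measurable]:
 "f:borel_measurable M ==> g:borel_measurable M ==> (%x. f x*.g x):borel_measurable M"
 by (rule borel_measurable_continuous_Pair) (auto intro!: continuous_intros)

lemma measurable_qcnj [measurable]:
 "f:borel_measurable M ==> (%x. qcnj (f x)):borel_measurable M"
 by (rule borel_measurable_continuous_on[OF continuous_on_qcnj[OF continuous_on_id]])

lemma measurable_qn [measurable]:
 "f:borel_measurable M ==> (%x. qn (f x)):borel_measurable M"
 unfolding qn_norm by measurable

section \<open>Invariance of the hyperbolic measure\<close>

lemma nn_integral_hyp:
 assumes [measurable]: "f:borel_measurable borel"
 shows "nnint hyp_measure (%w. f w) =
  nnint lborel (%z. nnint lborel (%r. f (z, r)*(ennreal (1/r^5)*indicator {0<..} r)))"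
proof -
 have 1: "(%(z::quat, r::real). if r > 0 then ennreal (1/r^5) else 0)
   = (%w. ennreal (1/snd w^5)*indicator {0<..} (snd w))"
  by (auto simp: fun_eq_iff)
 have [measurable]: "(%w. ennreal (1/snd w^5)*indicator {0<..} (snd w)):borel_measurable (borel :: (quat \<times> real) measure)"
  unfolding borel_prod[symmetric] by measurable
 have "nnint hyp_measure (%w. f w) =
  nnint (lborel \<Otimes>\<^sub>M lborel) (%w. (ennreal (1/snd w^5)*indicator {0<..} (snd w))*f w)"
  unfolding hyp_measure_def 1 lborel_prod
  by (subst nn_integral_density) auto
 also have "... = nnint lborel (%z. nnint lborel (%r. f (z, r)*(ennreal (1/r^5)*indicator {0<..} r)))"
 proof -
  have "(%w. (ennreal (1/snd w^5)*indicator {0<..} (snd w))*f w):borel_measurable (lborel \<Otimes>\<^sub>M lborel)"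
   unfolding lborel_prod by measurable
  from lborel.nn_integral_fst[OF this] show ?thesis by (simp add: mult.commute)
 qed
 finally show ?thesis .
qed

lemma sets_hyp [simp, measurable_cong]: "sets hyp_measure = sets borel"
 unfolding hyp_measure_def by simp

lemma space_hyp [simp]: "space hyp_measure = UNIV"
 unfolding hyp_measure_def by simp

lemma distr_orthogonal:
 fixes f :: "real^'n::{finite,wellorder} => real^'n::_"
 assumes "orthogonal_transformation f"
 shows "distr lborel borel f = lborel"
proof (rule sym, rule lborel_eqI)
 have cont: "f:borel_measurable borel"
  using assms by (intro borel_measurable_continuous_onI)
   (simp add: linear_continuous_on linear_conv_bounded_linear[symmetric] orthogonal_transformation_linear)
 fix l u :: "real^'n::{finite,wellorder}" assume le: "!!b. b:Basis ==> l \<bullet> b <= u \<bullet> b"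
 have inv: "orthogonal_transformation (inv f)" "bij f"
  using assms orthogonal_transformation_inv orthogonal_transformation_bij by blast+
 have eq: "f -` box l u = inv f ` box l u"
  using inv(2) by (simp add: bij_vimage_eq_inv_image)
 have "emeasure (distr lborel borel f) (box l u) = emeasure lborel (f -` box l u)"
  using cont by (subst emeasure_distr) auto
 also have "... = emeasure lebesgue (inv f ` box l u)"
  unfolding eq[symmetric] using cont by (simp add: measurable_sets_borel)
 also have "... = ennreal (measure lebesgue (inv f ` box l u))"
  by (rule emeasure_eq_ennreal_measure)
    (rule fmeasurableD2[OF measurable_orthogonal_image[OF inv(1) lmeasurable_box]])
 also have "... = emeasure lborel (box l u)"
  using measure_orthogonal_image[OF inv(1) lmeasurable_box] le
  by (simp add: emeasure_lborel_box_eq measure_lborel_box_eq)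
 finally show "emeasure (distr lborel borel f) (box l u) = (PROD b:Basis. (u-l) \<bullet> b)"
  using le by simp
qed simp

lemma nn_integral_orthogonal:
 fixes f :: "real^'n::{finite,wellorder} => real^'n::_"
 assumes "orthogonal_transformation f" and [measurable]: "h:borel_measurable borel"
 shows "nnint lborel (%x. h (f x)) = nnint lborel (%x. h x)"
proof -
 have [measurable]: "f:borel_measurable borel"
  using assms by (intro borel_measurable_continuous_onI)
   (simp add: linear_continuous_on linear_conv_bounded_linear[symmetric] orthogonal_transformation_linear)
 show ?thesis
  by (subst (2) distr_orthogonal[OF assms(1), symmetric]) (simp add: nn_integral_distr)
qed

lemma nn_integral_quat_affine:
 assumes "c ~= 0" and [measurable]: "h:borel_measurable borel"
 shows "nnint lborel (%x. h x) = ennreal (c^4)*nnint lborel (%x. h (b+c*R (x::quat)))"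
 by (subst lborel_affine[OF assms(1), of b])
   (simp add: nn_integral_density nn_integral_distr nn_integral_cmult)

text \<open>A two-sided multiplication is t times an orthogonal map because the norm is
  multiplicative; hence the Jacobian t^4.\<close>

lemma nn_integral_quat_similarity:
 assumes t: "qn a*qn c = t^2" "t > 0" and [measurable]: "h:borel_measurable borel"
 shows "nnint lborel (%x. h x) = ennreal (t^4)*nnint lborel (%x. h (a*.x*.c+b))"
proof -
 define f where "f x = (1/t)*R (a*.x*.c)" for x
 have "linear f" by (rule linearI) (auto simp: f_def qring)
 moreover have "norm (f x) = norm x" for x
 proof -
  have "(norm (f x))\<^sup>2 = (norm x)\<^sup>2"
   unfolding qn_norm[symmetric] using t by (simp add: f_def qn_qmul field_simps power2_eq_square)
  then show ?thesis by simp
 qed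
 ultimately have f: "orthogonal_transformation f" by (simp add: orthogonal_transformation)
 have "nnint lborel (%x. h x) = ennreal (t^4)*nnint lborel (%x. h (b+t*R x))"
  by (rule nn_integral_quat_affine) (use t in auto)
 also have "nnint lborel (%x. h (b+t*R x)) = nnint lborel (%x. h (b+t*R (f x)))"
  by (rule nn_integral_orthogonal[OF f, symmetric]) simp
 also have "(%x. b+t*R f x) = (%x. a*.x*.c+b)"
  using t by (auto simp: f_def)
 finally show ?thesis .
qed

lemma nn_integral_qcnj:
 assumes [measurable]: "h:borel_measurable borel"
 shows "nnint lborel (%x. h (qcnj x)) = nnint lborel (%x. h x)"
proof (rule nn_integral_orthogonal)
 have "norm (qcnj x) = norm x" for x
  using qn_simps(1)[of x] unfolding qn_norm by simp
 then show "orthogonal_transformation qcnj"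
  unfolding orthogonal_transformation
  using bounded_linear_qcnj bounded_linear.linear by blast
qed simp

text \<open>Substitution on the compact intervals [A n, B n] passes to their union by continuity of
  measure from below; for this the endpoints and their images have to move monotonically.\<close>

lemma nn_integral_substitution_Un:
 fixes f :: "real => ennreal" and A B :: "nat => real"
 assumes f: "f:borel_measurable borel"
  and AB: "!!n. A n < B n" "decseq A" "incseq B" "decseq (%n. g (A n))" "incseq (%n. g (B n))"
  and I: "(UN n. {A n..B n}) = I" and J: "(UN n. {g (A n)..g (B n)}) = J"
  and g: "!!x. x:I ==> (g has_real_derivative g' x) (at x)" "continuous_on I g'"
   "!!x. x:I ==> g' x >= 0" "(%x. f (g x)*ennreal (g' x)):borel_measurable borel"
 shows "nnint lborel (%x. f x*indicator J x) = nnint lborel (%x. f (g x)*ennreal (g' x)*indicator I x)"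
proof -
 let ?h = "%x. f (g x)*ennreal (g' x)"
 have eq: "nnint lborel (%x. f x*indicator {g (A n)..g (B n)} x) =
   nnint lborel (%x. ?h x*indicator {A n..B n} x)" for n
 proof (rule nn_integral_substitution_aux)
  have sub: "{A n..B n} <= I" using I by blast
  show "(g has_real_derivative g' x) (at x)" "g' x >= 0" if "x:{A n..B n}" for x
   using g sub that by blast+
  show "continuous_on {A n..B n} g'" using g(2) sub by (rule continuous_on_subset)
 qed (use AB f in auto)
 have "nnint lborel (%x. f x*indicator J x) = emeasure (density lborel f) J"
  using f J[symmetric] by (subst emeasure_density) auto
 also have "... = (SUP n. emeasure (density lborel f) {g (A n)..g (B n)})"
  unfolding J[symmetric] using AB(4,5)
  by (subst SUP_emeasure_incseq) (force simp: incseq_def decseq_def)+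
 also have "... = (SUP n. emeasure (density lborel ?h) {A n..B n})"
  using f g(4) by (subst (1 2) emeasure_density) (auto simp: eq)
 also have "... = emeasure (density lborel ?h) I"
  unfolding I[symmetric] using AB(2,3)
  by (subst SUP_emeasure_incseq) (force simp: incseq_def decseq_def)+
 also have "... = nnint lborel (%x. ?h x*indicator I x)"
  using g(4) I[symmetric] by (subst emeasure_density) auto
 finally show ?thesis .
qed

lemma UN_real_intervals:
 fixes a :: real
 assumes "!!n. a < A n" "A \<longlonglongrightarrow> a" "filterlim B at_top sequentially"
 shows "(UN n::nat. {A n..B n}) = {a<..}"
proof -
 have "EX n. A n <= y & y <= B n" if "a < y" for y
 proof -
  have "\<forall>\<^sub>F n in sequentially. A n < y" using assms(2) that by (rule order_tendstoD)
  moreover have "\<forall>\<^sub>F n in sequentially. y <= B n"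
   using assms(3) by (simp add: filterlim_at_top)
  ultimately have "\<forall>\<^sub>F n in sequentially. A n <= y & y <= B n" by eventually_elim auto
  then show ?thesis using eventually_happens sequentially_bot by blast
 qed
 then have "{a<..} <= (UN n::nat. {A n..B n})" by fastforce
 moreover have "(UN n::nat. {A n..B n}) <= {a<..}"
  using less_le_trans[OF assms(1)] by auto
 ultimately show ?thesis by blast
qed

lemma nn_integral_subst_square:
 assumes [measurable]: "f:borel_measurable borel"
 shows "nnint lborel (%s. f s*indicator {k<..} s) =
  nnint lborel (%r. f (k+r^2)*ennreal (2*r)*indicator {0<..} r)"
proof (rule nn_integral_substitution_Un[where A="%n. 1/(real n+1)" and B="%n. real n+2"])
 have inv: "(%n. 1/(real n+1)) \<longlonglongrightarrow> 0"
  using LIMSEQ_inverse_real_of_nat by (simp add: inverse_eq_divide add.commute)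
 have top: "filterlim (%n. real n+2) at_top sequentially"
  using filterlim_tendsto_add_at_top[OF tendsto_const[of 2] filterlim_real_sequentially]
  by (simp add: add.commute)
 show "(UN n. {1/(real n+1)..real n+2}) = {0<..}"
  using UN_real_intervals[OF _ inv top] by force
 have "(UN n. {k+(1/(real n+1))\<^sup>2..k+(real n+2)\<^sup>2}) = {k<..}"
 proof (rule UN_real_intervals)
  show "(%n. k+(1/(real n+1))\<^sup>2) \<longlonglongrightarrow> k"
   using tendsto_add[OF tendsto_const[of k] tendsto_power[OF inv, of 2]] by simp
  show "filterlim (%n. k+(real n+2)\<^sup>2) at_top sequentially"
   by (intro filterlim_tendsto_add_at_top[OF tendsto_const] filterlim_pow_at_top top) simp
 qed auto
 then show "(UN n. {k+(1/(real n+1))\<^sup>2..k+(real n+2)\<^sup>2}) = {k<..}" by simp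
 show "1/(real n+1) < real n+2" for n
  by (rule le_less_trans[of _ 1]) auto
 show "decseq (%n. 1/(real n+1))" "incseq (%n. real n+2)"
  by (auto simp: decseq_def incseq_def intro!: divide_left_mono)
 show "decseq (%n. k+(1/(real n+1))\<^sup>2)"
  by (auto simp: decseq_def intro!: power_mono divide_left_mono)
 show "incseq (%n. k+(real n+2)\<^sup>2)"
  by (auto simp: incseq_def intro!: power_mono)
 show "((%x. k+x\<^sup>2) has_real_derivative 2*x) (at x)" for x
  by (auto intro!: derivative_eq_intros)
 show "continuous_on {0<..} (%x. 2*x :: real)" by (intro continuous_intros)
qed auto

text \<open>Since t to 1/t decreases, the integral is first reflected to the negative half line and
  the increasing map t to -1/t is substituted there.\<close>

lemma nn_integral_subst_inverse:
 assumes [measurable]: "f:borel_measurable borel"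
 shows "nnint lborel (%s. f s*indicator {0<..} s) =
  nnint lborel (%t. f (1/t)*ennreal (1/t^2)*indicator {0<..} t)"
proof -
 have inv: "(%n. 1/(real n+2)) \<longlonglongrightarrow> 0"
  using LIMSEQ_ignore_initial_segment[OF LIMSEQ_inverse_real_of_nat, of 1]
  by (simp add: inverse_eq_divide add.commute)
 have top: "filterlim (%n. real n+2) at_top sequentially"
  using filterlim_tendsto_add_at_top[OF tendsto_const[of 2] filterlim_real_sequentially]
  by (simp add: add.commute)
 have U: "(UN n. {1/(real n+2)..real n+2}) = {0<..}"
  using UN_real_intervals[OF _ inv top] by force
 have U2: "(UN n. {- 1/(1/(real n+2))..- 1/(real n+2)}) = {..<0}"
 proof -
  have "(UN n. {- 1/(1/(real n+2))..- 1/(real n+2)}) = uminus ` (UN n. {1/(real n+2)..real n+2})"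
   unfolding image_UN by simp
  also have "... = {..<0}" unfolding U by simp
  finally show ?thesis .
 qed
 have "nnint lborel (%s. f s*indicator {0<..} s) = nnint lborel (%s. f (0+(-1) * s)*indicator {0<..} (0+(-1) * s))"
  by (subst nn_integral_real_affine[where c="-1" and t=0]) auto
 also have "... = nnint lborel (%s. f (- s)*indicator {..<0} s)"
  by (intro nn_integral_cong) (auto split: split_indicator)
 also have "... = nnint lborel (%t. f (- (- 1/t))*ennreal (1/t^2)*indicator {0<..} t)"
 proof (rule nn_integral_substitution_Un[where A="%n. 1/(real n+2)" and B="%n. real n+2"])
  show "1/(real n+2) < real n+2" for n
   by (rule le_less_trans[of _ 1]) auto
  show "decseq (%n. 1/(real n+2))" "incseq (%n. real n+2)"
   by (auto simp: decseq_def incseq_def intro!: divide_left_mono)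
  show "decseq (%n. - 1/(1/(real n+2)))"
   by (auto simp: decseq_def)
  show "incseq (%n. - 1/(real n+2))"
   by (auto simp: incseq_def intro!: divide_left_mono)
  show "continuous_on {0<..} (%x. 1/x\<^sup>2 :: real)" by (auto intro!: continuous_intros)
  show "((%x. - 1/x) has_real_derivative 1/x\<^sup>2) (at x)" if "x:{0<..}" for x :: real
   using that by (auto intro!: derivative_eq_intros simp: power2_eq_square)
 qed (use U U2 in auto)
 finally show ?thesis by simp
qed

text \<open>The action of the matrix with rows (0, 1) and (1, 0): inversion in the unit sphere
  followed by conjugation of the horizontal coordinate.\<close>

definition inv5 :: "quat \<times> real => quat \<times> real" where
 "inv5 w = ((1/(qn (fst w)+(snd w)^2))*R qcnj (fst w), snd w/(qn (fst w)+(snd w)^2))"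

lemma measurable_inv5 [measurable]: "inv5:borel_measurable borel"
 unfolding inv5_def borel_prod[symmetric] by measurable

text \<open>With s = n(z) + r^2 as vertical coordinate the inversion reads y = conj(z)/s, t = 1/s.
  The change of variables in five dimensions therefore splits into r to s at fixed z
  (\<open>1\<close>), z to y at fixed s (\<open>2\<close>), and s to 1/s and back to a height at
  fixed y (\<open>3\<close>), joined by Fubini.\<close>

lemma nn_integral_inv5:
 assumes [measurable]: "f:borel_measurable borel"
 shows "nnint hyp_measure (%w. f (inv5 w)) = nnint hyp_measure (%w. f w)"
proof -
 have [measurable]: "f:borel_measurable (borel \<Otimes>\<^sub>M borel)" using assms by (simp add: borel_prod)
 \<comment> \<open>The factor \<open>1/(2*(s-qn z)^3)\<close> is r^(-5) dr expressed in s, because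
   ds = 2 r dr and s - n(z) = r^2.\<close>
 define F where "F z s = f ((1/s)*R qcnj z, sqrt (s-qn z)/s)*ennreal (1/(2*(s-qn z)^3))" for z s
 define G where "G s y = indicator {qn y<..} (1/s)*(ennreal (s^4)*(f (y, sqrt (s-s^2*qn y)/s) *
  ennreal (1/(2*(s-s^2*qn y)^3))))" for s y
 have [measurable]: "case_prod F:borel_measurable (borel \<Otimes>\<^sub>M borel)" unfolding F_def by measurable
 have [measurable]: "case_prod G:borel_measurable (borel \<Otimes>\<^sub>M borel)"
  unfolding G_def indicator_def greaterThan_iff by measurable
 have ind: "(%(z, s). indicator {qn z<..} s :: ennreal):borel_measurable (borel \<Otimes>\<^sub>M borel)"
  unfolding indicator_def greaterThan_iff by measurable
 note [measurable] = ind
 have jac: "ennreal (1/r^5) = ennreal (1/(2*(r^2)^3))*ennreal (2*r)" if "r > 0" for r :: real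
 proof -
  have "1/(2*(r^2)^3)*(2*r) = 1/r^5" using that by (simp add: eval_nat_numeral)
  then show ?thesis using that by (subst ennreal_mult[symmetric]) auto
 qed
 have 1: "nnint lborel (%r. f (inv5 (z, r))*(ennreal (1/r^5)*indicator {0<..} r)) =
   nnint lborel (%s. F z s*indicator {qn z<..} s)" for z
 proof -
  have "f (inv5 (z, r))*(ennreal (1/r^5)*indicator {0<..} r) =
   F z (qn z+r^2)*ennreal (2*r)*indicator {0<..} r" for r
  proof (cases "r > 0")
   case True
   have "F z (qn z+r^2) = f (inv5 (z, r))*ennreal (1/(2*(r^2)^3))"
    using True unfolding F_def inv5_def fst_conv snd_conv add_diff_cancel_left' by simp
   then show ?thesis unfolding jac[OF True] by (simp only: mult.assoc)
  qed simp
  then show ?thesis by (subst nn_integral_subst_square) simp_all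
 qed
 have 2: "nnint lborel (%z. F z s*indicator {qn z<..} s) = nnint lborel (%y. G s y*indicator {0<..} s)" for s
 proof (cases "s > 0")
  case True
  have "nnint lborel (%z. F z s*indicator {qn z<..} s) =
    ennreal (s^4)*nnint lborel (%y. F (0+s*R y) s*indicator {qn (0+s*R y)<..} s)"
   by (rule nn_integral_quat_affine) (use True in auto)
  also have "... = ennreal (s^4)*nnint lborel (%y. F (s*R qcnj y) s*indicator {qn (s*R qcnj y)<..} s)"
  proof -
   have m: "(%y. F (s*R y) s*indicator {qn (s*R y)<..} s):borel_measurable borel"
    unfolding indicator_def greaterThan_iff by measurable
   show ?thesis by (subst nn_integral_qcnj[OF m]) simp
  qed
  also have "... = nnint lborel (%y. ennreal (s^4)*(F (s*R qcnj y) s*indicator {qn (s*R qcnj y)<..} s))"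
   by (rule nn_integral_cmult[symmetric]) measurable
  also have "... = nnint lborel (%y. G s y*indicator {0<..} s)"
  proof (intro nn_integral_cong)
   fix y
   have "indicator {qn (s*R qcnj y)<..} s = (indicator {qn y<..} (1/s) :: ennreal)"
    using True by (auto simp: field_simps power2_eq_square split: split_indicator)
   then show "ennreal (s^4)*(F (s*R qcnj y) s*indicator {qn (s*R qcnj y)<..} s) = G s y*indicator {0<..} s"
    using True by (simp add: F_def G_def mult_ac)
  qed
  finally show ?thesis .
 next
  case False
  then have "indicator {qn z<..} s = (0::ennreal)" for z
   using qn_nonneg[of z] by (auto split: split_indicator simp del: qn_nonneg)
  then show ?thesis using False by simp
 qed
 have 3: "nnint lborel (%s. G s y*indicator {0<..} s) =
   nnint lborel (%r. f (y, r)*(ennreal (1/r^5)*indicator {0<..} r))" for y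
 proof -
  have "nnint lborel (%s. G s y*indicator {0<..} s) =
    nnint lborel (%t. G (1/t) y*ennreal (1/t^2)*indicator {0<..} t)"
   by (rule nn_integral_subst_inverse) measurable
  also have "... = nnint lborel (%t. (f (y, sqrt (t-qn y))*ennreal (1/(2*(t-qn y)^3)))*indicator {qn y<..} t)"
  proof (intro nn_integral_cong)
   fix t :: real
   show "G (1/t) y*ennreal (1/t^2)*indicator {0<..} t =
    (f (y, sqrt (t-qn y))*ennreal (1/(2*(t-qn y)^3)))*indicator {qn y<..} t"
   proof (cases "t > qn y")
    case True
    then have t: "t > 0" using qn_nonneg[of y] by linarith
    have e: "1/t-(1/t)\<^sup>2*qn y = (t-qn y)/t^2"
     using t by (simp add: field_simps power2_eq_square)
    have s: "sqrt ((t-qn y)/t\<^sup>2)/(1/t) = sqrt (t-qn y)"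
     using t by (simp add: real_sqrt_divide)
    have em: "0 <= a ==> 0 <= b ==> 0 <= c ==> ennreal a*ennreal b*ennreal c = ennreal (a*b*c)" for a b c
     by (simp add: ennreal_mult)
    have "ennreal ((1/t)^4)*ennreal (1/(2*((t-qn y)/t^2)^3))*ennreal (1/t^2) =
      ennreal ((1/t)^4*(1/(2*((t-qn y)/t^2)^3))*(1/t^2))"
     by (rule em) (use True t in auto)
    also have "(1/t)^4*(1/(2*((t-qn y)/t^2)^3))*(1/t^2) = 1/(2*(t-qn y)^3)"
    proof -
     have "(1/a)^4*(1/(2*(x/a^2)^3))*(1/a^2) = 1/(2*x^3)" if "a > 0" "x > 0" for a x :: real
      using that by (simp add: divide_simps eval_nat_numeral)
     then show ?thesis using t True by simp
    qed
    finally have eq: "ennreal ((1/t)^4)*ennreal (1/(2*((t-qn y)/t^2)^3))*ennreal (1/t^2) =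
     ennreal (1/(2*(t-qn y)^3))" .
    have ind: "indicator {qn y<..} (1/(1/t)) = (1::ennreal)" "indicator {0<..} t = (1::ennreal)"
     "indicator {qn y<..} t = (1::ennreal)" using True t by auto
    show ?thesis unfolding G_def e s ind eq[symmetric] by (simp only: mult_1_left mult_1_right mult_ac)
   next
    case False
    then show ?thesis unfolding G_def by simp
   qed
  qed
  also have "... = nnint lborel (%r. f (y, sqrt (r^2))*ennreal (1/(2*(r^2)^3))*ennreal (2*r)*indicator {0<..} r)"
   by (subst nn_integral_subst_square) auto
  also have "... = nnint lborel (%r. f (y, r)*(ennreal (1/r^5)*indicator {0<..} r))"
  proof (intro nn_integral_cong)
   fix r :: real
   show "f (y, sqrt (r^2))*ennreal (1/(2*(r^2)^3))*ennreal (2*r)*indicator {0<..} r =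
    f (y, r)*(ennreal (1/r^5)*indicator {0<..} r)"
   proof (cases "r > 0")
    case True
    then have "sqrt (r^2) = r" by simp
    then show ?thesis unfolding jac[OF True] by (simp only: mult.assoc)
   qed simp
  qed
  finally show ?thesis .
 qed
 have "nnint hyp_measure (%w. f (inv5 w)) = nnint lborel (%z. nnint lborel (%s. F z s*indicator {qn z<..} s))"
  by (subst nn_integral_hyp) (simp_all add: 1)
 also have "... = nnint lborel (%s. nnint lborel (%z. F z s*indicator {qn z<..} s))"
  by (rule lborel_pair.Fubini'[symmetric]) measurable
 also have "... = nnint lborel (%s. nnint lborel (%y. G s y*indicator {0<..} s))"
  by (simp add: 2)
 also have "... = nnint lborel (%y. nnint lborel (%s. G s y*indicator {0<..} s))"
  by (rule lborel_pair.Fubini'[symmetric]) measurable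
 also have "... = nnint hyp_measure (%w. f w)"
  by (subst nn_integral_hyp) (simp_all add: 3)
 finally show ?thesis .
qed

lemma nn_integral_hyp_similarity:
 assumes t: "qn a*qn c = t^2" "t > 0" and [measurable]: "f:borel_measurable borel"
 shows "nnint hyp_measure (%w. f (a*.fst w*.c+b, t * snd w)) = nnint hyp_measure (%w. f w)"
proof -
 have [measurable]: "f:borel_measurable (borel \<Otimes>\<^sub>M borel)" using assms by (simp add: borel_prod)
 define H where "H = (%z. nnint lborel (%r. f (z, r)*(ennreal (1/r^5)*indicator {0<..} r)))"
 have [measurable]: "H:borel_measurable borel" unfolding H_def by measurable
 have [measurable]: "(%w. f (a*.fst w*.c+b, t * snd w)):borel_measurable borel"
  by (subst borel_prod[symmetric]) measurable
 have "nnint lborel (%r. f (z, t*r)*(ennreal (1/r^5)*indicator {0<..} r)) = ennreal (t^4)*H z" for z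
 proof -
  have "H z = ennreal t*nnint lborel (%r. f (z, 0+t*r)*(ennreal (1/(0+t*r)^5)*indicator {0<..} (0+t*r)))"
   unfolding H_def by (subst nn_integral_real_affine[where c=t and t=0]) (use t in auto)
  then have "ennreal (t^4)*H z = nnint lborel (%r. (ennreal (t^4)*ennreal t)*(f (z, t*r)*(ennreal (1/(t*r)^5)*indicator {0<..} (t*r))))"
   by (subst nn_integral_cmult) (auto simp: mult.assoc)
  also have "... = nnint lborel (%r. f (z, t*r)*(ennreal (1/r^5)*indicator {0<..} r))"
  proof (intro nn_integral_cong)
   fix r :: real
   have "ennreal (t^4)*ennreal t*ennreal (1/(t*r)^5) = ennreal (1/r^5)" if "r > 0"
    using that t by (subst ennreal_mult[symmetric], simp, simp, subst ennreal_mult[symmetric])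
     (auto simp: power_mult_distrib field_simps eval_nat_numeral)
   then show "(ennreal (t^4)*ennreal t)*(f (z, t*r)*(ennreal (1/(t*r)^5)*indicator {0<..} (t*r))) =
    f (z, t*r)*(ennreal (1/r^5)*indicator {0<..} r)"
    using t by (cases "r > 0") (auto simp: mult_ac zero_less_mult_iff split: split_indicator)
  qed
  finally show ?thesis by simp
 qed
 then have "nnint hyp_measure (%w. f (a*.fst w*.c+b, t * snd w)) =
   nnint lborel (%z. ennreal (t^4)*H (a*.z*.c+b))"
  by (subst nn_integral_hyp) auto
 also have "... = nnint lborel (%z. H z)"
  by (subst (2) nn_integral_quat_similarity[OF t]) (auto simp: nn_integral_cmult)
 also have "... = nnint hyp_measure (%w. f w)"
  unfolding nn_integral_hyp[OF assms(3)] H_def ..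
 finally show ?thesis .
qed

lemma Det_sq_schur:
 assumes "c ~= 0"
 shows "Det_sq (a, b, c, d) = qn (b-a*.qinv c*.d)*qn c"
proof -
 define e where "e = qinv c*.d"
 have d: "d = c*.e" using assms by (simp add: e_def)
 have "qtr (a*.qcnj c*.d*.qcnj b) = qn c*qtr (a*.e*.qcnj b)"
  by (simp add: d qmul_assoc qmul_qcnj_left)
 then have "Det_sq (a, b, c, d) = qn c*qn (a*.e-b)"
  by (simp add: Det_sq_def qn_diff d qn_qmul algebra_simps)
 also have "qn (a*.e-b) = qn (b-a*.e)" by (metis minus_diff_eq qn_simps(2))
 finally show ?thesis by (simp add: e_def qmul_assoc)
qed

text \<open>Bruhat decomposition for nonzero c: a translation by \<open>qinv c*.d\<close>, then
  \<open>inv5\<close>, then a similarity. Invariance of the measure reduces to these three kinds of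
  maps.\<close>

lemma act_c_nonzero:
 assumes c: "c ~= 0" and r: "r > 0"
 shows "act (a, b, c, d) (z, r) =
  (let w = inv5 (z+qinv c*.d, r) in
   ((1/qn c)*R (b-a*.qinv c*.d)*.fst w*.qcnj c+a*.qinv c, 1/qn c * snd w))"
proof -
 define u where "u = z+qinv c*.d"
 have cz: "c*.z+d = c*.u" using c by (simp add: u_def qmul_add)
 have az: "a*.z+b = a*.u+(b-a*.qinv c*.d)" by (simp add: u_def qmul_add qmul_assoc)
 have nc: "qn c > 0" using c by simp
 have p: "qn u+r^2 > 0" using r by (simp add: add_nonneg_pos)
 have ac: "a*.qcnj c = qn c*R (a*.qinv c)" using nc by (simp add: qinv_def)
 have num: "(a*.u+g)*.(qcnj u*.qcnj c)+r^2*R (a*.qcnj c)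
   = g*.(qcnj u*.qcnj c)+(qn c*(qn u+r^2))*R (a*.qinv c)" for g
  by (simp add: qmul_add qmul_assoc qmul_qcnj_left ac distrib_left scaleR_add_left mult.commute)
 have den: "qn (c*.u)+r^2*qn c = qn c*(qn u+r^2)" by (simp add: qn_qmul algebra_simps)
 show ?thesis
  unfolding act_def inv5_def Let_def case_prod_conv cz az den qcnj_qmul num fst_conv snd_conv u_def[symmetric]
  using nc p by (simp add: scaleR_add_right qmul_assoc mult.commute)
qed

lemma measurable_act [measurable]: "act M:borel_measurable borel"
proof -
 obtain a b c d where M: "M = (a, b, c, d)" by (cases M) auto
 have "act M = (%p. let den = qn (qmul c (fst p)+d)+(snd p)^2*qn c in
   ((1/den)*R (qmul (qmul a (fst p)+b) (qcnj (qmul c (fst p)+d))+((snd p)^2)*R qmul a (qcnj c)),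
   (snd p)/den))"
  by (auto simp: M act_def fun_eq_iff)
 also have "...:borel_measurable borel" unfolding Let_def borel_prod[symmetric] by measurable
 finally show ?thesis .
qed

lemma nn_integral_hyp_cong:
 "(!!z r. r > 0 ==> f (z, r) = g (z, r)) ==> (nnint hyp_measure (%w. f w)) = nnint hyp_measure (%w. g w)"
proof (rule nn_integral_cong_AE)
 assume *: "!!z r. r > 0 ==> f (z, r) = g (z, r)"
 show "AE w in hyp_measure. f w = g w"
  unfolding hyp_measure_def
  by (subst AE_density) (auto simp: * borel_prod[symmetric] lborel_prod intro!: AE_I2 split: if_splits)
qed

theorem nn_integral_act:
 assumes det: "Det_sq M = 1" and f [measurable]: "f:borel_measurable borel"
 shows "nnint hyp_measure (%w. f (act M w)) = nnint hyp_measure (%w. f w)"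
proof -
 obtain a b c d where M: "M = (a, b, c, d)" by (cases M) auto
 show ?thesis
 proof (cases "c = 0")
  case True
  then have ad: "qn a*qn d = 1" using det by (simp add: M Det_sq_def qn_qmul)
  then have d: "qn d > 0" by (metis mult_zero_right qn_eq_0 qn_pos zero_neq_one)
  have "act M w = ((1/qn d)*R a*.fst w*.qcnj d+(1/qn d)*R (b*.qcnj d), 1/qn d * snd w)" for w
   by (cases w) (simp add: M True act_def Let_def qring)
  then show ?thesis
   using nn_integral_hyp_similarity[of "(1/qn d)*R a" "qcnj d" "1/qn d" f "(1/qn d)*R (b*.qcnj d)"] ad d f
   by (simp add: power2_eq_square field_simps)
 next
  case False
  define g where "g w = f ((1/qn c)*R (b-a*.qinv c*.d)*.fst w*.qcnj c+a*.qinv c, 1/qn c * snd w)" for w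
  have [measurable]: "g:borel_measurable borel"
   unfolding g_def by (subst borel_prod[symmetric]) (use f in \<open>simp add: borel_prod[symmetric]\<close>)
  have nc: "qn c > 0" using False by simp
  have "qn (b-a*.qinv c*.d)*qn c = 1" using det Det_sq_schur[OF False] M by simp
  then have sim: "qn ((1/qn c)*R (b-a*.qinv c*.d))*qn (qcnj c) = (1/qn c)^2"
   by (simp add: power2_eq_square)
  have [measurable]: "(%w. g (inv5 w)):borel_measurable borel" by measurable
  have "nnint hyp_measure (%w. f (act M w)) = nnint hyp_measure (%w. g (inv5 (qone*.fst w*.qone+qinv c*.d, 1 * snd w)))"
   by (rule nn_integral_hyp_cong) (use False in \<open>simp add: M act_c_nonzero g_def Let_def\<close>)
  also have "... = nnint hyp_measure (%w. g (inv5 w))"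
   by (rule nn_integral_hyp_similarity[of qone qone 1 "%w. g (inv5 w)"]) auto
  also have "... = nnint hyp_measure (%w. g w)" by (rule nn_integral_inv5) measurable
  also have "... = nnint hyp_measure (%w. f w)"
   unfolding g_def by (rule nn_integral_hyp_similarity[OF sim]) (use nc in auto)
  finally show ?thesis .
 qed
qed

section \<open>Quaternionic matrices and hermitian forms\<close>

fun mmul :: "qmat => qmat => qmat" (infixl "\<odot>" 70) where
 "(a, b, c, d) \<odot> (p, q, s, t) = (a*.p+b*.s, a*.q+b*.t, c*.p+d*.s, c*.q+d*.t)"

fun mvec :: "qmat => quat \<times> quat => quat \<times> quat" where
 "mvec (a, b, c, d) (x, y) = (a*.x+b*.y, c*.x+d*.y)"

fun vmul :: "quat \<times> quat => qmat => quat \<times> quat" where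
 "vmul (x, y) (a, b, c, d) = (x*.a+y*.c, x*.b+y*.d)"

text \<open>Analogue of the adjugate: a matrix times its \<open>madj\<close> is the scalar
  \<open>Det_sq\<close>. The entries are formed from the given ones by products, conjugates and
  norms, so matrices of determinant one over an order stable under conjugation have their inverses
  over the same order.\<close>

fun madj :: "qmat => qmat" where
 "madj (a, b, c, d) =
  (qn d*R qcnj a-qcnj c*.d*.qcnj b, qn b*R qcnj c-qcnj a*.b*.qcnj d,
   qn c*R qcnj b-qcnj d*.c*.qcnj a, qn a*R qcnj d-qcnj b*.a*.qcnj c)"

fun mscale :: "real => qmat => qmat" where
 "mscale t (a, b, c, d) = (t*R a, t*R b, t*R c, t*R d)"

definition minv :: "qmat => qmat" where
 "minv M = mscale (1/Det_sq M) (madj M)"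

definition mrow2 :: "qmat => quat \<times> quat" where
 "mrow2 M = vmul (0, qone) M"

lemma mrow2_simps [simp]: "mrow2 (a, b, c, d) = (c, d)"
 by (simp add: mrow2_def)

lemma qmat_cases [cases type]:
 obtains a b c d :: quat where "M = (a, b, c, d)" by (cases M) auto

lemma mmul_assoc: "(L \<odot> M) \<odot> N = L \<odot> (M \<odot> N)"
 by (cases L, cases M, cases N) (simp add: qring ac_simps)

lemma vmul_vmul: "vmul (vmul v M) N = vmul v (M \<odot> N)"
 by (cases v, cases M, cases N) (simp add: qring ac_simps)

lemma mvec_mvec: "mvec M (mvec N v) = mvec (M \<odot> N) v"
 by (cases v, cases M, cases N) (simp add: qring ac_simps)

lemma mmul_id [simp]: "M \<odot> qmat_id = M" "qmat_id \<odot> M = M"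
 by (cases M; simp add: qmat_id_def)+

lemma mvec_id [simp]: "mvec qmat_id v = v" by (cases v) (simp add: qmat_id_def)
lemma vmul_id [simp]: "vmul v qmat_id = v" by (cases v) (simp add: qmat_id_def)

lemma Det_sq_id [simp]: "Det_sq qmat_id = 1"
 by (simp add: qmat_id_def Det_sq_def qn_qmul)

lemma Det_sq_scale: "Det_sq (mscale t M) = t^4*Det_sq M"
 by (cases M) (simp add: Det_sq_def qn_qmul power2_eq_square eval_nat_numeral algebra_simps)

lemma Det_sq_column_op: "Det_sq (a, a*.z+b, c, c*.z+d) = Det_sq (a, b, c, d)"
proof -
 have 1: "qtr (a*.(qcnj c*.(c*.(z*.(qcnj z*.qcnj a))))) = 2*qn a*qn c*qn z"
  by (simp add: qmul_qcnj_left qmul_qcnj)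
 have 2: "qtr (a*.(qcnj c*.(c*.(z*.qcnj b)))) = qn c*qtr (a*.(z*.qcnj b))"
  by (simp add: qmul_qcnj_left)
 have "qtr (a*.(qcnj c*.(d*.(qcnj z*.qcnj a)))) = qtr ((qcnj c*.(d*.(qcnj z*.qcnj a)))*.a)"
  by (rule qtr_commute)
 also have "... = qn a*qtr (qcnj c*.(d*.qcnj z))"
  by (simp add: qmul_assoc qmul_qcnj)
 also have "qtr (qcnj c*.(d*.qcnj z)) = qtr (d*.(qcnj z*.qcnj c))" by (rule qtr_cyclic)
 also have "... = qtr (c*.(z*.qcnj d))"
  by (metis qtr_cnj_swap qcnj_qmul qmul_assoc)
 finally have 3: "qtr (a*.(qcnj c*.(d*.(qcnj z*.qcnj a)))) = qn a*qtr (c*.(z*.qcnj d))" .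
 show ?thesis
  unfolding Det_sq_def case_prod_conv qn_qmul qn_add
  by (simp add: qring qtr_add 1 2 3 algebra_simps)
qed

text \<open>The left side is the Gram determinant of the rows (a, u) and (c, v) for the hermitian
  form diag(h, 1). The same identity yields multiplicativity of the determinant and the
  transformation of \<open>Qf\<close> under the action.\<close>

lemma gram_identity:
 "(qn u+h*qn a)*(qn v+h*qn c)-qn (u*.qcnj v+h*R (a*.qcnj c)) = h*Det_sq (a, u, c, v)"
proof -
 have "qtr (a*.(qcnj c*.(v *. qcnj u))) = qtr (u*.(qcnj v *. (c*.qcnj a)))"
  by (metis qtr_simps(3) qcnj_qmul qcnj_qcnj qmul_assoc)
 then show ?thesis
  by (simp add: Det_sq_def qn_add qn_qmul qring power2_eq_square algebra_simps)
qed

lemma Det_sq_gram: "Det_sq (a, b, c, d) = (qn a+qn b)*(qn c+qn d)-qn (a*.qcnj c+b*.qcnj d)"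
 using gram_identity[of b 1 a d c] by (simp add: add.commute)

lemma Det_sq_nonneg: "Det_sq M >= 0"
proof -
 obtain a b c d where M: "M = (a, b, c, d)" by (cases M) auto
 show ?thesis
 proof (cases "c = 0")
  case True then show ?thesis by (simp add: M Det_sq_def)
 next
  case False then show ?thesis by (simp add: M Det_sq_schur)
 qed
qed

text \<open>\<open>Det_sq\<close> is the Gram determinant of the rows. For a product, the form is
  the Gram matrix of \<open>N\<close>; completing the square (\<open>rowC\<close>) turns it into
  diag(h, 1) up to the scalar C, so that \<open>gram_identity\<close> applies and a column operation
  removes the shear. If C = 0 the second row of \<open>N\<close> is zero.\<close>

lemma Det_sq_mmul: "Det_sq (M \<odot> N) = Det_sq M*Det_sq N"
proof -
 obtain a b c d where M: "M = (a, b, c, d)" by (cases M) auto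
 obtain p q s t where N: "N = (p, q, s, t)" by (cases N) auto
 define A where "A = qn p+qn q"
 define B where "B = p*.qcnj s+q*.qcnj t"
 define C where "C = qn s+qn t"
 define h where "h = A*C-qn B"
 have h: "Det_sq N = h" by (simp add: N Det_sq_gram h_def A_def B_def C_def)
 have row: "qn (x*.p+y*.s)+qn (x*.q+y*.t) = qn x*A+qtr (x*.B*.qcnj y)+qn y*C" for x y
  by (simp add: qn_add qn_qmul A_def B_def C_def qring qtr_add algebra_simps)
 have off: "(a*.p+b*.s)*.qcnj (c*.p+d*.s)+(a*.q+b*.t)*.qcnj (c*.q+d*.t)
   = A*R (a*.qcnj c)+a*.B*.qcnj d+b*.qcnj B*.qcnj c+C*R (b*.qcnj d)"
  by (simp add: A_def B_def C_def qring qmul_qcnj_left)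
 show ?thesis
 proof (cases "C = 0")
  case True
  then have "s = 0 & t = 0" unfolding C_def by (simp add: add_nonneg_eq_0_iff)
  then have B: "B = 0" by (simp add: B_def)
  have "Det_sq (M \<odot> N) = 0"
   unfolding M N mmul.simps Det_sq_gram row off True B
   by (simp add: qn_qmul power2_eq_square)
  then show ?thesis using h by (simp add: h_def True B)
 next
  case False
  define u v where "u = a*.B+C*R b" and "v = c*.B+C*R d"
  have C: "C > 0" using False unfolding C_def by (metis add_nonneg_nonneg less_eq_real_def qn_nonneg)
  have rowC: "C*(qn x*A+qtr (x*.B*.qcnj y)+qn y*C) = qn (x*.B+C*R y)+h*qn x" for x y
   by (simp add: qn_add qn_qmul h_def power2_eq_square algebra_simps)
  have offC: "C*R (A*R (a*.qcnj c)+a*.B*.qcnj d+b*.qcnj B*.qcnj c+C*R (b*.qcnj d))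
   = u*.qcnj v+h*R (a*.qcnj c)"
   by (simp add: u_def v_def qring qmul_qcnj_left h_def mult.commute)
  have "C^2*Det_sq (M \<odot> N) =
   (C*(qn a*A+qtr (a*.B*.qcnj b)+qn b*C))*(C*(qn c*A+qtr (c*.B*.qcnj d)+qn d*C))
   - qn (C*R (A*R (a*.qcnj c)+a*.B*.qcnj d+b*.qcnj B*.qcnj c+C*R (b*.qcnj d)))"
   unfolding M N mmul.simps Det_sq_gram row off qn_simps(3) by (simp add: power2_eq_square algebra_simps)
  also have "... = h*Det_sq (a, u, c, v)"
   unfolding rowC offC gram_identity[symmetric] u_def v_def ..
  also have "Det_sq (a, u, c, v) = Det_sq (a, C*R b, c, C*R d)"
   unfolding u_def v_def by (rule Det_sq_column_op)
  also have "... = C^2*Det_sq M" by (simp add: M Det_sq_def qn_qmul power2_eq_square algebra_simps)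
  finally show ?thesis using C h by simp
 qed
qed

lemma mmul_madj: "M \<odot> madj M = mscale (Det_sq M) qmat_id"
proof -
 obtain a b c d where M: "M = (a, b, c, d)" by (cases M) auto
 define t where "t = qtr (a*.(qcnj c*.(d*.qcnj b)))"
 have e1: "a*.(qcnj c*.(d*.qcnj b)) = t*R qone-b*.(qcnj d*.(c*.qcnj a))"
  using qtr_qone[of "a*.(qcnj c*.(d*.qcnj b))"] unfolding t_def by (simp add: qring eq_diff_eq)
 have "t = qtr (d*.(qcnj b*.(a*.qcnj c)))"
  unfolding t_def using qtr_commute[of "a*.qcnj c" "d*.qcnj b"] by (simp add: qmul_assoc)
 then have e2: "d*.(qcnj b*.(a*.qcnj c)) = t*R qone-c*.(qcnj a*.(b*.qcnj d))"
  using qtr_qone[of "d*.(qcnj b*.(a*.qcnj c))"] by (simp add: qring eq_diff_eq)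
 have "Det_sq M = qn a*qn d+qn b*qn c-t"
  by (simp add: M Det_sq_def qn_qmul t_def qmul_assoc)
 then show ?thesis
  by (simp add: M qmat_id_def qring qmul_qcnj_left qmul_qcnj e1 e2) (simp add: algebra_simps)
qed

lemma mscale_mscale [simp]: "mscale s (mscale t M) = mscale (s*t) M" by (cases M) simp
lemma mscale_one [simp]: "mscale 1 M = M" by (cases M) simp
lemma mmul_mscale [simp]: "M \<odot> mscale t N = mscale t (M \<odot> N)" "mscale t M \<odot> N = mscale t (M \<odot> N)"
 by (cases M, cases N, simp add: qring)+

lemma minv_right: "Det_sq M ~= 0 ==> M \<odot> minv M = qmat_id"
 by (simp add: minv_def mmul_madj)

lemma Det_sq_minv: "Det_sq M ~= 0 ==> Det_sq (minv M) = 1/Det_sq M"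
 using Det_sq_mmul[of M "minv M"] by (simp add: minv_right field_simps)

lemma minv_left: "Det_sq M ~= 0 ==> minv M \<odot> M = qmat_id"
 by (metis minv_right Det_sq_minv mmul_assoc mmul_id divide_eq_0_iff zero_neq_one)

section \<open>The quadratic form of a point, and the laws of the action\<close>

definition Qf :: "quat \<times> real => quat \<times> quat => real" where
 "Qf w v = (case w of (z, r) => case v of (c, d) => (qn (c*.z+d)+r^2*qn c)/r)"

lemma Qf_pos: "r > 0 ==> v ~= 0 ==> Qf (z, r) v > 0"
proof (cases v)
 case (Pair c d)
 assume "r > 0" "v ~= 0"
 then have "qn (c*.z+d)+r^2*qn c > 0"
  by (cases "c = 0") (simp_all add: Pair zero_prod_def add_nonneg_pos)
 with \<open>r > 0\<close> show ?thesis by (simp add: Qf_def Pair)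
qed

lemma Qf_nonneg: "r > 0 ==> Qf (z, r) v >= 0"
 unfolding Qf_def by (cases v) auto

lemma snd_act: "snd w > 0 ==> snd (act M w) = 1/Qf w (mrow2 M)"
 by (cases M, cases w) (simp add: act_def Qf_def Let_def)

lemma mrow2_nonzero: "Det_sq M ~= 0 ==> mrow2 M ~= 0"
 by (cases M) (auto simp: Det_sq_def zero_prod_def)

lemma act_H5: "Det_sq M ~= 0 ==> snd w > 0 ==> snd (act M w) > 0"
 using Qf_pos[of "snd w" "mrow2 M" "fst w"] mrow2_nonzero by (simp add: snd_act)

text \<open>By \<open>gram_identity\<close> and determinant one, the numerator Z of the new
  horizontal coordinate satisfies n(Z) = (n(u) + r^2 n(a)) den - r^2; the denominators then
  cancel.\<close>

lemma Qf_act: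
 assumes det: "Det_sq M = 1" and w: "snd w > 0"
 shows "Qf (act M w) v = Qf w (vmul v M)"
proof -
 obtain a b c d where M: "M = (a, b, c, d)" by (cases M) auto
 obtain z r where wz: "w = (z, r)" by (cases w) auto
 obtain p q where v: "v = (p, q)" by (cases v) auto
 define u t den where "u = a*.z+b" and "t = c*.z+d" and "den = qn t+r^2*qn c"
 define Z where "Z = u*.qcnj t+r^2*R (a*.qcnj c)"
 have r: "r > 0" using w wz by simp
 have den: "den > 0"
  using Qf_pos[OF r, of "(c, d)" z] mrow2_nonzero[of M] det M r
  by (simp add: Qf_def den_def t_def zero_less_divide_iff)
 have act: "act M w = ((1/den)*R Z, r/den)"
  unfolding M wz act_def by (simp add: Let_def Z_def den_def u_def t_def)
 have "(qn u+r^2*qn a)*den-qn Z = r^2*Det_sq (a, u, c, t)"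
  unfolding den_def Z_def by (rule gram_identity)
 also have "Det_sq (a, u, c, t) = 1" unfolding u_def t_def Det_sq_column_op using det M by simp
 finally have nZ: "qn Z = (qn u+r^2*qn a)*den-r^2" by simp
 have "Qf (act M w) v = (qn ((1/den)*R (p*.Z)+q)+(r/den)^2*qn p)/(r/den)"
  unfolding act v Qf_def by simp
 also have "qn ((1/den)*R (p*.Z)+q) = qn p*qn Z/den^2+qn q+qtr (p*.Z*.qcnj q)/den"
  by (simp add: qn_add qn_qmul power_divide)
 also have "qn p*qn Z/den^2+qn q+qtr (p*.Z*.qcnj q)/den+(r/den)^2*qn p
   = (qn p*(qn u+r^2*qn a)+qn q*den+qtr (p*.Z*.qcnj q))/den"
  using den by (simp add: nZ field_simps power2_eq_square)
 also have ".../(r/den) = (qn p*(qn u+r^2*qn a)+qn q*den+qtr (p*.Z*.qcnj q))/r"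
  using den by simp
 also have "qn p*(qn u+r^2*qn a)+qn q*den+qtr (p*.Z*.qcnj q)
   = qn (p*.u+q*.t)+r^2*qn (p*.a+q*.c)"
  by (simp add: qn_add qn_qmul Z_def den_def qring qtr_add algebra_simps)
 also have "p*.u+q*.t = (p*.a+q*.c)*.z+(p*.b+q*.d)"
  by (simp add: u_def t_def qring algebra_simps)
 finally show ?thesis by (simp add: Qf_def M wz v)
qed

text \<open>The value at (0, 1) determines r, and then the value at (1, -z') detects z = z'. The
  composition law for the action thus follows from associativity of \<open>vmul\<close>, with no
  computation with fractions.\<close>

lemma Qf_inject:
 assumes "snd w > 0" "snd w' > 0" "!!v. Qf w v = Qf w' v"
 shows "w = w'"
proof -
 obtain z r z' r' where w: "w = (z, r)" "w' = (z', r')" by (cases w, cases w') auto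
 have "1/r = 1/r'" using assms(3)[of "(0, qone)"] by (simp add: w Qf_def)
 then have r: "r = r'" using assms(1,2) w by simp
 have "Qf w (qone, - z') = Qf w' (qone, - z')" using assms(3) by blast
 then have "z = z'" using assms(1,2) by (simp add: w Qf_def r)
 then show ?thesis using r w by simp
qed

lemma act_mmul:
 assumes "Det_sq M = 1" "Det_sq N = 1" "snd w > 0"
 shows "act (M \<odot> N) w = act M (act N w)"
 by (rule Qf_inject)
   (simp_all add: assms Qf_act Det_sq_mmul act_H5 vmul_vmul)

lemma act_id: "snd w > 0 ==> act qmat_id w = w"
 by (rule Qf_inject) (simp_all add: Qf_act act_H5)

lemma Qf_measurable [measurable]: "(%w. Qf w v):borel_measurable borel"
proof -
 have "(%w. Qf w v) = (%w. (qn (fst v *. fst w+snd v)+(snd w)^2*qn (fst v))/snd w)"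
  by (auto simp: Qf_def split: prod.splits)
 also have "...:borel_measurable borel" unfolding borel_prod[symmetric] by measurable
 finally show ?thesis .
qed

section \<open>Measurable selection\<close>

fun lexl :: "'a::euclidean_space list => 'a => 'a => bool" where
 "lexl [] x y = False"
| "lexl (b # bs) x y = (x \<bullet> b < y \<bullet> b | (x \<bullet> b = y \<bullet> b & lexl bs x y))"

lemma lexl_irrefl: "~ lexl bs x x" by (induction bs) auto
lemma lexl_trans: "lexl bs x y ==> lexl bs y z ==> lexl bs x z" by (induction bs) auto
lemma lexl_total: "lexl bs x y | lexl bs y x | (ALL b:set bs. x \<bullet> b = y \<bullet> b)" by (induction bs) auto

text \<open>A strict total order that refines \<rho> and is still measurable. Breaking ties
  lexicographically gives a discrete orbit exactly one least point, so that fundamental domains need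
  no discussion of their boundaries.\<close>

definition lless :: "('a::euclidean_space => real) => 'a => 'a => bool" where
 "lless \<rho> x y \<longleftrightarrow> \<rho> x < \<rho> y | (\<rho> x = \<rho> y & lexl (SOME bs. set bs = Basis) x y)"

lemma lless_irrefl [simp]: "~ lless \<rho> x x" by (simp add: lless_def lexl_irrefl)
lemma lless_trans: "lless \<rho> x y ==> lless \<rho> y z ==> lless \<rho> x z"
 unfolding lless_def using lexl_trans by fastforce

lemma lless_total: "x ~= y ==> lless \<rho> x y | lless \<rho> y x"
proof -
 assume "x ~= y"
 have "set (SOME bs. set bs = (Basis::'a set)) = Basis"
  using finite_list[OF finite_Basis] by (rule someI_ex)
 then show ?thesis
  using lexl_total[of "SOME bs. set bs = Basis" x y] \<open>x ~= y\<close> euclidean_eqI[of x y] unfolding lless_def by auto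
qed

lemma lless_measurable [measurable]:
 assumes [measurable]: "f:borel_measurable M" "g:borel_measurable M" "\<rho>:borel_measurable borel"
 shows "Measurable.pred M (%x. lless \<rho> (f x) (g x))"
proof -
 have [measurable]: "Measurable.pred M (%x. lexl bs (f x) (g x))" for bs
  by (induction bs) auto
 show ?thesis unfolding lless_def by measurable
qed

lemma exists_lless_least:
 assumes "S ~= {}" and fin: "!!R. finite {x:S. \<rho> x <= R}"
 shows "EX m:S. ALL x:S. x ~= m --> lless \<rho> m x"
proof -
 have *: "finite T ==> T ~= {} ==> EX m:T. ALL x:T. x ~= m --> lless \<rho> m x" for T
 proof (induction T rule: finite_ne_induct)
  case (insert x F)
  then obtain m where m: "m:F" "ALL y:F. y ~= m --> lless \<rho> m y" by auto
  show ?case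
  proof (cases "lless \<rho> m x")
   case True then show ?thesis using m by auto
  next
   case False
   then have "lless \<rho> x m" using lless_total m(1) insert by metis
   then show ?thesis using m lless_trans[of \<rho> x m] by auto
  qed
 qed simp
 obtain s where s: "s:S" using assms by auto
 have "EX m:{x:S. \<rho> x <= \<rho> s}. ALL x:{x:S. \<rho> x <= \<rho> s}. x ~= m --> lless \<rho> m x"
  by (rule *) (use s fin in auto)
 then obtain m where m: "m:S" "\<rho> m <= \<rho> s" "!!x. x:S ==> \<rho> x <= \<rho> s ==> x ~= m ==> lless \<rho> m x" by auto
 have "lless \<rho> m x" if "x:S" "x ~= m" for x
  using m(3)[of x] m(2) that by (cases "\<rho> x <= \<rho> s") (auto simp: lless_def)
 then show ?thesis using m(1) by auto
qed

section \<open>Lattices and covolume\<close>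

text \<open>Lattices are described metrically, as uniformly discrete and relatively dense subgroups.
  Ideals, duals and multiplier sets are recognised as lattices without choosing a basis; only
  \<open>Oo\<close> itself and its dual call for one.\<close>

definition is_lat :: "'a::euclidean_space set => bool" where
 "is_lat L \<longleftrightarrow> 0:L & (ALL x:L. ALL y:L. x-y:L) &
  (EX e>0. ALL x:L. x ~= 0 --> e <= norm x) & (EX R. ALL x. EX l:L. norm (x-l) <= R)"

lemma lat_zero: "is_lat L ==> 0:L"
 and lat_diff: "is_lat L ==> x:L ==> y:L ==> x-y:L"
 by (auto simp: is_lat_def)

lemma lat_minus: "is_lat L ==> x:L ==> - x:L"
 using lat_diff[of L 0 x] lat_zero by auto

lemma lat_add: "is_lat L ==> x:L ==> y:L ==> x+y:L"
 using lat_diff[of L x "- y"] lat_minus by auto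

lemma lat_finite:
 assumes "is_lat L" "bounded S"
 shows "finite (L Int S)"
proof (rule ccontr)
 assume "infinite (L Int S)"
 then obtain x where x: "x islimpt (L Int S)"
  using bounded_infinite_imp_islimpt[OF subset_refl bounded_Int] assms(2) by blast
 obtain e where e: "e > 0" "!!x. x:L ==> x ~= 0 ==> e <= norm x" using assms(1) unfolding is_lat_def by blast
 obtain y where y: "y:L" "y ~= x" "dist y x < e/2"
  using x e(1) unfolding islimpt_approachable by (metis IntD1 half_gt_zero)
 obtain y' where y': "y':L" "y' ~= x" "dist y' x < min (dist y x) (e/2)"
  using x e(1) y(2) unfolding islimpt_approachable by (metis IntD1 half_gt_zero min_less_iff_conj zero_less_dist_iff)
 have "y-y':L" "y-y' ~= 0" using lat_diff[OF assms(1)] y y' by auto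
 then have "e <= dist y y'" using e(2) by (simp add: dist_norm)
 also have "dist y y' <= dist y x+dist y' x" by (rule dist_triangle2)
 finally show False using y y' by simp
qed

lemma lat_countable: "is_lat L ==> countable L"
proof -
 assume L: "is_lat L"
 have "L = (UN n. L Int cball 0 (real n))" using real_arch_simple by (auto simp: dist_norm)
 moreover have "countable (UN n. L Int cball 0 (real n))"
  by (intro countable_UN) (auto intro: countable_finite lat_finite[OF L])
 ultimately show ?thesis by simp
qed

lemma lat_subgroup:
 assumes L: "is_lat L" and m: "m ~= 0" "!!x. x:L ==> m*R x:L'" and L': "L' <= L"
  and "!!x y. x:L' ==> y:L' ==> x-y:L'"
 shows "is_lat L'"
proof -
 obtain R where R: "!!x. EX l:L. norm (x-l) <= R" using L unfolding is_lat_def by blast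
 have "EX l:L'. norm (x-l) <= \<bar>m\<bar> * R" for x
 proof -
  obtain l where l: "l:L" "norm ((1/m)*R x-l) <= R" using R by blast
  have "x-m*R l = m*R ((1/m)*R x-l)" using m by (simp add: scaleR_diff_right)
  then have "norm (x-m*R l) <= \<bar>m\<bar> * R" using l(2) by (simp add: mult_left_mono)
  then show ?thesis using m(2)[OF l(1)] by blast
 qed
 moreover have "0:L'" using m(2)[OF lat_zero[OF L]] by simp
 ultimately show ?thesis using assms unfolding is_lat_def by (meson subsetD)
qed

definition fdom :: "'a::euclidean_space set => 'a set => bool" where
 "fdom L B \<longleftrightarrow> B:sets borel & bounded B & (ALL x. EX! l. l:L & x+l:B)"

text \<open>The Dirichlet-Voronoi cell of the origin; the order \<open>lless norm\<close> decides on
  its boundary, so every coset meets it exactly once.\<close>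

lemma fdom_exists:
 assumes L: "is_lat L"
 shows "EX B. fdom L B"
proof
 define B where "B = {x. ALL l:L. l ~= 0 --> lless norm x (x+l)}"
 obtain R where R: "!!x. EX l:L. norm (x-l) <= R" using L unfolding is_lat_def by blast
 have "norm x <= R" if x: "x:B" for x
 proof -
  obtain l where l: "l:L" "norm (x-l) <= R" using R by blast
  have "norm x <= norm (x-l)"
   using x lat_minus[OF L l(1)] unfolding B_def lless_def by (cases "l = 0") force+
  then show ?thesis using l by simp
 qed
 then have "bounded B" by (auto simp: bounded_iff)
 moreover have "B:sets borel"
 proof -
  have "{x:space borel. l ~= 0 --> lless norm x (x+l)}:sets borel" for l by measurable
  then have "{x. l ~= 0 --> lless norm x (x+l)}:sets borel" for l by simp
  then have "(INT l:L. {x. l ~= 0 --> lless norm x (x+l)}):sets borel"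
   using lat_countable[OF L] lat_zero[OF L] by (intro sets.countable_INT') auto
  moreover have "B = (INT l:L. {x. l ~= 0 --> lless norm x (x+l)})" unfolding B_def by blast
  ultimately show ?thesis by simp
 qed
 moreover have "EX! l. l:L & x+l:B" for x
 proof -
  have "EX m:(+) x ` L. ALL y:(+) x ` L. y ~= m --> lless norm m y"
  proof (rule exists_lless_least)
   fix T
   have "{y:(+) x ` L. norm y <= T} <= (+) x ` (L Int cball (- x) T)"
    by (auto simp: dist_norm norm_minus_commute algebra_simps)
   then show "finite {y:(+) x ` L. norm y <= T}"
    by (rule finite_subset) (intro finite_imageI lat_finite[OF L bounded_cball])
  qed (use lat_zero[OF L] in auto)
  then obtain l where l: "l:L" "!!l'. l':L ==> l' ~= l ==> lless norm (x+l) (x+l')" by auto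
  have inB: "x+l':B \<longleftrightarrow> (ALL k:L. k ~= l' --> lless norm (x+l') (x+k))" if "l':L" for l'
  proof
   assume "x+l':B"
   then show "ALL k:L. k ~= l' --> lless norm (x+l') (x+k)"
    using lat_diff[OF L _ that] unfolding B_def by (force simp: algebra_simps)
  next
   assume "ALL k:L. k ~= l' --> lless norm (x+l') (x+k)"
   then show "x+l':B"
    using lat_add[OF L that] unfolding B_def by (auto simp: add.assoc)
  qed
  show ?thesis
  proof (rule ex1I[of _ l])
   show "l:L & x+l:B" using l inB by blast
   fix l' assume "l':L & x+l':B"
   then show "l' = l" using l inB lless_trans lless_irrefl by metis
  qed
 qed
 ultimately show "fdom L B" unfolding fdom_def by blast
qed

lemma nn_integral_count_space_unique:
 assumes "EX! l. l:L & P l"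
 shows "csum L (%l. of_bool (P l)) = (1::ennreal)"
proof -
 obtain l0 where l0: "l0:L" "P l0" "!!l. l:L ==> P l ==> l = l0" using assms by blast
 have "csum L (%l. of_bool (P l)) = csum L (%l. indicator {l0} l)"
 proof (rule nn_integral_cong)
  fix l assume "l:space (count_space L)"
  then have "P l \<longleftrightarrow> l = l0" using l0(2) l0(3)[of l] by auto
  then show "of_bool (P l) = (indicator {l0} l :: ennreal)" by (cases "l = l0") simp_all
 qed
 also have "... = 1" using l0(1) by (subst nn_integral_indicator) (auto simp: emeasure_count_space)
 finally show ?thesis .
qed

text \<open>Unfolding over the cosets of \<open>L\<close>. Uniqueness of the covolume, the index
  formula, Minkowski's theorem and the ball counts all come from this identity for an indicator
  function.\<close>

lemma lat_mean:
 fixes S :: "'a::euclidean_space set"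
 assumes B: "fdom L B" and L: "countable L" and f [measurable]: "f:borel_measurable borel"
 shows "nnint lborel (%x. f x) = nnint lborel (%x. indicator B x*csum L (%l. f (x-l)))"
proof -
 have [measurable]: "B:sets borel" using B unfolding fdom_def by auto
 have "nnint lborel (%x. f x) = nnint lborel (%x. f x*csum L (%l. indicator B (x+l)))"
 proof (intro nn_integral_cong)
  fix x
  have "csum L (%l. indicator B (x+l)) = (1::ennreal)"
   using nn_integral_count_space_unique[of L "%l. x+l:B"] B unfolding fdom_def indicator_def by simp
  then show "f x = f x*csum L (%l. indicator B (x+l))" by simp
 qed
 also have "... = nnint lborel (%x. csum L (%l. f x*indicator B (x+l)))"
  by (intro nn_integral_cong nn_integral_cmult[symmetric]) auto
 also have "... = csum L (%l. nnint lborel (%x. f x*indicator B (x+l)))"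
  by (rule nn_integral_count_space_nn_integral[OF L]) measurable
 also have "... = csum L (%l. nnint lborel (%x. indicator B x*f (x-l)))"
 proof (rule nn_integral_cong)
  fix l
  have "nnint lborel (%x. indicator B x*f (x-l)) = (nnint (distr lborel borel ((+) l)) (%x. indicator B x*f (x-l)))"
   by (simp add: lborel_distr_plus)
  also have "... = nnint lborel (%x. indicator B (l+x)*f (l+x-l))"
   by (subst nn_integral_distr) auto
  finally show "nnint lborel (%x. f x*indicator B (x+l)) = nnint lborel (%x. indicator B x*f (x-l))"
   by (simp add: mult.commute add.commute)
 qed
 also have "... = nnint lborel (%x. csum L (%l. indicator B x*f (x-l)))"
  by (rule nn_integral_count_space_nn_integral[OF L, symmetric]) measurable
 also have "... = nnint lborel (%x. indicator B x*csum L (%l. f (x-l)))"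
  by (intro nn_integral_cong nn_integral_cmult) auto
 finally show ?thesis .
qed

lemma lat_mean_count:
 fixes S :: "'a::euclidean_space set"
 assumes B: "fdom L B" and L: "countable L" and S: "S:sets borel"
  and n: "!!x. x:B ==> finite {l:L. x-l:S} & card {l:L. x-l:S} = n"
 shows "emeasure lborel S = of_nat n*emeasure lborel B"
proof -
 have "csum L (%l. indicator S (x-l)) = (of_nat n :: ennreal)" if "x:B" for x
 proof -
  have "csum L (%l. indicator S (x-l)) = csum L (%l. indicator {l:L. x-l:S} l)"
   by (intro nn_integral_cong) (auto split: split_indicator)
  also have "... = of_nat n" using n[OF that] by (subst nn_integral_indicator) (auto simp: emeasure_count_space)
  finally show ?thesis .
 qed
 then have "nnint lborel (%x. indicator B x*csum L (%l. indicator S (x-l))) =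
   nnint lborel (%x. of_nat n*indicator B x)"
  by (intro nn_integral_cong) (auto split: split_indicator)
 also have "... = of_nat n*emeasure lborel B"
  using B unfolding fdom_def by (simp add: nn_integral_cmult_indicator)
 finally show ?thesis
  using lat_mean[OF B L, of "indicator S"] S by simp
qed

lemma lat_mean_mono:
 fixes S :: "'a::euclidean_space set"
 assumes B: "fdom L B" and L: "countable L" and S: "S:sets borel"
 shows "(!!x. \<exists>\<^sub>\<le>\<^sub>1l. l:L & x-l:S) ==> emeasure lborel S <= emeasure lborel B"
  and "(!!x. EX l:L. x-l:S) ==> emeasure lborel B <= emeasure lborel S"
proof -
 have BS: "B:sets lborel" using B by (simp add: fdom_def)
 have eq: "emeasure lborel S = nnint lborel (%x. indicator B x*csum L (%l. indicator S (x-l)))"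
  using lat_mean[OF B L, of "indicator S"] S by simp
 have eq': "emeasure lborel B = nnint lborel (%x. indicator B x*1)"
  using BS by simp
 have cs: "csum L (%l. indicator S (x-l)) = emeasure (count_space L) {l:L. x-l:S}" for x
 proof -
  have "csum L (%l. indicator S (x-l)) = csum L (%l. indicator {l:L. x-l:S} l)"
   by (intro nn_integral_cong) (auto split: split_indicator)
  also have "... = emeasure (count_space L) {l:L. x-l:S}" by (intro nn_integral_indicator) auto
  finally show ?thesis .
 qed
 {
  assume *: "!!x. \<exists>\<^sub>\<le>\<^sub>1l. l:L & x-l:S"
  have "emeasure (count_space L) {l:L. x-l:S} <= 1" for x
  proof (cases "{l:L. x-l:S} = {}")
   case False
   then obtain l where "{l:L. x-l:S} = {l}" using *[of x] unfolding Uniq_def by blast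
   moreover have "l:L" using calculation by auto
   ultimately show ?thesis by (simp add: emeasure_count_space)
  next
   case True
   show ?thesis unfolding True by simp
  qed
  then show "emeasure lborel S <= emeasure lborel B"
   unfolding eq eq' cs by (intro nn_integral_mono mult_left_mono) auto
 }
 {
  assume *: "!!x. EX l:L. x-l:S"
  have "emeasure (count_space L) {l:L. x-l:S} >= 1" for x
  proof -
   obtain l where l: "l:L" "x-l:S" using * by blast
   then have "emeasure (count_space L) {l} <= emeasure (count_space L) {l:L. x-l:S}"
    by (intro emeasure_mono) auto
   then show ?thesis using l by (simp add: emeasure_count_space)
  qed
  then show "emeasure lborel B <= emeasure lborel S"
   unfolding eq eq' cs by (intro nn_integral_mono mult_left_mono) auto
 }
qed

definition covol :: "'a::euclidean_space set => real" where
 "covol L = measure lborel (SOME B. fdom L B)"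

lemma fdom_finite: "fdom L B ==> emeasure lborel B < \<infinity>"
 using emeasure_bounded_finite[of B] unfolding fdom_def by simp

lemma fdom_emeasure_unique:
 assumes L: "countable L" and "!!l. l:L ==> - l:L" and B: "fdom L B" "fdom L B'"
 shows "emeasure lborel B <= emeasure lborel B'"
proof (rule lat_mean_mono(1)[OF B(2) L])
 show "B:sets borel" using B by (simp add: fdom_def)
 show "\<exists>\<^sub>\<le>\<^sub>1l. l:L & x-l:B" for x
  unfolding Uniq_def
 proof clarify
  fix k l assume "k:L" "l:L" "x-k:B" "x-l:B"
  then have "- k:L & x+- k:B" "- l:L & x+- l:B" using assms(2) by auto
  moreover have "EX! l. l:L & x+l:B" using B unfolding fdom_def by blast
  ultimately show "k = l" by (metis neg_equal_iff_equal)
 qed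
qed

lemma emeasure_fdom:
 assumes "is_lat L" "fdom L B"
 shows "emeasure lborel B = ennreal (covol L)"
proof -
 have *: "fdom L (SOME B. fdom L B)" using assms(2) by (rule someI)
 have "emeasure lborel B = emeasure lborel (SOME B. fdom L B)"
  by (rule antisym) (use fdom_emeasure_unique[OF lat_countable[OF assms(1)] lat_minus[OF assms(1)]] assms * in blast)+
 also have "... = ennreal (covol L)"
  unfolding covol_def using fdom_finite[OF *] by (intro emeasure_eq_ennreal_measure) auto
 finally show ?thesis .
qed

lemma covol_pos:
 assumes "is_lat L"
 shows "covol L > 0"
proof (rule ccontr)
 assume "~ covol L > 0"
 then have c: "covol L = 0" by (simp add: covol_def zero_less_measure_iff)
 obtain B where B: "fdom L B" using fdom_exists[OF assms] by blast
 have "B:null_sets lborel" using B emeasure_fdom[OF assms B] c by (auto simp: fdom_def)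
 \<comment> \<open>A null domain would make the whole space null, by averaging the constant
   1.\<close>
 then have "nnint lborel (%x. indicator B x*csum L (%l. 1)) = 0"
  by (subst nn_integral_cong_AE[of _ "%_. 0"]) (auto dest!: AE_not_in elim!: eventually_mono split: split_indicator)
 then show False using lat_mean[OF B lat_countable[OF assms], of "%_. 1"] by simp
qed

section \<open>Indices of sublattices, Minkowski's theorem, sheared and similar lattices\<close>

definition lidx :: "'a::euclidean_space set => 'a set => nat" where
 "lidx L L' = card ((%l. (+) l ` L') ` L)"

lemma lat_coset_eq: "is_lat L ==> (+) x ` L = (+) y ` L \<longleftrightarrow> x-y:L"
proof
 assume L: "is_lat L" and "(+) x ` L = (+) y ` L"
 then have "x+0:(+) y ` L" using lat_zero[OF L] by blast
 then show "x-y:L" by auto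
next
 assume L: "is_lat L" and *: "x-y:L"
 have "(+) x ` L <= (+) y ` L" if "x-y:L" for x y
 proof
  fix z assume "z:(+) x ` L"
  then obtain l where "l:L" "z = x+l" by auto
  then have "z = y+(x-y+l)" "x-y+l:L" using that lat_add[OF L] by auto
  then show "z:(+) y ` L" by blast
 qed
 then show "(+) x ` L = (+) y ` L" using * lat_minus[OF L *] by (metis minus_diff_eq subset_antisym)
qed

lemma lidx_finite:
 assumes L: "is_lat L" and L': "is_lat L'" and sub: "L' <= L"
 shows "finite ((%l. (+) l ` L') ` L)"
proof -
 obtain R where R: "!!x. EX l:L'. norm (x-l) <= R" using L' unfolding is_lat_def by blast
 have "(%l. (+) l ` L') ` L <= (%l. (+) l ` L') ` (L Int cball 0 R)"
 proof
  fix C assume "C:(%l. (+) l ` L') ` L"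
  then obtain l where l: "l:L" "C = (+) l ` L'" by auto
  obtain k where k: "k:L'" "norm (l-k) <= R" using R by blast
  have "C = (+) (l-k) ` L'" using l lat_coset_eq[OF L'] k by simp
  moreover have "l-k:L Int cball 0 R" using l k sub lat_diff[OF L] by (auto simp: dist_norm norm_minus_commute)
  ultimately show "C:(%l. (+) l ` L') ` (L Int cball 0 R)" by blast
 qed
 then show ?thesis by (rule finite_subset) (intro finite_imageI lat_finite[OF L bounded_cball])
qed

text \<open>For each x, the points l of \<open>L\<close> with x - l in a domain of \<open>L'\<close>
  represent every class of \<open>L\<close> modulo \<open>L'\<close> exactly once, so averaging over
  a domain of \<open>L\<close> counts the index.\<close>

lemma covol_lidx:
 assumes L: "is_lat L" and L': "is_lat L'" and sub: "L' <= L"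
 shows "covol L' = real (lidx L L')*covol L" and "lidx L L' > 0"
proof -
 let ?C = "(%l. (+) l ` L') ` L"
 obtain B B' where B: "fdom L B" "fdom L' B'" using fdom_exists assms by meson
 have "finite {l:L. x-l:B'} & card {l:L. x-l:B'} = lidx L L'" for x
 proof -
  have un: "l = k" if "l:L'" "k:L'" "y+l:B'" "y+k:B'" for y l k
   using B(2) that unfolding fdom_def by blast
  have "bij_betw (%l. (+) l ` L') {l:L. x-l:B'} ?C"
   unfolding bij_betw_def
  proof
   show "inj_on (%l. (+) l ` L') {l:L. x-l:B'}"
   proof (rule inj_onI)
    fix k l assume *: "k:{l:L. x-l:B'}" "l:{l:L. x-l:B'}" "(+) k ` L' = (+) l ` L'"
    then have "l-k:L'" using lat_coset_eq[OF L'] by (metis lat_minus[OF L'] minus_diff_eq)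
    then have "l-k = 0" using un[of "l-k" 0 "x-l"] * lat_zero[OF L'] by auto
    then show "k = l" by simp
   qed
   show "(%l. (+) l ` L') ` {l:L. x-l:B'} = ?C"
   proof (rule antisym, blast, rule subsetI)
    fix C assume "C:?C"
    then obtain l where l: "l:L" "C = (+) l ` L'" by auto
    obtain k where k: "k:L'" "x-l+k:B'" using B(2) unfolding fdom_def by blast
    have "l-k:{l:L. x-l:B'}" using l k sub lat_diff[OF L] by (auto simp: algebra_simps)
    moreover have "C = (+) (l-k) ` L'" using l lat_coset_eq[OF L'] k by simp
    ultimately show "C:(%l. (+) l ` L') ` {l:L. x-l:B'}" by blast
   qed
  qed
  from bij_betw_finite[OF this] bij_betw_same_card[OF this] show ?thesis
   using lidx_finite[OF assms] unfolding lidx_def by simp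
 qed
 then have "emeasure lborel B' = of_nat (lidx L L')*emeasure lborel B"
  by (intro lat_mean_count[OF B(1) lat_countable[OF L]]) (use B in \<open>auto simp: fdom_def\<close>)
 then have "ennreal (covol L') = ennreal (real (lidx L L')*covol L)"
  using emeasure_fdom[OF L B(1)] emeasure_fdom[OF L' B(2)] covol_pos[OF L]
  by (simp add: ennreal_mult ennreal_of_nat_eq_real_of_nat)
 then show "covol L' = real (lidx L L')*covol L"
  using covol_pos[OF L] covol_pos[OF L'] by (subst (asm) ennreal_inj) auto
 show "lidx L L' > 0"
  unfolding lidx_def using lidx_finite[OF assms] lat_zero[OF L] by (auto simp: card_gt_0_iff)
qed

lemma covol_subset:
 assumes "is_lat L" "is_lat L'" "L' <= L" "covol L' = covol L"
 shows "L' = L"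
proof -
 have "lidx L L' = 1" using covol_lidx[OF assms(1-3)] assms(4) covol_pos[OF assms(1)] by simp
 then obtain C where C: "(%l. (+) l ` L') ` L = {C}" unfolding lidx_def by (meson card_1_singletonE)
 have "l:L'" if "l:L" for l
 proof -
  have "(+) l ` L' = (+) 0 ` L'" using C that lat_zero[OF assms(1)] by (metis imageI singletonD)
  then show ?thesis using lat_coset_eq[OF assms(2), of l 0] by simp
 qed
 then show ?thesis using assms(3) by blast
qed

lemma covol_le_cover:
 assumes L: "is_lat L" and L': "is_lat L'" "L' <= L" and "finite R" "!!l. l:L ==> EX r:R. l-r:L'"
 shows "covol L' <= real (card R)*covol L"
proof -
 have "(%l. (+) l ` L') ` L <= (%l. (+) l ` L') ` R"
 proof
  fix C assume "C:(%l. (+) l ` L') ` L"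
  then obtain l r where "C = (+) l ` L'" "r:R" "l-r:L'" using assms(5) by blast
  then have "C = (+) r ` L'" using lat_coset_eq[OF L'(1)] by simp
  then show "C:(%l. (+) l ` L') ` R" using \<open>r : R\<close> by (rule image_eqI)
 qed
 then have "lidx L L' <= card R"
  unfolding lidx_def using \<open>finite R\<close> by (meson card_image_le card_mono finite_imageI le_trans)
 then show ?thesis using covol_lidx(1)[OF L L'] covol_pos[OF L] by (simp add: mult_right_mono)
qed

text \<open>Blichfeldt's form of the theorem: were the translates of \<open>S\<close> by
  \<open>L\<close> disjoint, averaging would bound the volume of \<open>S\<close> by that of
  \<open>B\<close>.\<close>

lemma minkowski:
 assumes B: "fdom L B" and L: "countable L" and S: "S:sets borel" "emeasure lborel B < emeasure lborel S"
 shows "EX k:L. EX l:L. k ~= l & (EX x. x-k:S & x-l:S)"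
 using lat_mean_mono(1)[OF B L S(1)] S(2) unfolding Uniq_def by (metis not_less)

text \<open>Over each x the sheared set is a translate of \<open>L2\<close>, so the product of the
  two domains still works. The Minkowski lattice behind ideal norms and the lattice of rows under
  \<open>Qf\<close> both have this shape.\<close>

lemma fdom_shear:
 fixes L1 :: "'a::euclidean_space set" and L2 :: "'b::euclidean_space set"
 assumes "fdom L1 B1" "fdom L2 B2"
 shows "fdom {(x, \<phi> x+j) | x j. x:L1 & j:L2} (B1 \<times> B2)"
 unfolding fdom_def
proof (intro conjI allI)
 show "B1 \<times> B2:sets borel" using assms unfolding fdom_def borel_prod[symmetric] by auto
 show "bounded (B1 \<times> B2)" using assms unfolding fdom_def by (auto intro: bounded_Times)
 fix w :: "'a \<times> 'b"
 obtain X Y where w: "w = (X, Y)" by (cases w) auto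
 obtain x where x: "x:L1" "X+x:B1" "!!x'. x':L1 ==> X+x':B1 ==> x' = x"
  using assms(1) unfolding fdom_def by metis
 obtain j where j: "j:L2" "Y+\<phi> x+j:B2" "!!j'. j':L2 ==> Y+\<phi> x+j':B2 ==> j' = j"
  using assms(2) unfolding fdom_def by metis
 show "EX! l. l:{(x, \<phi> x+j) | x j. x:L1 & j:L2} & w+l:B1 \<times> B2"
 proof (rule ex1I[of _ "(x, \<phi> x+j)"])
  show "(x, \<phi> x+j):{(x, \<phi> x+j) | x j. x:L1 & j:L2} & w+(x, \<phi> x+j):B1 \<times> B2"
   using x(1,2) j(1,2) w by (auto simp: add.assoc)
  fix l assume l: "l:{(x, \<phi> x+j) | x j. x:L1 & j:L2} & w+l:B1 \<times> B2"
  then obtain x' j' where l': "l = (x', \<phi> x'+j')" "x':L1" "j':L2" by blast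
  then have "X+x':B1" "Y+\<phi> x'+j':B2" using l w by (simp_all add: add.assoc)
  then have "x' = x" "j' = j" using x(3)[of x'] j(3)[of j'] l' by auto
  then show "l = (x, \<phi> x+j)" using l' by simp
 qed
qed

lemma emeasure_Times: 
 assumes "A:sets borel" "B:sets borel"
 shows "emeasure lborel (A \<times> B) = emeasure lborel A*emeasure lborel (B :: 'b::euclidean_space set)"
 using assms by (subst lborel_prod[symmetric]) (simp add: lborel.emeasure_pair_measure_Times)

lemma lat_similarity:
 assumes L: "is_lat L" and ac: "a ~= 0" "c ~= 0"
 shows "is_lat ((%x. a*.x*.c) ` L)" and "covol ((%x. a*.x*.c) ` L) = (qn a*qn c)^2*covol L"
proof -
 let ?f = "%x. a*.x*.c"
 let ?g = "%x. qinv a*.x*.qinv c"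
 have gf: "?g (?f x) = x" and fg: "?f (?g x) = x" for x
  using ac by (simp_all add: qmul_assoc)
 have nf: "norm (?f x) = norm a*norm c*norm x" for x by (simp add: norm_qmul)
 have lf: "?f x-?f y = ?f (x-y)" "?f x+?f y = ?f (x+y)" for x y by (simp_all add: qring)
 show lat: "is_lat (?f ` L)"
  unfolding is_lat_def
 proof (intro conjI)
  show "0:?f ` L" using lat_zero[OF L] by force
  show "ALL x:?f ` L. ALL y:?f ` L. x-y:?f ` L" using lat_diff[OF L] by (auto simp: lf)
  obtain e where e: "e > 0" "!!x. x:L ==> x ~= 0 ==> e <= norm x" using L unfolding is_lat_def by blast
  have "norm a*norm c > 0" using ac by simp
  then show "EX e>0. ALL x:?f ` L. x ~= 0 --> e <= norm x"
   using e by (intro exI[of _ "norm a*norm c*e"]) (auto simp: nf)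
  obtain R where R: "!!x. EX l:L. norm (x-l) <= R" using L unfolding is_lat_def by blast
  show "EX R. ALL x. EX l:?f ` L. norm (x-l) <= R"
  proof (intro exI allI)
   fix x
   obtain l where l: "l:L" "norm (?g x-l) <= R" using R by blast
   have "x-?f l = ?f (?g x-l)" using fg lf by metis
   then have "norm (x-?f l) <= norm a*norm c * R" using l by (simp add: nf mult_left_mono)
   then show "EX l:?f ` L. norm (x-l) <= norm a*norm c * R" using l by blast
  qed
 qed
 obtain B where B: "fdom L B" using fdom_exists[OF L] by blast
 have "B:sets borel" "bounded B" using B by (auto simp: fdom_def)
 note [measurable] = this(1)
 have img: "?f ` S = ?g -` S" for S
 proof (intro set_eqI iffI)
  fix x assume "x:?f ` S" then show "x:?g -` S" using gf by auto
 next
  fix x assume "x:?g -` S"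
  then have "?f (?g x):?f ` S" by blast
  then show "x:?f ` S" unfolding fg .
 qed
 have mg: "?g:borel_measurable borel" by measurable
 have fd: "fdom (?f ` L) (?f ` B)"
  unfolding fdom_def
 proof (intro conjI allI)
  show "?f ` B:sets borel" unfolding img by (rule measurable_sets_borel[OF mg]) simp
  obtain K where "!!x. x:B ==> norm x <= K" using \<open>bounded B\<close> by (auto simp: bounded_iff)
  then show "bounded (?f ` B)"
   by (auto simp: bounded_iff nf intro!: exI[of _ "norm a*norm c*K"] mult_left_mono)
  fix x
  obtain l where l: "l:L" "?g x+l:B" "!!l'. l':L ==> ?g x+l':B ==> l' = l"
   using B unfolding fdom_def by metis
  have eq: "?g x+l' = ?g (x+?f l')" for l' by (simp add: qmul_add gf[simplified qmul_assoc] qmul_assoc)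
  have inB: "x+?f l':?f ` B \<longleftrightarrow> ?g x+l':B" for l'
   unfolding eq img by simp
  show "EX! l. l:?f ` L & x+l:?f ` B"
  proof (rule ex1I[of _ "?f l"])
   show "?f l:?f ` L & x+?f l:?f ` B" using l(1,2) inB[of l] by blast
   fix k assume k: "k:?f ` L & x+k:?f ` B"
   then obtain l' where l': "l':L" "k = ?f l'" by blast
   then have "?g x+l':B" using k inB[of l'] by blast
   then show "k = ?f l" using l(3)[of l'] l' by simp
  qed
 qed
 have t: "qn a*qn c = (norm a*norm c)^2" "norm a*norm c > 0" "?f ` B:sets borel"
  using ac fd by (simp_all add: qn_norm power_mult_distrib fdom_def)
 have "emeasure lborel (?f ` B) = nnint lborel (%x. indicator (?f ` B) x)" using t(3) by simp
 also have "... = ennreal ((norm a*norm c)^4)*nnint lborel (%x. indicator (?f ` B) (a*.x*.c+0))"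
  by (rule nn_integral_quat_similarity[OF t(1,2)]) (use t in simp)
 also have "(%x. indicator (?f ` B) (a*.x*.c+0) :: ennreal) = indicator B"
  by (simp add: fun_eq_iff img indicator_def gf)
 finally have "ennreal (covol (?f ` L)) = ennreal ((norm a*norm c)^4*covol L)"
  using emeasure_fdom[OF L B] emeasure_fdom[OF lat fd] covol_pos[OF L] by (simp add: ennreal_mult)
 then have "covol (?f ` L) = (norm a*norm c)^4*covol L"
  using covol_pos[OF L] covol_pos[OF lat] by (subst (asm) ennreal_inj) auto
 also have "(norm a*norm c)^4 = (qn a*qn c)^2" unfolding t(1) by (simp add: power_mult[symmetric])
 finally show "covol (?f ` L) = (qn a*qn c)^2*covol L" .
qed

lemma lat_left:
 assumes "is_lat L" "a ~= 0"
 shows "is_lat ((*.) a ` L)" "covol ((*.) a ` L) = (qn a)^2*covol L"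
 using lat_similarity[OF assms, of qone] by auto

lemma lat_scale:
 assumes "is_lat L" "t ~= 0"
 shows "is_lat ((*R) t ` (L::quat set))" "covol ((*R) t ` L) = t^4*covol L"
proof -
 have "(*R) t = (*.) (t*R qone)" by (auto simp: fun_eq_iff)
 then show "is_lat ((*R) t ` (L::quat set))" "covol ((*R) t ` L) = t^4*covol L"
  using lat_left[OF assms(1), of "t*R qone"] assms(2) by (auto simp: power_mult[symmetric])
qed

section \<open>Discrete groups of isometries\<close>

text \<open>An exhaustion function adapted to the group: by \<open>Qf_act\<close> its value at
  \<open>act M w\<close> is the sum of \<open>Qf w\<close> over the two rows of M, so a bound on it
  leaves finitely many integral M.\<close>

definition ppair :: "quat \<times> real => real" where
 "ppair w = Qf w (qone, 0)+Qf w (0, qone)"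

lemma ppair_measurable [measurable]: "ppair:borel_measurable borel"
 unfolding ppair_def by measurable

lemma AE_hyp_pos: "AE w in hyp_measure. snd w > 0"
 unfolding hyp_measure_def
 by (subst AE_density) (auto simp: borel_prod[symmetric] lborel_prod intro!: AE_I2 split: if_splits)

lemma null_sets_hyp:
 assumes "N:null_sets lborel"
 shows "N:null_sets hyp_measure"
proof -
 have [measurable]: "(%(z, r). if r > 0 then ennreal (1/r^5) else 0):borel_measurable (lborel :: (quat \<times> real) measure)"
  unfolding lborel_prod[symmetric] by measurable
 have "AE w in lborel. w ~: N" using assms by (rule AE_not_in)
 then have "AE w in hyp_measure. w ~: N"
  unfolding hyp_measure_def by (subst AE_density) auto
 moreover have "N:sets hyp_measure" using assms by auto
 ultimately show ?thesis by (subst (asm) AE_iff_null_sets[symmetric]) auto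
qed

lemma emeasure_subset_null: "A <= N ==> N:null_sets M ==> emeasure M A = 0"
 by (cases "A:sets M") (auto simp: emeasure_notin_sets dest: null_sets_subset)

lemma inner_qmul: "(x*.y) \<bullet> e = y \<bullet> (qcnj x*.e)" "(x*.y) \<bullet> e = x \<bullet> (e*.qcnj y)"
 by (simp_all add: inner_vec_def sum_four qmul_nth qcnj_nth algebra_simps)

text \<open>If c is nonzero, the height of a fixed point is determined by its horizontal coordinate.
  If c = 0, fixed points satisfy a z + b = z d, which confines z to a hyperplane unless a = d is
  real; in that case M is, up to sign, a nontrivial translation and has no fixed point.\<close>

lemma fixed_points_null:
 assumes det: "Det_sq M = 1" and M: "M ~= qmat_id" "M ~= qmat_neg qmat_id"
 shows "EX N:null_sets hyp_measure. {w. snd w > 0 & act M w = w} <= N"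
proof -
 obtain a b c d where Me: "M = (a, b, c, d)" by (cases M) auto
 have fix_iff: "qn (c*.z+d)+r^2*qn c = 1" "(a*.z+b)*.qcnj (c*.z+d)+r^2*R (a*.qcnj c) = z"
  if "r > 0" "act M (z, r) = (z, r)" for z r
 proof -
  have eq: "r/(qn (c*.z+d)+r^2*qn c) = r"
   and eq2: "(1/(qn (c*.z+d)+r^2*qn c))*R ((a*.z+b)*.qcnj (c*.z+d)+r^2*R (a*.qcnj c)) = z"
   using that(2) by (simp_all add: Me act_def Let_def)
  have "D = 1" if "r/D = r" for D
   using that \<open>r > 0\<close> by (auto simp: divide_eq_eq split: if_splits)
  then show 1: "qn (c*.z+d)+r^2*qn c = 1" using eq .
  show "(a*.z+b)*.qcnj (c*.z+d)+r^2*R (a*.qcnj c) = z" using eq2 unfolding 1 by simp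
 qed
 show ?thesis
 proof (cases "c = 0")
  case False
  define N where "N = {w:space (lborel \<Otimes>\<^sub>M lborel). snd w > (0::real) & qn (c*.fst w+d)+(snd w)^2*qn c = 1}"
  have Nm: "N:sets (lborel \<Otimes>\<^sub>M lborel)" unfolding N_def by measurable
  have "emeasure lborel (Pair z -` N) = 0" for z
  proof -
   have "r = s" if "r:Pair z -` N" "s:Pair z -` N" for r s
   proof -
    have e: "qn (c*.z+d)+r^2*qn c = 1" "qn (c*.z+d)+s^2*qn c = 1" "r > 0" "s > 0"
     using that by (simp_all add: N_def)
    then have "r^2*qn c = s^2*qn c" by linarith
    then have "r^2 = s^2" using False by simp
    then show "r = s" using e by (simp add: power2_eq_iff)
   qed
   then have "Pair z -` N = {} | (EX r. Pair z -` N = {r})" by blast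
   then show ?thesis by auto
  qed
  then have "emeasure lborel N = 0" "N:sets lborel"
   using lborel.emeasure_pair_measure_alt[OF Nm] Nm by (simp_all add: lborel_prod[symmetric])
  then have "N:null_sets lborel" by (simp add: null_setsI)
  moreover have "{w. snd w > 0 & act M w = w} <= N"
   using fix_iff(1) by (auto simp: N_def space_pair_measure)
  ultimately show ?thesis using null_sets_hyp by blast
 next
  case True
  have fixed: "a*.z+b = z*.d" if "r > 0" "act M (z, r) = (z, r)" for z r
  proof -
   have 1: "qn d = 1" "(a*.z+b)*.qcnj d = z" using fix_iff[OF that] by (simp_all add: True)
   have "((a*.z+b)*.qcnj d)*.d = a*.z+b" by (simp add: qmul_assoc qmul_qcnj 1(1))
   then show ?thesis unfolding 1(2) by (rule sym)
  qed
  show ?thesis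
  proof (cases "ALL z. a*.z = z*.d")
   case all: True
   then have ad: "a = d" by (metis qmul_one)
   then obtain t where t: "a = t*R qone" using central_quat all by metis
   have "t^4 = 1" using det by (simp add: Me True Det_sq_def qn_qmul ad[symmetric] t power_mult[symmetric] flip: power_add)
   then have "t = 1 | t = - 1" by (metis power4_eq_xxxx abs_square_eq_1 power2_eq_square mult.assoc power2_eq_1_iff abs_1 abs_mult abs_power2 power_mult_distrib power_one_right real_sqrt_abs2 real_sqrt_one)
   then have "b ~= 0" using M by (auto simp: Me True ad[symmetric] t qmat_id_def qmat_neg_def)
   then have "{w. snd w > 0 & act M w = w} = {}" using fixed all by auto
   then show ?thesis by (intro bexI[of _ "{}"]) auto
  next
   case False
   then obtain z0 where z0: "a*.z0-z0*.d ~= 0" by auto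
   define e where "e = a*.z0-z0*.d"
   \<comment> \<open>The adjoint of the map z to a z - z d, applied to e. Pairing the fixed point
     equation with e puts z on a hyperplane with normal y, and y is nonzero because e is a nonzero
     value of that map.\<close>
   define y where "y = qcnj a*.e-e*.qcnj d"
   have ip: "y \<bullet> z = (a*.z-z*.d) \<bullet> e" for z
    unfolding y_def inner_diff_left inner_qmul(1)[of a z e] inner_qmul(2)[of z d e]
    by (simp add: inner_diff_left inner_diff_right inner_commute)
   have "y \<bullet> z0 ~= 0" using z0 unfolding ip e_def[symmetric] by simp
   then have "y ~= 0" by auto
   define H where "H = {z. y \<bullet> z = - (b \<bullet> e)}"
   have Hb: "H:sets borel" unfolding H_def by (simp add: closed_hyperplane borel_closed)
   have "emeasure lborel H = 0"
    using negligible_hyperplane[of y "- (b \<bullet> e)"] \<open>y ~= 0\<close> Hb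
    by (simp add: negligible_iff_null_sets H_def[symmetric] null_sets_def)
   then have "emeasure lborel (H \<times> (UNIV :: real set)) = 0"
    using Hb by (simp add: emeasure_Times)
   moreover have "H \<times> (UNIV :: real set):sets lborel"
    using Hb unfolding sets_lborel borel_prod[symmetric] by (intro pair_measureI) auto
   ultimately have "H \<times> (UNIV :: real set):null_sets lborel" by auto
   moreover have "{w. snd w > 0 & act M w = w} <= H \<times> UNIV"
   proof
    fix w assume w: "w:{w. snd w > 0 & act M w = w}"
    obtain z r where wz: "w = (z, r)" by (cases w) auto
    then have "a*.z+b = z*.d" using w fixed[of r z] by simp
    then have "a*.z-z*.d = - b" by (simp add: algebra_simps)
    then show "w:H \<times> UNIV" by (simp add: wz H_def ip)
   qed
   ultimately show ?thesis using null_sets_hyp by blast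
  qed
 qed
qed

locale kleinian =
 fixes G :: "qmat set"
 assumes det: "M:G ==> Det_sq M = 1"
  and mul_closed: "M:G ==> N:G ==> M \<odot> N:G"
  and inv_closed: "M:G ==> minv M:G"
  and id_closed: "qmat_id:G"
  and neg_id_closed: "qmat_neg qmat_id:G"
  and count: "countable G"
  and proper: "snd w > 0 ==> finite {M:G. ppair (act M w) <= R}"
begin

lemma inverse: "M:G ==> M \<odot> minv M = qmat_id" "M:G ==> minv M \<odot> M = qmat_id"
 by (simp_all add: minv_right minv_left det)

lemma act_inverse: "M:G ==> snd w > 0 ==> act (minv M) (act M w) = w"
  "M:G ==> snd w > 0 ==> act M (act (minv M) w) = w"
 by (simp_all add: act_mmul[symmetric] det inv_closed inverse act_id)

lemma act_pos: "M:G ==> snd w > 0 ==> snd (act M w) > 0"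
 by (simp add: act_H5 det)

text \<open>Only elements that move w are tested, so points with a nontrivial stabiliser are not
  excluded; the overlaps of translates that remain consist of fixed points and are null.\<close>

definition dirichlet :: "(quat \<times> real) set" where
 "dirichlet = {w:H5. ALL M:G. act M w ~= w --> lless ppair w (act M w)}"

lemma dirichlet_fund_domain: "fund_domain G dirichlet"
 unfolding fund_domain_def
proof (intro conjI ballI impI)
 have H5b: "H5:sets (borel :: (quat \<times> real) measure)"
 proof -
  have "{w:space (borel \<Otimes>\<^sub>M borel). snd w > (0::real)}:sets ((borel :: quat measure) \<Otimes>\<^sub>M borel)"
   by measurable
  moreover have "H5 = {w:space ((borel :: quat measure) \<Otimes>\<^sub>M borel). snd w > (0::real)}" by (auto simp: H5_def space_pair_measure)
  ultimately have "H5:sets (borel \<Otimes>\<^sub>M borel)" by (simp only:)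
  then show ?thesis unfolding borel_prod .
 qed
 have "{w:space borel. act M w ~= w --> lless ppair w (act M w)}:sets borel" for M by measurable
 then have "{w. act M w ~= w --> lless ppair w (act M w)}:sets borel" for M by simp
 then have "(INT M:G. {w. act M w ~= w --> lless ppair w (act M w)}):sets borel"
  using count id_closed by (intro sets.countable_INT') auto
 moreover have "dirichlet = H5 Int (INT M:G. {w. act M w ~= w --> lless ppair w (act M w)})"
  unfolding dirichlet_def by blast
 ultimately show "dirichlet:sets lborel" using H5b by simp
 show "dirichlet <= H5" by (auto simp: dirichlet_def)
next
 fix w assume "w:H5"
 then have w: "snd w > 0" by (auto simp: H5_def)
 have "EX m:(%M. act M w) ` G. ALL x:(%M. act M w) ` G. x ~= m --> lless ppair m x"
 proof (rule exists_lless_least)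
  fix R
  have "{x:(%M. act M w) ` G. ppair x <= R} = (%M. act M w) ` {M:G. ppair (act M w) <= R}" by auto
  then show "finite {x:(%M. act M w) ` G. ppair x <= R}" using proper[OF w] by simp
 qed (use id_closed in auto)
 then obtain M where M: "M:G" "!!N. N:G ==> act N w ~= act M w ==> lless ppair (act M w) (act N w)" by auto
 have "act M w:dirichlet"
  unfolding dirichlet_def
 proof (intro CollectI conjI ballI impI)
  show "act M w:H5" using act_pos[OF M(1) w] by (cases "act M w") (auto simp: H5_def)
  fix N assume N: "N:G" "act N (act M w) ~= act M w"
  then show "lless ppair (act M w) (act N (act M w))"
   using M(2)[of "N \<odot> M"] mul_closed[OF N(1) M(1)] by (simp add: act_mmul det M(1) w)
 qed
 then show "EX M:G. act M w:dirichlet" using M(1) by blast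
next
 fix M assume M: "M:G" "M ~= qmat_id & M ~= qmat_neg qmat_id"
 have "dirichlet Int act M ` dirichlet <= {w. snd w > 0 & act M w = w}"
 proof
  fix w assume w: "w:dirichlet Int act M ` dirichlet"
  then obtain w' where w': "w':dirichlet" "w = act M w'" by auto
  have pos: "snd w > 0" "snd w' > 0" using w w' by (auto simp: dirichlet_def H5_def)
  have "w' = act (minv M) w" using act_inverse(1)[OF M(1) pos(2)] w'(2) by simp
  then have "w = w'"
   using w w' M(1) inv_closed[OF M(1)] lless_trans[of ppair w w' w] unfolding dirichlet_def by force
  then show "w:{w. snd w > 0 & act M w = w}" using w' pos by simp
 qed
 moreover obtain N where "N:null_sets hyp_measure" "{w. snd w > 0 & act M w = w} <= N"
  using fixed_points_null[OF det[OF M(1)]] M(2) by blast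
 ultimately show "emeasure hyp_measure (dirichlet Int act M ` dirichlet) = 0"
  by (meson emeasure_subset_null subset_trans)
qed

lemma act_neg: "act (qmat_neg M) w = act M w"
proof -
 have "(- x)*.z+(- y) = - (x*.z+y)" for x y z by simp
 then show ?thesis
  by (cases M, cases w) (simp only: qmat_neg_def act_def Let_def case_prod_conv qn_simps qcnj_minus qmul_minus minus_minus)
qed

lemma neg_closed: "M:G ==> qmat_neg M:G"
proof -
 assume "M:G"
 moreover have "qmat_neg M = qmat_neg qmat_id \<odot> M" by (cases M) (simp add: qmat_neg_def qmat_id_def)
 ultimately show ?thesis using mul_closed neg_id_closed by simp
qed

text \<open>A fundamental domain is defined by null overlaps of F with its translates. Invariance of
  the measure turns this into a statement on almost every orbit: at most one pair M, -M carries w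
  into F.\<close>

lemma fund_domain_overlap:
 assumes F: "fund_domain G F"
 shows "AE w in hyp_measure. ALL M:G. ALL N:G. act M w:F --> act N w:F --> M = N | M = qmat_neg N"
proof -
 have Fb [measurable]: "F:sets borel" and FH: "F <= H5" using F by (auto simp: fund_domain_def)
 have "AE w in hyp_measure. act M w:F --> act N w:F --> M = N | M = qmat_neg N" if MN: "M:G" "N:G" for M N
 proof (cases "M = N | M = qmat_neg N")
  case False
  define K where "K = M \<odot> minv N"
  have K: "K:G" unfolding K_def using MN mul_closed inv_closed by simp
  have KN: "M = K \<odot> N" unfolding K_def by (simp add: mmul_assoc inverse MN)
  have Kne: "minv K ~= qmat_id" "minv K ~= qmat_neg qmat_id"
  proof -
   have "K = qmat_id" if "minv K = qmat_id" using inverse(1)[OF K] that by simp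
   moreover have "K = qmat_neg qmat_id" if "minv K = qmat_neg qmat_id"
   proof -
    have "qmat_neg K = qmat_id" using inverse(1)[OF K] that by (cases K) (simp add: qmat_neg_def qmat_id_def)
    then show ?thesis by (cases K) (auto simp: qmat_neg_def qmat_id_def minus_equation_iff[of _ qone])
   qed
   moreover have "K ~= qmat_id" "K ~= qmat_neg qmat_id"
    using False KN by (auto simp: qmat_neg_def qmat_id_def) (metis (no_types) mmul_id(2) qmat_id_def, cases N, auto)
   ultimately show "minv K ~= qmat_id" "minv K ~= qmat_neg qmat_id" by blast+
  qed
  have eq: "{w:F. act K w:F} = F Int act (minv K) ` F"
  proof (intro set_eqI iffI)
   fix w assume w: "w:{w:F. act K w:F}"
   then have "w = act (minv K) (act K w)" using act_inverse(1)[OF K] FH by (auto simp: H5_def)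
   then show "w:F Int act (minv K) ` F" using w by blast
  next
   fix w assume "w:F Int act (minv K) ` F"
   then obtain w' where "w:F" "w':F" "w = act (minv K) w'" by blast
   then show "w:{w:F. act K w:F}" using act_inverse(2)[OF K] FH by (auto simp: H5_def)
  qed
  have "nnint hyp_measure (%w. indicator F w*indicator F (act K w)) = emeasure hyp_measure {w:F. act K w:F}"
  proof -
   have "{w:space borel. w:F & act K w:F}:sets borel" by measurable
   then have "{w:F. act K w:F}:sets hyp_measure" by simp
   moreover have "nnint hyp_measure (%w. indicator F w*indicator F (act K w)) = nnint hyp_measure (%w. indicator {w:F. act K w:F} w)"
    by (intro nn_integral_cong) (auto split: split_indicator)
   ultimately show ?thesis by simp
  qed
  also have "... = 0"
   unfolding eq using F inv_closed[OF K] Kne unfolding fund_domain_def by blast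
  finally have 0: "nnint hyp_measure (%w. indicator F w*indicator F (act K w)) = 0" .
  have "nnint hyp_measure (%w. indicator F (act N w)*indicator F (act K (act N w))) = (0::ennreal)"
   using nn_integral_act[OF det[OF MN(2)], of "%w. indicator F w*indicator F (act K w)"] 0 by simp
  then have "AE w in hyp_measure. indicator F (act N w)*indicator F (act K (act N w)) = (0::ennreal)"
   by (subst (asm) nn_integral_0_iff_AE) auto
  then show ?thesis
   using AE_hyp_pos
  proof eventually_elim
   case (elim w)
   then have "act N w ~: F | act M w ~: F"
    unfolding KN by (simp add: act_mmul det K MN(2) split: split_indicator_asm)
   then show ?case by blast
  qed
 qed simp
 then show ?thesis unfolding AE_ball_countable[OF count] by blast
qed

text \<open>Invariance moves the group element from f to the indicator of F; the factor 2 counts M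
  and -M, which act alike.\<close>

theorem orbit_unfolding:
 assumes F: "fund_domain G F" and f [measurable]: "f:borel_measurable borel"
 shows "nnint hyp_measure (%w. indicator F w*csum G (%M. f (act M w))) = 2*nnint hyp_measure (%w. f w)"
proof -
 have Fb [measurable]: "F:sets borel" using F by (auto simp: fund_domain_def)
 have "nnint hyp_measure (%w. indicator F w*csum G (%M. f (act M w))) =
  nnint hyp_measure (%w. csum G (%M. indicator F w*f (act M w)))"
  by (intro nn_integral_cong nn_integral_cmult[symmetric]) auto
 also have "... = csum G (%M. nnint hyp_measure (%w. indicator F w*f (act M w)))"
  by (rule nn_integral_count_space_nn_integral[OF count]) measurable
 also have "... = csum G (%M. nnint hyp_measure (%w. indicator F (act (minv M) w)*f w))"
 proof (rule nn_integral_cong)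
  fix M assume "M:space (count_space G)"
  then have M: "M:G" by simp
  have "nnint hyp_measure (%w. indicator F w*f (act M w)) =
   nnint hyp_measure (%w. indicator F (act (minv M) (act M w))*f (act M w))"
   by (rule nn_integral_hyp_cong) (simp add: act_inverse M)
  also have "... = nnint hyp_measure (%w. indicator F (act (minv M) w)*f w)"
   by (rule nn_integral_act[OF det[OF M], of "%w. indicator F (act (minv M) w)*f w"]) measurable
  finally show "nnint hyp_measure (%w. indicator F w*f (act M w)) =
   nnint hyp_measure (%w. indicator F (act (minv M) w)*f w)" .
 qed
 also have "... = nnint hyp_measure (%w. csum G (%M. indicator F (act (minv M) w)*f w))"
  by (rule nn_integral_count_space_nn_integral[OF count, symmetric]) measurable
 also have "... = nnint hyp_measure (%w. 2*f w)"
 proof (rule nn_integral_cong_AE)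
  show "AE w in hyp_measure. (csum G (%M. indicator F (act (minv M) w)*f w)) = 2*f w"
   using fund_domain_overlap[OF F] AE_hyp_pos
  proof eventually_elim
   case (elim w)
   then have "w:H5" by (cases w) (auto simp: H5_def)
   then obtain M0 where M0: "M0:G" "act M0 w:F" using F unfolding fund_domain_def by blast
   have set: "{M:G. act M w:F} = {M0, qmat_neg M0}"
   proof (intro set_eqI iffI)
    fix M assume "M:{M:G. act M w:F}"
    then show "M:{M0, qmat_neg M0}" using elim(1) M0 by blast
   next
    fix M assume "M:{M0, qmat_neg M0}"
    then show "M:{M:G. act M w:F}" using M0 neg_closed[OF M0(1)] by (elim insertE) (simp_all add: act_neg)
   qed
   have ne: "M0 ~= qmat_neg M0"
   proof
    assume "M0 = qmat_neg M0"
    moreover have "x = - x ==> x = 0" for x :: quat by (auto simp: quat_eq_iff)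
    ultimately have "M0 = (0, 0, 0, 0)" by (cases M0) (auto simp: qmat_neg_def)
    then show False using det[OF M0(1)] by (simp add: Det_sq_def)
   qed
   have bij: "bij_betw minv G G"
    by (rule bij_betw_byWitness[of _ minv])
     (use inv_closed in \<open>auto, (metis inverse mmul_assoc mmul_id inv_closed)+\<close>)
   have "csum G (%M. indicator F (act (minv M) w)*f w) =
    csum G (%M. indicator F (act (minv M) w))*f w"
    by (rule nn_integral_multc) auto
   also have "csum G (%M. indicator F (act (minv M) w)) = csum G (%M. indicator F (act M w))"
    by (rule nn_integral_bij_count_space[OF bij])
   also have "... = csum G (%M. indicator {M:G. act M w:F} M)"
    by (intro nn_integral_cong) (auto split: split_indicator)
   also have "... = emeasure (count_space G) {M:G. act M w:F}" by (rule nn_integral_indicator) auto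
   also have "... = 2" unfolding set using ne M0(1) neg_closed by (subst emeasure_count_space_finite) auto
   finally show ?case .
  qed
 qed
 also have "... = 2*nnint hyp_measure (%w. f w)" by (rule nn_integral_cmult) auto
 finally show ?thesis .
qed

end

section \<open>Maximal orders\<close>

lemma Rats_square_Ints:
 assumes "(q::real):\<rat>" "q^2:\<int>"
 shows "q:\<int>"
proof -
 obtain a b :: int where ab: "b > 0" "coprime a b" "q = of_int a/of_int b"
  using assms(1) by (metis Rats_cases')
 obtain k where k: "q^2 = of_int k" using assms(2) by (auto elim: Ints_cases)
 have "of_int (a^2) = (of_int (k*b^2) :: real)"
 proof -
  have "of_int a = q * of_int b" using ab by simp
  then show ?thesis using k by (simp add: power_mult_distrib)
 qed
 then have "a^2 = k*b^2" by (subst (asm) of_int_eq_iff)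
 then have 1: "b^2 dvd a^2" by simp
 have 2: "coprime (b^2) (a^2)" using ab(2) by (simp add: coprime_commute)
 have "is_unit (b^2)" using coprime_common_divisor[OF 2 dvd_refl 1] .
 then have "b = 1" using ab(1) by (auto simp: power2_eq_1_iff)
 then show ?thesis using ab(3) by simp
qed

lemma Rats_cancel: "k ~= 0 ==> k:\<rat> ==> k*x:\<rat> ==> (x::real):\<rat>"
 using Rats_divide[of "k*x" k] by simp

lemma common_denominator:
 assumes "finite T" "!!s. s:T ==> g s:(\<rat> :: real set)"
 shows "EX m::nat. m > 0 & (ALL s:T. real m*g s:\<int>)"
 using assms
proof (induction T rule: finite_induct)
 case empty then show ?case by (auto intro: exI[of _ 1])
next
 case (insert x F)
 then obtain m where m: "m > 0" "ALL s:F. real m*g s:\<int>" by auto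
 obtain a b :: int where ab: "b > 0" "g x = of_int a/of_int b"
  using insert(4)[of x] by (metis Rats_cases' insertI1)
 have "real (m*nat b)*g s:\<int>" if "s:insert x F" for s
 proof (cases "s = x")
  case True
  have "real (m*nat b)*g s = of_int (int m*a)" using ab True by simp
  then show ?thesis by (metis Ints_of_int)
 next
  case False
  then have "real m*g s:\<int>" using m that by auto
  then have "of_int b*(real m*g s):\<int>" by simp
  then show ?thesis using ab(1) by (simp add: mult_ac)
 qed
 then show ?case using m ab by (intro exI[of _ "m*nat b"]) auto
qed

definition zspan :: "quat set => quat set" where
 "zspan S = {x. EX c :: quat => int. x = (SUM s:S. of_int (c s)*R s)}"

lemma int_scale_closed:
 assumes "0:X" "!!x y. x:X ==> y:X ==> x-y:(X :: quat set)" "x:X"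
 shows "of_int k*R x:X"
proof -
 have neg: "- y:X" if "y:X" for y using assms(2)[OF assms(1) that] by simp
 have add: "y+z:X" if "y:X" "z:X" for y z using assms(2)[OF that(1) neg[OF that(2)]] by simp
 have nat: "real n*R x:X" for n
  by (induction n) (auto simp: assms(1) scaleR_add_left intro!: add assms(3))
 show ?thesis
  using nat[of "nat k"] neg[OF nat[of "nat (- k)"]] by (cases "k >= 0") auto
qed

lemma sum_closed:
 assumes "0:X" "!!x y. x:X ==> y:X ==> x-y:(X :: quat set)" "!!s. s:T ==> f s:X"
 shows "sum f T:X"
proof -
 have "y+z:X" if "y:X" "z:X" for y z
  using assms(2)[OF that(1) assms(2)[OF assms(1) that(2)]] by simp
 then show ?thesis using assms(1,3) by (induction T rule: infinite_finite_induct) auto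
qed

lemma zspan_subset:
 assumes "0:X" "!!x y. x:X ==> y:X ==> x-y:X" "S <= X"
 shows "zspan S <= X"
 unfolding zspan_def using assms(3) by (auto intro!: sum_closed[OF assms(1,2)] int_scale_closed[OF assms(1,2)])

lemma zspan_zero: "0:zspan S"
 unfolding zspan_def by (auto intro!: exI[of _ "%_. 0"])

lemma zspan_diff: "x:zspan S ==> y:zspan S ==> x-y:zspan S"
proof -
 assume "x:zspan S" "y:zspan S"
 then obtain c d where "x = (SUM s:S. of_int (c s)*R s)" "y = (SUM s:S. of_int (d s)*R s)"
  unfolding zspan_def by blast
 then have "x-y = (SUM s:S. of_int (c s-d s)*R s)"
  by (simp add: sum_subtractf scaleR_diff_left)
 then show ?thesis unfolding zspan_def by (intro CollectI exI)
qed

lemma zspan_base: "finite S ==> s:S ==> s:zspan S"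
 unfolding zspan_def by (auto intro!: exI[of _ "%x. if x = s then 1 else 0"] simp: if_distrib if_distribR sum.delta cong: if_cong)

lemma zspan_qmul:
 assumes X: "0:X" "!!x y. x:X ==> y:X ==> x-y:X"
  and "!!s t. s:S ==> t:T ==> s*.y*.t:X" "a:zspan S" "b:zspan T"
 shows "a*.y*.b:X"
proof -
 obtain c d where c: "a = (SUM s:S. of_int (c s)*R s)" and d: "b = (SUM s:T. of_int (d s)*R s)"
  using assms(4,5) unfolding zspan_def by blast
 have "a*.y*.b = (SUM t:T. SUM s:S. of_int (d t)*R of_int (c s)*R (s*.y*.t))"
  unfolding c d qmul_sum by (simp add: qmul_sum scaleR_sum_right)
 also have "...:X" by (intro sum_closed[OF X] int_scale_closed[OF X] assms(3))
 finally show ?thesis .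
qed

text \<open>For an order this is the inverse different.\<close>

definition qdual :: "quat set => quat set" where
 "qdual L = {y. ALL x:L. qtr (y*.x):\<int>}"

lemma lat_qdual:
 assumes L: "is_lat L" and k: "k ~= 0" "!!x. x:L ==> k*R x:qdual L"
 shows "is_lat (qdual L)"
proof -
 obtain R where R: "!!x. EX l:L. norm (x-l) <= R" using L unfolding is_lat_def by blast
 have R0: "R >= 0" using R[of 0] norm_ge_zero order_trans by blast
 have sep: "1/(2*(2 * R+1)) <= norm y" if y: "y:qdual L" "y ~= 0" for y
 proof (rule ccontr)
  assume "~ 1/(2*(2 * R+1)) <= norm y"
  then have small: "2*norm y*(2 * R+1) < 1" using R0 by (simp add: field_simps)
  \<comment> \<open>The trace of y against u is 2 (R+1) |y|, and moving u to a lattice point within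
    R changes it by at most 2 R |y|. A nonzero y that is too short would have a trace strictly
    between 0 and 1.\<close>
  define u where "u = ((R+1)/norm y)*R qcnj y"
  obtain l where l: "l:L" "norm (u-l) <= R" using R by blast
  have ny: "norm y > 0" "norm (qcnj y) = norm y" using y qn_simps(1)[of y] unfolding qn_norm by simp_all
  have tr: "qtr (y*.x) = 2*(y \<bullet> qcnj x)" for x using qtr_inner[of y "qcnj x"] by simp
  have "qtr (y*.u) = 2*norm y*(R+1)"
   using ny(1) unfolding tr u_def by (simp add: power2_norm_eq_inner[symmetric] power2_eq_square)
  moreover have "\<bar>qtr (y*.(u-l))\<bar> <= 2*norm y * R"
  proof -
   have "\<bar>y \<bullet> qcnj (u-l)\<bar> <= norm y*norm (qcnj (u-l))" by (rule Cauchy_Schwarz_ineq2)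
   also have "norm (qcnj (u-l)) <= R" using l(2) qn_simps(1)[of "u-l"] unfolding qn_norm by simp
   finally show ?thesis unfolding tr using ny by (simp add: mult_left_mono)
  qed
  moreover have "qtr (y*.l) = qtr (y*.u)-qtr (y*.(u-l))" by (simp add: qmul_diff qtr_diff)
  ultimately have "qtr (y*.l) >= 2*norm y" "qtr (y*.l) <= 2*norm y*(2 * R+1)"
   by (auto simp: algebra_simps abs_le_iff)
  then have "0 < qtr (y*.l)" "qtr (y*.l) < 1" using ny small by linarith+
  moreover have "qtr (y*.l):\<int>" using y l unfolding qdual_def by blast
  ultimately show False by (auto elim!: Ints_cases)
 qed
 obtain R' where R': "!!x. EX l:(*R) k ` L. norm (x-l) <= R'"
  using lat_scale(1)[OF L k(1)] unfolding is_lat_def by blast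
 have "EX l:qdual L. norm (x-l) <= R'" for x
 proof -
  obtain l where "l:(*R) k ` L" "norm (x-l) <= R'" using R' by blast
  moreover have "l:qdual L" using calculation k(2) by auto
  ultimately show ?thesis by blast
 qed
 moreover have "x-y:qdual L" if "x:qdual L" "y:qdual L" for x y
  using that unfolding qdual_def by (auto simp: qmul_diff qtr_diff)
 moreover have "EX e>0. ALL x:qdual L. x ~= 0 --> e <= norm x"
  using sep R0 by (intro exI[of _ "1/(2*(2 * R+1))"]) auto
 moreover have "0:qdual L" by (simp add: qdual_def)
 ultimately show ?thesis unfolding is_lat_def by blast
qed

lemma lat_multiple:
 fixes L L' :: "quat set"
 assumes "is_lat L" "is_lat L'" "L' <= L" "y:L"
 shows "EX k::nat. k > 0 & real k*R y:L'"
proof -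
 have yk: "of_int k*R y:L" for k
  using int_scale_closed[of L y k] lat_zero[OF assms(1)] lat_diff[OF assms(1)] assms(4) by blast
 have "~ inj (%k::nat. (+) (real k*R y) ` L')"
 proof
  assume "inj (%k::nat. (+) (real k*R y) ` L')"
  moreover have "range (%k::nat. (+) (real k*R y) ` L') <= (%l. (+) l ` L') ` L"
   using yk[of "int _"] by auto
  ultimately show False
   using lidx_finite[OF assms(1-3)] finite_imageD finite_subset infinite_UNIV_nat by metis
 qed
 then obtain i j :: nat where ij: "i ~= j" "(+) (real i*R y) ` L' = (+) (real j*R y) ` L'"
  unfolding inj_def by blast
 have *: "EX k::nat. k > 0 & real k*R y:L'" if "i < j" "(+) (real i*R y) ` L' = (+) (real j*R y) ` L'" for i j :: nat
 proof -
  have "real j*R y-real i*R y:L'" using that lat_coset_eq[OF assms(2)] by metis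
  then have "real (j-i)*R y:L'" using that by (simp add: of_nat_diff scaleR_diff_left)
  then show ?thesis using that by (intro exI[of _ "j-i"]) auto
 qed
 show ?thesis using *[of i j] *[of j i] ij by (cases "i < j") auto
qed

section \<open>Linear images of lattices and the standard integral lattice\<close>

lemma lat_linear:
 fixes f :: "real^'n::{finite,wellorder} => real^'n::_"
 assumes L: "is_lat L" and f: "linear f" "inj f"
 shows "is_lat (f ` L)" and "covol (f ` L) = \<bar>det (matrix f)\<bar>*covol L"
proof -
 obtain b where b: "b > 0" "!!x. b*norm x <= norm (f x)"
  using linear_inj_bounded_below_pos[OF f] by blast
 have surj: "surj f" using linear_injective_imp_surjective[OF f] by simp
 have bl: "bounded_linear f" using f by (simp add: linear_conv_bounded_linear)
 obtain K where K: "!!x. norm (f x) <= norm x*K" "K > 0"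
  using bounded_linear.pos_bounded[OF bl] by blast
 show lat: "is_lat (f ` L)"
  unfolding is_lat_def
 proof (intro conjI)
  show "0:f ` L" using lat_zero[OF L] linear_0[OF f(1)] by force
  show "ALL x:f ` L. ALL y:f ` L. x-y:f ` L" using lat_diff[OF L] by (auto simp: linear_diff[OF f(1), symmetric])
  obtain e where e: "e > 0" "!!x. x:L ==> x ~= 0 ==> e <= norm x" using L unfolding is_lat_def by blast
  have "b*e <= norm (f x)" if "x:L" "f x ~= 0" for x
  proof -
   have "x ~= 0" using that linear_0[OF f(1)] by auto
   then have "b*e <= b*norm x" using e(2)[OF that(1)] b(1) by simp
   then show ?thesis using b(2)[of x] by linarith
  qed
  then show "EX e>0. ALL x:f ` L. x ~= 0 --> e <= norm x" using e(1) b(1) by (intro exI[of _ "b*e"]) auto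
  obtain R where R: "!!x. EX l:L. norm (x-l) <= R" using L unfolding is_lat_def by blast
  have "EX l:f ` L. norm (y-l) <= R*K" for y
  proof -
   obtain x where x: "y = f x" using surj by (metis surjD)
   obtain l where l: "l:L" "norm (x-l) <= R" using R by blast
   have "norm (y-f l) <= norm (x-l)*K" unfolding x linear_diff[OF f(1), symmetric] by (rule K)
   also have "... <= R*K" using l(2) K(2) by (simp add: mult_right_mono)
   finally show ?thesis using l(1) by blast
  qed
  then show "EX R. ALL x. EX l:f ` L. norm (x-l) <= R" by blast
 qed
 obtain B where B: "fdom L B" using fdom_exists[OF L] by blast
 have Bb: "B:sets borel" "bounded B" using B by (auto simp: fdom_def)
 have bij: "bij f" using f(2) surj by (simp add: bij_def)
 have linv: "linear (inv f)" using f by (rule inj_linear_imp_inv_linear)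
 have fB: "f ` B:sets borel"
 proof -
  have "inv f:borel_measurable borel"
   using linv by (intro borel_measurable_continuous_onI) (simp add: linear_continuous_on linear_conv_bounded_linear[symmetric])
  moreover have "f ` B = inv f -` B" using bij by (simp add: bij_vimage_eq_inv_image inv_inv_eq bij_imp_bij_inv)
  ultimately show ?thesis using Bb(1) by (simp add: measurable_sets_borel)
 qed
 have fd: "fdom (f ` L) (f ` B)"
  unfolding fdom_def
 proof (intro conjI allI)
  show "bounded (f ` B)" using bounded_linear_image[OF Bb(2) bl] .
  fix y
  obtain x where x: "y = f x" using surj by (metis surjD)
  obtain l where l: "l:L" "x+l:B" "!!l'. l':L ==> x+l':B ==> l' = l"
   using B unfolding fdom_def by metis
  have inB: "y+f l':f ` B \<longleftrightarrow> x+l':B" for l'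
   unfolding x linear_add[OF f(1), symmetric] using f(2) by (simp add: inj_image_mem_iff)
  show "EX! l. l:f ` L & y+l:f ` B"
  proof (rule ex1I[of _ "f l"])
   show "f l:f ` L & y+f l:f ` B" using l(1,2) inB[of l] by blast
   fix k assume k: "k:f ` L & y+k:f ` B"
   then obtain l' where l': "l':L" "k = f l'" by blast
   then show "k = f l" using l(3)[of l'] inB[of l'] k by simp
  qed
 qed (rule fB)
 have Bl: "B:lmeasurable" using Bb by (simp add: bounded_set_imp_lmeasurable)
 have "measure lebesgue (f ` B) = \<bar>det (matrix f)\<bar>*measure lebesgue B"
  using measure_linear_image[OF f(1) Bl] .
 then have "measure lborel (f ` B) = \<bar>det (matrix f)\<bar>*measure lborel B"
  using fB Bb(1) by simp
 moreover have "measure lborel B = covol L" "measure lborel (f ` B) = covol (f ` L)"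
  using emeasure_fdom[OF L B] emeasure_fdom[OF lat fd] covol_pos[OF L] covol_pos[OF lat] by (simp_all add: measure_def)
 ultimately show "covol (f ` L) = \<bar>det (matrix f)\<bar>*covol L" by simp
qed

definition intvec :: "(real^4) set" where "intvec = {c. ALL i. c$i:\<int>}"

lemma lat_intvec: "is_lat intvec" and covol_intvec: "covol intvec = 1"
proof -
 show lat: "is_lat intvec"
  unfolding is_lat_def
 proof (intro conjI)
  show "EX e>0. ALL x:intvec. x ~= 0 --> e <= norm x"
  proof (intro exI[of _ 1] conjI ballI impI)
   fix x assume "x:intvec" "x ~= 0"
   then obtain i where "x$i ~= 0" "x$i:\<int>" by (auto simp: vec_eq_iff intvec_def)
   then have "1 <= \<bar>x$i\<bar>" by (metis Ints_nonzero_abs_ge1)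
   then show "1 <= norm x" using component_le_norm_cart[of x i] by linarith
  qed simp
  show "EX R. ALL x. EX l:intvec. norm (x-l) <= R"
  proof (intro exI allI)
   fix x :: "real^4"
   define l :: "real^4" where "l = (\<chi> i. of_int \<lfloor>x$i\<rfloor>)"
   have "norm (x-l) <= (SUM i:UNIV. \<bar>(x-l)$i\<bar>)" by (rule norm_le_l1_cart)
   also have "... <= (SUM i:(UNIV::4 set). 1)" by (intro sum_mono) (simp add: l_def, linarith)
   finally show "EX l:intvec. norm (x-l) <= real CARD(4)"
    by (intro bexI[of _ l]) (auto simp: l_def intvec_def)
  qed
 qed (auto simp: intvec_def)
 define B :: "(real^4) set" where "B = {x. ALL i. 0 <= x$i & x$i < 1}"
 have "B = (INT i. {x. 0 <= x$i & x$i < 1})" by (auto simp: B_def)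
 also have "...:sets borel"
 proof (intro sets.countable_INT)
  have "{x. x$i >= (0::real)} Int {x. x$i < 1}:sets borel" for i :: 4
   by (intro sets.Int borel_closed borel_open closed_halfspace_component_ge_cart open_halfspace_component_lt_cart)
  moreover have "{x. 0 <= x$i & x$i < 1} = {x. x$i >= (0::real)} Int {x. x$i < 1}" for i :: 4 by auto
  ultimately show "range (%i::4. {x. 0 <= x$i & x$i < (1::real)}) <= sets borel" by auto
 qed auto
 finally have Bb: "B:sets borel" .
 have sub: "box 0 1 <= B" "B <= cbox 0 1" unfolding B_def mem_box_cart subset_iff by (auto simp: mem_box_cart intro: less_imp_le)
 have fd: "fdom intvec B"
  unfolding fdom_def
 proof (intro conjI allI)
  show "bounded B" using sub(2) bounded_cbox bounded_subset by blast
  fix x :: "real^4"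
  show "EX! l. l:intvec & x+l:B"
  proof (rule ex1I[of _ "\<chi> i. - of_int \<lfloor>x$i\<rfloor>"])
   show "(\<chi> i. - of_int \<lfloor>x$i\<rfloor>):intvec & x+(\<chi> i. - of_int \<lfloor>x$i\<rfloor>):B"
    by (auto simp: intvec_def B_def) linarith+
   fix l assume l: "l:intvec & x+l:B"
   show "l = (\<chi> i. - of_int \<lfloor>x$i\<rfloor>)"
    unfolding vec_eq_iff
   proof
    fix i
    obtain k where k: "l$i = of_int k" using l by (auto simp: intvec_def elim: Ints_cases)
    have "0 <= x$i + of_int k" "x$i + of_int k < 1" using l k unfolding B_def by (metis (mono_tags, lifting) mem_Collect_eq vector_add_component)+
    then have "\<lfloor>x$i\<rfloor> = - k" by (intro floor_unique) auto
    then show "l$i = (\<chi> i. - of_int \<lfloor>x$i\<rfloor>)$i" using k by simp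
   qed
  qed
 qed (rule Bb)
 have m: "measure lborel (cbox 0 (1::real^4)) = 1"
 proof -
  have "cbox 0 (1::real^4) ~= {}" by (simp add: interval_ne_empty_cart)
  then show ?thesis using content_cbox_cart[of 0 "1::real^4"] by simp
 qed
 have e1: "emeasure lborel (cbox 0 (1::real^4)) = 1"
  using m emeasure_lborel_cbox_finite[of 0 "1::real^4"] by (simp add: emeasure_eq_ennreal_measure less_top)
 have e2: "emeasure lborel (box 0 (1::real^4)) = 1"
  unfolding e1[symmetric] by (simp only: emeasure_lborel_box_eq emeasure_lborel_cbox_eq)
 have "emeasure lborel B = 1"
  using emeasure_mono[OF sub(1), of lborel] emeasure_mono[OF sub(2), of lborel] Bb e1 e2 by simp
 then show "covol intvec = 1"
  using emeasure_fdom[OF lat fd] covol_pos[OF lat] by (simp add: ennreal_eq_1)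
qed

section \<open>Integrality and the criterion for membership in a maximal order\<close>

locale max_order =
 fixes A Oo :: "quat set"
 assumes alg: "definite_quat_alg A" and maximal: "is_maximal_order A Oo"
begin

lemma order: "is_order A Oo" using maximal by (simp add: is_maximal_order_def)

lemma O_one: "qone:Oo" and O_zero: "0:Oo"
 and O_add: "x:Oo ==> y:Oo ==> x+y:Oo"
 and O_diff: "x:Oo ==> y:Oo ==> x-y:Oo"
 and O_mul: "x:Oo ==> y:Oo ==> x*.y:Oo"
 and O_sub_A: "Oo <= A"
 using order by (auto simp: is_order_def)

lemma A_one: "qone:A" and A_mul: "x:A ==> y:A ==> x*.y:A"
 using alg by (auto simp: definite_quat_alg_def)

lemma O_neg: "x:Oo ==> - x:Oo" using O_diff[OF O_zero, of x] by simp

lemma O_int: "x:Oo ==> of_int k*R x:Oo"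
 using int_scale_closed[OF O_zero O_diff] by blast

lemma O_Ints: "t:\<int> ==> x:Oo ==> t*R x:Oo"
 using O_int by (auto elim!: Ints_cases)

lemma A_eq: "x:A \<longleftrightarrow> (EX S c. finite S & S <= Oo & (ALL s:S. c s:\<rat>) & x = (SUM s:S. c s*R s))"
 using order unfolding is_order_def by blast

lemma A_add: "x:A ==> y:A ==> x+y:A"
 and A_scale: "t:\<rat> ==> x:A ==> t*R x:A"
proof -
 obtain e :: "nat => quat" where e: "A = {x. EX c :: nat => real. (ALL i<4. c i:\<rat>) & x = (SUM i<4. c i*R e i)}"
  using alg unfolding definite_quat_alg_def by blast
 show "x:A ==> y:A ==> x+y:A"
 proof -
  assume "x:A" "y:A"
  then obtain c d where "ALL i<4. c i:\<rat>" "x = (SUM i<4. c i*R e i)" "ALL i<4. d i:\<rat>" "y = (SUM i<4. d i*R e i)"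
   unfolding e by blast
  then show ?thesis unfolding e
   by (intro CollectI exI[of _ "%i. c i+d i"]) (auto simp: scaleR_add_left sum.distrib)
 qed
 show "t:\<rat> ==> x:A ==> t*R x:A"
 proof -
  assume "t:\<rat>" "x:A"
  then obtain c where "ALL i<4. c i:\<rat>" "x = (SUM i<4. c i*R e i)" unfolding e by blast
  then show ?thesis unfolding e using \<open>t : \<rat>\<close>
   by (intro CollectI exI[of _ "%i. t*c i"]) (auto simp: scaleR_sum_right)
 qed
qed

lemma A_zero: "0:A" using O_zero O_sub_A by blast

lemma A_diff: "x:A ==> y:A ==> x-y:A"
 using A_add[of x "(-1)*R y"] A_scale[of "-1" y] by simp

lemma A_denominator:
 assumes "x:A"
 shows "EX k::nat. k > 0 & real k*R x:Oo"
proof -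
 obtain S c where S: "finite S" "S <= Oo" "ALL s:S. c s:\<rat>" "x = (SUM s:S. c s*R s)"
  using assms[unfolded A_eq] by blast
 obtain m :: nat where m: "m > 0" "ALL s:S. real m*c s:\<int>" using common_denominator[of S c] S by blast
 have "real m*R x = (SUM s:S. (real m*c s)*R s)" using S by (simp add: scaleR_sum_right)
 also have "...:Oo" using S m by (intro sum_closed[OF O_zero O_diff] O_Ints) auto
 finally show ?thesis using m by blast
qed

lemma generators:
 obtains S where "finite S" "S <= Oo" "Oo = zspan S"
 using order unfolding is_order_def zspan_def by blast

text \<open>Clearing denominators in a rational basis of A puts a lattice with an explicit basis
  inside \<open>Oo\<close>; since \<open>Oo\<close> has finitely many generators, a multiple of it
  lies back inside that lattice.\<close>

lemma O_frame:
 obtains f :: "real^4 => quat" and P :: nat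
 where "linear f" "inj f" "f ` intvec <= Oo" "P > 0" "!!x. x:Oo ==> real P*R x:f ` intvec"
proof -
 obtain e :: "nat => quat" where ind: "!!c. (SUM i<4. c i*R e i) = 0 ==> (ALL i<4. c i = (0::real))"
  and e: "A = {x. EX c :: nat => real. (ALL i<4. c i:\<rat>) & x = (SUM i<4. c i*R e i)}"
  using alg unfolding definite_quat_alg_def by blast
 have four: "(SUM i<4. g i) = g 0+g 1+g 2+g (3::nat)" for g :: "nat => quat"
  by (simp add: eval_nat_numeral)
 have "EX k::nat. k > 0 & real k*R e i:Oo" if "i < 4" for i
 proof -
  have "e i = (SUM j<4. (if j = i then 1 else 0)*R e j)" using that by (simp add: if_distrib if_distribR cong: if_cong)
  then have "e i:A" unfolding e by (intro CollectI exI[of _ "%j. if j = i then 1 else 0"]) auto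
  then show ?thesis by (rule A_denominator)
 qed
 then obtain k :: "nat => nat" where k: "!!i. i < 4 ==> k i > 0 & real (k i)*R e i:Oo" by metis
 define g where "g i = real (k i)*R e i" for i
 define f :: "real^4 => quat" where "f c = c$0*R g 0+c$1*R g 1+c$2*R g 2+c$3*R g 3" for c
 have k0: "k 0 > 0" "k 1 > 0" "k 2 > 0" "k 3 > 0" using k by auto
 have lin: "linear f" by (rule linearI) (auto simp: f_def algebra_simps scaleR_add_left)
 have inj: "inj f"
  unfolding linear_injective_0[OF lin]
 proof (intro allI impI)
  fix c assume c: "f c = 0"
  define c' where "c' i = (if i = 0 then c$0 else if i = 1 then c$1 else if i = 2 then c$2 else c$3)*real (k i)" for i :: nat
  have "(SUM i<4. c' i*R e i) = 0" using c unfolding four f_def c'_def g_def by simp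
  then have "ALL i<4. c' i = 0" by (rule ind)
  then have "c' 0 = 0" "c' 1 = 0" "c' 2 = 0" "c' 3 = 0" by auto
  then show "c = 0" unfolding c'_def quat_eq_iff using k0 by simp
 qed
 have gO: "g 0:Oo" "g 1:Oo" "g 2:Oo" "g 3:Oo" unfolding g_def using k by auto
 have sub: "f ` intvec <= Oo" unfolding f_def intvec_def using gO by (auto intro!: O_add O_Ints)
 have "EX c. x = f c & (ALL i. c$i:\<rat>)" if "x:A" for x
 proof -
  obtain c where c: "ALL i<4. c i:\<rat>" "x = (SUM i<4. c i*R e i)" using \<open>x : A\<close> unfolding e by blast
  show ?thesis
   by (rule exI[of _ "mkq (c 0/real (k 0)) (c 1/real (k 1)) (c 2/real (k 2)) (c 3/real (k 3))"])
    (use c k0 in \<open>simp add: forall_four f_def g_def four\<close>)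
 qed
 then obtain c where c: "!!x. x:A ==> x = f (c x) & (ALL i. c x$i:\<rat>)" by metis
 obtain S where S: "finite S" "S <= Oo" "Oo = zspan S" by (rule generators)
 have SA: "s:A" if "s:S" for s using that S(2) O_sub_A by blast
 obtain P :: nat where P: "P > 0" "ALL q:S \<times> UNIV. real P*(c (fst q)$snd q):\<int>"
  using common_denominator[of "S \<times> (UNIV :: 4 set)" "%q. c (fst q)$snd q"] S(1) c[OF SA] by auto
 let ?X = "{x. real P*R x:f ` intvec}"
 have "zspan S <= ?X"
 proof (rule zspan_subset)
  show "0:?X" using lat_zero[OF lat_intvec] linear_0[OF lin] by (auto intro: image_eqI[of _ _ 0])
  fix x y assume "x:?X" "y:?X"
  then obtain a b where "real P*R x = f a" "a:intvec" "real P*R y = f b" "b:intvec" by auto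
  then have "real P*R (x-y) = f (a-b)" "a-b:intvec"
   using lat_diff[OF lat_intvec] by (simp_all add: scaleR_diff_right linear_diff[OF lin])
  then show "x-y:?X" by blast
 next
  show "S <= ?X"
  proof
   fix s assume s: "s:S"
   have "real P*R s = f (real P*R c s)" using c[OF SA[OF s]] linear_cmul[OF lin] by metis
   moreover have "real P*R c s:intvec" using P(2) s by (auto simp: intvec_def)
   ultimately show "s:?X" by blast
  qed
 qed
 then show ?thesis using that[OF lin inj sub P(1)] S(3) by blast
qed

lemma lat_O: "is_lat Oo"
proof -
 obtain f :: "real^4 => quat" and P :: nat where f: "linear f" "inj f" "f ` intvec <= Oo" "P > 0" "!!x. x:Oo ==> real P*R x:f ` intvec"
  by (rule O_frame) (rule that)
 let ?L = "(*R) (1/real P) ` f ` intvec"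
 show ?thesis
 proof (rule lat_subgroup[of ?L "real P"])
  show "is_lat ?L" using lat_scale(1)[OF lat_linear(1)[OF lat_intvec f(1,2)], of "1/real P"] f(4) by simp
  show "Oo <= ?L"
  proof
   fix x assume "x:Oo"
   then show "x:?L" using f(4) by (intro image_eqI[OF _ f(5)]) simp_all
  qed
  show "x:?L ==> real P*R x:Oo" for x using f(3,4) by auto
 qed (use f(4) O_diff in auto)
qed

lemma O_left_ideal: "x:Oo ==> (*.) x ` Oo <= Oo"
 using O_mul by auto

text \<open>n(x)^2 is the index of x O in O.\<close>

lemma norm_square_Ints: "x:Oo ==> (qn x)^2:\<int>"
proof (cases "x = 0")
 case False
 assume x: "x:Oo"
 have "(qn x)^2*covol Oo = real (lidx Oo ((*.) x ` Oo))*covol Oo"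
  using covol_lidx(1)[OF lat_O lat_left(1)[OF lat_O False] O_left_ideal[OF x]] lat_left(2)[OF lat_O False] by simp
 then have "(qn x)^2 = real (lidx Oo ((*.) x ` Oo))" using covol_pos[OF lat_O] by simp
 then show ?thesis by simp
qed simp

text \<open>So far only squares of norms are known to be integers. Applied to x + k this gives a
  quartic in k with integral values at integers; finite differences show trace and norm to be
  rational, and a rational number with integral square is an integer.\<close>

lemma O_integral:
 assumes x: "x:Oo"
 shows "qn x:\<int>" "qtr x:\<int>"
proof -
 define N t where "N = qn x" and "t = qtr x"
 have f: "(N+k*t+k^2)^2:\<int>" if "k:\<int>" for k
 proof -
  have "x+k*R qone:Oo" using O_add[OF x O_Ints[OF that O_one]] .
  moreover have "qn (x+k*R qone) = N+k*t+k^2" by (simp add: qn_add N_def t_def)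
  ultimately show ?thesis using norm_square_Ints by metis
 qed
 \<comment> \<open>The values at k and -k differ by 4 k t (N + k^2); combining k = 2 with k = 1
   eliminates N t.\<close>
 have "((N+2*t+2^2)^2-(N+(-2)*t+(-2)^2)^2)-2*((N+1*t+1^2)^2-(N+(-1)*t+(-1)^2)^2):\<int>"
  using f[of 2] f[of "-2"] f[of 1] f[of "-1"] by (intro Ints_diff Ints_mult) auto
 also have "((N+2*t+2^2)^2-(N+(-2)*t+(-2)^2)^2)-2*((N+1*t+1^2)^2-(N+(-1)*t+(-1)^2)^2) = 24*t"
  by (simp add: power2_eq_square algebra_simps)
 finally have "24*t:\<rat>" using Ints_subset_Rats by blast
 then have t: "t:\<rat>" by (intro Rats_cancel[of 24 t]) auto
 have "((N+1*t+1^2)^2+(N+(-1)*t+(-1)^2)^2)-2*(N+0*t+0^2)^2:\<rat>"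
  using f[of 1] f[of "-1"] f[of 0] Ints_subset_Rats by (intro Rats_diff Rats_add Rats_mult) auto
 then have "(((N+1*t+1^2)^2+(N+(-1)*t+(-1)^2)^2)-2*(N+0*t+0^2)^2)-(2*t^2+2):\<rat>"
  by (rule Rats_diff) (use t in simp)
 also have "(((N+1*t+1^2)^2+(N+(-1)*t+(-1)^2)^2)-2*(N+0*t+0^2)^2)-(2*t^2+2) = 4*N"
  by (simp add: power2_eq_square algebra_simps)
 finally have N: "N:\<rat>" by (intro Rats_cancel[of 4 N]) auto
 have "N:\<int>" using Rats_square_Ints[OF N] f[of 0] by simp
 moreover have "t:\<int>"
 proof -
  have "N+t+1:\<rat>" using N t by (intro Rats_add) auto
  then have "N+t+1:\<int>" by (rule Rats_square_Ints) (use f[of 1] in simp)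
  from Ints_diff[OF Ints_diff[OF this \<open>N : \<int>\<close>] Ints_1] show ?thesis by simp
 qed
 ultimately show "qn x:\<int>" "qtr x:\<int>" by (simp_all add: N_def t_def)
qed

lemma O_cnj: "x:Oo ==> qcnj x:Oo"
 unfolding qcnj_eq using O_integral by (intro O_diff O_Ints O_one) auto

lemma A_cnj: "x:A ==> qcnj x:A"
proof -
 assume "x:A"
 then obtain k :: nat where k: "k > 0" "real k*R x:Oo" using A_denominator by blast
 then have "qcnj (real k*R x):A" using O_cnj O_sub_A by blast
 then have "(1/real k)*R qcnj (real k*R x):A" by (intro A_scale) auto
 then show ?thesis using k by simp
qed

lemma A_rational: "x:A ==> qn x:\<rat>" "x:A ==> qtr x:\<rat>"
proof -
 assume "x:A"
 then obtain k :: nat where k: "k > 0" "real k*R x:Oo" using A_denominator by blast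
 then have "(real k)^2*qn x:\<rat>" "real k*qtr x:\<rat>" using O_integral[OF k(2)] Ints_subset_Rats by auto
 then show "qn x:\<rat>" "qtr x:\<rat>"
  using Rats_cancel[of "(real k)^2" "qn x"] Rats_cancel[of "real k" "qtr x"] k(1) by auto
qed

lemma A_inv: "x:A ==> qinv x:A"
 unfolding qinv_def by (intro A_scale A_cnj Rats_divide A_rational) auto

lemma O_sub_qdual: "Oo <= qdual Oo"
 unfolding qdual_def using O_integral(2) O_mul by auto

lemma lat_qdual_O: "is_lat (qdual Oo)"
 using lat_qdual[OF lat_O, of 1] O_sub_qdual by auto

lemma qdual_denominator:
 assumes "y:qdual Oo"
 shows "EX k::nat. k > 0 & real k*R y:Oo"
 using lat_multiple[OF lat_qdual_O lat_O O_sub_qdual assms] .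

text \<open>If \<open>y\<close> is integral together with all its traces against the order, then \<open>O + O y O\<close> is again an order.\<close>

lemma O_maximal:
 assumes y: "y:qdual Oo" and ny: "qn y:\<int>"
 shows "y:Oo"
proof -
 obtain k :: nat where k: "k > 0" "real k*R y:Oo" using qdual_denominator[OF y] by blast
 have yA: "y:A" using A_scale[OF _ subsetD[OF O_sub_A k(2)], of "1/real k"] k(1) by simp
 obtain S where S: "finite S" "S <= Oo" "Oo = zspan S" by (rule generators)
 \<comment> \<open>Finitely many generators of O + O y O as a group: an order has to be finitely
   generated.\<close>
 define T where "T = S Un (%(s, t). s*.y*.t) ` (S \<times> S)"
 define X where "X = zspan T"
 have T: "finite T" using S by (simp add: T_def)
 have X: "0:X" "!!x y. x:X ==> y:X ==> x-y:X"
  unfolding X_def by (rule zspan_zero, rule zspan_diff)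
 have OX: "Oo <= X" unfolding S(3)
  by (rule zspan_subset[OF X]) (auto simp: X_def T_def intro!: zspan_base[OF T, unfolded T_def])
 have ab: "a*.y*.b:X" if "a:Oo" "b:Oo" for a b
  by (rule zspan_qmul[OF X, of S S]) (use that S(3) in \<open>auto simp: X_def T_def intro!: zspan_base[OF T, unfolded T_def]\<close>)
 have TA: "T <= A" using S(2) O_sub_A yA by (auto simp: T_def intro!: A_mul)
 have XA: "X <= A" unfolding X_def by (rule zspan_subset[OF A_zero A_diff TA])
 have Xadd: "u+v:X" if "u:X" "v:X" for u v
  using X(2)[OF that(1) X(2)[OF X(1) that(2)]] by simp
 have TT: "s*.qone*.t:X" if s: "s:T" and t: "t:T" for s t
 proof -
  have sO: "s:Oo | (EX a:Oo. EX b:Oo. s = a*.y*.b)" if "s:T" for s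
   using that S(2) unfolding T_def by auto
  from sO[OF s] sO[OF t] show ?thesis
  proof (elim disjE bexE)
   assume "s:Oo" "t:Oo" then show ?thesis using OX O_mul by auto
  next
   fix a b assume "s:Oo" "a:Oo" "b:Oo" "t = a*.y*.b"
   then show ?thesis using ab[of "s*.a" b] O_mul by (simp add: qmul_assoc)
  next
   fix a b assume "t:Oo" "a:Oo" "b:Oo" "s = a*.y*.b"
   then show ?thesis using ab[of a "b*.t"] O_mul by (simp add: qmul_assoc)
  next
   fix a b c d assume *: "a:Oo" "b:Oo" "s = a*.y*.b" "c:Oo" "d:Oo" "t = c*.y*.d"
   \<comment> \<open>Two factors y collapse to one by \<open>qmul_sandwich\<close>; the coefficients
     are a trace of y against the order and n(y), both integers by assumption.\<close>
   have "s*.t = a*.(y*.(b*.c)*.y)*.d" using * by (simp add: qmul_assoc)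
   also have "... = qtr (y*.(b*.c))*R (a*.y*.d)-qn y*R (a*.qcnj (b*.c)*.d)"
    unfolding qmul_sandwich by (simp add: qring qtr_commute[of y])
   also have "...:X"
   proof -
    have "qtr (y*.(b*.c)):\<int>" using y * O_mul unfolding qdual_def by blast
    then have "qtr (y*.(b*.c))*R (a*.y*.d):X"
     using int_scale_closed[OF X ab[OF *(1) *(5)]] by (auto elim!: Ints_cases)
    moreover have "qn y*R (a*.qcnj (b*.c)*.d):X"
     using OX * ny by (intro subsetD[OF OX] O_Ints O_mul O_cnj) auto
    ultimately show ?thesis by (rule X(2))
   qed
   finally show ?thesis by simp
  qed
 qed
 have Xmul: "u*.v:X" if "u:X" "v:X" for u v
  using zspan_qmul[where y=qone and a=u and b=v, OF X TT] that unfolding X_def by simp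
 have "is_order A X"
  unfolding is_order_def
 proof (intro conjI ballI)
  show "EX S. finite S & S <= X & X = {x. EX c :: quat => int. x = (SUM s:S. of_int (c s)*R s)}"
   using T zspan_base[OF T] unfolding X_def zspan_def[symmetric] by blast
  show "A = {x. EX S c. finite S & S <= X & (ALL s:S. c s:\<rat>) & x = (SUM s:S. c s*R s)}"
  proof (intro set_eqI iffI)
   fix x assume "x:A"
   then show "x:{x. EX S c. finite S & S <= X & (ALL s:S. c s:\<rat>) & x = (SUM s:S. c s*R s)}"
    using OX unfolding A_eq by blast
  next
   fix x assume "x:{x. EX S c. finite S & S <= X & (ALL s:S. c s:\<rat>) & x = (SUM s:S. c s*R s)}"
   then show "x:A" using XA by (auto intro!: sum_closed[OF A_zero A_diff] A_scale)
  qed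
 qed (use XA OX O_one X Xadd Xmul in auto)
 then have "X = Oo" using maximal OX unfolding is_maximal_order_def by blast
 then show ?thesis using ab[OF O_one O_one] by simp
qed

end

section \<open>Right ideals and their norms\<close>

text \<open>Multiplicities in numerator and denominator agree prime by prime. Global covolume
  formulas are deduced with this from comparisons at a single prime.\<close>

lemma eq_one_if_local_unit:
 assumes "!!p. prime (p::nat) ==> EX a b. b > 0 & ~ p dvd a & ~ p dvd b & q = real a/real b"
 shows "q = 1"
proof -
 obtain a b :: nat where ab: "b > 0" "~ 2 dvd a" "q = real a/real b" using assms[OF two_is_prime_nat] by blast
 have *: "multiplicity p a = multiplicity p b" if p: "prime p" for p
 proof -
  obtain c d where cd: "d > 0" "~ p dvd c" "~ p dvd d" "q = real c/real d" using assms[OF p] by blast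
  have "real (a*d) = real (c*b)" using ab cd by (simp add: field_simps)
  then have "a*d = c*b" by (simp only: of_nat_eq_iff)
  then have "multiplicity p (a*d) = multiplicity p (c*b)" by simp
  moreover have "a > 0" "c > 0" using ab(2) cd(2) by (auto intro!: Nat.gr0I)
  ultimately show ?thesis using p ab(1) cd(1) not_dvd_imp_multiplicity_0[OF cd(2)] not_dvd_imp_multiplicity_0[OF cd(3)]
   by (simp add: prime_elem_multiplicity_mult_distrib)
 qed
 have "a = b" by (rule multiplicity_eq_nat) (use * ab in \<open>auto intro!: Nat.gr0I\<close>)
 then show ?thesis using ab by simp
qed

context max_order
begin

definition rideal :: "quat set => bool" where
 "rideal I \<longleftrightarrow> 0:I & (ALL x:I. ALL y:I. x-y:I) & (ALL x:I. ALL a:Oo. x*.a:I) &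
  (EX x:I. x ~= 0) & (EX m::nat. m > 0 & (ALL x:I. real m*R x:Oo))"

lemma rideal_zero: "rideal I ==> 0:I"
 and rideal_diff: "rideal I ==> x:I ==> y:I ==> x-y:I"
 and rideal_mul: "rideal I ==> x:I ==> a:Oo ==> x*.a:I"
 by (auto simp: rideal_def)

lemma rideal_add: "rideal I ==> x:I ==> y:I ==> x+y:I"
 using rideal_diff[of I x "0-y"] rideal_diff[of I 0 y] rideal_zero by simp

lemma rideal_int: "rideal I ==> x:I ==> of_int k*R x:I"
 using int_scale_closed[of I x k] rideal_zero rideal_diff by blast

lemma rideal_nat: "rideal I ==> x:I ==> real k*R x:I"
 using rideal_int[of I x "int k"] by simp

lemma rideal_A: "rideal I ==> x:I ==> x:A"
proof -
 assume "rideal I" "x:I"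
 then obtain m :: nat where "m > 0" "real m*R x:Oo" unfolding rideal_def by blast
 then show ?thesis using A_scale[OF _ subsetD[OF O_sub_A], of "1/real m" "real m*R x"] by simp
qed

lemma rideal_O: "rideal Oo"
 unfolding rideal_def using O_zero O_diff O_mul O_one by (auto intro!: bexI[of _ qone] exI[of _ 1])

lemma rideal_element_multiple:
 assumes I: "rideal I" and x: "x:I" "x ~= 0"
 shows "EX k::nat. k > 0 & (ALL y:Oo. real k*R y:(*.) x ` Oo)"
proof -
 obtain m :: nat where m: "m > 0" "real m*R x:Oo" using I x unfolding rideal_def by blast
 define n where "n = qn (real m*R x)"
 have n: "n:\<int>" "n > 0" using O_integral(1)[OF m(2)] m x by (auto simp: n_def)
 then obtain k :: nat where k: "n = real k" by (intro that[of "nat \<lfloor>n\<rfloor>"]) (auto elim!: Ints_cases)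
 have "real k*R y:(*.) x ` Oo" if "y:Oo" for y
 proof
  show "real k*R y = x*.(real m*R (qcnj (real m*R x)*.y))"
   unfolding k[symmetric] n_def by (simp add: qmul_qcnj_left power2_eq_square)
  show "real m*R (qcnj (real m*R x)*.y):Oo"
   using O_cnj[OF m(2)] that by (intro O_Ints O_mul) auto
 qed
 then show ?thesis using n k by (intro exI[of _ k]) auto
qed

lemma rideal_contains_multiple:
 assumes "rideal I"
 shows "EX k::nat. k > 0 & (ALL y:Oo. real k*R y:I)"
proof -
 obtain x where x: "x:I" "x ~= 0" using assms unfolding rideal_def by blast
 have "(*.) x ` Oo <= I" using rideal_mul[OF assms x(1)] by auto
 then show ?thesis using rideal_element_multiple[OF assms x] subsetD by metis
qed

lemma lat_rideal: "rideal I ==> is_lat I"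
proof -
 assume I: "rideal I"
 obtain m :: nat where m: "m > 0" "!!x. x:I ==> real m*R x:Oo" using I unfolding rideal_def by blast
 obtain k :: nat where k: "k > 0" "!!y. y:Oo ==> real k*R y:I" using rideal_contains_multiple[OF I] by blast
 show ?thesis
 proof (rule lat_subgroup[of "(*R) (1/real m) ` Oo" "real k*real m"])
  show "is_lat ((*R) (1/real m) ` Oo)" using lat_scale(1)[OF lat_O] m by simp
  show "I <= (*R) (1/real m) ` Oo"
  proof
   fix x assume "x:I"
   then have "x = (1/real m)*R (real m*R x)" "real m*R x:Oo" using m by auto
   then show "x:(*R) (1/real m) ` Oo" by (rule image_eqI)
  qed
 qed (use k m rideal_diff[OF I] in auto)
qed

lemma rideal_left:
 assumes I: "rideal I" and a: "a:A" "a ~= 0"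
 shows "rideal ((*.) a ` I)"
proof -
 obtain m :: nat where m: "m > 0" "!!x. x:I ==> real m*R x:Oo" using I unfolding rideal_def by blast
 obtain k :: nat where k: "k > 0" "real k*R a:Oo" using A_denominator[OF a(1)] by blast
 show ?thesis
  unfolding rideal_def
 proof (intro conjI ballI)
  show "EX n::nat. n > 0 & (ALL x:(*.) a ` I. real n*R x:Oo)"
  proof (intro exI conjI ballI)
   show "k*m > 0" using k m by simp
   fix x assume "x:(*.) a ` I"
   then obtain y where y: "y:I" "x = a*.y" by auto
   then have "real (k*m)*R x = (real k*R a)*.(real m*R y)" by simp
   then show "real (k*m)*R x:Oo" using O_mul k m y by metis
  qed
  show "EX x:(*.) a ` I. x ~= 0" using I a unfolding rideal_def by auto
  show "0:(*.) a ` I" using rideal_zero[OF I] by force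
 next
  fix u v assume "u:(*.) a ` I" "v:(*.) a ` I"
  then obtain x y where "u = a*.x" "v = a*.y" "x:I" "y:I" by auto
  then have "u-v = a*.(x-y)" "x-y:I" using rideal_diff[OF I] by (auto simp: qmul_diff)
  then show "u-v:(*.) a ` I" by blast
 next
  fix u b assume "u:(*.) a ` I" "b:Oo"
  then obtain x where "u*.b = a*.(x*.b)" "x*.b:I" using rideal_mul[OF I] by (auto simp: qmul_assoc)
  then show "u*.b:(*.) a ` I" by blast
 qed
qed

lemma rideal_sum:
 assumes "rideal I" "rideal J"
 shows "rideal {x+y | x y. x:I & y:J}"
proof -
 obtain m :: nat where m: "m > 0" "!!x. x:I ==> real m*R x:Oo" using assms(1) unfolding rideal_def by blast
 obtain k :: nat where k: "k > 0" "!!x. x:J ==> real k*R x:Oo" using assms(2) unfolding rideal_def by blast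
 show ?thesis
  unfolding rideal_def
 proof (intro conjI ballI)
  show "EX n::nat. n > 0 & (ALL x:{x+y | x y. x:I & y:J}. real n*R x:Oo)"
  proof (intro exI conjI ballI)
   show "k*m > 0" using k m by simp
   fix z assume "z:{x+y | x y. x:I & y:J}"
   then obtain x y where z: "z = x+y" "x:I" "y:J" by auto
   then have "real (k*m)*R z = real k*R (real m*R x)+real m*R (real k*R y)"
    by (simp add: scaleR_add_right mult.commute)
   moreover have "real k*R (real m*R x):Oo" "real m*R (real k*R y):Oo"
    using O_Ints[OF Ints_of_nat m(2)[OF z(2)], of k] O_Ints[OF Ints_of_nat k(2)[OF z(3)], of m] by auto
   ultimately show "real (k*m)*R z:Oo" using O_add by simp
  qed
  obtain x where x: "x:I" "x ~= 0" using assms unfolding rideal_def by blast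
  show "EX x:{x+y | x y. x:I & y:J}. x ~= 0"
  proof
   show "x:{x+y | x y. x:I & y:J}"
    using x(1) rideal_zero[OF assms(2)] by (intro CollectI exI[of _ x] exI[of _ 0]) simp
  qed (rule x(2))
  show "0:{x+y | x y. x:I & y:J}" using rideal_zero assms by (auto intro!: exI[of _ 0])
 next
  fix u v assume "u:{x+y | x y. x:I & y:J}" "v:{x+y | x y. x:I & y:J}"
  then obtain x y x' y' where *: "u = x+y" "x:I" "y:J" "v = x'+y'" "x':I" "y':J" by auto
  have "u-v = (x-x')+(y-y')" "x-x':I" "y-y':J" using * rideal_diff assms by auto
  then show "u-v:{x+y | x y. x:I & y:J}" by blast
 next
  fix u a assume "u:{x+y | x y. x:I & y:J}" "a:Oo"
  then obtain x y where *: "u = x+y" "x:I" "y:J" by auto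
  have "u*.a = x*.a+y*.a" "x*.a:I" "y*.a:J"
   using * rideal_mul[OF assms(1)] rideal_mul[OF assms(2)] \<open>a : Oo\<close> by (auto simp: qmul_add)
  then show "u*.a:{x+y | x y. x:I & y:J}" by blast
 qed
qed

lemma rideal_inter:
 assumes "rideal I" "rideal J"
 shows "rideal (I Int J)"
proof -
 obtain k :: nat where k: "k > 0" "!!y. y:Oo ==> real k*R y:I" using rideal_contains_multiple[OF assms(1)] by blast
 obtain l :: nat where l: "l > 0" "!!y. y:Oo ==> real l*R y:J" using rideal_contains_multiple[OF assms(2)] by blast
 have "real (k*l)*R qone:I"
  using k(2)[of "real l*R qone"] O_Ints[of "real l"] O_one by simp
 moreover have "real (k*l)*R qone:J"
  using l(2)[of "real k*R qone"] O_Ints[of "real k"] O_one by (simp add: mult.commute)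
 ultimately have "EX x:I Int J. x ~= 0" using k(1) l(1) by (intro bexI[of _ "real (k*l)*R qone"]) auto
 moreover have "EX m::nat. m > 0 & (ALL x:I Int J. real m*R x:Oo)"
  using assms(1) unfolding rideal_def by blast
 moreover have "0:I Int J" using rideal_zero assms by blast
 moreover have "ALL x:I Int J. ALL y:I Int J. x-y:I Int J" using rideal_diff assms by blast
 moreover have "ALL x:I Int J. ALL a:Oo. x*.a:I Int J" using rideal_mul assms by blast
 ultimately show ?thesis unfolding rideal_def by blast
qed

text \<open>The norm of an ideal is the positive generator of the group spanned by the norms of its
  elements. It is stated as integrality of all quotients together with primitivity at each prime;
  the second half supplies local generators.\<close>

definition is_NI :: "quat set => real => bool" where
 "is_NI I r \<longleftrightarrow> r > 0 & (ALL x:I. EX k::int. qn x = r * of_int k) &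
  (ALL p::nat. prime p --> (EX x:I. EX k::int. qn x = r * of_int k & ~ int p dvd k))"

lemma is_NI_exists:
 assumes "rideal I"
 shows "EX r. is_NI I r"
proof -
 obtain m :: nat where m: "m > 0" "!!x. x:I ==> real m*R x:Oo" using assms unfolding rideal_def by blast
 define h where "h x = \<lfloor>qn (real m*R x)\<rfloor>" for x
 have h: "of_int (h x) = (real m)^2*qn x" if "x:I" for x
  using O_integral(1)[OF m(2)[OF that]] unfolding h_def by (auto elim!: Ints_cases)
 define g where "g = Gcd (h ` I)"
 obtain x0 where x0: "x0:I" "x0 ~= 0" using assms unfolding rideal_def by blast
 have "h x0 ~= 0" using h[OF x0(1)] x0 m by (metis mult_eq_0_iff of_int_0 of_nat_eq_0_iff power_eq_0_iff qn_eq_0 less_irrefl)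
 then have g: "g > 0" using x0(1) unfolding g_def
  by (metis Gcd_int_greater_eq_0 Gcd_0_iff image_subset_iff le_less singletonD)
 have gd: "g dvd h x" if "x:I" for x using that unfolding g_def by auto
 have eq: "qn x = (of_int g/(real m)^2) * of_int (h x div g)" if "x:I" for x
 proof -
  have "h x = g*(h x div g)" using gd[OF that] by simp
  then have "(real m)^2*qn x = of_int g * of_int (h x div g)" using h[OF that] by (metis of_int_mult)
  then show ?thesis using m by (simp add: field_simps)
 qed
 have "is_NI I (of_int g/(real m)^2)"
  unfolding is_NI_def
 proof (intro conjI ballI allI impI)
  show "of_int g/(real m)^2 > 0" using g m by simp
  show "EX k::int. qn x = (of_int g/(real m)^2) * of_int k" if "x:I" for x using eq[OF that] by blast
  fix p :: nat assume p: "prime p"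
  have "EX x:I. ~ int p dvd h x div g"
  proof (rule ccontr)
   assume "~ ?thesis"
   then have "g*int p dvd h x" if "x:I" for x
    using gd[OF that] that g by (metis dvd_mult_div_cancel mult_dvd_mono dvd_refl)
   then have "g*int p dvd g" unfolding g_def by (intro Gcd_greatest) auto
   then show False using g p by (simp add: dvd_mult_cancel_left zdvd_mult_cancel1 prime_gt_1_nat)
  qed
  then show "EX x:I. EX k::int. qn x = (of_int g/(real m)^2) * of_int k & ~ int p dvd k" using eq by blast
 qed
 then show ?thesis by blast
qed

lemma is_NI_unique:
 assumes "rideal I" and r: "is_NI I r" and s: "is_NI I s"
 shows "r = s"
proof -
 obtain x where x: "x:I" "x ~= 0" using assms unfolding rideal_def by blast
 have "r/s = 1"
 proof (rule eq_one_if_local_unit)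
  fix p :: nat assume p: "prime p"
  obtain x k where x: "x:I" "qn x = r * of_int k" "~ int p dvd k" using r p unfolding is_NI_def by blast
  obtain k' where k': "qn x = s * of_int k'" using s x unfolding is_NI_def by blast
  obtain y l where y: "y:I" "qn y = s * of_int l" "~ int p dvd l" using s p unfolding is_NI_def by blast
  obtain l' where l': "qn y = r * of_int l'" using r y unfolding is_NI_def by blast
  have rs: "r > 0" "s > 0" using r s unfolding is_NI_def by auto
  have "real_of_int (k*l) = real_of_int (k'*l')"
  proof -
   have "(r * s)*(real_of_int k*real_of_int l) = (r * s)*(real_of_int k'*real_of_int l')"
    using x(2) k' y(2) l' by (metis mult.assoc mult.left_commute mult.commute)
   then show ?thesis using rs by simp
  qed
  then have kl: "k*l = k'*l'" by (simp only: of_int_eq_iff)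
  have "~ int p dvd k*l" using x y p by (simp add: prime_dvd_mult_iff)
  then have "~ int p dvd k'" using kl by auto
  have pos: "k > 0" "k' > 0"
  proof -
   have "k ~= 0" using x(3) by auto
   then have "qn x > 0" using x(2) rs(1) by (metis mult_eq_0_iff of_int_eq_0_iff less_le qn_nonneg less_irrefl)
   then show "k > 0" "k' > 0" using x(2) k' rs by (metis zero_less_mult_iff of_int_0_less_iff less_asym)+
  qed
  have "r/s = real (nat k')/real (nat k)" using x(2) k' rs pos by (simp add: field_simps)
  moreover have "~ p dvd nat k'" "~ p dvd nat k" using \<open>~ int p dvd k'\<close> x(3) pos by (simp_all add: int_dvd_int_iff[symmetric])
  ultimately show "EX a b. b > 0 & ~ p dvd a & ~ p dvd b & r/s = real a/real b" using pos by (intro exI[of _ "nat k'"] exI[of _ "nat k"]) auto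
 qed
 then show ?thesis using s unfolding is_NI_def by simp
qed

definition NI :: "quat set => real" where "NI I = (SOME r. is_NI I r)"

text \<open>The primitive integral quadratic form attached to an ideal; on the ideal the floor is
  exact (\<open>qn_nv\<close>). An element at which it is prime to p generates the ideal locally at
  p.\<close>

definition nv :: "quat set => quat => int" where "nv I x = \<lfloor>qn x/NI I\<rfloor>"

lemma is_NI_NI: "rideal I ==> is_NI I (NI I)"
 unfolding NI_def using is_NI_exists by (rule someI_ex)

lemma NI_eqI: "rideal I ==> is_NI I r ==> NI I = r"
 using is_NI_unique is_NI_NI by blast

lemma NI_pos: "rideal I ==> NI I > 0"
 using is_NI_NI unfolding is_NI_def by blast

lemma qn_nv: "rideal I ==> x:I ==> qn x = NI I * of_int (nv I x)"
proof -
 assume "rideal I" "x:I"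
 then obtain k :: int where "qn x = NI I * of_int k" "NI I > 0" using is_NI_NI unfolding is_NI_def by blast
 then show ?thesis by (simp add: nv_def)
qed

lemma nv_eqI: "rideal I ==> qn x = NI I * of_int k ==> nv I x = k"
 using NI_pos[of I] by (simp add: nv_def)

lemma nv_primitive: "rideal I ==> prime p ==> EX x:I. ~ int p dvd nv I x"
 using is_NI_NI[of I] nv_eqI unfolding is_NI_def by blast

lemma nv_pos: "rideal I ==> x:I ==> x ~= 0 ==> nv I x > 0"
 using qn_nv[of I x] NI_pos[of I] by (metis qn_pos zero_less_mult_pos of_int_0_less_iff)

lemma nv_bilinear: "rideal I ==> x:I ==> y:I ==> qtr (x*.qcnj y) = NI I * of_int (nv I (x+y)-nv I x-nv I y)"
 using qn_nv[of I "x+y"] qn_nv[of I x] qn_nv[of I y] rideal_add[of I x y] by (simp add: qn_add algebra_simps)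

lemma NI_O [simp]: "NI Oo = 1"
proof (rule NI_eqI[OF rideal_O])
 show "is_NI Oo 1"
  unfolding is_NI_def
 proof (intro conjI ballI allI impI)
  show "EX k::int. qn x = 1 * of_int k" if "x:Oo" for x using O_integral(1)[OF that] by (auto elim: Ints_cases)
  show "EX x:Oo. EX k::int. qn x = 1 * of_int k & ~ int p dvd k" if "prime p" for p :: nat
   using that O_one by (intro bexI[of _ qone] exI[of _ 1]) auto
 qed simp
qed

lemma qn_nv_O: "x:Oo ==> qn x = of_int (nv Oo x)"
 using qn_nv[OF rideal_O] by simp

lemma nv_linear:
 assumes "rideal I" "x:I" "y:I"
 shows "nv I (of_int a*R x + of_int b*R y) = a^2*nv I x+b^2*nv I y+a*b*(nv I (x+y)-nv I x-nv I y)"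
 by (rule nv_eqI[OF assms(1)])
   (simp add: qn_add qn_nv[OF assms(1,2)] qn_nv[OF assms(1,3)] nv_bilinear[OF assms] algebra_simps)

text \<open>Chinese remaindering: with m the product of the primes already treated, p x + m y
  behaves like m y at p and like p x at each prime dividing m.\<close>

lemma nv_primitive_finite:
 assumes I: "rideal I" and "finite P" "!!p. p:P ==> prime p"
 shows "EX x:I. ALL p:P. ~ int p dvd nv I x"
 using assms(2,3)
proof (induction P rule: finite_induct)
 case empty then show ?case using rideal_zero[OF I] by auto
next
 case (insert p P)
 then obtain x where x: "x:I" "!!q. q:P ==> ~ int q dvd nv I x" by auto
 obtain y where y: "y:I" "~ int p dvd nv I y" using nv_primitive[OF I, of p] insert(4)[of p] by auto
 define m where "m = (\<Prod>P)"
 define z where "z = of_int (int p)*R x + of_int (int m)*R y"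
 have z: "nv I z = (int p)^2*nv I x+(int m)^2*nv I y+int p*int m*(nv I (x+y)-nv I x-nv I y)"
  unfolding z_def by (rule nv_linear[OF I x(1) y(1)])
 have pp: "prime p" "!!q. q:P ==> prime q" using insert by auto
 have "~ int p dvd nv I z"
 proof
  assume "int p dvd nv I z"
  moreover have "int p dvd (int p)^2*nv I x" "int p dvd int p*int m*(nv I (x+y)-nv I x-nv I y)"
   by (simp_all add: power2_eq_square)
  ultimately have "int p dvd (int m)^2*nv I y" unfolding z by (metis dvd_add_right_iff dvd_add_left_iff)
  then have "int p dvd int m" using y(2) pp(1) by (simp add: prime_dvd_mult_iff prime_dvd_power_iff)
  then have "p dvd m" by simp
  then obtain q where "q:P" "p dvd q" using pp(1) insert(1) unfolding m_def by (auto simp: prime_dvd_prod_iff)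
  then show False using pp insert(2) primes_dvd_imp_eq by metis
 qed
 moreover have "~ int q dvd nv I z" if q: "q:P" for q
 proof
  have qm: "int q dvd int m" using q insert(1) unfolding m_def by (simp add: dvd_prodI)
  assume "int q dvd nv I z"
  moreover have "int q dvd (int m)^2*nv I y" "int q dvd int p*int m*(nv I (x+y)-nv I x-nv I y)"
   using qm by (simp_all add: power2_eq_square)
  ultimately have "int q dvd (int p)^2*nv I x" unfolding z by (metis dvd_add_right_iff dvd_add_left_iff)
  then have "q dvd p" using x(2)[OF q] pp(2)[OF q] by (simp add: prime_dvd_mult_iff prime_dvd_power_iff)
  then show False using pp q insert(2) primes_dvd_imp_eq by metis
 qed
 moreover have "z:I" unfolding z_def by (intro rideal_add rideal_int I x y)
 ultimately show ?case by blast
qed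

text \<open>The values of \<open>nv I\<close> have no common prime divisor, so no denominator of c
  survives.\<close>

lemma nv_cancel:
 fixes c :: real
 assumes I: "rideal I" and c: "!!x. x:I ==> of_int (nv I x)*c:\<int>"
 shows "c:\<int>"
proof -
 obtain x0 where x0: "x0:I" "x0 ~= 0" using I unfolding rideal_def by blast
 have "c:\<rat>" using Rats_cancel[of "of_int (nv I x0)" c] c[OF x0(1)] nv_pos[OF I x0] Ints_subset_Rats by auto
 then obtain a b :: int where ab: "b > 0" "coprime a b" "c = of_int a/of_int b" by (metis Rats_cases')
 have bd: "b dvd nv I x" if x: "x:I" for x
 proof -
  obtain k where "of_int (nv I x)*c = of_int k" using c[OF x] by (auto elim: Ints_cases)
  then have "real_of_int (nv I x*a) = real_of_int (k*b)" using ab by (simp add: field_simps)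
  then have "nv I x*a = k*b" by (simp only: of_int_eq_iff)
  then have "b dvd nv I x*a" by simp
  then show ?thesis using ab(2) by (simp add: coprime_commute coprime_dvd_mult_left_iff)
 qed
 have "b = 1"
 proof (rule ccontr)
  assume "b ~= 1"
  then have "nat b ~= 1" using ab(1) by simp
  then obtain p where p: "prime p" "p dvd nat b" using prime_factor_nat by blast
  then have "int p dvd b" using ab(1) by (metis int_dvd_int_iff nat_0_le less_imp_le)
  then show False using nv_primitive[OF I p(1)] bd dvd_trans by blast
 qed
 then show ?thesis using ab by simp
qed

lemma NI_sub:
 assumes "rideal I" "rideal J" "J <= I"
 shows "EX k::nat. k > 0 & NI J = NI I*real k"
proof -
 have "NI J/NI I:\<int>"
 proof (rule nv_cancel[OF assms(2)])
  fix x assume "x:J"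
  then have "of_int (nv J x)*(NI J/NI I) = of_int (nv I x)"
   using qn_nv[OF assms(1), of x] qn_nv[OF assms(2), of x] assms(3) NI_pos[OF assms(1)] by (auto simp: field_simps)
  then show "of_int (nv J x)*(NI J/NI I):\<int>" by simp
 qed
 then obtain k where k: "NI J/NI I = of_int k" by (auto elim: Ints_cases)
 then have "k > 0" using NI_pos[OF assms(1)] NI_pos[OF assms(2)] by (metis divide_pos_pos of_int_0_less_iff)
 then show ?thesis using k NI_pos[OF assms(1)] by (intro exI[of _ "nat k"]) (auto simp: field_simps)
qed

lemma NI_integral: "rideal I ==> I <= Oo ==> EX k::nat. k > 0 & NI I = real k"
 using NI_sub[OF rideal_O] by simp

lemma NI_left:
 assumes I: "rideal I" and a: "a:A" "a ~= 0"
 shows "NI ((*.) a ` I) = qn a*NI I"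
proof (rule NI_eqI[OF rideal_left[OF assms]])
 show "is_NI ((*.) a ` I) (qn a*NI I)"
  unfolding is_NI_def
 proof (intro conjI ballI allI impI)
  show "qn a*NI I > 0" using a NI_pos[OF I] by simp
  show "EX k::int. qn x = qn a*NI I * of_int k" if "x:(*.) a ` I" for x
   using that qn_nv[OF I] by (auto simp: qn_qmul mult.assoc)
  fix p :: nat assume "prime p"
  then obtain x where "x:I" "~ int p dvd nv I x" using nv_primitive[OF I] by blast
  then show "EX x:(*.) a ` I. EX k::int. qn x = qn a*NI I * of_int k & ~ int p dvd k"
   using qn_nv[OF I] by (intro bexI[of _ "a*.x"] exI[of _ "nv I x"]) (auto simp: qn_qmul mult.assoc)
 qed
qed

lemma NI_scale:
 assumes "rideal I" "t:\<rat>" "t ~= 0"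
 shows "rideal ((*R) t ` I)" "NI ((*R) t ` I) = t^2*NI I"
proof -
 have "(*R) t = (*.) (t*R qone)" by (auto simp: fun_eq_iff)
 then show "rideal ((*R) t ` I)" "NI ((*R) t ` I) = t^2*NI I"
  using rideal_left[OF assms(1), of "t*R qone"] NI_left[OF assms(1), of "t*R qone"] assms(2,3) A_scale[OF _ A_one] by auto
qed

text \<open>Right ideals are locally principal: any \<open>x \<in> I\<close> generates \<open>I\<close> away from \<open>nv I x\<close>.\<close>

lemma ideal_quotient:
 assumes I: "rideal I" and x: "x:I" and y: "y:I"
 shows "(1/NI I)*R (qcnj x*.y):Oo"
proof (rule O_maximal)
 have "qtr ((1/NI I)*R (qcnj x*.y)*.a):\<int>" if "a:Oo" for a
 proof -
  have "qtr (qcnj x*.(y*.a)) = qtr ((y*.a)*.qcnj x)" by (rule qtr_commute)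
  also have "... = NI I * of_int (nv I (y*.a+x)-nv I (y*.a)-nv I x)"
   by (rule nv_bilinear[OF I rideal_mul[OF I y that] x])
  finally show ?thesis using NI_pos[OF I] by (simp add: qmul_assoc)
 qed
 then show "(1/NI I)*R (qcnj x*.y):qdual Oo" by (simp add: qdual_def)
 have "qn ((1/NI I)*R (qcnj x*.y)) = of_int (nv I x*nv I y)"
  using NI_pos[OF I] qn_nv[OF I x] qn_nv[OF I y] by (simp add: qn_qmul power2_eq_square)
 then show "qn ((1/NI I)*R (qcnj x*.y)):\<int>" by simp
qed

lemma ideal_quotient_mul:
 assumes I: "rideal I" and x: "x:I"
 shows "x*.((1/NI I)*R (qcnj x*.y)) = of_int (nv I x)*R y"
 using NI_pos[OF I] qn_nv[OF I x] by (simp add: qmul_qcnj_left)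

lemma nv_multiple:
 assumes "rideal I" "x:I" "y:I"
 shows "of_int (nv I x)*R y:(*.) x ` Oo"
 using ideal_quotient_mul[OF assms(1,2), of y] ideal_quotient[OF assms] by (metis image_eqI)

text \<open>\<open>L'\<close> contains f L, so the index divides f^4.\<close>

lemma local_index:
 assumes L: "is_lat (L :: quat set)" and L': "is_lat L'" "L' <= L" and f: "f > 0" "!!x. x:L ==> of_int f*R x:L'"
  and p: "prime p" "~ int p dvd f"
 shows "EX i::nat. i > 0 & ~ p dvd i & covol L' = real i*covol L"
proof -
 define i where "i = lidx L L'"
 define j where "j = lidx L' ((*R) (of_int f) ` L)"
 have i: "i > 0" "covol L' = real i*covol L" using covol_lidx[OF L L'] by (auto simp: i_def)
 have "covol ((*R) (of_int f) ` L) = (of_int f)^4*covol L" "is_lat ((*R) (of_int f) ` L)"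
  using lat_scale[OF L, of "of_int f"] f by auto
 moreover have "covol ((*R) (of_int f) ` L) = real j*covol L'"
  unfolding j_def by (rule covol_lidx(1)[OF L'(1) calculation(2)]) (use f(2) in auto)
 ultimately have "real j*real i = (of_int f)^4" using i covol_pos[OF L] by simp
 then have "real (j*i) = real ((nat f)^4)" using f(1) by simp
 then have ji: "j*i = (nat f)^4" by (simp only: of_nat_eq_iff)
 have "~ p dvd (nat f)^4" using p f(1) by (metis prime_dvd_power int_dvd_int_iff nat_0_le less_imp_le)
 then have "~ p dvd i" using ji by (metis dvd_mult)
 then show ?thesis using i by blast
qed

text \<open>At a prime p choose x in I with \<open>nv I x\<close> prime to p: x O has index prime to
  p in I, and its covolume is n(x)^2 times that of O.\<close>

lemma covol_rideal:
 assumes I: "rideal I"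
 shows "covol I = (NI I)^2*covol Oo"
proof -
 have "covol I/((NI I)^2*covol Oo) = 1"
 proof (rule eq_one_if_local_unit)
  fix p :: nat assume p: "prime p"
  obtain x where x: "x:I" "~ int p dvd nv I x" using nv_primitive[OF I p] by blast
  define f where "f = nv I x"
  have x0: "x ~= 0" using x nv_eqI[OF I, of 0 0] by auto
  have f: "f > 0" using nv_pos[OF I x(1) x0] by (simp add: f_def)
  have "(*.) x ` Oo <= I" using rideal_mul[OF I x(1)] by auto
  from local_index[OF lat_rideal[OF I] lat_left(1)[OF lat_O x0] this f _ p]
  obtain i where i: "i > 0" "~ p dvd i" "covol ((*.) x ` Oo) = real i*covol I"
   using nv_multiple[OF I x(1)] x(2) unfolding f_def by blast
  have "(NI I * of_int f)^2*covol Oo = real i*covol I"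
   using i(3) lat_left(2)[OF lat_O x0] qn_nv[OF I x(1)] by (simp add: f_def)
  then have "covol I/((NI I)^2*covol Oo) = real ((nat f)^2)/real i"
   using i(1) f NI_pos[OF I] covol_pos[OF lat_O] by (simp add: field_simps power_mult_distrib)
  moreover have "~ p dvd (nat f)^2" using p x(2) f unfolding f_def
   by (metis prime_dvd_power int_dvd_int_iff nat_0_le less_imp_le)
  ultimately show "EX a b. b > 0 & ~ p dvd a & ~ p dvd b & covol I/((NI I)^2*covol Oo) = real a/real b"
   using i by blast
 qed
 then show ?thesis using NI_pos[OF I] covol_pos[OF lat_O] by (simp add: field_simps)
qed

lemma rideal_eqI:
 assumes "rideal I" "rideal J" "J <= I" "NI J = NI I"
 shows "J = I"
 using covol_subset[OF lat_rideal[OF assms(1)] lat_rideal[OF assms(2)] assms(3)] covol_rideal assms by simp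

text \<open>Homomorphisms of right modules from I to K, as left multiplications. They form the
  unipotent part of the stabiliser of K + I, and their covolume enters the unfolding as the
  horizontal volume of a cusp.\<close>

definition colon :: "quat set => quat set => quat set" where
 "colon K I = {b. ALL y:I. b*.y:K}"

text \<open>The multiplier lattice lies between K x^(-1) and the multiple \<open>nv I x\<close> of
  it, so the two agree at the primes not dividing \<open>nv I x\<close>.\<close>

lemma colon_local:
 assumes K: "rideal K" and I: "rideal I" and x: "x:I" "x ~= 0"
 shows "colon K I <= (%k. qone*.k*.qinv x) ` K"
  and "b:(%k. qone*.k*.qinv x) ` K ==> of_int (nv I x)*R b:colon K I"
  and "is_lat (colon K I)"
proof -
 let ?Y = "(%k. qone*.k*.qinv x) ` K"
 show 1: "colon K I <= ?Y"
 proof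
  fix b assume "b:colon K I"
  then have "b*.x:K" using x by (simp add: colon_def)
  moreover have "b = qone*.(b*.x)*.qinv x" using x by (simp add: qmul_assoc)
  ultimately show "b:?Y" by blast
 qed
 show 2: "of_int (nv I x)*R b:colon K I" if b: "b:?Y" for b
  unfolding colon_def
 proof (intro CollectI ballI)
  fix y assume y: "y:I"
  obtain k where k: "k:K" "b = k*.qinv x" using b by auto
  obtain a where a: "a:Oo" "of_int (nv I x)*R y = x*.a" using nv_multiple[OF I x(1) y] by auto
  have "of_int (nv I x)*R b*.y = k*.(qinv x*.(of_int (nv I x)*R y))" by (simp add: k qmul_assoc)
  also have "... = k*.a" unfolding a using x by simp
  finally show "of_int (nv I x)*R b*.y:K" using rideal_mul[OF K k(1) a(1)] by simp
 qed
 have "is_lat ?Y" by (rule lat_similarity(1)[OF lat_rideal[OF K]]) (use x in auto)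
 then show "is_lat (colon K I)"
  by (rule lat_subgroup[OF _ _ 2 1]) (use nv_pos[OF I x] rideal_diff[OF K] in \<open>auto simp: colon_def qmul_diff\<close>)
qed

lemma lat_colon: "rideal K ==> rideal I ==> is_lat (colon K I)"
proof -
 assume K: "rideal K" and I: "rideal I"
 obtain x where "x:I" "x ~= 0" using I unfolding rideal_def by blast
 then show ?thesis by (rule colon_local(3)[OF K I])
qed

lemma covol_colon:
 assumes K: "rideal K" and I: "rideal I"
 shows "covol (colon K I) = (NI K)^2/(NI I)^2*covol Oo"
proof -
 define q where "q = covol (colon K I)*(NI I)^2/((NI K)^2*covol Oo)"
 have "q = 1"
 proof (rule eq_one_if_local_unit)
  fix p :: nat assume p: "prime p"
  obtain x where x: "x:I" "~ int p dvd nv I x" using nv_primitive[OF I p] by blast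
  define f where "f = nv I x"
  have x0: "x ~= 0" using x nv_eqI[OF I, of 0 0] by auto
  have f: "f > 0" using nv_pos[OF I x(1) x0] by (simp add: f_def)
  let ?Y = "(%k. qone*.k*.qinv x) ` K"
  have Y: "is_lat ?Y" "covol ?Y = (1/qn x)^2*((NI K)^2*covol Oo)"
   using lat_similarity[OF lat_rideal[OF K], of qone "qinv x"] x0 covol_rideal[OF K] by auto
  obtain i where i: "i > 0" "~ p dvd i" "covol (colon K I) = real i*covol ?Y"
   using local_index[OF Y(1) colon_local(3)[OF K I x(1) x0] colon_local(1)[OF K I x(1) x0] f _ p]
    colon_local(2)[OF K I x(1) x0] x(2) unfolding f_def by blast
  have "q = real i/real ((nat f)^2)"
   unfolding q_def i(3) Y(2) using qn_nv[OF I x(1)] f NI_pos[OF I] NI_pos[OF K] covol_pos[OF lat_O]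
   by (simp add: f_def[symmetric] field_simps power_mult_distrib)
  moreover have "~ p dvd (nat f)^2" using p x(2) f unfolding f_def
   by (metis prime_dvd_power int_dvd_int_iff nat_0_le less_imp_le)
  ultimately show "EX a b. b > 0 & ~ p dvd a & ~ p dvd b & q = real a/real b"
   using i f by (intro exI[of _ i] exI[of _ "(nat f)^2"]) auto
 qed
 then show ?thesis using NI_pos[OF K] NI_pos[OF I] covol_pos[OF lat_O] unfolding q_def by (simp add: field_simps)
qed

end

section \<open>Local structure at a prime\<close>

definition pdiv :: "nat => real => bool" where
 "pdiv p r \<longleftrightarrow> (EX k::int. r = real p * of_int k)"

lemma pdiv_add: "pdiv p r ==> pdiv p s ==> pdiv p (r+s)"
 and pdiv_diff: "pdiv p r ==> pdiv p s ==> pdiv p (r-s)"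
 and pdiv_mult: "t:\<int> ==> pdiv p r ==> pdiv p (t*r)"
 and pdiv_mult2: "t:\<int> ==> pdiv p r ==> pdiv p (r*t)"
 and pdiv_zero [simp]: "pdiv p 0"
 and pdiv_self: "t:\<int> ==> pdiv p (real p*t)"
proof -
 show "pdiv p r ==> pdiv p s ==> pdiv p (r+s)" unfolding pdiv_def by (metis distrib_left of_int_add)
 show "pdiv p r ==> pdiv p s ==> pdiv p (r-s)" unfolding pdiv_def by (metis right_diff_distrib of_int_diff)
 show *: "t:\<int> ==> pdiv p r ==> pdiv p (t*r)" unfolding pdiv_def
  by (elim Ints_cases) (metis mult.left_commute of_int_mult)
 show "t:\<int> ==> pdiv p r ==> pdiv p (r*t)" using * by (simp add: mult.commute)
 show "pdiv p 0" unfolding pdiv_def by (auto intro: exI[of _ 0])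
 show "t:\<int> ==> pdiv p (real p*t)" unfolding pdiv_def by (auto elim: Ints_cases)
qed

lemma pdiv_of_int: "p > 0 ==> pdiv p (of_int m) \<longleftrightarrow> int p dvd m"
proof
 assume "p > 0" "pdiv p (of_int m)"
 then obtain k where "of_int m = (real p * of_int k)" unfolding pdiv_def by blast
 then have "real_of_int m = real_of_int (int p * k)" by simp
 then have "m = int p * k" by (simp only: of_int_eq_iff)
 then show "int p dvd m" by simp
qed (auto simp: pdiv_def)

lemma pdiv_dvd: "a dvd b ==> pdiv b r ==> pdiv a r"
 unfolding pdiv_def by (auto elim!: dvdE) (metis mult.assoc of_int_mult of_int_of_nat_eq)

lemma prime_inverse:
 assumes "prime p" "~ int p dvd u"
 shows "EX k l. k*u = 1+int p*l"
proof -
 have "coprime (int p) u" using assms by (intro prime_imp_coprime) auto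
 then have "coprime u (int p)" by (simp add: coprime_commute)
 then obtain k l where "k*u+l*int p = 1"
  using bezout_int[of u "int p"] by auto
 then show ?thesis by (intro exI[of _ k] exI[of _ "- l"]) (auto simp: algebra_simps)
qed

text \<open>Pigeonhole: s^2 and c - a t^2 each take at least (p + 1)/2 residues modulo p.\<close>

lemma binary_form_represents:
 fixes a c :: int
 assumes p: "prime p" "odd p" and a: "~ int p dvd a"
 shows "EX s t. int p dvd s^2+a*t^2-c"
proof -
 define h where "h = (p-1) div 2"
 have p2: "p = 2*h+1" using p(2) by (auto simp: h_def elim: oddE)
 let ?f = "%s::int. s^2 mod int p"
 let ?g = "%t::int. (c-a*t^2) mod int p"
 have sq: "s = t" if "s:{0..int h}" "t:{0..int h}" "int p dvd s^2-t^2" for s t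
 proof -
  have "int p dvd (s-t)*(s+t)" using that(3) by (simp add: power2_eq_square algebra_simps)
  then have "int p dvd s-t | int p dvd s+t" using p(1) by (simp add: prime_dvd_mult_iff)
  moreover have "\<bar>s-t\<bar> < int p" "0 <= s+t" "s+t < int p" using that p2 by auto
  ultimately have "s-t = 0 | s+t = 0" by (metis abs_of_nonneg dvd_imp_le_int not_le abs_of_nat)
  then show ?thesis using that by auto
 qed
 have "inj_on ?f {0..int h}" by (rule inj_onI) (auto simp: mod_eq_dvd_iff intro: sq)
 moreover have "inj_on ?g {0..int h}"
 proof (rule inj_onI)
  fix s t assume *: "s:{0..int h}" "t:{0..int h}" "?g s = ?g t"
  then have "int p dvd a*(t^2-s^2)" by (simp add: mod_eq_dvd_iff algebra_simps)
  then have "int p dvd t^2-s^2" using a p(1) by (simp add: prime_dvd_mult_iff)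
  then show "s = t" using sq[of t s] * by auto
 qed
 ultimately have cards: "card (?f ` {0..int h}) = h+1" "card (?g ` {0..int h}) = h+1"
  by (simp_all add: card_image)
 have sub: "?f ` {0..int h} <= {0..<int p}" "?g ` {0..int h} <= {0..<int p}" using p2 by auto
 have "?f ` {0..int h} Int ?g ` {0..int h} ~= {}"
 proof
  assume "?f ` {0..int h} Int ?g ` {0..int h} = {}"
  then have "card (?f ` {0..int h} Un ?g ` {0..int h}) = (h+1)+(h+1)"
   by (subst card_Un_disjoint) (auto simp: cards)
  moreover have "card (?f ` {0..int h} Un ?g ` {0..int h}) <= card {0..<int p}"
   using sub by (intro card_mono) auto
  ultimately show False using p2 by simp
 qed
 then obtain s t where "s^2 mod int p = (c-a*t^2) mod int p" by blast
 then show ?thesis by (intro exI[of _ s] exI[of _ t]) (simp add: mod_eq_dvd_iff algebra_simps)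
qed

lemma order_multiple:
 assumes O1: "is_order A O1" and O2: "is_order A O2"
 shows "EX m::nat. m > 0 & (ALL x:O1. real m*R x:O2)"
proof -
 have O2c: "0:O2" "!!x y. x:O2 ==> y:O2 ==> x-y:O2" using O2 by (auto simp: is_order_def)
 have den: "EX k::nat. k > 0 & real k*R x:O2" if x: "x:A" for x
 proof -
  have "x:{x. EX S c. finite S & S <= O2 & (ALL s:S. c s:\<rat>) & x = (SUM s:S. c s*R s)}"
   using x O2 unfolding is_order_def by blast
  then obtain S c where S: "finite S" "S <= O2" "ALL s:S. c s:\<rat>" "x = (SUM s:S. c s*R s)" by blast
  obtain m :: nat where m: "m > 0" "ALL s:S. real m*c s:\<int>" using common_denominator[of S c] S by blast
  have "real m*R x = (SUM s:S. (real m*c s)*R s)" using S by (simp add: scaleR_sum_right)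
  also have "...:O2"
  proof (rule sum_closed[OF O2c])
   fix s assume "s:S"
   then obtain k where "real m*c s = of_int k" "s:O2" using m S by (metis Ints_cases subsetD)
   then show "(real m*c s)*R s:O2" using int_scale_closed[OF O2c] by simp
  qed
  finally show ?thesis using m by blast
 qed
 obtain S where S: "finite S" "S <= O1" "O1 = zspan S" using O1 unfolding is_order_def zspan_def by blast
 have "O1 <= A" using O1 unfolding is_order_def by (elim conjE)
 then have "S <= A" using S(2) by (rule order_trans[rotated])
 then have "ALL s:S. EX k::nat. k > 0 & real k*R s:O2" using den by blast
 then obtain k :: "quat => nat" where k: "!!s. s:S ==> k s > 0 & real (k s)*R s:O2" by metis
 define P where "P = (PROD s:S. k s)"
 have "S <= {x. real P*R x:O2}"
 proof
  fix s assume s: "s:S"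
  have "P = (PROD s:S - {s}. k s) * k s" unfolding P_def using prod.remove[OF S(1) s, of k] by (simp add: mult.commute)
  then have "real P*R s = of_int (int (PROD s:S - {s}. k s))*R (real (k s)*R s)" by simp
  then show "s:{x. real P*R x:O2}" using int_scale_closed[OF O2c] k[OF s] by (metis mem_Collect_eq)
 qed
 then have "zspan S <= {x. real P*R x:O2}"
  using O2c by (intro zspan_subset) (auto simp: scaleR_diff_right)
 moreover have "P > 0" using k by (auto simp: P_def intro!: prod_pos)
 ultimately show ?thesis using S(3) by blast
qed

context max_order
begin

definition pO :: "nat => quat set" where "pO p = (*R) (real p) ` Oo"

lemma pO_iff: "p > 0 ==> x:pO p \<longleftrightarrow> (1/real p)*R x:Oo"
 unfolding pO_def by (auto simp: image_iff intro!: bexI[of _ "(1/real p)*R x"])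

lemma rideal_pO: "p > 0 ==> rideal (pO p)" and NI_pO: "p > 0 ==> NI (pO p) = (real p)^2"
 unfolding pO_def using NI_scale[OF rideal_O, of "real p"] by auto

lemma pO_sub_O: "pO p <= Oo"
 unfolding pO_def using O_Ints by auto

lemma pO_mul: "x:Oo ==> y:pO p ==> x*.y:pO p" "x:Oo ==> y:pO p ==> y*.x:pO p"
 unfolding pO_def using O_mul by auto

lemma pO_norm: "x:pO p ==> pdiv (p^2) (qn x)"
 unfolding pO_def pdiv_def using O_integral(1) by (auto elim!: Ints_cases) (metis Ints_cases)

lemma unit_multiple_sub:
 assumes X: "0:X" "!!x y. x:X ==> y:X ==> x-y:(X :: quat set)"
  and p: "prime p" "~ int p dvd u" "of_int u*R x:X" "real p*R x:X"
 shows "x:X"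
proof -
 obtain k l where kl: "k*u = 1+int p*l" using prime_inverse[OF p(1,2)] by blast
 have "real_of_int (k*u) = 1+real p * of_int l" unfolding kl by simp
 then have "x = of_int k*R (of_int u*R x)-of_int l*R (real p*R x)"
  by (simp add: algebra_simps scaleR_add_left)
 then show ?thesis using X(2) int_scale_closed[OF X p(3)] int_scale_closed[OF X p(4)] by metis
qed

lemma outside_pO:
 assumes p: "p > 0" and R: "finite R" "card R < p^4"
 shows "EX x:Oo. ALL r:R. x-r ~: pO p"
proof (rule ccontr)
 assume "~ ?thesis"
 then have "EX r:R. x-r:pO p" if "x:Oo" for x using that by blast
 then have "covol (pO p) <= real (card R)*covol Oo"
  by (intro covol_le_cover lat_O lat_rideal rideal_pO p pO_sub_O R)
 then have "real (p^4)*covol Oo <= real (card R)*covol Oo"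
  using covol_rideal[OF rideal_pO[OF p]] NI_pO[OF p] by (simp add: power_mult[symmetric])
 then show False using covol_pos[OF lat_O] R(2) by (simp del: of_nat_power)
qed

text \<open>Integral combinations of three elements reach at most p^3 of the p^4 classes of O modulo
  p. This replaces a basis modulo p.\<close>

lemma not_in_pO_combination:
 assumes p: "p > 1" and that: "a:Oo" "b:Oo" "c:Oo"
 shows "EX x:Oo. ALL i j k :: int. x-(of_int i*R a + of_int j*R b + of_int k*R c) ~: pO p"
proof -
 define h where "h = (%(i, j, k). of_int i*R a + of_int j*R b + of_int k*R c)"
 define R where "R = h ` ({0..<int p} \<times> {0..<int p} \<times> {0..<int p})"
 have "finite R" unfolding R_def by simp
 moreover have "card R < p^4"
 proof -
  have "card R <= card ({0..<int p} \<times> {0..<int p} \<times> {0..<int p})" unfolding R_def by (rule card_image_le) simp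
  also have "... = p^3" by (simp add: card_cartesian_product eval_nat_numeral)
  also have "p^3 < p^4" using p by (simp add: power_strict_increasing)
  finally show ?thesis .
 qed
 ultimately obtain x where x: "x:Oo" "!!r. r:R ==> x-r ~: pO p" using outside_pO[of p R] p by auto
 have "x-(of_int i*R a + of_int j*R b + of_int k*R c) ~: pO p" for i j k
 proof
  assume *: "x-(of_int i*R a + of_int j*R b + of_int k*R c):pO p"
  define d where "d i = of_int (i mod int p)-(of_int i :: real)" for i
  have d: "d i = real p * of_int (- (i div int p))" for i
  proof -
   have "i mod int p-i = int p*(- (i div int p))" by (simp add: minus_div_mult_eq_mod[symmetric])
   then show ?thesis unfolding d_def by (metis of_int_diff of_int_mult of_int_of_nat_eq)
  qed
  have mem: "d i*R y:pO p" if "y:Oo" for i y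
  proof -
   have "d i*R y = real p*R (of_int (- (i div int p))*R y)" unfolding d by simp
   then show ?thesis unfolding pO_def using O_int[OF that] by blast
  qed
  have rp: "rideal (pO p)" using rideal_pO p by simp
  have "x-h (i mod int p, j mod int p, k mod int p) =
    x-(of_int i*R a + of_int j*R b + of_int k*R c)-(d i*R a+d j*R b+d k*R c)"
   unfolding h_def d_def by (simp add: scaleR_diff_left)
  also have "...:pO p"
   by (intro rideal_diff[OF rp] rideal_add[OF rp] mem that *)
  finally show False using x(2)[of "h (i mod int p, j mod int p, k mod int p)"] p unfolding R_def by auto
 qed
 then show ?thesis using x(1) by blast
qed

text \<open>Modulo an odd prime the norm form restricted to \<open>1, v, w\<close> is made diagonal, and a binary form represents every residue.
  For the prime two, a form that is odd off \<open>2 O\<close> would contradict the identity for \<open>n (a + b + c)\<close>.\<close>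

lemma qn_three: "qn (a+b+c)+qn a+qn b+qn c = qn (a+b)+qn (a+c)+qn (b+c)"
 by (simp add: qn_add qring qtr_add)

lemma exists_norm_divisible:
 assumes p: "prime p"
 shows "EX x:Oo. x ~: pO p & pdiv p (qn x)"
proof (cases "odd p")
 case True
 have p0: "p > 1" "p > 0" using p prime_gt_1_nat prime_gt_0_nat by auto
 have rp: "rideal (pO p)" using rideal_pO p0 by simp
 obtain v0 where v0: "v0:Oo" "!!i :: int. v0-of_int i*R qone ~: pO p"
  using not_in_pO_combination[OF p0(1) O_one O_zero O_zero] by auto
 obtain t where t: "qtr v0 = of_int t" using O_integral(2)[OF v0(1)] by (auto elim: Ints_cases)
 define v where "v = 2*R v0-of_int t*R qone"
 have vO: "v:Oo" unfolding v_def by (intro O_diff O_Ints v0 O_one) auto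
 have trv: "qtr v = 0" by (simp add: v_def qtr_diff t)
 obtain a where a: "qn v = of_int a" using O_integral(1)[OF vO] by (auto elim: Ints_cases)
 have two: "~ int p dvd 2" using True p by (metis int_dvd_int_iff of_nat_numeral primes_dvd_imp_eq two_is_prime_nat dvd_refl)
 have v_not: "v ~: pO p"
 proof
  assume v: "v:pO p"
  let ?X = "{x. EX i::int. x-of_int i*R qone:pO p}"
  have X: "0:?X" "!!x y. x:?X ==> y:?X ==> x-y:?X"
  proof -
   show "0:?X" using rideal_zero[OF rp] by (auto intro!: exI[of _ 0])
   fix x y assume "x:?X" "y:?X"
   then obtain i j where "x-of_int i*R qone:pO p" "y-of_int j*R qone:pO p" by auto
   from rideal_diff[OF rp this] have "(x-y)-of_int (i-j)*R qone:pO p" by (simp add: scaleR_diff_left algebra_simps)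
   then show "x-y:?X" by blast
  qed
  have "of_int 2*R v0:?X" using v unfolding v_def by (intro CollectI exI[of _ t]) simp
  moreover have "real p*R v0:pO p" unfolding pO_def using v0(1) by (rule imageI)
  then have "real p*R v0:?X" by (intro CollectI exI[of _ 0]) simp
  ultimately have "v0:?X" using unit_multiple_sub[of ?X p 2 v0, OF X p two] by blast
  then show False using v0(2) by auto
 qed
 show ?thesis
 proof (cases "int p dvd a")
  case True
  then show ?thesis using vO v_not p0(2) a by (auto simp: pdiv_of_int intro!: bexI[of _ v])
 next
  case False
  obtain w0 where w0: "w0:Oo" "!!i j :: int. w0-(of_int i*R qone + of_int j*R v) ~: pO p"
   using not_in_pO_combination[OF p0(1) O_one vO O_zero] by auto
  obtain s where s: "qtr w0 = of_int s" using O_integral(2)[OF w0(1)] by (auto elim: Ints_cases)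
  define w1 where "w1 = 2*R w0-of_int s*R qone"
  have w1O: "w1:Oo" unfolding w1_def by (intro O_diff O_Ints w0 O_one) auto
  have trw1: "qtr w1 = 0" by (simp add: w1_def qtr_diff s)
  obtain b where b: "qtr (w1*.qcnj v) = of_int b"
   using O_integral(2)[OF O_mul[OF w1O O_cnj[OF vO]]] by (auto elim: Ints_cases)
  \<comment> \<open>The component of w1 orthogonal to v, scaled by 2 n(v) to clear denominators; p
    is odd and does not divide n(v), so nothing is lost modulo p.\<close>
  define w where "w = of_int (2*a)*R w1-of_int b*R v"
  have wO: "w:Oo" unfolding w_def by (intro O_diff O_int w1O vO)
  have orth: "qtr w = 0" "qtr (w*.qcnj v) = 0"
   by (simp_all add: w_def qtr_diff qmul_diff trw1 trv b qmul_qcnj a)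
  obtain c where c: "qn w = of_int c" using O_integral(1)[OF wO] by (auto elim: Ints_cases)
  obtain s' t' where st: "int p dvd s'^2+a*t'^2-(- c)"
   using binary_form_represents[OF p \<open>odd p\<close> False] by blast
  define x where "x = of_int s' *R qone + of_int t' *R v+w"
  have xO: "x:Oo" unfolding x_def by (intro O_add O_int O_one vO wO)
  have "qn x = of_int (s'^2+a*t'^2+c)"
   using orth trv qtr_cnj_swap[of v w] unfolding x_def by (simp add: qn_add qmul_add qtr_add a c mult.commute)
  then have "pdiv p (qn x)" using st p0 by (simp add: pdiv_of_int del: of_int_add of_int_mult of_int_power)
  moreover have "x ~: pO p"
  proof
   assume x: "x:pO p"
   let ?X = "{x. EX i j::int. x-(of_int i*R qone + of_int j*R v):pO p}"
   have X: "0:?X" "!!x y. x:?X ==> y:?X ==> x-y:?X"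
   proof -
    show "0:?X" using rideal_zero[OF rp] by (auto intro!: exI[of _ 0])
    fix x y assume "x:?X" "y:?X"
    then obtain i j i' j' where "x-(of_int i*R qone + of_int j*R v):pO p" "y-(of_int i' *R qone + of_int j' *R v):pO p" by auto
    from rideal_diff[OF rp this] have "(x-y)-(of_int (i-i')*R qone + of_int (j-j')*R v):pO p"
     by (simp add: scaleR_diff_left algebra_simps)
    then show "x-y:?X" by blast
   qed
   have "of_int (4*a)*R w0-(of_int (2*a * s-s')*R qone + of_int (b-t')*R v) = x"
    unfolding x_def w_def w1_def by (simp add: scaleR_diff_right scaleR_diff_left)
   then have "of_int (4*a)*R w0:?X" using x by blast
   moreover have "~ int p dvd 4*a"
   proof
    assume "int p dvd 4*a"
    then have "int p dvd 2*(2*a)" by simp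
    moreover have "prime (int p)" using p by simp
    ultimately show False using two False by (simp only: prime_dvd_mult_iff simp_thms)
   qed
   moreover have "real p*R w0:pO p" unfolding pO_def using w0(1) by (rule imageI)
   then have "real p*R w0:?X" by (intro CollectI exI[of _ 0]) simp
   ultimately have "w0:?X" using unit_multiple_sub[of ?X p "4*a" w0, OF X p] by blast
   then show False using w0(2) by auto
  qed
  ultimately show ?thesis using xO by blast
 qed
next
 case False
 then have p2: "p = 2" using p primes_dvd_imp_eq two_is_prime_nat by blast
 show ?thesis
 proof (rule ccontr)
  assume contra: "~ ?thesis"
  have odd: "odd (nv Oo x)" if "x:Oo" "x ~: pO 2" for x
  proof -
   have "~ pdiv 2 (of_int (nv Oo x))" using contra that qn_nv_O[OF that(1)] unfolding p2 by auto
   then show ?thesis by (simp add: pdiv_of_int)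
  qed
  obtain y where y: "y:Oo" "!!i :: int. y-of_int i*R qone ~: pO 2"
   using not_in_pO_combination[of 2 qone 0 0] O_one O_zero by auto
  obtain z where z: "z:Oo" "!!i j :: int. z-(of_int i*R qone + of_int j*R y) ~: pO 2"
   using not_in_pO_combination[of 2 qone y 0] O_one O_zero y(1) by auto
  have sums: "qone+y:Oo" "qone+z:Oo" "y+z:Oo" "qone+y+z:Oo" using O_add O_one y z by auto
  have one: "qone ~: pO 2"
  proof
   assume "qone:pO 2"
   then have "pdiv (2^2) 1" using pO_norm by fastforce
   then show False using pdiv_of_int[of "2^2" 1] by simp
  qed
  have nots: "y ~: pO 2" "z ~: pO 2" "qone+y ~: pO 2" "qone+z ~: pO 2" "y+z ~: pO 2" "qone+y+z ~: pO 2"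
   using y(2)[of 0] z(2)[of 0 0] y(2)[of "-1"] z(2)[of "-1" 0] z(2)[of 0 "-1"] z(2)[of "-1" "-1"]
   by (simp_all add: algebra_simps)
  have "real_of_int (nv Oo (qone+y+z)+nv Oo qone+nv Oo y+nv Oo z) =
   real_of_int (nv Oo (qone+y)+nv Oo (qone+z)+nv Oo (y+z))"
   using qn_three[of qone y z] by (simp add: qn_nv_O[symmetric] sums O_one y z)
  then have "nv Oo (qone+y+z)+nv Oo qone+nv Oo y+nv Oo z = nv Oo (qone+y)+nv Oo (qone+z)+nv Oo (y+z)"
   by (simp only: of_int_eq_iff)
  moreover have "odd (nv Oo (qone+y+z))" "odd (nv Oo qone)" "odd (nv Oo y)" "odd (nv Oo z)" "odd (nv Oo (qone+y))"
   "odd (nv Oo (qone+z))" "odd (nv Oo (y+z))" using odd nots sums O_one y(1) z(1) one by blast+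
  ultimately show False by presburger
 qed
qed

section \<open>The radical of the trace form modulo a prime\<close>

definition rad :: "nat => quat set" where
 "rad p = {w:Oo. ALL y:Oo. pdiv p (qtr (w*.y))}"

text \<open>Ramification as degeneracy of the trace form modulo p; that it coincides with anisotropy
  over the p-adic numbers is \<open>ram_iff_ramified\<close>. At such p the radical plays the part
  of the two-sided prime ideal above p.\<close>

definition ram :: "nat => bool" where "ram p \<longleftrightarrow> prime p & rad p ~= pO p"

lemma pO_sub_rad: "pO p <= rad p"
proof
 fix x assume "x:pO p"
 then obtain w where w: "w:Oo" "x = real p*R w" unfolding pO_def by blast
 have "pdiv p (qtr (x*.y))" if "y:Oo" for y
  using pdiv_self[OF O_integral(2)[OF O_mul[OF w(1) that]]] w by simp
 then show "x:rad p" unfolding rad_def using pO_sub_O \<open>x : pO p\<close> by blast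
qed

lemma rad_mul: "w:rad p ==> a:Oo ==> w*.a:rad p" "w:rad p ==> a:Oo ==> a*.w:rad p"
proof -
 show "w:rad p ==> a:Oo ==> w*.a:rad p" unfolding rad_def using O_mul by (auto simp: qmul_assoc)
 show "a*.w:rad p" if w: "w:rad p" and a: "a:Oo"
 proof -
  have "qtr ((a*.w)*.y) = qtr (w*.(y*.a))" for y using qtr_cyclic[of a w y] by (simp add: qmul_assoc)
  then show ?thesis using w a O_mul unfolding rad_def by auto
 qed
qed

lemma rad_cnj: "w:rad p ==> qcnj w:rad p"
proof -
 assume w: "w:rad p"
 have "qtr (qcnj w*.y) = qtr (w*.qcnj y)" for y
  by (metis qtr_simps(3) qcnj_qmul qcnj_qcnj qtr_commute)
 then show ?thesis using w O_cnj unfolding rad_def by auto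
qed

lemma rideal_rad: "p > 0 ==> rideal (rad p)"
proof -
 assume p: "p > 0"
 have "EX x:pO p. x ~= 0" using rideal_pO[OF p] by (auto simp: rideal_def)
 moreover have "0:rad p" using O_zero by (simp add: rad_def)
 moreover have "x-y:rad p" if "x:rad p" "y:rad p" for x y
  using that O_diff unfolding rad_def by (auto simp: qmul_diff qtr_diff pdiv_diff)
 moreover have "EX m::nat. m > 0 & (ALL x:rad p. real m*R x:Oo)" by (intro exI[of _ 1]) (auto simp: rad_def)
 moreover have "EX x:rad p. x ~= 0" using calculation(1) pO_sub_rad by blast
 moreover have "ALL x:rad p. ALL a:Oo. x*.a:rad p" using rad_mul(1) by blast
 ultimately show ?thesis unfolding rideal_def by (intro conjI ballI) blast+
qed

text \<open>Here maximality enters: w/p has integral norm and integral traces against the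
  order.\<close>

lemma rad_norm_square:
 assumes p: "p > 0" and w: "w:rad p" "pdiv (p^2) (qn w)"
 shows "w:pO p"
proof -
 have "(1/real p)*R w:Oo"
 proof (rule O_maximal)
  show "(1/real p)*R w:qdual Oo" using w(1) p unfolding rad_def qdual_def pdiv_def by fastforce
  show "qn ((1/real p)*R w):\<int>" using w(2) p unfolding pdiv_def by (auto simp: power_divide)
 qed
 then show ?thesis using p by (simp add: pO_iff)
qed

text \<open>Since tr(1) = 2, only p = 2 could fail. Then n would be additive modulo 2, and an
  element of even norm outside 2 O would have norm 2 modulo 4 by \<open>rad_norm_square\<close>.
  Three independent such elements and their partial sums contradict \<open>qn_three\<close>: four
  times 2 is not three times 2 modulo 4.\<close>

lemma rad_not_O:
 assumes p: "prime p"
 shows "rad p ~= Oo"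
proof
 assume rO: "rad p = Oo"
 have p0: "p > 0" using p prime_gt_0_nat by auto
 have "qone:rad p" using O_one rO by simp
 then have "pdiv p (qtr (qone*.qone))" using O_one unfolding rad_def by blast
 then have "int p dvd 2" using pdiv_of_int[OF p0, of 2] by simp
 then have "p dvd 2" by (metis int_dvd_int_iff of_nat_numeral)
 then have p2: "p = 2" using p primes_dvd_imp_eq two_is_prime_nat by blast
 have ev: "even (nv Oo (x+y)-nv Oo x-nv Oo y)" if "x:Oo" "y:Oo" for x y
 proof -
  have "pdiv 2 (qtr (x*.qcnj y))" using that O_cnj rO unfolding rad_def p2 by blast
  then have "pdiv 2 (of_int (nv Oo (x+y)-nv Oo x-nv Oo y))" using nv_bilinear[OF rideal_O that] by simp
  then show ?thesis using pdiv_of_int[of 2 "nv Oo (x+y)-nv Oo x-nv Oo y"] by simp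
 qed
 have four: "nv Oo x mod 4 = 2" if "x:Oo" "x ~: pO 2" "even (nv Oo x)" for x
 proof -
  have "~ pdiv (2^2) (qn x)" using rad_norm_square[of 2 x] that rO p2 by auto
  then have "~ 4 dvd nv Oo x" using qn_nv_O[OF that(1)] pdiv_of_int[of 4] by simp
  then show ?thesis using that(3) by presburger
 qed
 have p1: "(2::nat) > 1" by simp
 \<comment> \<open>Adding 1 changes the parity of the norm, since the bilinear form is even here and
   n(1) = 1.\<close>
 have even_shift: "EX i::int. even (nv Oo (x + of_int i*R qone))" if "x:Oo" for x
 proof (cases "even (nv Oo x)")
  case True then show ?thesis by (intro exI[of _ 0]) simp
 next
  case False
  have "nv Oo qone = 1" by (rule nv_eqI[OF rideal_O]) simp
  then have "even (nv Oo (x+qone))" using ev[OF that O_one] False by simp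
  then show ?thesis by (intro exI[of _ 1]) simp
 qed
 obtain a0 where a0: "a0:Oo" "!!i :: int. a0-of_int i*R qone ~: pO 2"
  using not_in_pO_combination[OF p1 O_one O_zero O_zero] by auto
 obtain ia where a: "even (nv Oo (a0 + of_int ia*R qone))" using even_shift a0(1) by blast
 obtain b0 where b0: "b0:Oo" "!!i j :: int. b0-(of_int i*R qone + of_int j*R a0) ~: pO 2"
  using not_in_pO_combination[OF p1 O_one a0(1) O_zero] by auto
 obtain ib where b: "even (nv Oo (b0 + of_int ib*R qone))" using even_shift b0(1) by blast
 obtain c0 where c0: "c0:Oo" "!!i j k :: int. c0-(of_int i*R qone + of_int j*R a0 + of_int k*R b0) ~: pO 2"
  using not_in_pO_combination[OF p1 O_one a0(1) b0(1)] by auto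
 obtain ic where c: "even (nv Oo (c0 + of_int ic*R qone))" using even_shift c0(1) by blast
 define a1 b1 c1 where "a1 = a0 + of_int ia*R qone" and "b1 = b0 + of_int ib*R qone" and "c1 = c0 + of_int ic*R qone"
 have O1: "a1:Oo" "b1:Oo" "c1:Oo" unfolding a1_def b1_def c1_def by (intro O_add a0 b0 c0 O_int O_one)+
 have sums: "a1+b1:Oo" "a1+c1:Oo" "b1+c1:Oo" "a1+b1+c1:Oo" using O_add O1 by auto
 have nots: "a1 ~: pO 2" "b1 ~: pO 2" "c1 ~: pO 2" "a1+b1 ~: pO 2" "a1+c1 ~: pO 2" "b1+c1 ~: pO 2" "a1+b1+c1 ~: pO 2"
  using a0(2)[of "- ia"] b0(2)[of "- ib" 0] c0(2)[of "- ic" 0 0] b0(2)[of "- ia-ib" "-1"]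
   c0(2)[of "- ia-ic" "-1" 0] c0(2)[of "- ib-ic" 0 "-1"] c0(2)[of "- ia-ib-ic" "-1" "-1"]
  by (simp_all add: a1_def b1_def c1_def algebra_simps scaleR_diff_left scaleR_add_left)
 have evs: "even (nv Oo a1)" "even (nv Oo b1)" "even (nv Oo c1)" using a b c by (simp_all add: a1_def b1_def c1_def)
 have "even (nv Oo (a1+b1))" "even (nv Oo (a1+c1))" "even (nv Oo (b1+c1))"
  using ev[OF O1(1,2)] ev[OF O1(1,3)] ev[OF O1(2,3)] evs by simp_all
 moreover have "even (nv Oo (a1+b1+c1))" using ev[OF sums(1) O1(3)] calculation evs by simp
 ultimately have fours: "nv Oo (a1+b1) mod 4 = 2" "nv Oo (a1+c1) mod 4 = 2" "nv Oo (b1+c1) mod 4 = 2"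
  "nv Oo (a1+b1+c1) mod 4 = 2" "nv Oo a1 mod 4 = 2" "nv Oo b1 mod 4 = 2" "nv Oo c1 mod 4 = 2"
  using four O1 sums nots evs by blast+
 have "real_of_int (nv Oo (a1+b1+c1)+nv Oo a1+nv Oo b1+nv Oo c1) =
   real_of_int (nv Oo (a1+b1)+nv Oo (a1+c1)+nv Oo (b1+c1))"
  using qn_three[of a1 b1 c1] by (simp add: qn_nv_O[symmetric] sums O1)
 then have "nv Oo (a1+b1+c1)+nv Oo a1+nv Oo b1+nv Oo c1 = nv Oo (a1+b1)+nv Oo (a1+c1)+nv Oo (b1+c1)"
  by (simp only: of_int_eq_iff)
 then show False using fours by presburger
qed

lemma NI_between_pO:
 assumes p: "prime p" and J: "rideal J" "pO p <= J" "J <= Oo" "J ~= pO p" "J ~= Oo"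
 shows "NI J = real p"
proof -
 have p0: "p > 0" using p prime_gt_0_nat by auto
 obtain k where k: "k > 0" "NI J = real k" using NI_integral[OF J(1,3)] by blast
 obtain l where l: "l > 0" "NI (pO p) = NI J*real l" using NI_sub[OF J(1) rideal_pO[OF p0] J(2)] by blast
 have "real (p^2) = real (k*l)" using l k NI_pO[OF p0] by simp
 then have kl: "k*l = p^2" by (simp only: of_nat_eq_iff)
 then have "k dvd p^2" by (metis dvd_triv_left)
 then obtain i where i: "i <= 2" "k = p^i" using p by (auto simp: divides_primepow_nat)
 have "k ~= 1" using rideal_eqI[OF rideal_O J(1,3)] J(5) k by auto
 moreover have "k ~= p^2" using rideal_eqI[OF J(1) rideal_pO[OF p0] J(2)] J(4) k NI_pO[OF p0] by auto
 ultimately have "i = 1" using i by (cases "i = 0"; cases "i = 2") auto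
 then show ?thesis using i k by simp
qed

text \<open>Take t in the radical with n(t)/p prime to p. If p divides n(x), then p^2 divides n(x
  t), so x t lies in p O by \<open>rad_norm_square\<close>; multiplying by the conjugate of t and
  dividing by p shows that x, up to a unit at p, lies in the radical. Consequently p^2 dividing n(x)
  forces x into p O.\<close>

lemma ram_structure:
 assumes r: "ram p"
 shows NI_rad: "NI (rad p) = real p"
  and rad_iff: "x:rad p \<longleftrightarrow> x:Oo & pdiv p (qn x)"
  and ram_norm_square: "x:Oo ==> pdiv (p^2) (qn x) ==> x:pO p"
proof -
 have p: "prime p" "p > 0" and ne: "rad p ~= pO p" using r prime_gt_0_nat by (auto simp: ram_def)
 have T: "rideal (rad p)" using rideal_rad p by simp
 show N: "NI (rad p) = real p"
  by (rule NI_between_pO[OF p(1) T pO_sub_rad _ ne rad_not_O[OF p(1)]]) (auto simp: rad_def)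
 have fwd: "pdiv p (qn x)" if "x:rad p" for x
  using qn_nv[OF T that] unfolding pdiv_def N by (rule exI)
 have bwd: "x:rad p" if x: "x:Oo" "pdiv p (qn x)" for x
 proof -
  obtain t where t: "t:rad p" "~ int p dvd nv (rad p) t" using nv_primitive[OF T p(1)] by blast
  have xt: "x*.t:rad p" using rad_mul(2)[OF t(1) x(1)] .
  have "pdiv (p^2) (qn (x*.t))"
  proof -
   obtain k where "qn x = real p * of_int k" using x(2) unfolding pdiv_def by blast
   then have "qn (x*.t) = real (p^2) * of_int (k*nv (rad p) t)"
    using qn_nv[OF T t(1)] N by (simp add: qn_qmul power2_eq_square)
   then show ?thesis unfolding pdiv_def by blast
  qed
  then obtain z where z: "z:Oo" "x*.t = real p*R z" using rad_norm_square[OF p(2) xt] unfolding pO_def by blast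
  have "(x*.t)*.qcnj t = real p*R (of_int (nv (rad p) t)*R x)"
   using qn_nv[OF T t(1)] N by (simp add: qmul_assoc qmul_qcnj)
  moreover have "(x*.t)*.qcnj t = real p*R (z*.qcnj t)" unfolding z by simp
  ultimately have "real p*R (of_int (nv (rad p) t)*R x) = real p*R (z*.qcnj t)" by (rule trans[OF sym])
  then have "of_int (nv (rad p) t)*R x = z*.qcnj t" by (rule scaleR_left_imp_eq[rotated]) (use p(2) in simp)
  then have "of_int (nv (rad p) t)*R x:rad p" using rad_mul(2)[OF rad_cnj[OF t(1)] z(1)] by simp
  moreover have "real p*R x:rad p" using pO_sub_rad x(1) unfolding pO_def by blast
  ultimately show ?thesis
   using unit_multiple_sub[OF rideal_zero[OF T] rideal_diff[OF T] p(1) t(2)] by blast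
 qed
 show "x:rad p \<longleftrightarrow> x:Oo & pdiv p (qn x)" using fwd bwd unfolding rad_def by blast
 show "x:pO p" if "x:Oo" "pdiv (p^2) (qn x)"
  using rad_norm_square[OF p(2) bwd that(2)] that pdiv_dvd[of p "p^2"] by simp
qed

lemma ram_norm_power:
 assumes r: "ram p"
 shows "x:Oo ==> pdiv (p^(2*j)) (qn x) ==> EX y:Oo. x = (real p)^j*R y"
proof (induction j arbitrary: x)
 case 0 then show ?case by auto
next
 case (Suc j)
 have p: "p > 0" using r prime_gt_0_nat by (auto simp: ram_def)
 have "pdiv (p^2) (qn x)" by (rule pdiv_dvd[OF _ Suc.prems(2)]) (rule le_imp_power_dvd, simp)
 then obtain y where y: "y:Oo" "x = real p*R y" using ram_norm_square[OF r Suc.prems(1)] unfolding pO_def by blast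
 obtain k where "qn x = real (p^(2*Suc j)) * of_int k" using Suc.prems(2) unfolding pdiv_def by blast
 then have "qn y = real (p^(2*j)) * of_int k" using p y(2) by (simp add: power2_eq_square)
 then have "pdiv (p^(2*j)) (qn y)" unfolding pdiv_def by blast
 then obtain z where "z:Oo" "y = (real p)^j*R z" using Suc.IH y(1) by blast
 then show ?case using y by auto
qed

text \<open>Newton's iteration for n(x) = 0. An x outside the radical has some y with tr(x y) prime
  to p, and adding a suitable multiple of p^(k+1) conj(y) raises the divisibility of the norm by
  one.\<close>

lemma split_hensel:
 assumes p: "prime p" "rad p = pO p"
 obtains x where "!!k. x k:Oo" "!!k. EX y:Oo. x (Suc k)-x k = (real p)^(Suc k)*R y" "x 0 ~: pO p"
  "!!k. pdiv (p^(Suc k)) (qn (x k))"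
proof -
 have p0: "p > 0" using p prime_gt_0_nat by auto
 obtain x0 where x0: "x0:Oo" "x0 ~: pO p" "pdiv p (qn x0)" using exists_norm_divisible[OF p(1)] by blast
 have step: "EX x'. (x':Oo & x' ~: pO p & pdiv (p^(Suc (Suc k))) (qn x')) & (EX y:Oo. x'-x = (real p)^(Suc k)*R y)"
  if x: "x:Oo & x ~: pO p & pdiv (p^(Suc k)) (qn x)" for x k
 proof -
  obtain y where y: "y:Oo" "~ pdiv p (qtr (x*.y))" using x p(2) unfolding rad_def by blast
  obtain b where b: "qtr (x*.y) = of_int b" using O_integral(2)[OF O_mul] x y by (meson Ints_cases)
  have nb: "~ int p dvd b" using y b p0 by (simp add: pdiv_of_int)
  obtain m where m: "qn x = real (p^Suc k) * of_int m" using x unfolding pdiv_def by blast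
  obtain k' l where kl: "k'*b = 1+int p*l" using prime_inverse[OF p(1) nb] by blast
  obtain n where n: "qn y = of_int n" using O_integral(1)[OF y(1)] by (meson Ints_cases)
  \<comment> \<open>Chosen so that m + c b vanishes modulo p, k' being an inverse of b.\<close>
  define c where "c = - (m * k')"
  define x' where "x' = x+((real p)^Suc k * of_int c)*R qcnj y"
  have xO: "x':Oo" unfolding x'_def using x y O_cnj by (intro O_add O_Ints Ints_mult) auto
  have "m+c*b = int p*(- m*l)" unfolding c_def
   using arg_cong[OF kl, of "%t. m*t"] by (simp add: algebra_simps)
  then have mb: "of_int m + of_int c * of_int b = real p * of_int (- m*l)" by (metis of_int_add of_int_mult of_int_of_nat_eq)
  have "qn x' = real (p^Suc k) * of_int m+((real p)^Suc k * of_int c) * of_int b+((real p)^Suc k * of_int c)^2 * of_int n"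
   unfolding x'_def using m b n by (simp add: qn_add)
  also have "... = (real p)^Suc k*(of_int m + of_int c * of_int b)+(real p)^(Suc k)*((real p)^Suc k*(of_int c)^2 * of_int n)"
   by (simp add: power2_eq_square algebra_simps)
  also have "... = real (p^Suc (Suc k)) * of_int (- m*l+int (p^k)*c^2*n)"
   unfolding mb by (simp add: algebra_simps)
  finally have "pdiv (p^(Suc (Suc k))) (qn x')" unfolding pdiv_def by blast
  moreover have "x' ~: pO p"
  proof
   assume "x':pO p"
   moreover have "x = x'-real p*R (((real p)^k * of_int c)*R qcnj y)" unfolding x'_def by simp
   moreover have "real p*R (((real p)^k * of_int c)*R qcnj y):pO p"
    unfolding pO_def using y O_cnj by (intro imageI O_Ints Ints_mult) auto
   ultimately have "x:pO p" using rideal_diff[OF rideal_pO[OF p0]] by metis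
   then show False using x by blast
  qed
  moreover have "EX y:Oo. x'-x = (real p)^(Suc k)*R y"
   unfolding x'_def using y O_cnj O_int by (intro bexI[of _ "of_int c*R qcnj y"]) auto
  ultimately show ?thesis using xO by blast
 qed
 have "EX x. ALL k. (x k:Oo & x k ~: pO p & pdiv (p^(Suc k)) (qn (x k))) & (EX y:Oo. x (Suc k)-x k = (real p)^(Suc k)*R y)"
 proof (rule dependent_nat_choice)
  show "EX x. x:Oo & x ~: pO p & pdiv (p^(Suc 0)) (qn x)" using x0 by auto
 qed (rule step)
 then obtain x where x: "!!k. (x k:Oo & x k ~: pO p & pdiv (p^(Suc k)) (qn (x k)))"
  "!!k. EX y:Oo. x (Suc k)-x k = (real p)^(Suc k)*R y" by blast
 show thesis by (rule that[of x]) (use x in blast)+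
qed

end

section \<open>Ramified primes and the discriminant\<close>

lemma prod_primes_dvd:
 assumes "finite S" "!!p. p:S ==> prime (p::nat)" "!!p. p:S ==> int p dvd n"
 shows "int (\<Prod>S) dvd n"
 using assms
proof (induction S rule: finite_induct)
 case (insert p S)
 have "coprime (int p) (int (\<Prod>S))"
 proof (rule prime_imp_coprime)
  show "~ int p dvd int (\<Prod>S)"
  proof
   assume "int p dvd int (\<Prod>S)"
   then have "p dvd \<Prod>S" by (simp only: int_dvd_int_iff)
   then obtain q where "q:S" "p dvd q" using insert by (auto simp: prime_dvd_prod_iff)
   then show False using insert primes_dvd_imp_eq by (metis insertI1 insertI2)
  qed
 qed (use insert in simp)
 then have "int p*int (\<Prod>S) dvd n" using insert by (intro divides_mult) auto
 then show ?case using insert by simp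
qed simp

context max_order
begin

text \<open>Among the lattices with a basis inside \<open>Oo\<close>, one of least index is taken.
  If a vector were missed, one of its coordinates would have a fractional part t in (0, 1), and
  exchanging the corresponding basis vector for the reduced vector would multiply the index by
  t.\<close>

lemma exists_basis: "EX f. linear f & inj f & Oo = f ` intvec"
proof -
 define T where "T = {f. linear f & inj f & f ` intvec <= Oo}"
 have Tne: "T ~= {}"
 proof (rule O_frame)
  show "linear f ==> inj f ==> f ` intvec <= Oo ==> T ~= {}" for f unfolding T_def by blast
 qed
 define n where "n f = lidx Oo (f ` intvec)" for f
 obtain f where f: "f:T" "!!g. g:T ==> n f <= n g"
  using Tne ex_has_least_nat[of "%f. f:T" _ n] by (metis all_not_in_conv)
 have lin: "linear f" "inj f" "f ` intvec <= Oo" using f(1) by (auto simp: T_def)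
 have "Oo <= f ` intvec"
 proof (rule ccontr)
  assume "~ Oo <= f ` intvec"
  then obtain v where v: "v:Oo" "v ~: f ` intvec" by blast
  have "surj f" using linear_injective_imp_surjective[OF lin(1,2)] by simp
  then obtain c where c: "v = f c" by (metis surjD)
  define d :: "real^4" where "d = (\<chi> i. of_int \<lfloor>c$i\<rfloor>)"
  have dI: "d:intvec" by (auto simp: d_def intvec_def)
  obtain j where j: "c$j ~: \<int>" using v c by (auto simp: intvec_def)
  define t where "t = c$j-d$j"
  have t: "0 < t" "t < 1"
  proof -
   have "t = frac (c$j)" by (simp add: t_def d_def frac_def)
   then show "0 < t" "t < 1" using j by (auto simp: frac_gt_0_iff frac_lt_1)
  qed
  \<comment> \<open>Sends the j-th unit vector to the reduced vector c - d and fixes the other unit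
    vectors, so its determinant is t.\<close>
  define h :: "real^4 => real^4" where "h x = x+x$j*R (c-d-axis j 1)" for x
  have linh: "linear h" by (rule linearI) (auto simp: h_def algebra_simps scaleR_add_left)
  have hj: "(h x)$j = t*x$j" for x by (simp add: h_def t_def algebra_simps)
  have "inj h"
   unfolding linear_injective_0[OF linh]
  proof (intro allI impI)
   fix x assume "h x = 0"
   then have "x$j = 0" using hj[of x] t by simp
   then show "x = 0" using \<open>h x = 0\<close> by (simp add: h_def)
  qed
  have deth: "\<bar>det (matrix h)\<bar> = t"
  proof -
   have "matrix h = (\<chi> i k. if k = j then (c-d)$i else if i = k then 1 else 0)"
    by (auto simp: matrix_def h_def axis_def vec_eq_iff)
   also have "det ... = t"
   proof -
    have "det (\<chi> i k. if k = j then (c-d)$i else (mat 1 :: real^4^4)$i$k) = (c-d)$j*det (mat 1 :: real^4^4)"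
     using cramer_lemma[where A="mat 1 :: real^4^4" and k=j and x="c-d"] unfolding matrix_vector_mul_lid .
    moreover have "(\<chi> i k. if k = j then (c-d)$i else if i = k then 1 else 0) = (\<chi> i k. if k = j then (c-d)$i else (mat 1 :: real^4^4)$i$k)"
     by (simp add: mat_def cong: if_cong)
    ultimately show ?thesis by (simp add: t_def)
   qed
   finally show ?thesis using t by simp
  qed
  define g where "g = f \<circ> h"
  have ling: "linear g" "inj g" unfolding g_def using linear_compose[OF linh lin(1)] \<open>inj h\<close> lin(2) by (auto intro: inj_compose)
  have gsub: "g ` intvec <= Oo"
  proof
   fix y assume "y:g ` intvec"
   then obtain x where x: "x:intvec" "y = g x" by blast
   have "y = f x+x$j*R (v-f d-f (axis j 1))"
    unfolding x g_def h_def comp_def c by (simp add: linear_add[OF lin(1)] linear_diff[OF lin(1)] linear_cmul[OF lin(1)])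
   moreover have "axis j 1:intvec" by (auto simp: intvec_def axis_def)
   ultimately show "y:Oo" using x lin(3) v(1) dI by (auto simp: intvec_def intro!: O_add O_Ints O_diff)
  qed
  have gT: "g:T" unfolding T_def using ling gsub by blast
  have "det (matrix g) = det (matrix f)*det (matrix h)"
   unfolding g_def using matrix_compose[OF linh lin(1)] by (simp add: det_mul)
  then have "covol (g ` intvec) = t*covol (f ` intvec)"
   using lat_linear(2)[OF lat_intvec ling] lat_linear(2)[OF lat_intvec lin(1,2)] deth by (simp add: abs_mult)
  then have "real (n g)*covol Oo = t*(real (n f)*covol Oo)"
   using covol_lidx(1)[OF lat_O lat_linear(1)[OF lat_intvec ling] gsub] covol_lidx(1)[OF lat_O lat_linear(1)[OF lat_intvec lin(1,2)] lin(3)]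
   unfolding n_def by simp
  then have "real (n g) = t*real (n f)" using covol_pos[OF lat_O] by simp
  moreover have "n f > 0" unfolding n_def by (rule covol_lidx(2)[OF lat_O lat_linear(1)[OF lat_intvec lin(1,2)] lin(3)])
  then have "t*real (n f) < 1*real (n f)" using t by (intro mult_strict_right_mono) auto
  ultimately have "n g < n f" by simp
  then show False using f(2)[OF gT] by simp
 qed
 then show ?thesis using lin by blast
qed

text \<open>tr(y x) is twice the inner product of y with the conjugate of x, so the trace dual is
  half the conjugate of the Euclidean dual; in dimension four this contributes 2^(-4).\<close>

lemma covol_qdual: "covol (qdual Oo)*covol Oo = 1/16"
proof -
 obtain f where f: "linear f" "inj f" "Oo = f ` intvec" using exists_basis by blast
 have adj: "linear (adjoint f)" using f(1) by (rule adjoint_linear)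
 have detadj: "det (matrix (adjoint f)) = det (matrix f)" using matrix_adjoint[OF f(1)] by (simp add: det_transpose)
 have "det (matrix f) ~= 0" using det_nz_iff_inj[OF f(1)] f(2) by simp
 then have injadj: "inj (adjoint f)" using det_nz_iff_inj[OF adj] detadj by simp
 have surjadj: "surj (adjoint f)" using linear_injective_imp_surjective[OF adj injadj] by simp
 have iff: "y:qdual Oo \<longleftrightarrow> adjoint f (2*R qcnj y):intvec" for y
 proof -
  have tr: "qtr (y*.f c) = adjoint f (2*R qcnj y) \<bullet> c" for c
  proof -
   have "qtr (y*.f c) = 2*(y \<bullet> qcnj (f c))" using qtr_inner[of y "qcnj (f c)"] by simp
   also have "y \<bullet> qcnj (f c) = qcnj y \<bullet> f c" by (simp add: inner_vec_def sum_four qcnj_nth)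
   also have "2*(qcnj y \<bullet> f c) = (2*R qcnj y) \<bullet> f c" by simp
   also have "... = adjoint f (2*R qcnj y) \<bullet> c" using adjoint_works[OF f(1), of c "2*R qcnj y"] by (simp add: inner_commute)
   finally show ?thesis .
  qed
  show ?thesis
  proof
   assume y: "y:qdual Oo"
   have "adjoint f (2*R qcnj y)$i:\<int>" for i
   proof -
    have "axis i 1:intvec" by (auto simp: intvec_def axis_def)
    then have "qtr (y*.f (axis i 1)):\<int>" using y f(3) unfolding qdual_def by blast
    then show ?thesis unfolding tr by (simp add: inner_axis)
   qed
   then show "adjoint f (2*R qcnj y):intvec" by (simp add: intvec_def)
  next
   assume *: "adjoint f (2*R qcnj y):intvec"
   have "qtr (y*.f c):\<int>" if "c:intvec" for c
    unfolding tr inner_vec_def using * that by (auto simp: intvec_def intro!: Ints_sum Ints_mult)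
   then show "y:qdual Oo" unfolding qdual_def f(3) by blast
  qed
 qed
 have cnjd: "qcnj y:qdual Oo" if "y:qdual Oo" for y
 proof -
  have "qtr (qcnj y*.x) = qtr (y*.qcnj x)" for x by (metis qtr_simps(3) qcnj_qmul qcnj_qcnj qtr_commute)
  then show ?thesis using that O_cnj unfolding qdual_def by auto
 qed
 have "adjoint f ` ((*R) 2 ` qdual Oo) = intvec"
 proof (intro antisym subsetI)
  fix c assume "c:adjoint f ` ((*R) 2 ` qdual Oo)"
  then obtain y where "y:qdual Oo" "c = adjoint f (2*R y)" by auto
  then show "c:intvec" using iff[of "qcnj y"] cnjd by simp
 next
  fix c assume c: "c:intvec"
  obtain x where x: "c = adjoint f x" using surjadj by (metis surjD)
  define y where "y = qcnj ((1/2)*R x)"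
  have "2*R qcnj y = x" by (simp add: y_def)
  then have "qcnj y:qdual Oo" using iff[of y] c x cnjd by simp
  then show "c:adjoint f ` ((*R) 2 ` qdual Oo)" using x \<open>2 *R qcnj y = x\<close> by blast
 qed
 moreover have "is_lat ((*R) 2 ` qdual Oo)" "covol ((*R) 2 ` qdual Oo) = 16*covol (qdual Oo)"
  using lat_scale[OF lat_qdual_O, of 2] by auto
 ultimately have "1 = \<bar>det (matrix f)\<bar>*(16*covol (qdual Oo))"
  using lat_linear(2)[OF _ adj injadj, of "(*R) 2 ` qdual Oo"] covol_intvec detadj by simp
 moreover have "covol Oo = \<bar>det (matrix f)\<bar>"
  using lat_linear(2)[OF lat_intvec f(1,2)] covol_intvec f(3) by simp
 ultimately show ?thesis by (simp add: field_simps)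
qed

text \<open>\<open>rad p\<close> divided by p lies in the inverse different and has covolume
  covol(O)/p^2, which bounds p.\<close>

lemma finite_ram: "finite {p. ram p}"
proof -
 have "p <= nat \<lceil>covol Oo/covol (qdual Oo)\<rceil>" if r: "ram p" for p
 proof -
  have p: "p > 0" using r prime_gt_0_nat by (auto simp: ram_def)
  have T: "rideal (rad p)" using rideal_rad p by simp
  let ?L = "(*R) (1/real p) ` rad p"
  have L: "is_lat ?L" "covol ?L = (1/real p)^4*((real p)^2*covol Oo)"
   using lat_scale[OF lat_rideal[OF T], of "1/real p"] p covol_rideal[OF T] NI_rad[OF r] by auto
  have sub: "?L <= qdual Oo" using p unfolding rad_def qdual_def pdiv_def by fastforce
  have "covol ?L = real (lidx (qdual Oo) ?L)*covol (qdual Oo)" "lidx (qdual Oo) ?L > 0"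
   using covol_lidx[OF lat_qdual_O L(1) sub] by auto
  then have "covol (qdual Oo) <= covol ?L" using covol_pos[OF lat_qdual_O] by simp
  also have "covol ?L = covol Oo/(real p)^2" unfolding L(2) using p by (simp add: field_simps eval_nat_numeral)
  finally have "(real p)^2 <= covol Oo/covol (qdual Oo)" using p covol_pos[OF lat_qdual_O] by (simp add: field_simps)
  moreover have "real p <= (real p)^2" using p by (simp add: power2_eq_square)
  ultimately show ?thesis by linarith
 qed
 then have "{p. ram p} <= {..nat \<lceil>covol Oo/covol (qdual Oo)\<rceil>}" by auto
 then show ?thesis using finite_subset by blast
qed

definition DD :: nat where "DD = \<Prod>{p. ram p}"

text \<open>The different of the order, as the intersection of the radicals at the ramified primes;
  \<open>qdual_PP\<close> expresses the inverse different by it.\<close>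

definition PP :: "quat set" where "PP = {x:Oo. ALL p. ram p --> x:rad p}"

lemma DD_pos: "DD > 0"
 unfolding DD_def using prime_gt_0_nat by (auto simp: ram_def intro!: prod_pos)

lemma ram_prime: "ram p ==> prime p" by (simp add: ram_def)

lemma ram_dvd_DD: "prime p ==> p dvd DD \<longleftrightarrow> ram p"
proof
 assume p: "prime p" "p dvd DD"
 then obtain q where "ram q" "p dvd q" using finite_ram unfolding DD_def by (auto simp: prime_dvd_prod_iff)
 then show "ram p" using p primes_dvd_imp_eq ram_prime by metis
next
 assume "ram p" then show "p dvd DD" unfolding DD_def using finite_ram by (intro dvd_prodI) auto
qed

lemma pdiv_DD: "(!!p. ram p ==> pdiv p r) ==> r:\<int> ==> pdiv DD r"
proof -
 assume *: "!!p. ram p ==> pdiv p r" and "r:\<int>"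
 then obtain n where n: "r = of_int n" by (auto elim: Ints_cases)
 have "int p dvd n" if "p:{p. ram p}" for p using *[of p] that pdiv_of_int[of p n] n prime_gt_0_nat[OF ram_prime] by auto
 then have "int (\<Prod>{p. ram p}) dvd n" using finite_ram ram_prime by (intro prod_primes_dvd) auto
 then show "pdiv DD r" using n pdiv_of_int[OF DD_pos, of n] by (simp add: DD_def)
qed

lemma DD_not_square: "prime p ==> ram p ==> ~ p dvd DD div p"
proof
 assume p: "prime p" "ram p" "p dvd DD div p"
 have "DD = p*\<Prod>({q. ram q} - {p})" unfolding DD_def using prod.remove[OF finite_ram, of p "%x. x"] p by simp
 then have "DD div p = \<Prod>({q. ram q} - {p})" using p prime_gt_0_nat by simp
 then have "p dvd \<Prod>({q. ram q} - {p})" using p by simp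
 then obtain q where "ram q" "q ~= p" "p dvd q" using finite_ram p by (auto simp: prime_dvd_prod_iff)
 then show False using p primes_dvd_imp_eq ram_prime by metis
qed

lemma ram_DD_factor: "ram p ==> EX k. DD = p * k"
 using ram_dvd_DD[OF ram_prime] unfolding dvd_def by blast

lemma PP_DD: "x:Oo ==> real DD*R x:PP"
proof -
 assume x: "x:Oo"
 have "real DD*R x:rad p" if r: "ram p" for p
 proof -
  obtain k where k: "DD = p * k" using ram_DD_factor[OF r] by blast
  have "real DD*R x = real p*R (real k*R x)" by (simp add: k)
  moreover have "real k*R x:Oo" using x by (intro O_Ints) auto
  ultimately have "real DD*R x:pO p" unfolding pO_def by (rule image_eqI)
  then show ?thesis using pO_sub_rad by blast
 qed
 then show ?thesis unfolding PP_def using O_Ints x by simp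
qed

lemma rideal_PP: "rideal PP" and NI_PP: "NI PP = real DD"
proof -
 have r: "rideal (rad p)" if "ram p" for p using rideal_rad prime_gt_0_nat[OF ram_prime[OF that]] .
 show P: "rideal PP"
  unfolding rideal_def
 proof (intro conjI ballI)
  show "0:PP" unfolding PP_def using O_zero rideal_zero[OF r] by blast
  show "x-y:PP" if "x:PP" "y:PP" for x y using that O_diff rideal_diff[OF r] unfolding PP_def by blast
  show "x*.a:PP" if "x:PP" "a:Oo" for x a using that O_mul rideal_mul[OF r] unfolding PP_def by blast
  show "EX x:PP. x ~= 0" using PP_DD[OF O_one] DD_pos by (intro bexI[of _ "real DD*R qone"]) auto
  show "EX m::nat. m > 0 & (ALL x:PP. real m*R x:Oo)" by (intro exI[of _ 1]) (auto simp: PP_def)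
 qed
 show "NI PP = real DD"
 proof (rule NI_eqI[OF P])
  show "is_NI PP (real DD)"
   unfolding is_NI_def
  proof (intro conjI ballI allI impI)
   show "real DD > 0" using DD_pos by simp
   fix x assume x: "x:PP"
   then have "pdiv DD (qn x)" using rad_iff O_integral(1) by (intro pdiv_DD) (auto simp: PP_def)
   then show "EX k::int. qn x = real DD * of_int k" by (simp add: pdiv_def)
  next
   fix p :: nat assume p: "prime p"
   show "EX x:PP. EX k::int. qn x = real DD * of_int k & ~ int p dvd k"
   proof (cases "ram p")
    case True
    obtain w where w: "w:rad p" "~ int p dvd nv (rad p) w" using nv_primitive[OF r[OF True] p] by blast
    define k where "k = DD div p"
    have k: "DD = p * k" unfolding k_def using True ram_dvd_DD p by simp
    have "real k*R w:PP"
    proof -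
     have "real k*R w:rad q" if q: "ram q" for q
     proof (cases "q = p")
      case True then show ?thesis using rideal_nat[OF r] w q by simp
     next
      case False
      have "q dvd p * k" using q ram_dvd_DD ram_prime k by simp
      then have "q dvd k" using q p False ram_prime by (metis prime_dvd_mult_iff primes_dvd_imp_eq)
      then obtain l where "k = q*l" by auto
      then have "real k*R w = real q*R (real l*R w)" by simp
      moreover have "real l*R w:Oo" using w(1) by (intro O_Ints) (auto simp: rad_def)
      ultimately have "real k*R w:pO q" unfolding pO_def by (rule image_eqI)
      then show ?thesis using pO_sub_rad by blast
     qed
     then show ?thesis unfolding PP_def using w(1) O_Ints by (auto simp: rad_def)
    qed
    moreover have "qn (real k*R w) = real DD * of_int (int k*nv (rad p) w)"
     using qn_nv[OF r[OF True] w(1)] NI_rad[OF True] by (simp add: k power2_eq_square)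
    moreover have "~ int p dvd int k*nv (rad p) w"
     using w(2) DD_not_square[OF p True] p unfolding k_def[symmetric] by (simp add: prime_dvd_mult_iff)
    ultimately show ?thesis by blast
   next
    case False
    have "qn (real DD*R qone) = real DD * of_int (int DD)" by (simp add: power2_eq_square)
    moreover have "~ int p dvd int DD" using False ram_dvd_DD[OF p] by simp
    ultimately show ?thesis using PP_DD[OF O_one] by blast
   qed
  qed
 qed
qed

text \<open>Let m be the denominator of an element y of the inverse different. At a prime p dividing
  m, the element m y lies in \<open>rad p\<close> but not in p O, so p is ramified;
  \<open>nsq\<close> excludes p^2, hence m divides \<open>DD\<close>.\<close>

lemma qdual_PP: "qdual Oo = (*R) (1/real DD) ` PP"
proof (intro antisym subsetI)
 fix y assume "y:(*R) (1/real DD) ` PP"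
 then obtain x where x: "x:PP" "y = (1/real DD)*R x" by auto
 have "qtr (y*.a):\<int>" if a: "a:Oo" for a
 proof -
  have "pdiv p (qtr (x*.a))" if "ram p" for p using x(1) a that unfolding PP_def rad_def by blast
  then have "pdiv DD (qtr (x*.a))" using O_integral(2) O_mul x(1) a unfolding PP_def by (intro pdiv_DD) auto
  then show ?thesis using x(2) DD_pos unfolding pdiv_def by auto
 qed
 then show "y:qdual Oo" unfolding qdual_def by blast
next
 fix y assume y: "y:qdual Oo"
 have ymul: "real k*R y:qdual Oo" for k :: nat using y unfolding qdual_def by auto
 define m where "m = (LEAST m::nat. m > 0 & real m*R y:Oo)"
 have m: "m > 0" "real m*R y:Oo" using LeastI_ex[OF qdual_denominator[OF y]] unfolding m_def by auto
 have min: "real k*R y ~: Oo" if "k > 0" "k < m" for k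
  using not_less_Least[of k "%m. m > 0 & real m*R y:Oo"] that unfolding m_def by blast
 have radm: "ram p & real m*R y:rad p & real m*R y ~: pO p" if p: "prime p" "p dvd m" for p
 proof -
  obtain k where k: "m = p * k" using p(2) by auto
  have p0: "p > 1" using p prime_gt_1_nat by auto
  have "k > 0" "k < m" using k m(1) p0 by (auto intro: Nat.gr0I)
  then have "real k*R y ~: Oo" using min by blast
  then have "real m*R y ~: pO p" using p0 k by (simp add: pO_iff)
  moreover have "real m*R y:rad p"
   unfolding rad_def
  proof (intro CollectI conjI ballI m(2))
   fix a assume "a:Oo"
   then have "qtr ((real k*R y)*.a):\<int>" using ymul unfolding qdual_def by blast
   then show "pdiv p (qtr ((real m*R y)*.a))" using pdiv_self[of "qtr ((real k*R y)*.a)" p] k by (simp add: mult.assoc)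
  qed
  ultimately show ?thesis using p by (auto simp: ram_def)
 qed
 have nsq: "~ p^2 dvd m" if p: "prime p" for p
 proof
  assume pm: "p^2 dvd m"
  then have "p dvd m" by (metis dvd_trans dvd_triv_left power2_eq_square)
  then have r: "ram p" and w: "real m*R y:rad p" "real m*R y ~: pO p" using radm[OF p] by auto
  have p0: "p > 0" using p prime_gt_0_nat by auto
  have T: "rideal (rad p)" using rideal_rad p0 by simp
  define u where "u = nv (rad p) (real m*R y)"
  have qw: "qn (real m*R y) = real p * of_int u" using qn_nv[OF T w(1)] NI_rad[OF r] by (simp only: u_def)
  have u: "~ int p dvd u"
  proof
   assume "int p dvd u"
   then obtain v where "u = int p * v" by auto
   then have "qn (real m*R y) = real (p^2) * of_int v" using qw by (simp add: power2_eq_square)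
   then have "pdiv (p^2) (qn (real m*R y))" unfolding pdiv_def by blast
   then show False using ram_norm_square[OF r m(2)] w(2) by blast
  qed
  obtain k where k: "m = p^2 * k" using pm by auto
  \<comment> \<open>If p^2 divided m, then p a would be of the form m y b up to a unit at p, and
    integrality of the trace of m y b / p^2 would make every trace divisible by p, against
    \<open>rad_not_O\<close>.\<close>
  have "pdiv p (qtr (qone*.a))" if a: "a:Oo" for a
  proof -
   have "real p*R a:rad p" using pO_sub_rad a unfolding pO_def by blast
   then obtain b where b: "b:Oo" "of_int u*R (real p*R a) = (real m*R y)*.b"
    using nv_multiple[OF T w(1)] unfolding u_def by blast
   obtain t where t: "qtr ((real k*R y)*.b) = of_int t" using ymul[of k] b(1) unfolding qdual_def by (auto elim!: Ints_cases)
   obtain s where s: "qtr a = of_int s" using O_integral(2)[OF a] by (auto elim: Ints_cases)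
   have "qtr (of_int u*R (real p*R a)) = (real p)^2*qtr ((real k*R y)*.b)" unfolding b(2) k by (simp add: mult_ac)
   then have "real p*(of_int u * of_int s) = real p*(real p * of_int t)" unfolding t by (simp add: s power2_eq_square mult_ac)
   then have "real_of_int (u * s) = real_of_int (int p*t)" using p0 by simp
   then have "u * s = int p*t" by (simp only: of_int_eq_iff)
   then have "int p dvd u * s" by simp
   then have "int p dvd s" using u p by (simp add: prime_dvd_mult_iff)
   then show ?thesis using s p0 by (simp add: pdiv_of_int)
  qed
  then have "qone:rad p" unfolding rad_def using O_one by blast
  then have "rad p = Oo" using rideal_mul[OF T, of qone] unfolding rad_def by auto
  then show False using rad_not_O[OF p] by blast
 qed
 have "m dvd DD"
 proof (rule multiplicity_le_imp_dvd)
  show "m ~= 0" using m by simp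
  fix p :: nat assume p: "prime p"
  show "multiplicity p m <= multiplicity p DD"
  proof (cases "p dvd m")
   case True
   have "multiplicity p m < 2" using nsq[OF p] m p by (intro multiplicity_lessI) auto
   moreover have "multiplicity p DD >= 1" using radm[OF p True] ram_dvd_DD[OF p] DD_pos p
    by (intro multiplicity_geI) auto
   ultimately show ?thesis by simp
  next
   case False
   then show ?thesis by (simp add: not_dvd_imp_multiplicity_0)
  qed
 qed
 then obtain k where k: "DD = k*m" by (metis dvdE mult.commute)
 have Dy: "real DD*R y:Oo"
 proof -
  have "real DD*R y = real k*R (real m*R y)" by (simp add: k)
  then show ?thesis using O_Ints[OF Ints_of_nat m(2), of k] by (simp only:)
 qed
 have "real DD*R y:rad p" if r: "ram p" for p
 proof -
  obtain l where l: "DD = p*l" using ram_DD_factor[OF r] by blast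
  show ?thesis
   unfolding rad_def
  proof (intro CollectI conjI ballI Dy)
   fix a assume "a:Oo"
   then have "qtr ((real l*R y)*.a):\<int>" using ymul unfolding qdual_def by blast
   then show "pdiv p (qtr ((real DD*R y)*.a))" using pdiv_self[of "qtr ((real l*R y)*.a)" p] l by (simp add: mult.assoc)
  qed
 qed
 then have "real DD*R y:PP" using Dy unfolding PP_def by blast
 then show "y:(*R) (1/real DD) ` PP" using DD_pos by (intro image_eqI[of _ _ "real DD*R y"]) auto
qed

text \<open>The ideal norm gives covol(O)/D^2 for the inverse different, while duality fixes the
  product of the two covolumes as 1/16.\<close>

theorem covol_O: "covol Oo = real DD/4"
proof -
 have "covol (qdual Oo) = (1/real DD)^4*((real DD)^2*covol Oo)"
  unfolding qdual_PP using lat_scale(2)[OF lat_rideal[OF rideal_PP], of "1/real DD"] DD_pos covol_rideal[OF rideal_PP] NI_PP by simp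
 also have "... = covol Oo/(real DD)^2" using DD_pos by (simp add: field_simps eval_nat_numeral)
 finally have q: "covol (qdual Oo) = covol Oo/(real DD)^2" .
 have "covol Oo/(real DD)^2*covol Oo = 1/16" using covol_qdual unfolding q .
 then have "(covol Oo)^2 = (real DD/4)^2" using DD_pos by (simp add: field_simps power2_eq_square)
 then show ?thesis using covol_pos[OF lat_O] by (simp add: power2_eq_iff_nonneg)
qed

text \<open>Any order of A is commensurable with \<open>Oo\<close>, and p^s is the p-part of the two
  multipliers together. Far enough in the sequence the norm is divisible by so high a power of p
  that, by \<open>ram_norm_power\<close>, the term is divisible by p even inside the other order,
  against primitivity.\<close>

lemma ram_not_isotropic:
 assumes r: "ram p" and O': "is_order A O'"
 shows "~ padic_isotropic O' p"
proof
 assume "padic_isotropic O' p"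
 then obtain x where x: "!!k. x k:O'" "!!k. EX y:O'. x (Suc k)-x k = (real p^Suc k)*R y"
  "x 0 ~: (%y. real p*R y) ` O'" "!!k. EX m :: int. qn (x k) = real p^k * of_int m"
  unfolding padic_isotropic_def by blast
 have p: "prime p" "p > 0" using r ram_prime prime_gt_0_nat by auto
 have Oc: "0:O'" "!!x y. x:O' ==> y:O' ==> x-y:O'" using O' by (auto simp: is_order_def)
 define Y where "Y = (%y. real p*R y) ` O'"
 have Yc: "0:Y" "!!x y. x:Y ==> y:Y ==> x-y:Y"
 proof -
  show "0:Y" unfolding Y_def using Oc(1) by (intro image_eqI[of _ _ 0]) auto
  fix x y assume "x:Y" "y:Y"
  then obtain a b where "x = real p*R a" "y = real p*R b" "a:O'" "b:O'" unfolding Y_def by blast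
  then have "x-y = real p*R (a-b)" "a-b:O'" using Oc(2) by (auto simp: scaleR_diff_right)
  then show "x-y:Y" unfolding Y_def by (rule image_eqI)
 qed
 obtain m1 :: nat where m1: "m1 > 0" "ALL x:O'. real m1*R x:Oo" using order_multiple[OF O' order] by blast
 obtain m2 :: nat where m2: "m2 > 0" "ALL x:Oo. real m2*R x:O'" using order_multiple[OF order O'] by blast
 define s where "s = multiplicity p (m1*m2)"
 have nu: "m1*m2 ~= 0" "~ is_unit p" using m1(1) m2(1) p by auto
 obtain m' where m': "m1*m2 = p^s*m'" "~ p dvd m'"
  unfolding s_def using multiplicity_decompose'[OF nu] by metis
 \<comment> \<open>This extracts s + 1 powers of p, one more than the multipliers can
   absorb.\<close>
 define k where "k = 2*Suc s"
 have "pdiv (p^(2*Suc s)) (qn (real m1*R x k))"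
 proof -
  obtain m where "qn (x k) = real p^k * of_int m" using x(4) by blast
  then have "qn (real m1*R x k) = real (p^(2*Suc s)) * of_int (int (m1^2)*m)" by (simp add: k_def)
  then show ?thesis unfolding pdiv_def by blast
 qed
 then obtain y where y: "y:Oo" "real m1*R x k = (real p)^(Suc s)*R y"
  using ram_norm_power[OF r, of "real m1*R x k" "Suc s"] m1 x(1) by blast
 have "(real p)^s*R (of_int (int m')*R x k) = real m2*R (real m1*R x k)"
 proof -
  have "(real p)^s*real m' = real m2*real m1" using m'(1) by (metis mult.commute of_nat_mult of_nat_power)
  then show ?thesis by simp
 qed
 also have "... = (real p)^s*R (real p*R (real m2*R y))" unfolding y(2) by (simp add: mult_ac)
 finally have "of_int (int m')*R x k = real p*R (real m2*R y)"
  using p(2) by (metis scaleR_left_imp_eq power_not_zero of_nat_eq_0_iff less_irrefl)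
 moreover have "real m2*R y:O'" using m2(2) y(1) by blast
 ultimately have "of_int (int m')*R x k:Y" unfolding Y_def by (rule image_eqI)
 moreover have "real p*R x k:Y" unfolding Y_def using x(1) by blast
 ultimately have xk: "x k:Y" using unit_multiple_sub[of Y p "int m'" "x k", OF Yc p(1)] m'(2) by simp
 have "x k:Y ==> x 0:Y" for k
 proof (induction k)
  case (Suc k)
  obtain y where y: "y:O'" "x (Suc k)-x k = (real p^Suc k)*R y" using x(2) by blast
  have "real p^k*R y:O'" using int_scale_closed[OF Oc y(1), of "int (p^k)"] by simp
  then have "real p*R (real p^k*R y):Y" unfolding Y_def by (rule imageI)
  moreover have "x k = x (Suc k)-real p*R (real p^k*R y)" using y(2) by (simp add: algebra_simps)
  ultimately have "x k:Y" using Yc(2) Suc.prems by simp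
  then show ?case by (rule Suc.IH)
 qed simp
 then show False using x(3) xk unfolding Y_def by blast
qed

text \<open>The Hensel sequence is carried into the other order by m2 and divided by the largest
  power p^j that divides its term of index s; j cannot exceed s. Dropping the first t terms makes up
  for what the division costs in convergence and in divisibility of the norm.\<close>

lemma split_isotropic:
 assumes p: "prime p" "~ ram p" and O': "is_order A O'"
 shows "padic_isotropic O' p"
proof -
 have p0: "p > 0" "p > 1" using p prime_gt_0_nat prime_gt_1_nat by auto
 have "rad p = pO p" using p by (simp add: ram_def)
 then obtain x where x: "!!k. x k:Oo" "!!k. EX y:Oo. x (Suc k)-x k = (real p)^(Suc k)*R y" "x 0 ~: pO p"
  "!!k. pdiv (p^(Suc k)) (qn (x k))" using split_hensel p by metis
 have Oc: "0:O'" "!!x y. x:O' ==> y:O' ==> x-y:O'" using O' by (auto simp: is_order_def)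
 have Oadd: "a+b:O'" if "a:O'" "b:O'" for a b using O' that by (auto simp: is_order_def)
 have Onat: "real p^i*R a:O'" if "a:O'" for a i using int_scale_closed[OF Oc that, of "int (p^i)"] by simp
 obtain m1 :: nat where m1: "m1 > 0" "ALL x:O'. real m1*R x:Oo" using order_multiple[OF O' order] by blast
 obtain m2 :: nat where m2: "m2 > 0" "ALL x:Oo. real m2*R x:O'" using order_multiple[OF order O'] by blast
 define s where "s = multiplicity p (m1*m2)"
 have nu: "m1*m2 ~= 0" "~ is_unit p" using m1(1) m2(1) p0 by auto
 obtain m' where m': "m1*m2 = p^s*m'" "~ p dvd m'"
  unfolding s_def using multiplicity_decompose'[OF nu] by metis
 have diff: "EX y:Oo. x (k+i)-x k = (real p)^(Suc k)*R y" for k i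
 proof (induction i)
  case 0 then show ?case using O_zero by (intro bexI[of _ 0]) auto
 next
  case (Suc i)
  obtain y where y: "y:Oo" "x (k+i)-x k = (real p)^(Suc k)*R y" using Suc by blast
  obtain z where z: "z:Oo" "x (Suc (k+i))-x (k+i) = (real p)^(Suc (k+i))*R z" using x(2) by blast
  have "x (k+Suc i)-x k = (real p)^(Suc k)*R (y+(real p)^i*R z)"
  proof -
   have "x (k+Suc i)-x k = (x (Suc (k+i))-x (k+i))+(x (k+i)-x k)" by simp
   also have "... = (real p)^(Suc k)*R (y+(real p)^i*R z)" unfolding y(2) z(2) by (simp add: scaleR_add_right power_add mult_ac)
   finally show ?thesis .
  qed
  moreover have "y+(real p)^i*R z:Oo" using y z by (intro O_add O_Ints) auto
  ultimately show ?case by blast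
 qed
 have prim: "x k ~: pO p" for k
 proof
  assume k: "x k:pO p"
  obtain y where y: "y:Oo" "x k-x 0 = real p*R y" using diff[of 0 k] by auto
  have "x 0 = x k-real p*R y" using y(2) by (simp add: algebra_simps)
  then show False using x(3) rideal_diff[OF rideal_pO[OF p0(1)] k, of "real p*R y"] y(1) unfolding pO_def by auto
 qed
 define In where "In j k \<longleftrightarrow> (EX y:O'. real m2*R x k = (real p)^j*R y)" for j k
 have bound: "j <= s" if jk: "In j k" for j k
 proof (rule ccontr)
  assume "~ j <= s"
  then obtain i where i: "j = Suc (s+i)" by (metis less_imp_Suc_add not_le)
  obtain y where y: "y:O'" "real m2*R x k = (real p)^j*R y" using jk unfolding In_def by blast
  have "(real p)^s*real m' = real m1*real m2" using m'(1) by (metis of_nat_mult of_nat_power)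
  then have "(real p)^s*R (of_int (int m')*R x k) = real m1*R (real m2*R x k)" by simp
  also have "... = (real p)^s*R (real p*R ((real p)^i*R (real m1*R y)))" unfolding y(2) i by (simp add: power_add mult_ac)
  finally have "of_int (int m')*R x k = real p*R ((real p)^i*R (real m1*R y))"
   using p0(1) by (metis scaleR_left_imp_eq power_not_zero of_nat_eq_0_iff less_irrefl)
  moreover have "real m1*R y:Oo" using m1(2) y(1) by blast
  then have "(real p)^i*R (real m1*R y):Oo" by (intro O_Ints[of "(real p)^i"]) auto
  ultimately have "of_int (int m')*R x k:pO p" unfolding pO_def by (rule image_eqI)
  moreover have "real p*R x k:pO p" unfolding pO_def using x(1) by blast
  ultimately have "x k:pO p"
   using unit_multiple_sub[OF rideal_zero[OF rideal_pO[OF p0(1)]] rideal_diff[OF rideal_pO[OF p0(1)]] p(1), of "int m'" "x k"] m'(2) by simp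
  then show False using prim by blast
 qed
 define j where "j = (GREATEST j. In j s)"
 have In0: "In 0 s" unfolding In_def using m2(2) x(1) by auto
 have j: "In j s" unfolding j_def using GreatestI_nat[of "%j. In j s", OF In0] bound by blast
 have jmax: "~ In (Suc j) s" unfolding j_def using Greatest_le_nat[of "%j. In j s" "Suc j" s] bound j_def by fastforce
 have js: "j <= s" using bound[OF j] .
 define t where "t = s+2*j"
 obtain y0 where y0: "y0:O'" "real m2*R x s = (real p)^j*R y0" using j unfolding In_def by blast
 define y where "y k = (1/(real p)^j)*R (real m2*R x (k+t))" for k
 have ydiff: "EX z:O'. y k-y0 = real p*R z" for k
 proof -
  obtain z where z: "z:Oo" "x (s+(k+2*j))-x s = (real p)^(Suc s)*R z" using diff by blast
  have e: "Suc s = j+Suc (s-j)" using js by simp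
  have "y k-y0 = (1/(real p)^j)*R (real m2*R (x (s+(k+2*j))-x s))"
   unfolding y_def t_def scaleR_diff_right y0(2) using p0 by (simp add: add_ac)
  also have "... = real p*R ((real p)^(s-j)*R (real m2*R z))"
   unfolding z(2) e power_add using p0 by simp
  finally show ?thesis using Onat m2(2) z(1) by blast
 qed
 have yO: "y k:O'" for k
 proof -
  obtain z where z: "z:O'" "y k-y0 = real p*R z" using ydiff by blast
  then have "y k = y0+real p^1*R z" by (simp add: algebra_simps)
  then show ?thesis using Oadd[OF y0(1) Onat[OF z(1), of 1]] by simp
 qed
 show ?thesis
  unfolding padic_isotropic_def
 proof (intro exI[of _ y] conjI allI yO)
  show "EX z:O'. y (Suc k)-y k = (real p^Suc k)*R z" for k
  proof -
   obtain z where z: "z:Oo" "x (Suc (k+t))-x (k+t) = (real p)^(Suc (k+t))*R z" using x(2) by blast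
   have e: "Suc (k+t) = j+(Suc k+(s+j))" by (simp add: t_def)
   have "y (Suc k)-y k = (1/(real p)^j)*R (real m2*R (x (Suc (k+t))-x (k+t)))"
    unfolding y_def by (simp add: scaleR_diff_right)
   also have "... = (real p)^(Suc k)*R ((real p)^(s+j)*R (real m2*R z))"
    unfolding z(2) unfolding e power_add using p0 by simp
   finally show ?thesis using Onat m2(2) z(1) by blast
  qed
  show "y 0 ~: (%y. real p*R y) ` O'"
  proof
   assume "y 0:(%y. real p*R y) ` O'"
   then obtain z where z: "z:O'" "y 0 = real p*R z" by auto
   obtain z' where z': "z':O'" "y 0-y0 = real p*R z'" using ydiff by blast
   have "y0 = real p*R (z-z')" using z z' by (simp add: scaleR_diff_right algebra_simps)
   then have "In (Suc j) s" unfolding In_def using y0(2) Oc(2)[OF z(1) z'(1)] by (intro bexI[of _ "z-z'"]) (simp_all add: mult.commute)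
   then show False using jmax by blast
  qed
  show "EX m :: int. qn (y k) = real p^k * of_int m" for k
  proof -
   obtain m where m: "qn (x (k+t)) = real (p^(Suc (k+t))) * of_int m" using x(4) unfolding pdiv_def by blast
   have e: "Suc (k+t) = 2*j+(k+Suc s)" by (simp add: t_def)
   have "qn (y k) = real p^k * of_int (int (m2^2*p^(Suc s))*m)"
    unfolding y_def qn_simps m e using p0 by (simp add: power_divide power_add power_mult power2_eq_square power_mult_distrib)
   then show ?thesis by blast
  qed
 qed
qed

lemma ram_iff_ramified: "ram p \<longleftrightarrow> prime p & ramified A p"
 unfolding ramified_def using ram_not_isotropic[OF _ order] split_isotropic order ram_prime by blast

end

section \<open>Counting integral right ideals\<close>

lemma finite_intermediate_groups:
 assumes L: "is_lat L" and M: "is_lat M" "M <= L"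
 shows "finite {J. M <= J & J <= L & (ALL x:J. ALL y:J. x-y:J)}" (is "finite ?S")
proof -
 let ?c = "%l. (+) l ` M"
 have inj: "inj_on (%J. ?c ` J) ?S"
 proof (rule inj_onI)
  have un: "\<Union>(?c ` J) = J" if "J:?S" for J
  proof (intro antisym subsetI)
   fix x assume "x:\<Union>(?c ` J)"
   then obtain j m where jm: "j:J" "m:M" "x = j+m" by blast
   have "0-m:J" using that jm lat_zero[OF M(1)] by blast
   then have "j-(0-m):J" using that jm by blast
   then show "x:J" using jm by simp
  next
   fix x assume "x:J"
   moreover have "x:?c x" using lat_zero[OF M(1)] by force
   ultimately show "x:\<Union>(?c ` J)" by blast
  qed
  fix J K assume JK: "J:?S" "K:?S" "?c ` J = ?c ` K"
  show "J = K" using un[OF JK(1)] un[OF JK(2)] unfolding JK(3) by simp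
 qed
 have "(%J. ?c ` J) ` ?S <= Pow (?c ` L)" by blast
 moreover have "finite (Pow (?c ` L))" using lidx_finite[OF L M] by simp
 ultimately have "finite ((%J. ?c ` J) ` ?S)" by (rule finite_subset)
 then show ?thesis using inj by (rule finite_imageD)
qed

context max_order
begin

lemma nv_coprime_pair:
 assumes I: "rideal I"
 shows "EX x:I. EX y:I. coprime (nv I x) (nv I y)"
proof -
 obtain x where x: "x:I" "x ~= 0" using I unfolding rideal_def by blast
 have nx: "nv I x > 0" using nv_pos[OF I x] .
 obtain y where y: "y:I" "ALL p:prime_factors (nat (nv I x)). ~ int p dvd nv I y"
  using nv_primitive_finite[OF I, of "prime_factors (nat (nv I x))"] by auto
 have "coprime (nat (nv I x)) (nat \<bar>nv I y\<bar>)"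
 proof (rule ccontr)
  assume "~ coprime (nat (nv I x)) (nat \<bar>nv I y\<bar>)"
  then have "gcd (nat (nv I x)) (nat \<bar>nv I y\<bar>) ~= 1" unfolding coprime_iff_gcd_eq_1 .
  from prime_factor_nat[OF this] obtain p where "prime p" "p dvd gcd (nat (nv I x)) (nat \<bar>nv I y\<bar>)" by blast
  then have p: "prime p" "p dvd nat (nv I x)" "p dvd nat \<bar>nv I y\<bar>"
   using dvd_trans[OF _ gcd_dvd1] dvd_trans[OF _ gcd_dvd2] by blast+
  then have "p:prime_factors (nat (nv I x))" using nx by (simp add: in_prime_factors_iff)
  moreover have "int p dvd nv I y" using p(3) by (metis dvd_abs_iff int_dvd_int_iff nat_0_le abs_ge_zero)
  ultimately show False using y(2) by blast
 qed
 then have "coprime (nv I x) (nv I y)" using nx by (metis coprime_abs_right_iff coprime_int_iff nat_0_le abs_ge_zero less_imp_le)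
 then show ?thesis using x y by blast
qed

text \<open>For x in J, \<open>nv I x\<close> is k times \<open>nv J x\<close>, and
  \<open>nv I x\<close> times y lies in x O, hence in J. As \<open>nv J\<close> takes coprime values
  on J, the multiplier reduces to k by Bezout.\<close>

lemma ratio_multiple:
 assumes I: "rideal I" and J: "rideal J" "J <= I" and k: "NI J = real k*NI I" and y: "y:I"
 shows "real k*R y:J"
proof -
 have *: "of_int (nv J x)*R (real k*R y):J" if x: "x:J" for x
 proof -
  have "nv I x = int k*nv J x"
   by (rule nv_eqI[OF I]) (use qn_nv[OF J(1) x] k in simp)
  then have "of_int (nv I x)*R y = of_int (nv J x)*R (real k*R y)" by (simp add: mult.commute)
  moreover obtain a where "a:Oo" "of_int (nv I x)*R y = x*.a" using nv_multiple[OF I _ y] x J(2) by blast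
  ultimately show ?thesis using rideal_mul[OF J(1) x, of a] by simp
 qed
 obtain x x' where x: "x:J" "x':J" "coprime (nv J x) (nv J x')" using nv_coprime_pair[OF J(1)] by blast
 obtain a b where ab: "a*nv J x+b*nv J x' = 1" using bezout_int[of "nv J x" "nv J x'"] x(3) by auto
 have "real k*R y = of_int (a*nv J x+b*nv J x')*R (real k*R y)" unfolding ab by simp
 also have "... = of_int a*R (of_int (nv J x)*R (real k*R y)) + of_int b*R (of_int (nv J x')*R (real k*R y))"
  by (simp only: of_int_add of_int_mult scaleR_add_left scaleR_scaleR mult.assoc distrib_right)
 also have "...:J" by (intro rideal_add[OF J(1)] rideal_int[OF J(1)] * x)
 finally show ?thesis .
qed

lemma NI_between:
 assumes p: "prime p" and I: "rideal I" and J: "rideal J" "(*R) (real p) ` I <= J" "J <= I" "J ~= (*R) (real p) ` I" "J ~= I"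
 shows "NI J = real p*NI I"
proof -
 have p0: "p > 0" using p prime_gt_0_nat by auto
 have pI: "rideal ((*R) (real p) ` I)" "NI ((*R) (real p) ` I) = (real p)^2*NI I" using NI_scale[OF I, of "real p"] p0 by auto
 obtain k where k: "k > 0" "NI J = NI I*real k" using NI_sub[OF I J(1,3)] by blast
 obtain l where l: "l > 0" "NI ((*R) (real p) ` I) = NI J*real l" using NI_sub[OF J(1) pI(1) J(2)] by blast
 have "real (p^2) = real (k*l)" using l k pI NI_pos[OF I] by simp
 then have kl: "k*l = p^2" by (simp only: of_nat_eq_iff)
 then have "k dvd p^2" by (metis dvd_triv_left)
 then obtain i where i: "i <= 2" "k = p^i" using p by (auto simp: divides_primepow_nat)
 have "k ~= 1" using rideal_eqI[OF I J(1,3)] J(5) k by auto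
 moreover have "k ~= p^2" using rideal_eqI[OF J(1) pI(1) J(2)] J(4) k pI by auto
 ultimately have "i = 1" using i by (cases "i = 0"; cases "i = 2") auto
 then show ?thesis using i k by (simp add: mult.commute)
qed

definition subs :: "nat => quat set => quat set set" where
 "subs p I = {J. rideal J & J <= I & NI J = real p*NI I}"

definition ideals :: "nat => quat set set" where
 "ideals n = {J. rideal J & J <= Oo & NI J = real n}"

lemma subs_props:
 assumes p: "prime p" and I: "rideal I" and J: "J:subs p I"
 shows "(*R) (real p) ` I <= J" "J ~= I" "J ~= (*R) (real p) ` I"
proof -
 have p1: "p > 1" using p prime_gt_1_nat by auto
 show "(*R) (real p) ` I <= J" using ratio_multiple[OF I] J unfolding subs_def by auto
 show "J ~= I" using J NI_pos[OF I] p1 unfolding subs_def by auto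
 have "NI ((*R) (real p) ` I) = (real p)^2*NI I" using NI_scale[OF I, of "real p"] p1 by auto
 then show "J ~= (*R) (real p) ` I" using J NI_pos[OF I] p1 unfolding subs_def by (auto simp: power2_eq_square)
qed

lemma finite_ideals: "finite (ideals n)"
proof (cases "n = 0")
 case True
 have "ideals n = {}" using NI_pos unfolding ideals_def True by force
 then show ?thesis by simp
next
 case False
 have "ideals n <= {J. pO n <= J & J <= Oo & (ALL x:J. ALL y:J. x-y:J)}"
 proof
  fix J assume "J:ideals n"
  then have J: "rideal J" "J <= Oo" "NI J = real n*NI Oo" by (auto simp: ideals_def)
  have "pO n <= J" unfolding pO_def using ratio_multiple[OF rideal_O J] by auto
  then show "J:{J. pO n <= J & J <= Oo & (ALL x:J. ALL y:J. x-y:J)}" using J rideal_diff[OF J(1)] by blast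
 qed
 moreover have "is_lat (pO n)" using lat_rideal[OF rideal_pO] False by simp
 from finite_intermediate_groups[OF lat_O this pO_sub_O] calculation show ?thesis
  by (rule finite_subset[rotated])
qed

lemma rideal_unit_multiple:
 assumes J: "rideal J" and p: "prime p" "~ int p dvd u" "of_int u*R x:J" "real p*R x:J"
 shows "x:J"
 using unit_multiple_sub[OF rideal_zero[OF J] rideal_diff[OF J] p] .

text \<open>Multiplication by x and the map q are inverse to each other up to the factor f, a unit
  at p. Subideals of relative norm p contain p I, so only the situation at p matters and they are
  carried back and forth.\<close>

lemma subs_pullback:
 assumes p: "prime p" and I: "rideal I" and I': "rideal I'" and J: "J:subs p I"
  and x: "!!a. a:I' ==> x*.a:I" and q: "!!y. y:I ==> q y:I'"
  and xq: "!!y. x*.q y = of_int f*R y" and f: "~ int p dvd f"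
 shows "{a:I'. x*.a:J}:subs p I'" and "{y:I. q y:{a:I'. x*.a:J}} = J"
proof -
 have p0: "p > 0" using p prime_gt_0_nat by auto
 define H where "H = {a:I'. x*.a:J}"
 have Jr: "rideal J" "J <= I" using J by (auto simp: subs_def)
 note Jp = subs_props[OF p I J]
 note pI = NI_scale[OF I, of "real p"]
 have mem: "y:J" if "y:I" "of_int f*R y:J" for y
  using rideal_unit_multiple[OF Jr(1) p f that(2)] Jp(1) that(1) by blast
 have psub: "(*R) (real p) ` I' <= H"
 proof
  fix y assume "y:(*R) (real p) ` I'"
  then obtain a where a: "a:I'" "y = real p*R a" by blast
  have "real p*R (x*.a):J" using Jp(1) x[OF a(1)] by blast
  then show "y:H" unfolding H_def using a rideal_nat[OF I' a(1)] by simp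
 qed
 show inv: "{y:I. q y:{a:I'. x*.a:J}} = J"
 proof (intro antisym subsetI)
  fix y assume "y:{y:I. q y:{a:I'. x*.a:J}}"
  then show "y:J" using mem by (simp add: xq)
 next
  fix y assume "y:J"
  then show "y:{y:I. q y:{a:I'. x*.a:J}}" using q Jr(2) rideal_int[OF Jr(1)] by (auto simp: xq)
 qed
 have Hr: "rideal H"
  unfolding rideal_def
 proof (intro conjI ballI)
  show "0:H" using rideal_zero[OF I'] rideal_zero[OF Jr(1)] by (simp add: H_def)
  show "a-b:H" if "a:H" "b:H" for a b
   using that rideal_diff[OF I'] rideal_diff[OF Jr(1)] by (simp add: H_def qmul_diff)
  show "a*.b:H" if "a:H" "b:Oo" for a b
   using that rideal_mul[OF I'] rideal_mul[OF Jr(1)] by (simp add: H_def qmul_assoc[symmetric])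
  show "EX x:H. x ~= 0"     proof -
   obtain a where "a:I'" "a ~= 0" using I' unfolding rideal_def by blast
   then show ?thesis using psub p0 by (intro bexI[of _ "real p*R a"]) auto
  qed
  show "EX m::nat. m > 0 & (ALL x:H. real m*R x:Oo)" using I' unfolding rideal_def H_def by blast
 qed
 have "H ~= I'"
 proof
  assume "H = I'"
  then have "I <= J" using inv q unfolding H_def by blast
  then show False using Jp(2) Jr(2) by blast
 qed
 moreover have "H ~= (*R) (real p) ` I'"
 proof
  assume eq: "H = (*R) (real p) ` I'"
  have "J <= (*R) (real p) ` I"
  proof
   fix y assume "y:J"
   then have y: "y:I" "q y:H" using inv by (auto simp: H_def)
   then obtain a where a: "a:I'" "q y = real p*R a" unfolding eq by blast
   have "of_int f*R y = real p*R (x*.a)" using xq[of y] a by simp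
   then have "of_int f*R y:(*R) (real p) ` I" using x[OF a(1)] by blast
   then show "y:(*R) (real p) ` I" using rideal_unit_multiple[OF _ p f] pI(1) p0 y(1) by auto
  qed
  then show False using Jp by blast
 qed
 ultimately have "NI H = real p*NI I'" using NI_between[OF p I' Hr psub] unfolding H_def by blast
 then have "H:subs p I'" using Hr unfolding subs_def by (auto simp: H_def)
 then show "{a:I'. x*.a:J}:subs p I'" unfolding H_def .
qed

lemma primitive_quotient:
 assumes I: "rideal I" and x: "x:I"
 defines "q == (%y. (1/NI I)*R (qcnj x*.y))"
 shows "!!a. a:Oo ==> x*.a:I" "!!y. y:I ==> q y:Oo" "!!y. x*.q y = of_int (nv I x)*R y" "!!a. q (x*.a) = of_int (nv I x)*R a"
 using rideal_mul[OF I x] ideal_quotient[OF I x] ideal_quotient_mul[OF I x] qn_nv[OF I x] NI_pos[OF I]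
 by (simp_all add: q_def qmul_qcnj_left)

lemma subs_transport:
 assumes p: "prime p" and I: "rideal I"
 shows "card (subs p I) = card (subs p Oo)"
proof -
 obtain x where x: "x:I" "~ int p dvd nv I x" using nv_primitive[OF I p] by blast
 let ?q = "%y. (1/NI I)*R (qcnj x*.y)" and ?x = "(1/NI I)*R qcnj x"
 note Q = primitive_quotient[OF I x(1)]
 have X: "?x*.y = ?q y" for y by simp
 note d = subs_pullback[where x = x and q = ?q, OF p I rideal_O _ Q(1) Q(2) Q(3) x(2)]
 note u = subs_pullback[where x = ?x and q = "(*.) x", OF p rideal_O I _ Q(2)[folded X] Q(1) Q(4)[folded X] x(2)]
 have "bij_betw (%J. {a:Oo. x*.a:J}) (subs p I) (subs p Oo)"
  by (rule bij_betw_byWitness[of _ "%H. {y:I. ?x*.y:H}"]) (use d u in auto)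
 then show ?thesis by (rule bij_betw_same_card)
qed

lemma subs_ram:
 assumes "ram p"
 shows "subs p Oo = {rad p}"
proof -
 have p: "prime p" "p > 0" using assms ram_prime prime_gt_0_nat by auto
 have r: "rideal (rad p)" "NI (rad p) = real p" using rideal_rad[OF p(2)] NI_rad[OF assms] .
 have un: "J = rad p" if "rideal J" "J <= Oo" "NI J = real p" for J
 proof (rule rideal_eqI[OF r(1) that(1)])
  show "J <= rad p"
  proof
   fix x assume "x:J"
   moreover have "pdiv p (qn x)" unfolding pdiv_def using qn_nv[OF that(1) \<open>x : J\<close>] that(3) by auto
   ultimately show "x:rad p" using rad_iff[OF assms] that(2) by blast
  qed
 qed (use that r in simp)
 have sub: "rad p <= Oo" by (auto simp: rad_def)
 show ?thesis
 proof (intro set_eqI iffI)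
  fix J assume "J:subs p Oo"
  then have "J = rad p" by (intro un) (simp_all add: subs_def)
  then show "J:{rad p}" by simp
 next
  fix J assume "J:{rad p}"
  then show "J:subs p Oo" using r sub by (simp add: subs_def)
 qed
qed

section \<open>Ideals of norm p above a split prime\<close>

definition prin :: "nat => quat => quat set" where
 "prin p u = {x+y | x y. x:(*.) u ` Oo & y:pO p}"

lemma prin_subs:
 assumes p: "prime p" and u: "u:Oo" "u ~: pO p" "pdiv p (qn u)"
 shows "prin p u:subs p Oo" and "u:prin p u"
proof -
 have p0: "p > 0" using p prime_gt_0_nat by auto
 have u0: "u ~= 0" using u(2) rideal_zero[OF rideal_pO[OF p0]] by blast
 have r: "rideal (prin p u)"
  unfolding prin_def by (intro rideal_sum rideal_left rideal_O rideal_pO p0 u0) (use u(1) O_sub_A in blast)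
 show uin: "u:prin p u"
  unfolding prin_def using O_one rideal_zero[OF rideal_pO[OF p0]]
  by (intro CollectI exI[of _ u] exI[of _ 0]) (auto intro!: image_eqI[of _ _ qone])
 have sub: "prin p u <= Oo" unfolding prin_def using u(1) O_mul O_add pO_sub_O by blast
 have pos: "pO p <= prin p u"
 proof
  fix x assume "x:pO p"
  then show "x:prin p u" unfolding prin_def using O_zero
   by (intro CollectI exI[of _ 0] exI[of _ x]) (auto intro!: image_eqI[of _ _ 0])
 qed
 have "pdiv p (qn x)" if x: "x:prin p u" for x
 proof -
  obtain a b where ab: "x = u*.a+real p*R b" "a:Oo" "b:Oo" using x unfolding prin_def pO_def by blast
  have "qn x = qn a*qn u+real p*(real p*qn b)+real p*qtr (u*.a*.qcnj b)"
   by (simp add: ab(1) qn_add qn_qmul power2_eq_square)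
  then show ?thesis using u ab O_integral O_mul O_cnj by (auto intro!: pdiv_add pdiv_mult pdiv_self Ints_mult)
 qed
 then have "pdiv p (qn qone)" if "qone:prin p u" using that by blast
 moreover have "~ pdiv p (qn qone)" using pdiv_of_int[OF p0, of 1] prime_gt_1_nat[OF p] by simp
 ultimately have "qone ~: prin p u" by blast
 then have "prin p u ~= Oo" using O_one by blast
 moreover have "prin p u ~= pO p" using uin u(2) by blast
 ultimately have "NI (prin p u) = real p" using NI_between_pO[OF p r pos sub] by blast
 then show "prin p u:subs p Oo" unfolding subs_def using r sub by simp
qed

lemma prin_eq:
 assumes p: "prime p" and J: "J:subs p Oo" and u: "u:J" "u ~: pO p"
 shows "J = prin p u"
proof -
 have Jr: "rideal J" "J <= Oo" "NI J = real p" using J by (auto simp: subs_def)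
 have "pdiv p (qn u)" unfolding pdiv_def using qn_nv[OF Jr(1) u(1)] Jr(3) by auto
 then have P: "prin p u:subs p Oo" using prin_subs[OF p] u Jr by blast
 have "prin p u <= J"
  unfolding prin_def using subs_props(1)[OF p rideal_O J] rideal_mul[OF Jr(1) u(1)] rideal_add[OF Jr(1)] unfolding pO_def by blast
 then show ?thesis using rideal_eqI[OF Jr(1)] P Jr(3) unfolding subs_def by auto
qed

text \<open>For split \<open>p\<close> there is an idempotent \<open>e\<close> of trace one modulo \<open>p\<close>, and the off-diagonal block \<open>e O (1 - e)\<close> is one-dimensional modulo \<open>p\<close>.\<close>

lemma split_idempotent:
 assumes p: "prime p" "rad p = pO p"
 obtains e where "e:Oo" "pdiv p (qn e)" "pdiv p (qtr e-1)"
proof -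
 have p0: "p > 0" using p prime_gt_0_nat by auto
 obtain x where x: "x:Oo" "x ~: pO p" "pdiv p (qn x)" using exists_norm_divisible[OF p(1)] by blast
 obtain y where y: "y:Oo" "~ pdiv p (qtr (x*.y))" using x p(2) unfolding rad_def by blast
 obtain b where b: "qtr (x*.y) = of_int b" using O_integral(2)[OF O_mul] x y by (meson Ints_cases)
 obtain k l where kl: "k*b = 1+int p*l" using prime_inverse[OF p(1), of b] y b p0 by (auto simp: pdiv_of_int)
 define e where "e = x*.(of_int k*R y)"
 have "e:Oo" unfolding e_def using x y by (intro O_mul O_int)
 moreover have "pdiv p (qn e)" unfolding e_def qn_qmul using x y O_integral(1) O_int by (intro pdiv_mult2) auto
 moreover have "qtr e-1 = of_int (int p*l)"
 proof -
  have "qtr e = of_int (k*b)" by (simp add: e_def b)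
  then show ?thesis unfolding kl by simp
 qed
 then have "pdiv p (qtr e-1)" using p0 by (simp only: pdiv_of_int dvd_triv_left)
 ultimately show thesis using that by blast
qed

lemma pO_add: "p > 0 ==> x:pO p ==> y:pO p ==> x+y:pO p"
 and pO_diff: "p > 0 ==> x:pO p ==> y:pO p ==> x-y:pO p"
 using rideal_add[OF rideal_pO] rideal_diff[OF rideal_pO] by blast+

lemma pdiv_scale_pO: "pdiv p t ==> x:Oo ==> t*R x:pO p"
proof -
 assume "pdiv p t" "x:Oo"
 then obtain k :: int where "t = real p * of_int k" unfolding pdiv_def by blast
 then have "t*R x = real p*R (of_int k*R x)" by simp
 then show ?thesis unfolding pO_def using O_int[OF \<open>x : Oo\<close>] by (rule image_eqI)
qed

lemma pO_qtr: "x:pO p ==> pdiv p (qtr x)"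
 unfolding pO_def using O_integral(2) by (auto intro!: pdiv_self simp: qtr_simps)

lemma e_sandwich:
 assumes e: "e:Oo" "pdiv p (qn e)" and x: "x:Oo"
 shows "e*.x*.e-qtr (x*.e)*R e:pO p"
proof -
 have "e*.x*.e-qtr (x*.e)*R e = (- qn e)*R qcnj x" unfolding qmul_sandwich by simp
 then show ?thesis using pdiv_scale_pO[OF _ O_cnj[OF x], of p "- qn e"] pdiv_mult[of "-1" p "qn e"] e by simp
qed

text \<open>Put d = 1 - e. If e O d vanished modulo p, so would d O e by the trace pairing, and
  every z would be a combination of e and d, two dimensions out of four. Once some g = e s d
  survives, choose h with tr(g h) = 1 modulo p: then e r d agrees with (e r d h e) s d, whose first
  factor is a scalar multiple of e.\<close>

lemma split_block:
 assumes p: "prime p" "rad p = pO p" and e: "e:Oo" "pdiv p (qn e)" "pdiv p (qtr e-1)"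
 obtains s where "s:Oo" "e*.s*.(qone-e) ~: pO p"
  "!!r. r:Oo ==> EX k::int. e*.r*.(qone-e)-of_int k*R (e*.s*.(qone-e)):pO p"
proof -
 have p0: "p > 0" "p > 1" using p prime_gt_0_nat prime_gt_1_nat by auto
 define d where "d = qone-e"
 have dO: "d:Oo" unfolding d_def using O_one e by (intro O_diff)
 have nd: "qn d = 1-qtr e+qn e" by (simp add: d_def qn_diff)
 have "pdiv p (qn d)"
  unfolding nd using pdiv_diff[OF e(2) e(3)] by (simp add: algebra_simps)
 note d = dO this
 have ee: "e*.e-e:pO p"
 proof -
  have "e*.e-e = (qtr e-1)*R e-qn e*R qone" unfolding qmul_square by (simp add: algebra_simps)
  then show ?thesis using pO_diff[OF p0(1) pdiv_scale_pO[OF e(3,1)] pdiv_scale_pO[OF e(2) O_one]] by simp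
 qed
 have swap: "qtr (e*.s*.d*.r) = qtr (d*.r*.e*.s)" for r s
  using qtr_commute[of "e*.s" "d*.r"] by (simp add: qmul_assoc)
 have "EX s:Oo. e*.s*.d ~: pO p"
 proof (rule ccontr)
  assume "~ ?thesis"
  then have all: "e*.s*.d:pO p" if "s:Oo" for s using that by blast
  have all2: "d*.r*.e:pO p" if r: "r:Oo" for r
  proof -
   have "pdiv p (qtr (d*.r*.e*.s))" if s: "s:Oo" for s
    unfolding swap[symmetric] by (rule pO_qtr) (rule pO_mul(2)[OF r all[OF s]])
   then show ?thesis unfolding p(2)[symmetric] rad_def using O_mul d(1) e(1) r by blast
  qed
  obtain z where z: "z:Oo" "!!i j :: int. z-(of_int i*R e + of_int j*R d) ~: pO p"
   using not_in_pO_combination[OF p0(2) e(1) d(1) O_zero] by auto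
  obtain i where i: "qtr (z*.e) = of_int i" using O_integral(2) O_mul z e by (meson Ints_cases)
  obtain j where j: "qtr (z*.d) = of_int j" using O_integral(2) O_mul z d by (meson Ints_cases)
  have "z = e*.z*.e+e*.z*.d+d*.z*.e+d*.z*.d" by (simp add: d_def qring)
  then have "z-(of_int i*R e + of_int j*R d) = (e*.z*.e-qtr (z*.e)*R e)+e*.z*.d+d*.z*.e+(d*.z*.d-qtr (z*.d)*R d)"
   unfolding i j by (simp add: algebra_simps)
  also have "...:pO p"
   by (intro pO_add[OF p0(1)] e_sandwich e d z all all2)
  finally show False using z(2) by blast
 qed
 then obtain s where s: "s:Oo" "e*.s*.d ~: pO p" by blast
 define g where "g = e*.s*.d"
 have gO: "g:Oo" unfolding g_def using e d s O_mul by simp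
 obtain h0 where h0: "h0:Oo" "~ pdiv p (qtr (g*.h0))" using s p(2) gO unfolding rad_def g_def by blast
 obtain b where b: "qtr (g*.h0) = of_int b" using O_integral(2) O_mul gO h0 by (meson Ints_cases)
 obtain k l where kl: "k*b = 1+int p*l" using prime_inverse[OF p(1), of b] h0 b p0 by (auto simp: pdiv_of_int)
 define h where "h = of_int k*R h0"
 have hO: "h:Oo" unfolding h_def using h0 O_int by blast
 have trgh: "qtr (g*.h) = 1+real p * of_int l"
 proof -
  have "qtr (g*.h) = of_int (k*b)" by (simp add: h_def b)
  then show ?thesis unfolding kl by simp
 qed
 have "EX k::int. e*.r*.d-of_int k*R g:pO p" if r: "r:Oo" for r
 proof -
  have X: "r*.d*.h:Oo" "h*.e*.s:Oo" using r d e s hO O_mul by auto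
  obtain \<alpha> where \<alpha>: "qtr (r*.d*.h*.e) = of_int \<alpha>" using O_integral(2) O_mul X(1) e by (meson Ints_cases)
  have t1: "e*.(r*.d*.h)*.e-of_int \<alpha> *R e:pO p"
   using e_sandwich[OF e(1,2) X(1)] \<alpha> by (simp add: qmul_assoc)
  have tr2: "qtr (h*.e*.s*.d) = 1+real p * of_int l"
   unfolding trgh[symmetric] g_def using qtr_commute[of h "e*.s*.d"] by (simp add: qmul_assoc)
  have t2: "d*.(h*.e*.s)*.d-d:pO p"
  proof -
   have "d*.(h*.e*.s)*.d-qtr (h*.e*.s*.d)*R d:pO p" using e_sandwich[OF d X(2)] by simp
   moreover have "(real p * of_int l)*R d:pO p" by (rule pdiv_scale_pO[OF _ d(1)]) (auto simp: pdiv_def)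
   ultimately have "(d*.(h*.e*.s)*.d-qtr (h*.e*.s*.d)*R d)+(real p * of_int l)*R d:pO p"
    by (rule pO_add[OF p0(1)])
   then show ?thesis unfolding tr2 by (simp add: scaleR_add_left)
  qed
  have 1: "(e*.r)*.(d*.(h*.e*.s)*.d-d):pO p" using pO_mul(1)[OF O_mul[OF e(1) r] t2] .
  have 2: "(e*.(r*.d*.h)*.e-of_int \<alpha> *R e)*.(s*.d):pO p" using pO_mul(2)[OF O_mul[OF s(1) d(1)] t1] .
  have "e*.r*.d-of_int \<alpha> *R g =
   (e*.(r*.d*.h)*.e-of_int \<alpha> *R e)*.(s*.d)-(e*.r)*.(d*.(h*.e*.s)*.d-d)"
   by (simp add: g_def qmul_diff qmul_assoc)
  then show ?thesis using pO_diff[OF p0(1) 2 1] by metis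
 qed
 then show thesis using that[of s] s unfolding g_def d_def by blast
qed

text \<open>These are the p + 1 points of a projective line: \<open>prin p e\<close> at infinity and
  \<open>prin p (u k)\<close> for k modulo p, where u k = d + k g and g spans the block e O d modulo
  p.\<close>

lemma card_subs_split:
 assumes p: "prime p" "rad p = pO p"
 shows "card (subs p Oo) = p+1"
proof -
 have p0: "p > 0" "p > 1" using p prime_gt_0_nat prime_gt_1_nat by auto
 obtain e where e: "e:Oo" "pdiv p (qn e)" "pdiv p (qtr e-1)" using split_idempotent[OF p] .
 obtain s where s: "s:Oo" "e*.s*.(qone-e) ~: pO p"
  "!!r. r:Oo ==> EX k::int. e*.r*.(qone-e)-of_int k*R (e*.s*.(qone-e)):pO p"
  by (rule split_block[OF p e]) blast
 define d where "d = qone-e"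
 define g where "g = e*.s*.d"
 have dO: "d:Oo" unfolding d_def using O_one e by (intro O_diff)
 have gO: "g:Oo" unfolding g_def using e dO s O_mul by simp
 have "qn d = qn e-(qtr e-1)" by (simp add: d_def qn_diff)
 then have nd: "pdiv p (qn d)" using pdiv_diff[OF e(2) e(3)] by simp
 have one: "qone ~: J" if "J:subs p Oo" for J
  using subs_props(2)[OF p(1) rideal_O that] rideal_mul[of J qone] that unfolding subs_def by force
 have e_not: "e ~: pO p"
 proof
  assume "e:pO p"
  from pdiv_diff[OF pO_qtr[OF this] e(3)] show False using pdiv_of_int[OF p0(1), of 1] p0 by simp
 qed
 define u where "u k = d + of_int k*R g" for k :: int
 have uO: "u k:Oo" for k unfolding u_def using dO gO by (intro O_add O_int)
 have nu: "pdiv p (qn (u k))" for k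
 proof -
  have "d*.qcnj g = qn d*R (qcnj s*.qcnj e)" by (simp add: g_def qcnj_qmul qmul_qcnj_left)
  then have "qn (u k) = (1+(of_int k)^2*(qn e*qn s) + of_int k*qtr (qcnj s*.qcnj e))*qn d"
   unfolding u_def by (simp add: qn_add g_def qn_qmul algebra_simps)
  moreover have "1+(of_int k)^2*(qn e*qn s) + of_int k*qtr (qcnj s*.qcnj e):\<int>"
   using O_integral O_mul O_cnj e s by (intro Ints_add Ints_mult Ints_power) auto
  ultimately show ?thesis using nd pdiv_mult by simp
 qed
 have u_not: "u k ~: pO p" for k
 proof
  assume "u k:pO p"
  then have *: "d*.u k:pO p" using pO_mul(1)[OF dO] by blast
  have ed: "d*.e = qn e*R qone-(qtr e-1)*R e" unfolding d_def qmul_diff qmul_square by (simp add: algebra_simps)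
  have "d*.e:pO p" unfolding ed using pdiv_scale_pO e O_one by (intro pO_diff[OF p0(1)]) auto
  then have "(d*.e)*.(of_int k*R (s*.d)):pO p" by (rule pO_mul(2)[rotated]) (intro O_int O_mul s(1) dO)
  from pO_diff[OF p0(1) * this] have dd: "d*.d:pO p" by (simp add: u_def g_def qring)
  have trd: "qtr d = 1-(qtr e-1)" by (simp add: d_def qtr_diff)
  have "d*.d = d-(qtr e-1)*R d-qn d*R qone"
   using qmul_square[of d] unfolding trd by (simp only: scaleR_diff_left scaleR_one)
  then have "d = d*.d+(qtr e-1)*R d+qn d*R qone" by simp
  moreover have "d*.d+(qtr e-1)*R d+qn d*R qone:pO p"
   using pdiv_scale_pO e nd dO O_one dd by (intro pO_add[OF p0(1)]) auto
  ultimately have "pdiv p (qtr d)" using pO_qtr by simp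
  then have "pdiv p (qtr d+(qtr e-1))" using e(3) by (rule pdiv_add)
  then show False using pdiv_of_int[OF p0(1), of 1] p0 by (simp add: d_def qtr_diff)
 qed
 have Je: "prin p e:subs p Oo" "e:prin p e" using prin_subs[OF p(1) e(1) e_not e(2)] by auto
 have Ju: "prin p (u k):subs p Oo" "u k:prin p (u k)" for k using prin_subs[OF p(1) uO u_not nu] by auto
 have ne: "prin p (u k) ~= prin p e" for k
 proof
  assume eq: "prin p (u k) = prin p e"
  have r: "rideal (prin p e)" using Je by (simp add: subs_def)
  have "g:prin p e" unfolding g_def using rideal_mul[OF r rideal_mul[OF r Je(2) s(1)] dO] .
  then have "u k-of_int k*R g:prin p e" using Ju(2)[of k] eq by (intro rideal_diff[OF r] rideal_int[OF r]) auto
  then have "d+e:prin p e" using rideal_add[OF r _ Je(2)] by (simp add: u_def)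
  then show False using one[OF Je(1)] by (simp add: d_def)
 qed
 have inj: "inj_on (%k. prin p (u k)) {0..<int p}"
 proof (rule inj_onI, rule ccontr)
  fix k l assume kl: "k:{0..<int p}" "l:{0..<int p}" "prin p (u k) = prin p (u l)" "k ~= l"
  have r: "rideal (prin p (u k))" using Ju by (simp add: subs_def)
  have "u k-u l:prin p (u k)" using Ju(2)[of k] Ju(2)[of l] kl(3) by (intro rideal_diff[OF r]) auto
  then have "of_int (k-l)*R g:prin p (u k)" by (simp add: u_def scaleR_diff_left)
  moreover have "~ int p dvd k-l"
  proof
   assume "int p dvd k-l"
   then have "int p <= \<bar>k-l\<bar>" using kl(4) by (intro zdvd_imp_le) auto
   then show False using kl by auto
  qed
  moreover have "real p*R g:prin p (u k)" using subs_props(1)[OF p(1) rideal_O Ju(1)] gO by blast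
  ultimately have "g:prin p (u k)" using rideal_unit_multiple[OF r p(1)] by blast
  then have "prin p (u k) = prin p g" using prin_eq[OF p(1) Ju(1)] s(2) unfolding g_def d_def by blast
  moreover have "g:prin p e" using Je rideal_mul[of "prin p e"] s(1) dO unfolding subs_def g_def by blast
  then have "prin p e = prin p g" using prin_eq[OF p(1) Je(1)] s(2) unfolding g_def d_def by blast
  ultimately show False using ne by simp
 qed
 have "subs p Oo = insert (prin p e) ((%k. prin p (u k)) ` {0..<int p})"
 proof (intro antisym subsetI)
  fix J assume J: "J:subs p Oo"
  have Jr: "rideal J" "J <= Oo" "NI J = real p" using J by (auto simp: subs_def)
  have Jp: "pO p <= J" using subs_props(1)[OF p(1) rideal_O J] unfolding pO_def .
  show "J:insert (prin p e) ((%k. prin p (u k)) ` {0..<int p})"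
  proof (cases "J = prin p e")
   case False
   have er: "rideal (prin p e)" "prin p e <= Oo" "NI (prin p e) = real p" using Je by (auto simp: subs_def)
   define S where "S = {x+y | x y. x:J & y:prin p e}"
   have Sr: "rideal S" unfolding S_def using Jr er by (intro rideal_sum)
   have sub: "J <= S" "prin p e <= S" "S <= Oo"
    unfolding S_def using rideal_zero[OF Jr(1)] rideal_zero[OF er(1)] Jr(2) er(2) O_add by force+
   have "S = Oo"
   proof (rule ccontr)
    assume "S ~= Oo"
    moreover have "S ~= pO p" using sub(2) Je(2) e_not by blast
    ultimately have "NI S = real p" using NI_between_pO[OF p(1) Sr _ sub(3)] Jp sub(1) by blast
    then have "prin p e = S" "J = S" using rideal_eqI[OF Sr er(1) sub(2)] rideal_eqI[OF Sr Jr(1) sub(1)] er Jr by auto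
    then show False using False by simp
   qed
   \<comment> \<open>A J other than \<open>prin p e\<close> is comaximal with it, so d = j + e a + b
     with j in J; multiplying by d on the right moves e a into the one-dimensional block and
     exhibits some \<open>u k'\<close> in J.\<close>
   then have "d:S" using dO by simp
   then obtain j a b where j: "j:J" "a:Oo" "b:pO p" "d = j+(e*.a+b)" unfolding S_def prin_def by blast
   obtain k where k: "e*.(- a)*.d-of_int k*R g:pO p" using s(3)[OF O_neg[OF j(2)]] unfolding g_def d_def by blast
   define k' where "k' = k mod int p"
   have "u k' = j*.d+b*.d-(d*.d-d)-(e*.(- a)*.d-of_int k*R g)-of_int (k-k')*R g"
   proof -
    have "d*.d = j*.d+(e*.a*.d+b*.d)" using arg_cong[OF j(4), of "%x. x*.d"] by (simp add: qmul_add)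
    then have "j*.d = d*.d-e*.a*.d-b*.d" by (simp add: algebra_simps)
    then show ?thesis by (simp add: u_def scaleR_diff_left)
   qed
   also have "...:J"
   proof -
    have trd: "qtr d = 1+(- (qtr e-1))" by (simp add: d_def qtr_diff)
    have "d*.d-d = (- (qtr e-1))*R d-qn d*R qone"
     using qmul_square[of d] unfolding trd scaleR_add_left scaleR_one by simp
    then have "d*.d-d:pO p"
     using pdiv_scale_pO[OF _ dO, of p "- (qtr e-1)"] pdiv_scale_pO[OF nd O_one] pdiv_mult[of "-1" p "qtr e-1"] e(3)
     by (auto intro: pO_diff[OF p0(1)])
    moreover have "pdiv p (of_int (k-k'))" using p0 by (simp only: pdiv_of_int) (simp add: k'_def minus_mod_eq_mult_div)
    then have "of_int (k-k')*R g:pO p" using gO by (rule pdiv_scale_pO)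
    moreover have "j*.d:J" using rideal_mul[OF Jr(1) j(1) dO] .
    moreover have "b*.d:pO p" using pO_mul(2)[OF dO j(3)] .
    ultimately have m: "d*.d-d:J" "of_int (k-k')*R g:J" "j*.d:J" "b*.d:J"
     "e*.(- a)*.d-of_int k*R g:J" using k Jp by blast+
    show ?thesis
     by (rule rideal_diff[OF Jr(1) rideal_diff[OF Jr(1) rideal_diff[OF Jr(1) rideal_add[OF Jr(1) m(3,4)] m(1)] m(5)] m(2)])
   qed
   finally have "J = prin p (u k')" using prin_eq[OF p(1) J _ u_not] by blast
   moreover have "k':{0..<int p}" unfolding k'_def using p0 by simp
   ultimately show ?thesis by blast
  qed simp
 qed (use Je Ju in auto)
 moreover have "prin p e ~: (%k. prin p (u k)) ` {0..<int p}" using ne by (metis imageE)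
 moreover have "card ((%k. prin p (u k)) ` {0..<int p}) = p" using card_image[OF inj] by simp
 ultimately show ?thesis by simp
qed

lemma card_subs:
 assumes p: "prime p" and I: "rideal I"
 shows "card (subs p I) = (if ram p then 1 else p+1)"
proof (cases "ram p")
 case True
 then show ?thesis using subs_transport[OF p I] subs_ram by simp
next
 case False
 then have "rad p = pO p" using p by (simp add: ram_def)
 then show ?thesis using subs_transport[OF p I] card_subs_split[OF p] False by simp
qed

text \<open>The ideals of norm n above J are the subideals of J/p of relative norm p that lie in O.
  If J is inside p O the last condition is automatic; otherwise only the intersection of O with J/p
  qualifies.\<close>

lemma supers:
 assumes p: "prime p" and J: "J:ideals (n*p)"
 shows "card {I:ideals n. J <= I} = (if J <= pO p then (if ram p then 1 else p+1) else 1)"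
proof -
 have p0: "p > 0" "p > 1" using p prime_gt_0_nat prime_gt_1_nat by auto
 have Jr: "rideal J" "J <= Oo" "NI J = real (n*p)" using J by (auto simp: ideals_def)
 define J' where "J' = (*R) (1/real p) ` J"
 have J'r: "rideal J'" "NI J' = (1/real p)^2*NI J" unfolding J'_def using NI_scale[OF Jr(1), of "1/real p"] p0 by auto
 have pJ': "(*R) (real p) ` J' = J" unfolding J'_def image_image using p0 by simp
 have n: "real p*NI J' = real n" using J'r(2) Jr(3) p0 by (simp add: power2_eq_square)
 have S: "{I:ideals n. J <= I} = {I:subs p J'. I <= Oo}"
 proof (intro set_eqI iffI)
  fix I assume "I:{I:ideals n. J <= I}"
  then have I: "rideal I" "I <= Oo" "NI I = real n" "J <= I" by (auto simp: ideals_def)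
  have "y:J'" if "y:I" for y
  proof -
   have "real p*R y:J" using ratio_multiple[OF I(1) Jr(1) I(4) _ that, of p] I(3) Jr(3) by simp
   then show ?thesis unfolding J'_def using p0 by (intro image_eqI[of _ _ "real p*R y"]) auto
  qed
  then show "I:{I:subs p J'. I <= Oo}" unfolding subs_def using I n by auto
 next
  fix I assume I: "I:{I:subs p J'. I <= Oo}"
  then have "J <= I" using subs_props(1)[OF p J'r(1)] pJ' by auto
  then show "I:{I:ideals n. J <= I}" using I n unfolding subs_def ideals_def by auto
 qed
 show ?thesis
 proof (cases "J <= pO p")
  case True
  then have "J' <= Oo" unfolding J'_def using p0(1) by (auto simp: pO_iff[OF p0(1)])
  then have "{I:subs p J'. I <= Oo} = subs p J'" unfolding subs_def by auto
  then show ?thesis using S card_subs[OF p J'r(1)] True by simp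
 next
  case False
  define I0 where "I0 = Oo Int J'"
  have JJ': "J <= J'"
  proof
   fix y assume "y:J"
   then have "real p*R y:J" by (rule rideal_nat[OF Jr(1)])
   then show "y:J'" unfolding J'_def using p0 by (intro image_eqI[of _ _ "real p*R y"]) auto
  qed
  have I0r: "rideal I0" unfolding I0_def using rideal_inter[OF rideal_O J'r(1)] .
  have ne1: "I0 ~= J'"
  proof
   assume "I0 = J'"
   then have "J' <= Oo" unfolding I0_def by blast
   then have "J <= pO p" unfolding pJ'[symmetric] pO_def by blast
   then show False using False by blast
  qed
  \<comment> \<open>Equality would force J into p O: for x in J with \<open>nv J x\<close> prime to
    p, the number n(x)/p lies in O and in J/p, hence in x O up to a unit at p, so p divides the
    conjugate of x and therefore x.\<close>
  have "J ~= I0"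
  proof
   assume eq: "J = I0"
   obtain x where x: "x:J" "~ int p dvd nv J x" using nv_primitive[OF Jr(1) p] by blast
   have xO: "x:Oo" using x Jr by blast
   define y where "y = (qn x/real p)*R qone"
   have "qn x/real p = of_int (int n*nv J x)" using qn_nv[OF Jr(1) x(1)] Jr(3) p0 by simp
   then have yO: "y:Oo" unfolding y_def using O_int[OF O_one] by metis
   have "real p*R y = x*.qcnj x" unfolding y_def qmul_qcnj using p0 by simp
   then have "real p*R y:J" using rideal_mul[OF Jr(1) x(1) O_cnj[OF xO]] by simp
   then have "y:J'" unfolding J'_def using p0 by (intro image_eqI[of _ _ "real p*R y"]) auto
   then have "y:J" using eq yO unfolding I0_def by blast
   then obtain a where a: "a:Oo" "of_int (nv J x)*R y = x*.a" using nv_multiple[OF Jr(1) x(1)] by blast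
   have x0: "x ~= 0" using x(2) nv_eqI[OF Jr(1), of 0 0] by auto
   have "qcnj x*.(of_int (nv J x)*R y) = qn x*R a" unfolding a(2) by (rule qmul_qcnj_left(2))
   then have "(of_int (nv J x)*(qn x/real p))*R qcnj x = qn x*R a" unfolding y_def by simp
   then have "qn x*R (of_int (nv J x)*R qcnj x) = qn x*R (real p*R a)"
    using p0 by (metis (no_types, lifting) mult.commute mult.left_commute nonzero_mult_div_cancel_left of_nat_0_less_iff less_irrefl scaleR_scaleR times_divide_eq_right)
   moreover have "qn x ~= 0" using x0 by simp
   ultimately have "of_int (nv J x)*R qcnj x = real p*R a" by (metis scaleR_left_imp_eq)
   then have "of_int (nv J x)*R qcnj x:pO p" unfolding pO_def using a(1) by (rule image_eqI)
   moreover have "real p*R qcnj x:pO p" unfolding pO_def using O_cnj[OF xO] by blast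
   ultimately have "qcnj x:pO p" using rideal_unit_multiple[OF rideal_pO[OF p0(1)] p x(2)] by blast
   then obtain w where w: "w:Oo" "qcnj x = real p*R w" unfolding pO_def by blast
   have xw: "x = real p*R qcnj w" using w(2) by (metis qcnj_qcnj qcnj_scaleR)
   have "J <= pO p"
   proof
    fix z assume z: "z:J"
    then obtain b where b: "b:Oo" "of_int (nv J x)*R z = x*.b" using nv_multiple[OF Jr(1) x(1)] by blast
    have "of_int (nv J x)*R z = real p*R (qcnj w*.b)" using arg_cong[OF xw, of "%x. x*.b"] b(2) by simp
    then have "of_int (nv J x)*R z:pO p" unfolding pO_def using O_mul[OF O_cnj[OF w(1)] b(1)] by (rule image_eqI)
    moreover have "real p*R z:pO p" unfolding pO_def using z Jr(2) by blast
    ultimately show "z:pO p" using rideal_unit_multiple[OF rideal_pO[OF p0(1)] p x(2)] by blast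
   qed
   then show False using False by blast
  qed
  then have NI0: "NI I0 = real p*NI J'"
   using NI_between[OF p J'r(1) I0r] JJ' Jr(2) ne1 unfolding pJ' I0_def by blast
  have "{I:subs p J'. I <= Oo} = {I0}"
  proof (intro set_eqI iffI)
   fix I assume "I:{I:subs p J'. I <= Oo}"
   then have "rideal I" "I <= I0" "NI I = NI I0" unfolding subs_def I0_def using NI0 I0_def by auto
   then show "I:{I0}" using rideal_eqI[OF I0r] by auto
  next
   fix I assume "I:{I0}"
   then show "I:{I:subs p J'. I <= Oo}" unfolding subs_def using I0r NI0 I0_def by auto
  qed
  then show ?thesis using S False by simp
 qed
qed

lemma ideals_in_pO:
 assumes p: "prime p"
 shows "card {J:ideals (n*p). J <= pO p} = (if p dvd n then card (ideals (n div p)) else 0)"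
proof -
 have p0: "p > 0" using p prime_gt_0_nat by auto
 have div: "EX I:ideals m. n = p*m & J = (*R) (real p) ` I" if J: "J:ideals (n*p)" "J <= pO p" and m: "m = n div p" for J m
 proof -
  have Jr: "rideal J" "NI J = real (n*p)" using J by (auto simp: ideals_def)
  let ?I = "(*R) (1/real p) ` J"
  have Ir: "rideal ?I" "NI ?I = (1/real p)^2*NI J" using NI_scale[OF Jr(1), of "1/real p"] p0 by auto
  have sub: "?I <= Oo" using J(2) p0 by (auto simp: pO_iff)
  obtain k where k: "NI ?I = real k" using NI_integral[OF Ir(1) sub] by blast
  have "real n = real (p * k)" using Ir(2) Jr(2) k p0 by (simp add: power2_eq_square field_simps)
  then have nk: "n = p * k" by (simp only: of_nat_eq_iff)
  moreover have "J = (*R) (real p) ` ?I" unfolding image_image using p0 by simp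
  ultimately show ?thesis using Ir k sub m p0 unfolding ideals_def by auto
 qed
 show ?thesis
 proof (cases "p dvd n")
  case False
  have "J ~: {J:ideals (n*p). J <= pO p}" for J
  proof
   assume "J:{J:ideals (n*p). J <= pO p}"
   then have "n = p*(n div p)" using div[of J "n div p"] by blast
   then show False using False by (metis dvd_triv_left)
  qed
  then have e: "{J:ideals (n*p). J <= pO p} = {}" by blast
  show ?thesis unfolding e using False by simp
 next
  case True
  have "{J:ideals (n*p). J <= pO p} = (%I. (*R) (real p) ` I) ` ideals (n div p)"
  proof (intro antisym subsetI)
   fix J assume "J:{J:ideals (n*p). J <= pO p}"
   then show "J:(%I. (*R) (real p) ` I) ` ideals (n div p)" using div by blast
  next
   fix J assume "J:(%I. (*R) (real p) ` I) ` ideals (n div p)"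
   then obtain I where I: "I:ideals (n div p)" "J = (*R) (real p) ` I" by blast
   have Ir: "rideal I" "I <= Oo" "NI I = real (n div p)" using I(1) by (auto simp: ideals_def)
   have "NI J = real (n*p)" "rideal J"
    using NI_scale[OF Ir(1), of "real p"] p0 Ir(3) I(2) True by (auto simp: power2_eq_square real_of_nat_div)
   moreover have "J <= pO p" unfolding I(2) pO_def using Ir(2) by blast
   ultimately show "J:{J:ideals (n*p). J <= pO p}" unfolding ideals_def using pO_sub_O by blast
  qed
  moreover have "inj_on (%I. (*R) (real p) ` I) (ideals (n div p))"
  proof (rule inj_onI)
   fix I K :: "quat set" assume eq: "(*R) (real p) ` I = (*R) (real p) ` K"
   have "inj ((*R) (real p) :: quat => quat)" using p0 by (auto intro: injI)
   from eq[unfolded inj_image_eq_iff[OF this]] show "I = K" .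
  qed
  ultimately show ?thesis using True by (simp add: card_image)
 qed
qed

text \<open>The Hecke relation: pairs J inside I of norms n p and n are counted once from I by
  \<open>card_subs\<close> and once from J by \<open>supers\<close>.\<close>

lemma ideals_recursion:
 assumes p: "prime p"
 shows "ram p ==> card (ideals (n*p)) = card (ideals n)"
  and "~ ram p ==> card (ideals (n*p))+p*(if p dvd n then card (ideals (n div p)) else 0) = (p+1)*card (ideals n)"
proof -
 define R where "R = {(I, J). I:ideals n & J:ideals (n*p) & J <= I}"
 have "R = (SIGMA I:ideals n. subs p I)"
  unfolding R_def Sigma_def subs_def ideals_def by (auto simp: mult.commute)
 moreover have "finite (subs p I)" if "I:ideals n" for I
 proof -
  have "subs p I <= ideals (n*p)" using that unfolding subs_def ideals_def by (auto simp: mult.commute)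
  then show ?thesis using finite_ideals finite_subset by blast
 qed
 ultimately have "card R = (SUM I:ideals n. card (subs p I))" using finite_ideals by simp
 also have "... = (SUM I:ideals n. if ram p then 1 else p+1)"
  by (intro sum.cong) (auto simp: card_subs[OF p] ideals_def)
 finally have 1: "card R = (if ram p then 1 else p+1)*card (ideals n)" by simp
 have "R = prod.swap ` (SIGMA J:ideals (n*p). {I:ideals n. J <= I})" unfolding R_def by force
 then have "card R = card (SIGMA J:ideals (n*p). {I:ideals n. J <= I})" by (simp add: card_image)
 also have "... = (SUM J:ideals (n*p). card {I:ideals n. J <= I})"
  using finite_ideals by (intro card_SigmaI) auto
 also have "... = (SUM J:ideals (n*p). if J <= pO p then (if ram p then 1 else p+1) else 1)"
  by (intro sum.cong supers[OF p]) auto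
 finally have 2: "card R = (SUM J:ideals (n*p). if J <= pO p then (if ram p then 1 else p+1) else 1)" .
 show "card (ideals (n*p)) = card (ideals n)" if "ram p" using 1 2 that by (simp cong: if_cong)
 show "card (ideals (n*p))+p*(if p dvd n then card (ideals (n div p)) else 0) = (p+1)*card (ideals n)" if "~ ram p"
 proof -
  have "(SUM J:ideals (n*p). if J <= pO p then p+1 else 1) = (SUM J:ideals (n*p). 1+(if J <= pO p then p else 0))"
   by (intro sum.cong) auto
  also have "... = card (ideals (n*p))+(SUM J:ideals (n*p). if J <= pO p then p else 0)"
   unfolding sum.distrib by simp
  also have "(SUM J:ideals (n*p). if J <= pO p then p else 0) = (SUM J:{J:ideals (n*p). J <= pO p}. p)"
   using sum.inter_filter[OF finite_ideals[of "n*p"], where g="%_. p" and P="%J. J <= pO p"] by simp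
  also have "... = p*card {J:ideals (n*p). J <= pO p}" by simp
  finally have 3: "(SUM J:ideals (n*p). if J <= pO p then p+1 else 1) =
   card (ideals (n*p))+p*card {J:ideals (n*p). J <= pO p}" .
  have "card R = (p+1)*card (ideals n)" using 1 that by (simp only: if_False)
  moreover have "card R = (SUM J:ideals (n*p). if J <= pO p then p+1 else 1)" using 2 that by (simp only: if_False)
  ultimately show ?thesis using 3 unfolding ideals_in_pO[OF p, of n] by (simp only:)
 qed
qed

definition cdiv :: "nat => nat set" where "cdiv n = {d. d dvd n & coprime d DD}"

theorem card_ideals: "n > 0 ==> card (ideals n) = \<Sum>(cdiv n)"
proof (induction n rule: less_induct)
 case (less n)
 show ?case
 proof (cases "n = 1")
  case True
  have "ideals 1 = {Oo}" unfolding ideals_def using rideal_O rideal_eqI[OF rideal_O] by auto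
  moreover have "cdiv 1 = {1}" by (auto simp: cdiv_def)
  ultimately show ?thesis using True by simp
 next
  case False
  then obtain p where p: "prime p" "p dvd n" using prime_factor_nat by blast
  then obtain m where m: "n = m*p" by (metis dvdE mult.commute)
  have p0: "p > 0" "p > 1" using p prime_gt_0_nat prime_gt_1_nat by auto
  have m0: "m > 0" "m < n" using m less.prems p0 by auto
  have IHm: "card (ideals m) = \<Sum>(cdiv m)" using less.IH m0 by blast
  have fin: "finite (cdiv k)" if "k > 0" for k unfolding cdiv_def using that by simp
  show ?thesis
  proof (cases "ram p")
   case True
   have "cdiv n = cdiv m"
   proof (intro set_eqI iffI)
    fix d assume "d:cdiv n"
    then have d: "d dvd m*p" "coprime d DD" by (auto simp: cdiv_def m)
    have "coprime d p" using d(2) ram_dvd_DD[OF p(1)] True by (meson coprime_divisors dvd_refl)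
    then show "d:cdiv m" using d by (simp add: cdiv_def coprime_dvd_mult_left_iff)
   qed (auto simp: cdiv_def m)
   then show ?thesis using ideals_recursion(1)[OF p(1) True, of m] IHm m by simp
  next
   case False
   have cop: "coprime p DD" using False ram_dvd_DD[OF p(1)] p(1) by (intro prime_imp_coprime) auto
   have un: "cdiv n = cdiv m Un (%d. p*d) ` cdiv m"
   proof (intro antisym subsetI)
    fix d assume "d:cdiv n"
    then have d: "d dvd m*p" "coprime d DD" by (auto simp: cdiv_def m)
    show "d:cdiv m Un (%d. p*d) ` cdiv m"
    proof (cases "p dvd d")
     case True
     then obtain k where k: "d = p * k" by auto
     then have "k:cdiv m" using d p0 by (simp add: cdiv_def mult.commute[of m])
     then show ?thesis using k by blast
    next
     case False
     then have "coprime d p" using p(1) by (metis coprime_commute prime_imp_coprime)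
     then show ?thesis using d by (simp add: cdiv_def coprime_dvd_mult_left_iff)
    qed
   next
    fix d assume "d:cdiv m Un (%d. p*d) ` cdiv m"
    then show "d:cdiv n" using cop by (auto simp: cdiv_def m mult.commute)
   qed
   \<comment> \<open>The divisors counted twice are p times the divisors of m/p, which matches the
     correction term of the Hecke relation.\<close>
   have int: "cdiv m Int (%d. p*d) ` cdiv m = (if p dvd m then (%d. p*d) ` cdiv (m div p) else {})"
   proof (cases "p dvd m")
    case True
    then obtain k where k: "m = p * k" by auto
    have "cdiv m Int (%d. p*d) ` cdiv m = (%d. p*d) ` cdiv k"
     using p0 cop by (auto simp: cdiv_def k)
    then show ?thesis using True k p0 by simp
   next
    case False
    then show ?thesis by (auto simp: cdiv_def dest: dvd_mult_left)
   qed
   have inj: "inj_on (%d. p*d) X" for X using p0 by (auto intro: inj_onI)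
   have sumim: "\<Sum>((%d. p*d) ` X) = p*\<Sum>X" for X
    by (simp add: sum.reindex[OF inj] sum_distrib_left)
   have "\<Sum>(cdiv n)+\<Sum>(cdiv m Int (%d. p*d) ` cdiv m) = \<Sum>(cdiv m)+\<Sum>((%d. p*d) ` cdiv m)"
    unfolding un using fin[OF m0(1)] by (intro sum.union_inter) auto
   then have eq: "\<Sum>(cdiv n)+p*(if p dvd m then \<Sum>(cdiv (m div p)) else 0) = (p+1)*\<Sum>(cdiv m)"
    unfolding int by (cases "p dvd m") (simp_all add: sumim)
   have "card (ideals n)+p*(if p dvd m then card (ideals (m div p)) else 0) = (p+1)*card (ideals m)"
    using ideals_recursion(2)[OF p(1) False, of m] m by simp
   moreover have "card (ideals (m div p)) = \<Sum>(cdiv (m div p))" if "p dvd m"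
   proof (rule less.IH)
    show "m div p < n" "m div p > 0" using m0 p0 that by (auto simp: div_greater_zero_iff dvd_imp_le intro: le_less_trans[OF div_le_dividend])
   qed
   ultimately show ?thesis using eq IHm by (simp split: if_splits)
  qed
 qed
qed

end

section \<open>Rank two lattices are free\<close>

lemma pi_ge_three: "pi >= 3"
 using sin_x_le_x[of "pi/6"] sin_30 by simp

context max_order
begin

text \<open>Distinct X and Y occur only at split p, where a unit of the order modulo p relates them.
  Writing 1 = e + d with e in X and d in Y, the element u = d s e + e conj(s0) d sends X into Y, and
  n(u) is tr(g s) modulo p with g = e s0 d; s is chosen to make this trace a unit.\<close>

lemma local_unit:
 assumes p: "prime p" and X: "X:subs p Oo" and Y: "Y:subs p Oo"
 shows "EX u:Oo. ~ pdiv p (qn u) & (ALL a:Oo. u*.a:Y \<longleftrightarrow> a:X)"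
proof (cases "X = Y")
 case True
 have "~ pdiv p (qn qone)" using pdiv_of_int[of p 1] prime_gt_1_nat[OF p] by simp
 then show ?thesis using True O_one by (intro bexI[of _ qone]) auto
next
 case False
 have p0: "p > 0" "p > 1" using p prime_gt_0_nat prime_gt_1_nat by auto
 have "~ ram p" using False X Y subs_ram by auto
 then have sp: "rad p = pO p" using p by (simp add: ram_def)
 have Xr: "rideal X" "X <= Oo" "NI X = real p" and Yr: "rideal Y" "Y <= Oo" "NI Y = real p"
  using X Y by (auto simp: subs_def)
 have pX: "pO p <= X" "pO p <= Y" "X ~= Oo" "Y ~= Oo" using subs_props[OF p rideal_O X] subs_props[OF p rideal_O Y] unfolding pO_def by auto
 define S where "S = {x+y | x y. x:X & y:Y}"
 have Sr: "rideal S" unfolding S_def using Xr Yr by (intro rideal_sum)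
 have sub: "X <= S" "Y <= S" "S <= Oo"
  unfolding S_def using rideal_zero[OF Xr(1)] rideal_zero[OF Yr(1)] Xr(2) Yr(2) O_add by force+
 have "S = Oo"
 proof (rule ccontr)
  assume "S ~= Oo"
  moreover have "S ~= pO p" using sub(1) pX(1) subs_props(3)[OF p rideal_O X] unfolding pO_def by blast
  ultimately have "NI S = real p" using NI_between_pO[OF p Sr _ sub(3)] pX(1) sub(1) by blast
  then have "X = S" "Y = S" using rideal_eqI[OF Sr Xr(1) sub(1)] rideal_eqI[OF Sr Yr(1) sub(2)] Xr Yr by auto
  then show False using False by simp
 qed
 then have "qone:S" using O_one by simp
 then obtain e d where ed: "e:X" "d:Y" "qone = e+d" unfolding S_def by blast
 have d: "d = qone-e" unfolding ed(3) by simp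
 have eO: "e:Oo" and dO: "d:Oo" using ed Xr Yr by auto
 have ne: "pdiv p (qn e)" and nd: "pdiv p (qn d)"
  unfolding pdiv_def using qn_nv[OF Xr(1) ed(1)] qn_nv[OF Yr(1) ed(2)] Xr Yr by auto
 have tre: "pdiv p (qtr e-1)"
 proof -
  have "qtr e-1 = qn e-qn d" unfolding d by (simp add: qn_diff)
  then show ?thesis using pdiv_diff[OF ne nd] by simp
 qed
 obtain s0 where s0: "s0:Oo" "e*.s0*.d ~: pO p" using split_block[OF p sp eO ne tre] unfolding d by metis
 define g where "g = e*.s0*.d"
 have gO: "g:Oo" unfolding g_def using eO dO s0 O_mul by simp
 obtain s where s: "s:Oo" "~ pdiv p (qtr (g*.s))" using s0 gO sp unfolding rad_def g_def by blast
 define u where "u = d*.s*.e+e*.qcnj s0*.d"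
 have uO: "u:Oo" unfolding u_def using O_add O_mul O_cnj eO dO s s0 by simp
 have ee: "e*.e-e:pO p"
 proof -
  have "e*.e-e = (qtr e-1)*R e-qn e*R qone" unfolding qmul_square scaleR_diff_left by simp
  then show ?thesis using pO_diff[OF p0(1) pdiv_scale_pO[OF tre eO] pdiv_scale_pO[OF ne O_one]] by simp
 qed
 have de: "d*.e:pO p" "d*.d-d:pO p"
 proof -
  have "d*.e = - (e*.e-e)" "d*.d-d = e*.e-e" unfolding d by (simp_all add: qring)
  then show "d*.e:pO p" "d*.d-d:pO p" using ee pO_diff[OF p0(1) rideal_zero[OF rideal_pO[OF p0(1)]] ee] by simp_all
 qed
 have nu: "~ pdiv p (qn u)"
 proof
  assume nu: "pdiv p (qn u)"
  have 1: "qn u = qn s*qn e*qn d+qn s0*qn d*qn e+qtr (d*.s*.e*.(qcnj d*.s0*.qcnj e))"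
   unfolding u_def qn_add by (simp add: qn_qmul qcnj_qmul qmul_assoc mult_ac)
  have "pdiv p (qn u-(qn s*qn e*qn d+qn s0*qn d*qn e))"
   by (intro pdiv_diff[OF nu] pdiv_add pdiv_mult nd ne Ints_mult O_integral eO dO s s0)
  then have 2: "pdiv p (qtr (d*.s*.e*.(qcnj d*.s0*.qcnj e)))" unfolding 1 by simp
  \<comment> \<open>Modulo p the elements e and d are conjugate to each other, since tr(e) = 1; this
    rewrites the mixed trace in n(u) as tr(g s).\<close>
  have c1: "e-qcnj d:pO p"
  proof -
   have "e-qcnj d = (qtr e-1)*R qone" unfolding d by (simp add: qcoords)
   then show ?thesis using pdiv_scale_pO[OF tre O_one] by simp
  qed
  have c2: "d-qcnj e:pO p"
  proof -
   have "qcnj e-d = (qtr e-1)*R qone" unfolding d qcnj_eq[of e] by (simp add: scaleR_diff_left)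
   then have "qcnj e-d:pO p" using pdiv_scale_pO[OF tre O_one] by simp
   then show ?thesis using pO_diff[OF p0(1) rideal_zero[OF rideal_pO[OF p0(1)]]] by fastforce
  qed
  have O: "d*.s*.e:Oo" "s0*.qcnj e:Oo" "d*.s*.e*.(e*.s0):Oo" "d*.s:Oo" "s0*.d:Oo" "s*.e*.s0:Oo"
   using O_mul O_cnj eO dO s s0 by simp_all
  have "d*.s*.e*.(e*.s0*.d)-d*.s*.e*.(qcnj d*.s0*.qcnj e) =
   d*.s*.e*.((e-qcnj d)*.(s0*.qcnj e))+d*.s*.e*.(e*.s0)*.(d-qcnj e)"
   by (simp add: qring)
  also have "...:pO p"
   by (intro pO_add[OF p0(1)] pO_mul(1)[OF O(1) pO_mul(2)[OF O(2) c1]] pO_mul(1)[OF O(3) c2])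
  finally have "pdiv p (qtr (d*.s*.e*.(e*.s0*.d)-d*.s*.e*.(qcnj d*.s0*.qcnj e)))" by (rule pO_qtr)
  from pdiv_add[OF this 2] have 3: "pdiv p (qtr (d*.s*.e*.(e*.s0*.d)))" by (simp add: qtr_diff)
  have "d*.s*.e*.(e*.s0*.d)-d*.s*.(e*.s0*.d) = d*.s*.((e*.e-e)*.(s0*.d))" by (simp add: qring)
  also have "...:pO p" by (intro pO_mul(1)[OF O(4) pO_mul(2)[OF O(5) ee]])
  finally have "pdiv p (qtr (d*.s*.e*.(e*.s0*.d)-d*.s*.(e*.s0*.d)))" by (rule pO_qtr)
  from pdiv_diff[OF 3 this] have 4: "pdiv p (qtr (d*.s*.(e*.s0*.d)))" by (simp add: qtr_diff)
  have "qtr (d*.s*.(e*.s0*.d)) = qtr (d*.d*.(s*.e*.s0))"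
   using qtr_commute[of "d*.s*.e*.s0" d] by (simp add: qmul_assoc)
  also have "... = qtr ((d*.d-d)*.(s*.e*.s0))+qtr (d*.(s*.e*.s0))" by (simp add: qmul_diff qtr_diff)
  also have "qtr (d*.(s*.e*.s0)) = qtr (g*.s)"
   unfolding g_def using qtr_commute[of "d*.s" "e*.s0"] by (simp add: qmul_assoc)
  finally have "qtr (g*.s) = qtr (d*.s*.(e*.s0*.d))-qtr ((d*.d-d)*.(s*.e*.s0))" by simp
  moreover have "pdiv p (qtr ((d*.d-d)*.(s*.e*.s0)))" by (rule pO_qtr[OF pO_mul(2)[OF O(6) de(2)]])
  ultimately have "pdiv p (qtr (g*.s))" using pdiv_diff[OF 4] by simp
  then show False using s(2) by blast
 qed
 have ue: "u*.e:Y"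
 proof -
  have "u*.e = d*.(s*.e*.e)+(e*.qcnj s0)*.(d*.e)" by (simp add: u_def qring)
  moreover have "d*.(s*.e*.e):Y" using rideal_mul[OF Yr(1) ed(2)] O_mul s eO by blast
  moreover have "(e*.qcnj s0)*.(d*.e):Y" using pO_mul(1)[OF O_mul[OF eO O_cnj[OF s0(1)]] de(1)] pX(2) by blast
  ultimately show ?thesis using rideal_add[OF Yr(1)] by simp
 qed
 have e_not: "e ~: pO p"
 proof
  assume "e:pO p"
  from pdiv_diff[OF pO_qtr[OF this] tre] show False using pdiv_of_int[OF p0(1), of 1] p0 by simp
 qed
 have Xe: "X = prin p e" using prin_eq[OF p X ed(1) e_not] .
 have fwd: "u*.a:Y" if "a:X" for a
 proof -
  obtain b c where bc: "b:Oo" "c:pO p" "a = e*.b+c" using \<open>a : X\<close> unfolding Xe prin_def by blast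
  have "u*.a = (u*.e)*.b+u*.c" by (simp add: bc qring)
  moreover have "u*.c:Y" using pO_mul(1)[OF uO bc(2)] pX(2) by blast
  ultimately show ?thesis using rideal_add[OF Yr(1) rideal_mul[OF Yr(1) ue bc(1)]] by simp
 qed
 define Z where "Z = {a:Oo. u*.a:Y}"
 have XZ: "X <= Z" unfolding Z_def using fwd Xr(2) by blast
 have Zr: "rideal Z"
  unfolding rideal_def
 proof (intro conjI ballI)
  show "0:Z" using O_zero rideal_zero[OF Yr(1)] by (simp add: Z_def)
  show "a-b:Z" if "a:Z" "b:Z" for a b
   using that O_diff rideal_diff[OF Yr(1)] by (simp add: Z_def qmul_diff)
  show "a*.b:Z" if "a:Z" "b:Oo" for a b
   using that O_mul rideal_mul[OF Yr(1)] by (simp add: Z_def qmul_assoc[symmetric])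
  show "EX x:Z. x ~= 0" using XZ Xr(1) unfolding rideal_def by blast
  show "EX m::nat. m > 0 & (ALL x:Z. real m*R x:Oo)" by (intro exI[of _ 1]) (auto simp: Z_def)
 qed
 have "Z ~= Oo"
 proof
  assume "Z = Oo"
  then have "u:Y" using O_one unfolding Z_def by force
  then show False using nu qn_nv[OF Yr(1)] Yr(3) unfolding pdiv_def by auto
 qed
 moreover have "Z ~= pO p" using XZ ed(1) e_not by blast
 ultimately have "NI Z = real p" using NI_between_pO[OF p Zr _ _] pX(1) XZ unfolding Z_def by blast
 then have "X = Z" using rideal_eqI[OF Zr Xr(1) XZ] Xr(3) by simp
 then show ?thesis using uO nu unfolding Z_def by blast
qed

section \<open>Isomorphisms between sums of two right ideals\<close>

definition sim :: "quat set => quat set => quat set => quat set => bool" where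
 "sim K I K' I' \<longleftrightarrow> (EX h. Det_sq h ~= 0 & mvec h ` (K \<times> I) = K' \<times> I')"

lemma sim_refl: "sim K I K I"
 unfolding sim_def by (intro exI[of _ qmat_id]) (auto simp: image_def)

lemma sim_trans: "sim K I K' I' ==> sim K' I' K'' I'' ==> sim K I K'' I''"
proof -
 assume "sim K I K' I'" "sim K' I' K'' I''"
 then obtain h g where h: "Det_sq h ~= 0" "mvec h ` (K \<times> I) = K' \<times> I'" "Det_sq g ~= 0" "mvec g ` (K' \<times> I') = K'' \<times> I''"
  unfolding sim_def by blast
 have "mvec (g \<odot> h) ` (K \<times> I) = mvec g ` mvec h ` (K \<times> I)" by (simp add: image_image mvec_mvec)
 then show ?thesis unfolding sim_def using h by (intro exI[of _ "g \<odot> h"]) (simp add: Det_sq_mmul)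
qed

lemma sim_sym: "sim K I K' I' ==> sim K' I' K I"
proof -
 assume "sim K I K' I'"
 then obtain h where h: "Det_sq h ~= 0" "mvec h ` (K \<times> I) = K' \<times> I'" unfolding sim_def by blast
 have "mvec (minv h) ` (K' \<times> I') = K \<times> I"
  unfolding h(2)[symmetric] by (simp add: image_image mvec_mvec minv_left[OF h(1)])
 then show ?thesis unfolding sim_def using h Det_sq_minv[OF h(1)] by (intro exI[of _ "minv h"]) simp
qed

lemma sim_swap: "sim K I I K"
 unfolding sim_def
 by (intro exI[of _ "(0, qone, qone, 0)"]) (auto simp: Det_sq_def image_def)

lemma sim_left: "a ~= 0 ==> sim K I ((*.) a ` K) I"
 unfolding sim_def
 by (intro exI[of _ "(a, 0, 0, qone)"]) (auto simp: Det_sq_def image_def)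

lemma simI:
 assumes "h \<odot> g = qmat_id" "!!v. v:A' \<times> B ==> mvec h v:C \<times> D" "!!v. v:C \<times> D ==> mvec g v:A' \<times> B"
 shows "sim A' B C D"
proof -
 have "Det_sq h*Det_sq g = 1" using assms(1) Det_sq_mmul[of h g] by simp
 then have "Det_sq h ~= 0" by auto
 moreover have "mvec h ` (A' \<times> B) = C \<times> D"
 proof (intro antisym subsetI)
  fix v assume "v:C \<times> D"
  moreover have "v = mvec h (mvec g v)" by (simp add: mvec_mvec assms(1))
  ultimately show "v:mvec h ` (A' \<times> B)" using assms(3) by blast
 qed (use assms(2) in blast)
 ultimately show ?thesis unfolding sim_def by blast
qed

text \<open>Schanuel's lemma for the two simple quotients \<open>X / X1\<close> and \<open>K / K1\<close>, which are isomorphic because they have the same norm.\<close>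

lemma sim_step:
 assumes p: "prime p" and X: "rideal X" "X1:subs p X" and K: "rideal K" "K1:subs p K"
 shows "sim X1 K X K1"
proof -
 have p0: "p > 0" using p prime_gt_0_nat by auto
 have X1: "rideal X1" "X1 <= X" and K1: "rideal K1" "K1 <= K" using X K by (auto simp: subs_def)
 obtain x where x: "x:X" "~ int p dvd nv X x" using nv_primitive[OF X(1) p] by blast
 obtain k where k: "k:K" "~ int p dvd nv K k" using nv_primitive[OF K(1) p] by blast
 define X0 where "X0 = {a:Oo. x*.a:X1}"
 define K0 where "K0 = {a:Oo. k*.a:K1}"
 note X0 = subs_pullback[OF p X(1) rideal_O X(2) primitive_quotient(1-3)[OF X(1) x(1)] x(2), folded X0_def]
 note K0 = subs_pullback[OF p K(1) rideal_O K(2) primitive_quotient(1-3)[OF K(1) k(1)] k(2), folded K0_def]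
 obtain u where u: "u:Oo" "~ pdiv p (qn u)" "!!a. a:Oo ==> u*.a:X0 \<longleftrightarrow> a:K0"
  using local_unit[OF p K0(1) X0(1)] by blast
 obtain n where n: "qn u = of_int n" using O_integral(1)[OF u(1)] by (auto elim: Ints_cases)
 have "~ int p dvd n*(nv X x*nv K k)"
  using u(2) x(2) k(2) p p0 by (simp add: n pdiv_of_int prime_dvd_mult_iff)
 then obtain m l where ml: "m*(n*(nv X x*nv K k)) = 1+int p*l" using prime_inverse[OF p] by blast
 \<comment> \<open>\<sigma> maps K to X and K1 to X1, \<theta> goes back, and both composites are
   multiplication by 1 + p l: they induce mutually inverse isomorphisms of K/K1 and X/X1. The factor
   m inverts, modulo p, the product of n(u) with the two values of \<open>nv\<close>.\<close>
 define \<sigma> where "\<sigma> = (1/NI K)*R (x*.u*.qcnj k)"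
 define \<theta> where "\<theta> = (of_int m/NI X)*R (k*.qcnj u*.qcnj x)"
 have qx: "(1/NI X)*R (qcnj x*.y):Oo" if "y:X" for y by (rule ideal_quotient[OF X(1) x(1) that])
 have qk: "(1/NI K)*R (qcnj k*.y):Oo" if "y:K" for y by (rule ideal_quotient[OF K(1) k(1) that])
 have s: "\<sigma>*.y = x*.(u*.((1/NI K)*R (qcnj k*.y)))" for y by (simp add: \<sigma>_def qmul_assoc)
 have t: "\<theta>*.y = of_int m*R (k*.(qcnj u*.((1/NI X)*R (qcnj x*.y))))" for y by (simp add: \<theta>_def qmul_assoc)
 have sK: "\<sigma>*.y:X" if "y:K" for y
  unfolding s by (intro rideal_mul[OF X(1) x(1)] O_mul u qk that)
 have tX: "\<theta>*.y:K" if "y:X" for y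
  unfolding t by (intro rideal_int[OF K(1)] rideal_mul[OF K(1) k(1)] O_mul O_cnj u qx that)
 have sK1: "\<sigma>*.y:X1" if "y:K1" for y
 proof -
  let ?a = "(1/NI K)*R (qcnj k*.y)"
  have "?a:K0" using K0(2) that by blast
  then have "u*.?a:X0" using u(3)[of ?a] unfolding K0_def by blast
  then show ?thesis unfolding s X0_def by blast
 qed
 have tX1: "\<theta>*.y:K1" if "y:X1" for y
 proof -
  let ?a = "(1/NI X)*R (qcnj x*.y)"
  have a: "?a:X0" using X0(2) that by blast
  then have aO: "?a:Oo" unfolding X0_def by blast
  have "u*.(qcnj u*.?a) = of_int n*R ?a" unfolding qmul_qcnj_left n ..
  moreover have "of_int n*R ?a:X0" using X0(1) a rideal_int unfolding subs_def by blast
  ultimately have "qcnj u*.?a:K0" using u(3)[OF O_mul[OF O_cnj[OF u(1)] aO]] by simp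
  then show ?thesis unfolding t K0_def using rideal_int[OF K1(1)] by blast
 qed
 have pKX: "of_int (int p*j)*R y:K1" if "y:K" for y j
  using subs_props(1)[OF p K] that rideal_int[OF K1(1), of "real p*R y" j] by (auto simp: mult.commute)
 have pXX: "of_int (int p*j)*R y:X1" if "y:X" for y j
  using subs_props(1)[OF p X] that rideal_int[OF X1(1), of "real p*R y" j] by (auto simp: mult.commute)
 have c: "(of_int m/NI X*(1/NI K))*(qn u*(qn x*qn k)) = of_int (1+int p*l)"
  unfolding ml[symmetric] n using qn_nv[OF X(1) x(1)] qn_nv[OF K(1) k(1)] NI_pos[OF X(1)] NI_pos[OF K(1)] by simp
 have ts: "\<theta>*.\<sigma> = of_int (1+int p*l)*R qone"
 proof -
  have "\<theta>*.\<sigma> = (of_int m/NI X*(1/NI K))*R (k*.(qcnj u*.(qcnj x*.(x*.(u*.qcnj k)))))"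
   by (simp add: \<theta>_def \<sigma>_def qmul_assoc)
  also have "... = ((of_int m/NI X*(1/NI K))*(qn u*(qn x*qn k)))*R qone"
   by (simp add: qmul_qcnj_left qmul_qcnj mult_ac)
  finally show ?thesis unfolding c .
 qed
 have st: "\<sigma>*.\<theta> = of_int (1+int p*l)*R qone"
 proof -
  have "\<sigma>*.\<theta> = (of_int m/NI X*(1/NI K))*R (x*.(u*.(qcnj k*.(k*.(qcnj u*.qcnj x)))))"
   by (simp add: \<theta>_def \<sigma>_def qmul_assoc)
  also have "... = ((of_int m/NI X*(1/NI K))*(qn u*(qn x*qn k)))*R qone"
   by (simp add: qmul_qcnj_left qmul_qcnj mult_ac)
  finally show ?thesis unfolding c .
 qed
 define q where "q = of_int (int p*(- l))*R qone"
 have q1: "q = qone - \<theta>*.\<sigma>" "q = qone - \<sigma>*.\<theta>" unfolding ts st q_def by (simp_all add: scaleR_add_left)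
 have qc: "q*.y = of_int (int p*(- l))*R y" "y*.q = of_int (int p*(- l))*R y" for y by (simp_all add: q_def)
 have comm: "q*.y = y*.q" for y unfolding qc ..
 show ?thesis
 proof (rule simI)
  \<comment> \<open>The matrix behind Schanuel's lemma: q is a multiple of p that equals both 1 -
    \<sigma> \<theta> and 1 - \<theta> \<sigma>, and the matrix with rows (1, \<sigma>), (-\<theta>,
    q) has as inverse the one with rows (q, -\<sigma>), (\<theta>, 1).\<close>
  have e1: "q+\<sigma>*.\<theta> = qone" "\<theta>*.\<sigma>+q = qone" using q1 by simp_all
  have e3: "- \<theta>*.q+q*.\<theta> = 0" using comm[of \<theta>] by simp
  show "(qone, \<sigma>, - \<theta>, q) \<odot> (q, - \<sigma>, \<theta>, qone) = qmat_id"
   using e1 e3 unfolding qmat_id_def by simp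
  fix v :: "quat \<times> quat"
  show "mvec (qone, \<sigma>, - \<theta>, q) v:X \<times> K1" if v: "v:X1 \<times> K"
  proof -
   obtain y z where yz: "v = (y, z)" "y:X1" "z:K" using v by auto
   have "y+\<sigma>*.z:X" using rideal_add[OF X(1)] sK yz X1(2) by blast
   moreover have "q*.z - \<theta>*.y:K1" unfolding qc by (intro rideal_diff[OF K1(1)] tX1 pKX yz)
   ultimately show ?thesis by (simp add: yz(1))
  qed
  show "mvec (q, - \<sigma>, \<theta>, qone) v:X1 \<times> K" if v: "v:X \<times> K1"
  proof -
   obtain y z where yz: "v = (y, z)" "y:X" "z:K1" using v by auto
   have "\<theta>*.y+z:K" using rideal_add[OF K(1)] tX yz K1(2) by blast
   moreover have "q*.y - \<sigma>*.z:X1" unfolding qc by (intro rideal_diff[OF X1(1)] sK1 pXX yz)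
   ultimately show ?thesis by (simp add: yz(1))
  qed
 qed
qed

lemma subs_nonempty:
 assumes "prime p" "rideal I"
 shows "EX J. J:subs p I"
proof (rule ccontr)
 assume "~ ?thesis"
 then have "subs p I = {}" by blast
 then have "card (subs p I) = 0" by simp
 then show False using card_subs[OF assms] by (simp split: if_splits)
qed

text \<open>On C the form \<open>nv J\<close> is divisible by p, hence also on C + p J, which
  therefore is not J. Either this sum has relative norm p itself, or it is p J and any subideal of
  relative norm p will do.\<close>

lemma subs_above:
 assumes p: "prime p" and C: "rideal C" and J: "rideal J" "C <= J" and m: "NI C = real (p*m)*NI J"
 shows "EX J1:subs p J. C <= J1"
proof -
 have p0: "p > 0" using p prime_gt_0_nat by auto
 let ?P = "(*R) (real p) ` J"
 define S where "S = {x+y | x y. x:C & y:?P}"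
 have Pr: "rideal ?P" using NI_scale[OF J(1), of "real p"] p0 by auto
 have Sr: "rideal S" unfolding S_def by (rule rideal_sum[OF C Pr])
 have CS: "C <= S" unfolding S_def using rideal_zero[OF Pr] by force
 have PS: "?P <= S" unfolding S_def using rideal_zero[OF C] by force
 have SJ: "S <= J" unfolding S_def using J(2) rideal_add[OF J(1)] rideal_nat[OF J(1)] by blast
 have "S ~= J"
 proof
  assume SJeq: "S = J"
  obtain j where j: "j:J" "~ int p dvd nv J j" using nv_primitive[OF J(1) p] by blast
  then obtain c y where cy: "c:C" "y:J" "j = c+real p*R y" using SJeq unfolding S_def by blast
  have "nv J c = int p*(int m*nv C c)"
   by (rule nv_eqI[OF J(1)]) (use qn_nv[OF C cy(1)] m in simp)
  moreover have "nv J (of_int 1*R c + of_int (int p)*R y) = 1^2*nv J c+(int p)^2*nv J y+1*int p*(nv J (c+y)-nv J c-nv J y)"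
   by (rule nv_linear[OF J(1) _ cy(2)]) (use cy(1) J(2) in blast)
  ultimately have "nv J j = int p*(int m*nv C c+int p*nv J y+(nv J (c+y)-nv J c-nv J y))"
   using cy(3) by (simp add: power2_eq_square algebra_simps)
  then show False using j(2) by simp
 qed
 show ?thesis
 proof (cases "S = ?P")
  case True
  obtain J1 where J1: "J1:subs p J" using subs_nonempty[OF p J(1)] by blast
  have "C <= J1" using subs_props(1)[OF p J(1) J1] CS True by (rule_tac subset_trans[of C S J1]) simp_all
  then show ?thesis using J1 by (rule_tac bexI)
 next
  case False
  then have "NI S = real p*NI J" using NI_between[OF p J(1) Sr PS SJ] \<open>S ~= J\<close> by blast
  then have "S:subs p J" unfolding subs_def using Sr SJ by blast
  then show ?thesis using CS by blast
 qed
qed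

text \<open>Induction along a common subideal C. By \<open>sim_step\<close>, lowering J to J1 at a
  prime p is compensated by enlarging the other summand Y to Y'; the same Y' serves for J and J', so
  the induction hypothesis for J1 and J1' closes the chain.\<close>

lemma sim_equal_norm:
 assumes "rideal C" "m > 0"
 shows "rideal J ==> rideal J' ==> rideal Y ==> C <= J ==> C <= J' ==> NI C = real m*NI J ==> NI C = real m*NI J' ==> sim J Y J' Y"
 using assms(2)
proof (induction m arbitrary: J J' Y rule: less_induct)
 case (less m)
 show ?case
 proof (cases "m = 1")
  case True
  then have "C = J" "C = J'" using rideal_eqI[OF less.prems(1) assms(1)] rideal_eqI[OF less.prems(2) assms(1)] less.prems by simp_all
  then show ?thesis by (simp add: sim_refl)
 next
  case False
  then obtain p where p: "prime p" "p dvd m" using prime_factor_nat by blast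
  then obtain k where k: "m = p * k" by auto
  have p1: "p > 1" using prime_gt_1_nat[OF p(1)] .
  have k0: "k > 0" "k < m" using k less.prems p1 by auto
  obtain J1 where J1: "J1:subs p J" "C <= J1" using subs_above[OF p(1) assms(1) less.prems(1,4), of k] less.prems k by auto
  obtain J1' where J1': "J1':subs p J'" "C <= J1'" using subs_above[OF p(1) assms(1) less.prems(2,5), of k] less.prems k by auto
  \<comment> \<open>A subideal of relative norm p in Y/p contains Y, and Y has relative norm p in
    it: this is the way up by p.\<close>
  let ?Y2 = "(*R) (1/real p) ` Y"
  have Y2: "rideal ?Y2" "NI ?Y2 = (1/real p)^2*NI Y" using NI_scale[OF less.prems(3), of "1/real p"] p1 by auto
  obtain Y' where Y': "Y':subs p ?Y2" using subs_nonempty[OF p(1) Y2(1)] by blast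
  have pY2: "(*R) (real p) ` ?Y2 = Y" unfolding image_image using p1 by simp
  have Y'r: "rideal Y'" "NI Y' = real p*NI ?Y2" "Y <= Y'" using Y' subs_props(1)[OF p(1) Y2(1) Y'] pY2 by (auto simp: subs_def)
  have YY': "Y:subs p Y'"
   unfolding subs_def using Y'r less.prems(3) Y2(2) p1 by (simp add: power2_eq_square)
  have "sim J1 Y' J Y" using sim_step[OF p(1) less.prems(1) J1(1) Y'r(1) YY'] .
  moreover have "sim J1' Y' J' Y" using sim_step[OF p(1) less.prems(2) J1'(1) Y'r(1) YY'] .
  moreover have "sim J1 Y' J1' Y'"
   by (rule less.IH[OF k0(2)]) (use J1 J1' Y'r k0 less.prems k in \<open>auto simp: subs_def\<close>)
  ultimately show ?thesis using sim_sym sim_trans by blast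
 qed
qed

text \<open>For p = 2 the element 1 suffices. For odd p the order modulo its radical is larger than
  the prime field, so some v of trace zero lies outside the radical, and s^2 + n(v) t^2 with n(v)
  prime to p represents every residue.\<close>

lemma unit_norm:
 assumes r: "ram p" and c: "~ int p dvd c"
 shows "EX x:Oo. int p dvd nv Oo x-c"
proof (cases "odd p")
 case False
 have p: "prime p" using r ram_prime by blast
 then have p2: "p = 2" using False primes_dvd_imp_eq two_is_prime_nat by blast
 have "nv Oo qone = 1" by (rule nv_eqI[OF rideal_O]) simp
 then show ?thesis using c p2 O_one by (intro bexI[of _ qone]) auto
next
 case True
 have p: "prime p" "p > 1" "p > 0" using r ram_prime prime_gt_1_nat prime_gt_0_nat by auto
 have T: "rideal (rad p)" "rad p <= Oo" "NI (rad p) = real p" using rideal_rad[OF p(3)] NI_rad[OF r] by (auto simp: rad_def)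
 define Z where "Z = {x. EX i::int. x-of_int i*R qone:rad p}"
 have Z: "0:Z" "!!x y. x:Z ==> y:Z ==> x-y:Z"
 proof -
  show "0:Z" unfolding Z_def using rideal_zero[OF T(1)] by (auto intro!: exI[of _ 0])
  fix x y assume "x:Z" "y:Z"
  then obtain i j where "x-of_int i*R qone:rad p" "y-of_int j*R qone:rad p" unfolding Z_def by auto
  from rideal_diff[OF T(1) this] have "(x-y)-of_int (i-j)*R qone:rad p" by (simp add: scaleR_diff_left algebra_simps)
  then show "x-y:Z" unfolding Z_def by blast
 qed
 \<comment> \<open>If the integers exhausted O modulo the radical, the index would be at most p, but
   it is p^2.\<close>
 have "EX v:Oo. v ~: Z"
 proof (rule ccontr)
  assume "~ ?thesis"
  then have all: "x:Z" if "x:Oo" for x using that by blast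
  define R where "R = (%i::int. of_int i*R qone) ` {0..<int p}"
  have "EX r:R. x-r:rad p" if "x:Oo" for x
  proof -
   obtain i :: int where i: "x-of_int i*R qone:rad p" using all[OF \<open>x : Oo\<close>] unfolding Z_def by blast
   have "x-of_int (i mod int p)*R qone = (x-of_int i*R qone)+real p*R (of_int (i div int p)*R qone)"
   proof -
    have "i = int p*(i div int p)+i mod int p" by simp
    then have "real_of_int i = real p * of_int (i div int p) + of_int (i mod int p)" by (metis of_int_add of_int_mult of_int_of_nat_eq)
    then show ?thesis by (simp add: scaleR_add_left)
   qed
   moreover have "real p*R (of_int (i div int p)*R qone):rad p" using pO_sub_rad O_int[OF O_one] unfolding pO_def by blast
   ultimately have "x-of_int (i mod int p)*R qone:rad p" using rideal_add[OF T(1) i] by metis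
   moreover have "i mod int p:{0..<int p}" using p by simp
   ultimately show ?thesis unfolding R_def by blast
  qed
  then have "covol (rad p) <= real (card R)*covol Oo"
   by (intro covol_le_cover lat_O lat_rideal T) (auto simp: R_def)
  also have "... <= real p*covol Oo"
   using covol_pos[OF lat_O] card_image_le[of "{0..<int p}" "%i. of_int i*R qone"] by (intro mult_right_mono) (auto simp: R_def)
  finally have "(real p)^2*covol Oo <= real p*covol Oo" using covol_rideal[OF T(1)] T(3) by simp
  then show False using covol_pos[OF lat_O] p by (simp add: power2_eq_square)
 qed
 then obtain v0 where v0: "v0:Oo" "v0 ~: Z" by blast
 obtain t where t: "qtr v0 = of_int t" using O_integral(2)[OF v0(1)] by (auto elim: Ints_cases)
 define v where "v = 2*R v0-of_int t*R qone"
 have vO: "v:Oo" unfolding v_def by (intro O_diff O_Ints v0 O_one) auto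
 have trv: "qtr v = 0" by (simp add: v_def qtr_diff t)
 have two: "~ int p dvd 2" using True p by (metis int_dvd_int_iff of_nat_numeral primes_dvd_imp_eq two_is_prime_nat dvd_refl)
 have "v ~: rad p"
 proof
  assume v: "v:rad p"
  have "of_int 2*R v0:Z" unfolding Z_def using v unfolding v_def by (intro CollectI exI[of _ t]) simp
  moreover have "real p*R v0:rad p" using pO_sub_rad v0(1) unfolding pO_def by blast
  then have "real p*R v0:Z" unfolding Z_def by (intro CollectI exI[of _ 0]) simp
  ultimately have "v0:Z" using unit_multiple_sub[of Z p 2 v0, OF Z p(1) two] by blast
  then show False using v0(2) by blast
 qed
 then have "~ int p dvd nv Oo v" using rad_iff[OF r, of v] vO qn_nv_O[OF vO] p by (simp add: pdiv_of_int)
 then obtain s t' where st: "int p dvd s^2+nv Oo v * t'^2-c" using binary_form_represents[OF p(1) True] by blast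
 define x where "x = of_int s*R qone + of_int t' *R v"
 have "nv Oo x = s^2+nv Oo v * t'^2"
  by (rule nv_eqI[OF rideal_O]) (simp add: x_def qn_add trv qn_nv_O[OF vO] mult.commute)
 moreover have "x:Oo" unfolding x_def by (intro O_add O_int O_one vO)
 ultimately show ?thesis using st by (intro bexI[of _ x]) auto
qed

text \<open>At one ramified p, an element of J with \<open>nv J\<close> prime to p is multiplied by
  an element of O of inverse norm. The primes are then combined with coefficients \<alpha> + \<beta>
  = 1, where \<alpha> is divisible by p and \<beta> by the primes already treated. The congruence
  makes the form in \<open>NI_is_norm\<close> integral.\<close>

lemma exists_nv_one:
 assumes J: "rideal J"
 shows "EX a:J. int DD dvd nv J a-1"
proof -
 have local: "EX b:J. int p dvd nv J b-1" if r: "ram p" for p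
 proof -
  have p: "prime p" using r ram_prime by blast
  obtain b where b: "b:J" "~ int p dvd nv J b" using nv_primitive[OF J p] by blast
  obtain k l where kl: "k*nv J b = 1+int p*l" using prime_inverse[OF p b(2)] by blast
  have "~ int p dvd k"
  proof
   assume "int p dvd k"
   then have "int p dvd 1+int p*l" using kl by (metis dvd_mult2)
   then have "int p dvd 1" by (metis dvd_add_left_iff dvd_triv_left)
   then show False using p by simp
  qed
  then obtain x where x: "x:Oo" "int p dvd nv Oo x-k" using unit_norm[OF r] by blast
  have "nv J (b*.x) = nv J b*nv Oo x"
   by (rule nv_eqI[OF J]) (simp add: qn_qmul qn_nv[OF J b(1)] qn_nv_O[OF x(1)])
  moreover have "nv J b*nv Oo x-1 = nv J b*(nv Oo x-k)+int p*l" using kl by (simp add: algebra_simps)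
  ultimately have "int p dvd nv J (b*.x)-1" using x(2) by simp
  then show ?thesis using rideal_mul[OF J b(1) x(1)] by blast
 qed
 have "EX a:J. ALL p:S. int p dvd nv J a-1" if "finite S" "!!p. p:S ==> ram p" for S
  using that
 proof (induction S rule: finite_induct)
  case empty then show ?case using rideal_zero[OF J] by auto
 next
  case (insert p S)
  then obtain a where a: "a:J" "!!q. q:S ==> int q dvd nv J a-1" by auto
  obtain b where b: "b:J" "int p dvd nv J b-1" using local insert by blast
  define m where "m = (\<Prod>S)"
  have pr: "prime p" "!!q. q:S ==> prime q" using insert ram_prime by auto
  have "~ int p dvd int m"
  proof
   assume "int p dvd int m"
   then have "p dvd m" by (simp only: int_dvd_int_iff)
   then obtain q where "q:S" "p dvd q" using pr(1) insert(1) unfolding m_def by (auto simp: prime_dvd_prod_iff)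
   then show False using pr insert(2) primes_dvd_imp_eq by metis
  qed
  then obtain u v where uv: "u*int m = 1+int p * v" using prime_inverse[OF pr(1)] by blast
  define \<alpha> \<beta> where "\<alpha> = - (int p * v)" and "\<beta> = u*int m"
  have ab: "\<beta> = 1 - \<alpha>" using uv by (simp add: \<alpha>_def \<beta>_def)
  define z where "z = of_int \<alpha> *R a + of_int \<beta> *R b"
  define w where "w = nv J (a+b)-nv J a-nv J b"
  have nz: "nv J z = \<alpha>^2*nv J a+\<beta>^2*nv J b+\<alpha>*\<beta>*w" unfolding z_def w_def by (rule nv_linear[OF J a(1) b(1)])
  have "int p dvd nv J z-1"
  proof -
   have "nv J z-1 = \<alpha>*(\<alpha>*nv J a+\<beta>*w+(\<alpha> - 2)*nv J b)+(nv J b-1)"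
    unfolding nz ab by (simp add: power2_eq_square algebra_simps)
   moreover have "int p dvd \<alpha>" by (simp add: \<alpha>_def)
   ultimately show ?thesis using b(2) by (metis dvd_add dvd_mult2)
  qed
  moreover have "int q dvd nv J z-1" if q: "q:S" for q
  proof -
   have al: "\<alpha> = 1 - \<beta>" using ab by simp
   have "nv J z-1 = \<beta>*(\<beta>*nv J b+\<alpha>*w+(\<beta> - 2)*nv J a)+(nv J a-1)"
    unfolding nz al by (simp add: power2_eq_square algebra_simps)
   moreover have "int q dvd int m" using q insert(1) unfolding m_def by (simp add: dvd_prodI)
   then have "int q dvd \<beta>" unfolding \<beta>_def by simp
   ultimately show ?thesis using a(2)[OF q] by (metis dvd_add dvd_mult2)
  qed
  moreover have "z:J" unfolding z_def by (intro rideal_add rideal_int J a b)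
  ultimately show ?case by blast
 qed
 then obtain a where a: "a:J" "!!p. ram p ==> int p dvd nv J a-1" using finite_ram by (metis mem_Collect_eq)
 then have "int (\<Prod>{p. ram p}) dvd nv J a-1" using finite_ram ram_prime by (intro prod_primes_dvd) auto
 then show ?thesis using a(1) by (auto simp: DD_def)
qed

text \<open>Minkowski's theorem for the lattice of pairs \<open>(x, a x + j)\<close>, on which \<open>n x - n y / N J\<close> takes integral values.\<close>

lemma NI_is_norm:
 assumes J: "rideal J"
 shows "EX a:A. a ~= 0 & NI J = qn a"
proof -
 define m where "m = NI J"
 have m: "m > 0" using NI_pos[OF J] by (simp add: m_def)
 \<comment> \<open>For x in the inverse different, D n(x) is an integer. With n(a)/m congruent to 1
   modulo D, the denominators of n(x) and n(a x + j)/m cancel in the difference.\<close>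
 obtain a where a: "a:J" "int DD dvd nv J a-1" using exists_nv_one[OF J] by blast
 define L where "L = {(x, a*.x+j) | x j. x:qdual Oo & j:J}"
 obtain B1 B2 where B: "fdom (qdual Oo) B1" "fdom J B2" using fdom_exists lat_qdual_O lat_rideal[OF J] by meson
 have fd: "fdom L (B1 \<times> B2)" unfolding L_def by (rule fdom_shear[OF B])
 have "L = (%(x, j). (x, a*.x+j)) ` (qdual Oo \<times> J)" unfolding L_def by auto
 then have cL: "countable L" using lat_countable[OF lat_qdual_O] lat_countable[OF lat_rideal[OF J]] by simp
 \<comment> \<open>Differences of points of S have n(x) < 1 and n(y)/m < 1, so the integer n(x) -
   n(y)/m vanishes on the lattice vector that is found, and m becomes n(y)/n(x).\<close>
 define S where "S = ball (0::quat) (1/2) \<times> ball (0::quat) (sqrt m/2)"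
 have "emeasure lborel (B1 \<times> B2) = ennreal (covol (qdual Oo))*ennreal (covol J)"
  using B emeasure_fdom[OF lat_qdual_O B(1)] emeasure_fdom[OF lat_rideal[OF J] B(2)]
  by (subst emeasure_Times) (auto simp: fdom_def)
 also have "... = ennreal (m^2/16)"
 proof -
  have "covol (qdual Oo)*covol J = (covol (qdual Oo)*covol Oo)*m^2" using covol_rideal[OF J] by (simp add: m_def)
  also have "... = m^2/16" unfolding covol_qdual by simp
  finally show ?thesis using covol_pos[OF lat_qdual_O] covol_pos[OF lat_rideal[OF J]] by (simp add: ennreal_mult[symmetric])
 qed
 finally have vol: "emeasure lborel (B1 \<times> B2) = ennreal (m^2/16)" .
 have ball4: "emeasure lborel (ball (0::quat) r) = ennreal (pi^2/2*r^4)" if "r >= 0" for r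
  using emeasure_ball[OF that, of "0::quat"] by (simp add: unit_ball_vol_4)
 have "emeasure lborel S = ennreal (pi^2/2*(1/2)^4)*ennreal (pi^2/2*(sqrt m/2)^4)"
  unfolding S_def using m by (simp add: emeasure_Times ball4)
 also have "... = ennreal (pi^4*m^2/1024)"
 proof -
  have "(sqrt m)^4 = m^2" using m by (simp add: power4_eq_xxxx power2_eq_square)
  then have "pi^2/2*(1/2)^4*(pi^2/2*(sqrt m/2)^4) = pi^4*m^2/1024"
   by (simp add: power_divide field_simps)
  then show ?thesis by (subst ennreal_mult[symmetric]) auto
 qed
 finally have volS: "emeasure lborel S = ennreal (pi^4*m^2/1024)" .
 \<comment> \<open>S has volume pi^4 m^2/1024 against a covolume of m^2/16, so pi^4 > 64 is what is
   needed.\<close>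
 have "pi^4 >= 3^4" by (intro power_mono pi_ge_three) auto
 then have "m^2*64 < m^2*pi^4" using m by (intro mult_strict_left_mono) auto
 then have "emeasure lborel (B1 \<times> B2) < emeasure lborel S"
  unfolding vol volS using m by (subst ennreal_less_iff) (auto simp: mult.commute)
 moreover have "S:sets borel" unfolding S_def borel_prod[symmetric] by auto
 ultimately obtain k l w where kl: "k:L" "l:L" "k ~= l" "w-k:S" "w-l:S"
  using minkowski[OF fd cL] by blast
 obtain x1 j1 where k: "k = (x1, a*.x1+j1)" "x1:qdual Oo" "j1:J" using kl(1) unfolding L_def by blast
 obtain x2 j2 where l: "l = (x2, a*.x2+j2)" "x2:qdual Oo" "j2:J" using kl(2) unfolding L_def by blast
 define x j y where "x = x1-x2" and "j = j1-j2" and "y = a*.x+j"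
 have xD: "x:qdual Oo" unfolding x_def using k l lat_diff[OF lat_qdual_O] by blast
 have jJ: "j:J" unfolding j_def using k l rideal_diff[OF J] by blast
 obtain w1 w2 where w: "w = (w1, w2)" by (cases w)
 have nx: "norm x < 1"
 proof -
  have "norm (w1-x1) < 1/2" "norm (w1-x2) < 1/2" using kl(4,5) k l by (auto simp: S_def w)
  moreover have "x = (w1-x2)-(w1-x1)" by (simp add: x_def)
  ultimately show ?thesis using norm_triangle_ineq4[of "w1-x2" "w1-x1"] by simp
 qed
 have ny: "norm y < sqrt m"
 proof -
  have "norm (w2-(a*.x1+j1)) < sqrt m/2" "norm (w2-(a*.x2+j2)) < sqrt m/2" using kl(4,5) k l by (auto simp: S_def w)
  moreover have "y = (w2-(a*.x2+j2))-(w2-(a*.x1+j1))" by (simp add: x_def y_def j_def qmul_diff)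
  ultimately show ?thesis using norm_triangle_ineq4[of "w2-(a*.x2+j2)" "w2-(a*.x1+j1)"] by simp
 qed
 \<comment> \<open>If x were 0, then y = j would be a nonzero element of J of norm below
   \<open>NI J\<close>.\<close>
 have x0: "x ~= 0"
 proof
  assume x0: "x = 0"
  then have "y = j" "k ~= l" using kl by (simp_all add: y_def)
  then have "j ~= 0" using k l x0 by (auto simp: x_def j_def)
  then have "nv J j >= 1" using nv_pos[OF J jJ] by simp
  then have "m*1 <= m * of_int (nv J j)" using m by (intro mult_left_mono) auto
  then have "qn j >= m" using qn_nv[OF J jJ] by (simp add: m_def)
  moreover have "qn j < m"
  proof -
   have "(norm y)^2 < (sqrt m)^2" using ny by (intro power_strict_mono) auto
   then show ?thesis using m \<open>y = j\<close> by (simp add: qn_norm)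
  qed
  ultimately show False by simp
 qed
 have "qn x-qn y/m:\<int>"
 proof -
  obtain v where v: "v:PP" "x = (1/real DD)*R v" using xD unfolding qdual_PP by auto
  have qx: "qn x = of_int (nv PP v)/real DD"
   using qn_nv[OF rideal_PP v(1)] NI_PP DD_pos by (simp add: v(2) power2_eq_square)
  obtain t where t: "nv J a-1 = int DD*t" using a(2) by auto
  have qa: "qn a = m*(1+real DD * of_int t)"
  proof -
   have "nv J a = 1+int DD*t" using t by simp
   then show ?thesis using qn_nv[OF J a(1)] by (simp add: m_def)
  qed
  have "(1/NI J)*R (qcnj j*.a):Oo" by (rule ideal_quotient[OF J jJ a(1)])
  then have "qtr (x*.((1/NI J)*R (qcnj j*.a))):\<int>" using xD unfolding qdual_def by blast
  moreover have "qtr ((a*.x)*.qcnj j) = qtr (x*.(qcnj j*.a))" using qtr_cyclic[of a x "qcnj j"] by (simp add: qmul_assoc)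
  ultimately have tr: "qtr ((a*.x)*.qcnj j)/m:\<int>" by (simp add: m_def)
  have "qn y/m = qn a*qn x/m+qn j/m+qtr ((a*.x)*.qcnj j)/m"
   by (simp add: y_def qn_add qn_qmul add_divide_distrib)
  also have "qn a*qn x/m = qn x + of_int (t*nv PP v)"
   unfolding qa qx using m DD_pos by (simp add: field_simps)
  also have "qn j/m = of_int (nv J j)" using qn_nv[OF J jJ] m by (simp add: m_def)
  finally have "qn x-qn y/m = - (of_int (t*nv PP v) + of_int (nv J j)+qtr ((a*.x)*.qcnj j)/m)" by simp
  also have "...:\<int>" using tr by (intro Ints_minus Ints_add) auto
  finally show ?thesis .
 qed
 moreover have "\<bar>qn x-qn y/m\<bar> < 1"
 proof -
  have "(norm x)^2 < 1^2" "(norm y)^2 < (sqrt m)^2" using nx ny by (intro power_strict_mono; simp)+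
  then have "qn x < 1" "qn y < m" using m by (simp_all add: qn_norm)
  then have "qn x < 1" "qn y/m < 1" "qn x >= 0" "qn y/m >= 0" using m by auto
  then show ?thesis by linarith
 qed
 ultimately have eq: "qn x = qn y/m" by (metis Ints_nonzero_abs_less1 eq_iff_diff_eq_0)
 have xA: "x:A"
 proof -
  obtain k :: nat where "k > 0" "real k*R x:Oo" using qdual_denominator[OF xD] by blast
  then show ?thesis using A_scale[OF _ subsetD[OF O_sub_A], of "1/real k" "real k*R x"] by simp
 qed
 have yA: "y:A" unfolding y_def using rideal_A[OF J] a(1) jJ xA A_mul A_add by blast
 have "qn (y*.qinv x) = m" using eq m x0 by (simp add: qn_qmul field_simps)
 moreover have "y*.qinv x:A" using A_mul[OF yA A_inv[OF xA]] .
 moreover have "y*.qinv x ~= 0" using calculation(1) m by auto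
 ultimately show ?thesis unfolding m_def by metis
qed

text \<open>Dividing K by an element of norm \<open>NI K\<close> gives an ideal of norm one; it and
  O then have the same relative norm over their intersection, as \<open>sim_equal_norm\<close> asks.
  The two summands are treated one after the other.\<close>

theorem sim_free:
 assumes "rideal K" "rideal I"
 shows "sim Oo Oo K I"
proof -
 have *: "sim K Y Oo Y" if K: "rideal K" and Y: "rideal Y" for K Y
 proof -
  obtain a where a: "a:A" "a ~= 0" "NI K = qn a" using NI_is_norm[OF K] by blast
  define K' where "K' = (*.) (qinv a) ` K"
  have K': "rideal K'" "NI K' = 1"
   unfolding K'_def using rideal_left[OF K A_inv[OF a(1)]] NI_left[OF K A_inv[OF a(1)]] a by auto
  have C: "rideal (K' Int Oo)" by (rule rideal_inter[OF K'(1) rideal_O])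
  obtain m where m: "m > 0" "NI (K' Int Oo) = NI K'*real m" using NI_sub[OF K'(1) C] by blast
  have "sim K' Y Oo Y"
   by (rule sim_equal_norm[OF C m(1) K'(1) rideal_O Y]) (use m K' in auto)
  moreover have "sim K Y K' Y" unfolding K'_def using a by (intro sim_left) simp
  ultimately show ?thesis using sim_trans by blast
 qed
 have "sim K I Oo I" by (rule *[OF assms])
 moreover have "sim I Oo Oo Oo" by (rule *[OF assms(2) rideal_O])
 ultimately show ?thesis using sim_trans sim_sym sim_swap by blast
qed

end

section \<open>Orbits of integral rows\<close>

context max_order
begin

text \<open>Matrices of isomorphisms from O + O onto K + I; their second rows are the rows that
  generate I with complement K.\<close>

definition Frames :: "quat set => quat set => qmat set" where
 "Frames K I = {h. Det_sq h ~= 0 & mvec h ` (Oo \<times> Oo) = K \<times> I}"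

lemma Det_sq_integral:
 assumes K: "rideal K" "a:K" "b:K" and I: "rideal I" "c:I" "d:I"
 shows "Det_sq (a, b, c, d)/(NI K*NI I):\<int>"
proof -
 let ?x = "(1/NI K)*R (qcnj b*.a)" and ?y = "(1/NI I)*R (qcnj c*.d)"
 have "qtr (?x*.?y):\<int>" by (intro O_integral O_mul ideal_quotient K I)
 moreover have "qtr (a*.qcnj c*.d*.qcnj b) = qtr (qcnj b*.a*.(qcnj c*.d))" by (metis qtr_commute qmul_assoc)
 then have "Det_sq (a, b, c, d)/(NI K*NI I) =
   of_int (nv K a*nv I d+nv K b*nv I c)-qtr (?x*.?y)"
  using NI_pos[OF K(1)] NI_pos[OF I(1)] qn_nv[OF K(1,2)] qn_nv[OF K(1,3)] qn_nv[OF I(1,2)] qn_nv[OF I(1,3)]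
  by (simp add: Det_sq_def qn_qmul field_simps)
 ultimately show ?thesis by (metis Ints_diff Ints_of_int)
qed

lemma mvec_O_image:
 assumes "mvec (a, b, c, d) ` (Oo \<times> Oo) <= K \<times> I"
 shows "a:K" "b:K" "c:I" "d:I"
proof -
 have "mvec (a, b, c, d) (qone, 0):K \<times> I" "mvec (a, b, c, d) (0, qone):K \<times> I"
  using assms O_one O_zero by blast+
 then show "a:K" "b:K" "c:I" "d:I" by simp_all
qed

text \<open>\<open>Det_sq h\<close> divided by \<open>NI K*NI I\<close> is an integer, and so is the
  inverse quotient: diag(x, y) with x in K and y in I factors through h, and the values of
  \<open>nv\<close> on K and on I have no common divisor.\<close>

lemma Det_sq_frame:
 assumes K: "rideal K" and I: "rideal I" and h: "h:Frames K I"
 shows "Det_sq h = NI K*NI I"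
proof -
 let ?N = "NI K*NI I" and ?D = "Det_sq h"
 have N: "?N > 0" using NI_pos[OF K] NI_pos[OF I] by simp
 have D: "?D > 0" using h Det_sq_nonneg[of h] by (simp add: Frames_def)
 have "?D/?N:\<int>"
 proof (cases h)
  case (1 a b c d)
  then show ?thesis using h mvec_O_image[of a b c d K I] Det_sq_integral[OF K _ _ I] by (simp add: Frames_def)
 qed
 moreover have "of_int (nv K x)*(of_int (nv I y)*(?N/?D)):\<int>" if xy: "x:K" "y:I" for x y
 proof -
  have "(x, 0):mvec h ` (Oo \<times> Oo)" "(0, y):mvec h ` (Oo \<times> Oo)"
   using h xy rideal_zero[OF K] rideal_zero[OF I] by (auto simp: Frames_def)
  then obtain p q s t where g: "p:Oo" "q:Oo" "s:Oo" "t:Oo" "(x, 0) = mvec h (p, s)" "(0, y) = mvec h (q, t)"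
   by (elim imageE) auto
  have "(x, 0, 0, y) = h \<odot> (p, q, s, t)" using g(5,6) by (cases h) simp
  then have "Det_sq (x, 0, 0, y) = ?D*Det_sq (p, q, s, t)" by (simp only: Det_sq_mmul)
  moreover have "Det_sq (x, 0, 0, y) = qn x*qn y" by (simp add: Det_sq_def qn_qmul)
  ultimately have "qn x*qn y = ?D*Det_sq (p, q, s, t)" by simp
  moreover have "Det_sq (p, q, s, t):\<int>" using Det_sq_integral[OF rideal_O _ _ rideal_O] g by simp
  ultimately show ?thesis using qn_nv[OF K xy(1)] qn_nv[OF I xy(2)] D by (simp add: field_simps)
 qed
 then have "of_int (nv I y)*(?N/?D):\<int>" if "y:I" for y using nv_cancel[OF K] that by blast
 then have "?N/?D:\<int>" by (rule nv_cancel[OF I])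
 ultimately obtain i j :: int where ij: "?D/?N = of_int i" "?N/?D = of_int j" by (auto elim!: Ints_cases)
 have "real_of_int i*real_of_int j = 1" unfolding ij[symmetric] using D NI_pos[OF K] NI_pos[OF I] by simp
 then have "i*j = 1" by (metis of_int_mult of_int_eq_1_iff)
 moreover have "real_of_int i > 0" unfolding ij(1)[symmetric] using N D by simp
 ultimately have "i = 1" by (auto simp: zmult_eq_1_iff)
 then show ?thesis using ij(1) N by (simp add: field_simps)
qed

section \<open>Rows, the ideals they generate, and complements\<close>

definition rowspan :: "quat \<times> quat => quat set" where
 "rowspan v = (%u. fst v *. fst u+snd v *. snd u) ` (Oo \<times> Oo)"

lemma snd_mvec: "snd (mvec h u) = fst (mrow2 h)*.fst u+snd (mrow2 h)*.snd u"
 by (cases h; cases u) simp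

lemma frames_rowspan: "rideal K ==> h:Frames K I ==> rowspan (mrow2 h) = I"
proof -
 assume K: "rideal K" and h: "h:Frames K I"
 have "rowspan (mrow2 h) = snd ` (mvec h ` (Oo \<times> Oo))" unfolding rowspan_def image_image snd_mvec ..
 then show ?thesis using h rideal_zero[OF K] by (auto simp: Frames_def)
qed

lemma rideal_rowspan:
 assumes v: "c:Oo" "d:Oo" "(c, d) ~= 0"
 shows "rideal (rowspan (c, d))" "rowspan (c, d) <= Oo"
proof -
 show sub: "rowspan (c, d) <= Oo" unfolding rowspan_def using v O_add O_mul by auto
 have m: "c*.x+d*.y:rowspan (c, d)" if "x:Oo" "y:Oo" for x y
  unfolding rowspan_def by (rule image_eqI[of _ _ "(x, y)"]) (use that in auto)
 have "c:rowspan (c, d)" "d:rowspan (c, d)" "0:rowspan (c, d)"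
  using m[OF O_one O_zero] m[OF O_zero O_one] m[OF O_zero O_zero] by simp_all
 moreover have "x-y:rowspan (c, d)" if xy: "x:rowspan (c, d)" "y:rowspan (c, d)" for x y
 proof -
  obtain a b a' b' where o: "a:Oo" "b:Oo" "a':Oo" "b':Oo" "x = c*.a+d*.b" "y = c*.a'+d*.b'"
   using xy by (auto simp: rowspan_def)
  then have "x-y = c*.(a-a')+d*.(b-b')" by (simp add: qmul_diff)
  then show ?thesis using m O_diff o by simp
 qed
 moreover have "x*.y:rowspan (c, d)" if xy: "x:rowspan (c, d)" "y:Oo" for x y
 proof -
  obtain a b where o: "a:Oo" "b:Oo" "x = c*.a+d*.b" using xy by (auto simp: rowspan_def)
  then have "x*.y = c*.(a*.y)+d*.(b*.y)" by (simp add: qring)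
  then show ?thesis using m O_mul o xy by simp
 qed
 moreover have "EX x:rowspan (c, d). x ~= 0" using v(3) calculation(1,2) by (auto simp: zero_prod_def)
 ultimately show "rideal (rowspan (c, d))" unfolding rideal_def using sub by (auto intro!: exI[of _ 1])
qed

text \<open>The map from O^2 onto I given by the row splits. The integers k for which k times the
  identity of I lifts form an ideal of the integers (\<open>T\<close>); it contains every
  \<open>nv I x\<close>, hence 1.\<close>

lemma row_splitting:
 assumes v: "c:Oo" "d:Oo" "(c, d) ~= 0"
 shows "EX p q. c*.p+d*.q = qone & (ALL x:rowspan (c, d). p*.x:Oo & q*.x:Oo)"
proof -
 note I = rideal_rowspan[OF v]
 let ?I = "rowspan (c, d)"
 define T where "T = {k::int. EX p q. c*.p+d*.q = of_int k*R qone & (ALL x:?I. p*.x:Oo & q*.x:Oo)}"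
 have comb: "k-j*l:T" if kl: "k:T" "l:T" for k l j
 proof -
  obtain p q where 1: "c*.p+d*.q = of_int k*R qone" "!!x. x:?I ==> p*.x:Oo & q*.x:Oo" using kl(1) unfolding T_def by blast
  obtain p' q' where 2: "c*.p'+d*.q' = of_int l*R qone" "!!x. x:?I ==> p'*.x:Oo & q'*.x:Oo" using kl(2) unfolding T_def by blast
  let ?p = "p-of_int j*R p'" and ?q = "q-of_int j*R q'"
  have "c*.?p+d*.?q = (c*.p+d*.q)-of_int j*R (c*.p'+d*.q')" by (simp add: qmul_diff scaleR_add_right)
  then have "c*.?p+d*.?q = of_int (k-j*l)*R qone" unfolding 1 2 by (simp add: scaleR_diff_left)
  moreover have "ALL x:?I. ?p*.x:Oo & ?q*.x:Oo" using 1(2) 2(2) O_diff O_int by (simp add: qmul_diff)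
  ultimately show ?thesis unfolding T_def by blast
 qed
 have nvT: "nv ?I x:T" if x: "x:?I" for x
 proof -
  obtain a b where ab: "a:Oo" "b:Oo" "x = c*.a+d*.b" using x by (auto simp: rowspan_def)
  let ?y = "(1/NI ?I)*R qcnj x"
  have "c*.(a*.?y)+d*.(b*.?y) = x*.?y" unfolding ab by (simp add: qring)
  also have "... = of_int (nv ?I x)*R qone" using qn_nv[OF I(1) x] NI_pos[OF I(1)] by (simp add: qmul_qcnj)
  finally have "c*.(a*.?y)+d*.(b*.?y) = of_int (nv ?I x)*R qone" .
  moreover have "(e*.?y)*.z:Oo" if "e:Oo" "z:?I" for e z
   using O_mul[OF that(1) ideal_quotient[OF I(1) x that(2)]] by (simp add: qmul_assoc)
  ultimately show ?thesis using ab(1,2) unfolding T_def by blast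
 qed
 obtain x0 where x0: "x0:?I" "x0 ~= 0" using I(1) unfolding rideal_def by blast
 define m where "m = (LEAST n. n > 0 & int n:T)"
 have ex: "nat (nv ?I x0) > 0 & int (nat (nv ?I x0)):T" using nv_pos[OF I(1) x0] nvT[OF x0(1)] by simp
 have m: "m > 0" "int m:T" using LeastI[of "%n. n > 0 & int n:T", OF ex] by (auto simp: m_def)
 have least: "n >= m" if "n > 0" "int n:T" for n using that Least_le[of "%n. n > 0 & int n:T" n] by (simp add: m_def)
 have dv: "int m dvd k" if "k:T" for k
 proof (rule ccontr)
  assume "~ int m dvd k"
  then have "k mod int m ~= 0" by (simp add: dvd_eq_mod_eq_0)
  then have nz: "k mod int m > 0" using pos_mod_sign[of "int m" k] m(1) by linarith
  have "k mod int m:T" using comb[OF that m(2), of "k div int m"] by (simp add: minus_div_mult_eq_mod)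
  then have "nat (k mod int m) >= m" using nz by (intro least) auto
  moreover have "k mod int m < int m" using m(1) by simp
  ultimately show False using nz by linarith
 qed
 have "1/real m:\<int>"
 proof (rule nv_cancel[OF I(1)])
  fix x assume "x:?I"
  then obtain j where "nv ?I x = int m*j" using dv nvT by blast
  then show "of_int (nv ?I x)*(1/real m):\<int>" using m(1) by simp
 qed
 then obtain j :: int where "1/real m = of_int j" by (elim Ints_cases)
 then have "real_of_int (j*int m) = 1" using m(1) by (simp add: field_simps)
 then have "j*int m = 1" using of_int_eq_1_iff by blast
 then have "m = 1" using m(1) by (auto simp: zmult_eq_1_iff)
 then show ?thesis using m(2) unfolding T_def by simp
qed

text \<open>With a splitting (p, q), the complement of I is the kernel of the row, seen through its
  second coordinate \<open>snd u-q*.(c*.fst u+d*.snd u)\<close>. That coordinate is injective on the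
  kernel only for nonzero c, so c = 0 is treated apart.\<close>

lemma frame_exists:
 assumes v: "c:Oo" "d:Oo" "(c, d) ~= 0"
 shows "EX K. rideal K & (EX h:Frames K (rowspan (c, d)). mrow2 h = (c, d))"
proof (cases "c = 0")
 case True
 have "mvec (qone, 0, 0, d) ` (Oo \<times> Oo) = Oo \<times> rowspan (c, d)"
  unfolding rowspan_def True by (auto simp: image_iff)
 moreover have "Det_sq (qone, 0, 0, d) ~= 0" using v True by (simp add: Det_sq_def zero_prod_def)
 ultimately show ?thesis using rideal_O True unfolding Frames_def by (intro exI[of _ Oo] conjI bexI[of _ "(qone, 0, 0, d)"]) auto
next
 case False
 let ?I = "rowspan (c, d)"
 obtain p q where pq: "c*.p+d*.q = qone" "!!x. x:?I ==> p*.x:Oo" "!!x. x:?I ==> q*.x:Oo"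
  using row_splitting[OF v] by blast
 define h where "h = (- (q*.c), qone-q*.d, c, d)"
 define K where "K = (%u. fst (mvec h u)) ` (Oo \<times> Oo)"
 have h1: "mvec h u = (snd u-q*.(c*.fst u+d*.snd u), c*.fst u+d*.snd u)" for u
  unfolding h_def by (cases u) (simp add: qring)
 have cd: "c*.fst u+d*.snd u:?I" if "u:Oo \<times> Oo" for u unfolding rowspan_def using that by auto
 have det: "Det_sq h ~= 0"
  unfolding h_def Det_sq_schur[OF False] using False by (simp add: qmul_assoc)
 have img: "mvec h ` (Oo \<times> Oo) = K \<times> ?I"
 proof
  show "mvec h ` (Oo \<times> Oo) <= K \<times> ?I" unfolding K_def by (auto simp: h1 intro: cd)
  show "K \<times> ?I <= mvec h ` (Oo \<times> Oo)"
  proof (clarify)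
   fix k i assume "k:K" and i: "i:?I"
   then obtain u where u: "u:Oo \<times> Oo" "k = fst (mvec h u)" unfolding K_def by blast
   let ?j = "c*.fst u+d*.snd u"
   let ?w = "(fst u+p*.(i-?j), snd u+q*.(i-?j))"
   have ij: "i-?j:?I" using rideal_diff[OF rideal_rowspan(1)[OF v] i cd[OF u(1)]] .
   have w: "?w:Oo \<times> Oo" using u(1) pq(2,3)[OF ij] O_add by auto
   have "c*.fst ?w+d*.snd ?w = ?j+(c*.p+d*.q)*.(i-?j)" by (simp add: qring)
   then have 1: "c*.fst ?w+d*.snd ?w = i" unfolding pq(1) by simp
   have "snd ?w-q*.i = snd u-q*.?j" by (simp add: qmul_diff)
   then have "mvec h ?w = (k, i)" unfolding h1 1 u(2) by simp
   then show "(k, i):mvec h ` (Oo \<times> Oo)" using w by (metis image_eqI)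
  qed
 qed
 have "rideal K"
 proof -
  have add: "fst (mvec h u)-fst (mvec h u') = fst (mvec h (u-u'))"
   "fst (mvec h u)*.a = fst (mvec h (fst u*.a, snd u*.a))" for u u' a unfolding h1 by (simp_all add: qring)
  have KO: "K <= Oo" unfolding K_def h1 using O_diff pq(3)[OF cd] by auto
  have "0:K" unfolding K_def by (rule image_eqI[of _ _ "(0, 0)"]) (auto simp: h1 O_zero)
  moreover have "x-y:K" if xy: "x:K" "y:K" for x y
  proof -
   obtain u u' where u: "u:Oo \<times> Oo" "u':Oo \<times> Oo" "x = fst (mvec h u)" "y = fst (mvec h u')" using xy unfolding K_def by blast
   then have "u-u':Oo \<times> Oo" using O_diff by (auto simp: mem_Times_iff)
   then show ?thesis unfolding u add(1) K_def by (rule imageI)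
  qed
  moreover have "x*.a:K" if xy: "x:K" "a:Oo" for x a
  proof -
   obtain u where u: "u:Oo \<times> Oo" "x = fst (mvec h u)" using xy unfolding K_def by blast
   then have "(fst u*.a, snd u*.a):Oo \<times> Oo" using O_mul xy by (auto simp: mem_Times_iff)
   then show ?thesis unfolding u(2) add(2) K_def by (rule imageI)
  qed
  moreover have "EX x:K. x ~= 0"
  proof (rule ccontr)
   assume "~ ?thesis"
   then have K0: "K <= {0}" by blast
   have "mvec h (qone, 0):K \<times> ?I" "mvec h (0, qone):K \<times> ?I" unfolding img[symmetric] using O_one O_zero by auto
   then have "q*.c = 0" "qone-q*.d = 0" using K0 by (auto simp: h_def)
   then show False using False by simp
  qed
  ultimately show ?thesis unfolding rideal_def using KO by (auto intro!: exI[of _ 1])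
 qed
 then show ?thesis using det img unfolding Frames_def by (intro exI[of _ K] conjI bexI[of _ h]) (auto simp: h_def)
qed

lemma frames_left:
 assumes "h:Frames K I" "Det_sq t ~= 0" "mvec t ` (K \<times> I) = K' \<times> I'"
 shows "t \<odot> h:Frames K' I'"
proof -
 have "mvec (t \<odot> h) ` (Oo \<times> Oo) = mvec t ` (mvec h ` (Oo \<times> Oo))" unfolding image_image mvec_mvec ..
 then show ?thesis using assms by (simp add: Frames_def Det_sq_mmul)
qed

lemma Det_sq_upper: "Det_sq (a, b, 0, qone) = qn a"
 by (simp add: Det_sq_def)

lemma upper_image:
 assumes "rideal K'" "(*.) a ` K = K'" "b:colon K' I"
 shows "mvec (a, b, 0, qone) ` (K \<times> I) = K' \<times> I"
proof
 show "mvec (a, b, 0, qone) ` (K \<times> I) <= K' \<times> I"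
  using assms rideal_add[OF assms(1)] by (auto simp: colon_def)
 show "K' \<times> I <= mvec (a, b, 0, qone) ` (K \<times> I)"
 proof clarify
  fix k i assume k: "k:K'" "i:I"
  then have "k-b*.i:K'" using assms rideal_diff[OF assms(1)] by (simp add: colon_def)
  then obtain k0 where k0: "k0:K" "k-b*.i = a*.k0" using assms(2) by blast
  then have "(k, i) = mvec (a, b, 0, qone) (k0, i)" by (simp add: algebra_simps)
  then show "(k, i):mvec (a, b, 0, qone) ` (K \<times> I)" using k0 k by (metis SigmaI image_eqI)
 qed
qed

text \<open>h' h^(-1) has second row (0, 1); evaluating it on K + 0 and on 0 + I gives a and b.
  Frames with a common row thus differ by an isomorphism of complements and a homomorphism from
  I.\<close>

lemma row_change:
 assumes K: "rideal K" and K': "rideal K'" and I: "rideal I" and h: "h:Frames K I" "h':Frames K' I" "mrow2 h = mrow2 h'"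
 shows "EX a b. h' = (a, b, 0, qone) \<odot> h & (*.) a ` K = K' & b:colon K' I"
proof -
 have det: "Det_sq h ~= 0" using h by (simp add: Frames_def)
 define t where "t = h' \<odot> minv h"
 have th: "t \<odot> h = h'" unfolding t_def mmul_assoc minv_left[OF det] by simp
 have "mrow2 t = mrow2 (h \<odot> minv h)" using h(3) unfolding t_def mrow2_def vmul_vmul[symmetric] by simp
 then have "mrow2 t = (0, qone)" unfolding minv_right[OF det] by (simp add: qmat_id_def)
 then obtain a b where t: "t = (a, b, 0, qone)" by (cases t) auto
 have img: "mvec t ` (K \<times> I) = K' \<times> I"
 proof -
  have "mvec t ` (mvec h ` (Oo \<times> Oo)) = mvec h' ` (Oo \<times> Oo)" unfolding image_image mvec_mvec th ..
  then show ?thesis using h by (simp add: Frames_def)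
 qed
 have "a*.k:K'" if "k:K" for k
 proof -
  have "mvec t (k, 0):K' \<times> I" unfolding img[symmetric] using that rideal_zero[OF I] by blast
  then show ?thesis unfolding t by simp
 qed
 moreover have "k':(*.) a ` K" if k': "k':K'" for k'
 proof -
  have "(k', 0):mvec t ` (K \<times> I)" unfolding img using that rideal_zero[OF I] by blast
  then show ?thesis unfolding t by auto
 qed
 moreover have "b*.i:K'" if "i:I" for i
 proof -
  have "mvec t (0, i):K' \<times> I" unfolding img[symmetric] using that rideal_zero[OF K] by blast
  then show ?thesis unfolding t by simp
 qed
 ultimately show ?thesis using th t unfolding colon_def by blast
qed

text \<open>All frames have the same determinant by \<open>Det_sq_frame\<close>, so the quotient of
  two of them has determinant one and preserves O + O.\<close>

lemma bij_frames:
 assumes K: "rideal K" and I: "rideal I" and h: "h:Frames K I"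
 shows "bij_betw ((\<odot>) h) (SL2 Oo) (Frames K I)"
proof (rule bij_betw_byWitness[of _ "(\<odot>) (minv h)"])
 have det: "Det_sq h ~= 0" using h by (simp add: Frames_def)
 note inv = minv_left[OF det] minv_right[OF det]
 show "ALL g:SL2 Oo. minv h \<odot> (h \<odot> g) = g" "ALL h':Frames K I. h \<odot> (minv h \<odot> h') = h'"
  unfolding mmul_assoc[symmetric] inv by simp_all
 show "(\<odot>) h ` SL2 Oo <= Frames K I"
 proof
  fix h' assume "h':(\<odot>) h ` SL2 Oo"
  then obtain g where g': "h' = h \<odot> g" "g:SL2 Oo" by blast
  obtain a b c d where g4: "g = (a, b, c, d)" by (cases g) auto
  let ?g = "(a, b, c, d)"
  have g: "?g:SL2 Oo" using g' g4 by simp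
  have o: "a:Oo" "b:Oo" "c:Oo" "d:Oo" and dg: "Det_sq ?g = 1" using g by (auto simp: SL2_def)
  have mem: "mvec (p, q, s, t) u:Oo \<times> Oo" if "p:Oo" "q:Oo" "s:Oo" "t:Oo" "u:Oo \<times> Oo" for p q s t u
   using that O_add O_mul by (cases u) auto
  obtain p q s t where gi: "minv ?g = (p, q, s, t)" by (cases "minv ?g") auto
  have "p:Oo" "q:Oo" "s:Oo" "t:Oo"
   using gi[symmetric] o by (auto simp: minv_def dg intro!: O_diff O_mul O_cnj O_Ints O_integral)
  then have "mvec (minv ?g) u:Oo \<times> Oo" if "u:Oo \<times> Oo" for u unfolding gi using mem that by blast
  moreover have "u = mvec ?g (mvec (minv ?g) u)" for u unfolding mvec_mvec using minv_right[of ?g] dg by simp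
  ultimately have "mvec ?g ` (Oo \<times> Oo) = Oo \<times> Oo" using mem[OF o] by blast
  moreover have "mvec (h \<odot> ?g) ` (Oo \<times> Oo) = mvec h ` (mvec ?g ` (Oo \<times> Oo))" unfolding image_image mvec_mvec ..
  ultimately show "h':Frames K I" unfolding g' g4 using h dg by (simp add: Frames_def Det_sq_mmul)
 qed
 show "(\<odot>) (minv h) ` Frames K I <= SL2 Oo"
 proof
  fix g assume "g:(\<odot>) (minv h) ` Frames K I"
  then obtain h' where h': "h':Frames K I" "g = minv h \<odot> h'" by blast
  have "mvec g ` (Oo \<times> Oo) = mvec (minv h) ` (mvec h' ` (Oo \<times> Oo))" unfolding h' image_image mvec_mvec ..
  also have "... = mvec (minv h) ` (mvec h ` (Oo \<times> Oo))" using h h' by (simp add: Frames_def)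
  also have "... = Oo \<times> Oo" unfolding image_image mvec_mvec inv by simp
  finally have "mvec g ` (Oo \<times> Oo) <= Oo \<times> Oo" by simp
  moreover have "Det_sq g = 1"
   unfolding h' Det_sq_mmul Det_sq_minv[OF det] Det_sq_frame[OF K I h] Det_sq_frame[OF K I h'(1)] using NI_pos[OF K] NI_pos[OF I] by simp
  moreover obtain a b c d where "g = (a, b, c, d)" by (cases g) auto
  ultimately show "g:SL2 Oo" using mvec_O_image[of a b c d Oo Oo] by (simp add: SL2_def)
 qed
qed

end

section \<open>Unfolding the lattice count\<close>

lemma emeasure_ball_quat: "r >= 0 ==> emeasure lborel (ball (x::quat) r) = ennreal (pi^2/2*r^4)"
 using emeasure_ball[of r x] by (simp add: unit_ball_vol_4)

lemma Qf_bounds: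
 assumes "r > 0"
 shows "r*qn c <= Qf (z, r) (c, d)" "qn (c*.z+d) <= r*Qf (z, r) (c, d)"
 using assms by (simp_all add: Qf_def field_simps power2_eq_square)

context max_order
begin

lemma Qf_finite:
 assumes "snd w > 0"
 shows "finite {v:Oo \<times> Oo. Qf w v <= R}"
proof -
 obtain z r where w: "w = (z, r)" and r: "r > 0" using assms by (cases w) auto
 let ?c = "sqrt (R/r)" and ?d = "sqrt (r * R)"
 have "{v:Oo \<times> Oo. Qf w v <= R} <= (Oo Int cball 0 ?c) \<times> (Oo Int cball 0 (?d+?c*norm z))"
 proof clarify
  fix c d assume v: "c:Oo" "d:Oo" and R: "Qf w (c, d) <= R"
  have "(norm c)^2 <= R/r" using Qf_bounds(1)[OF r, of c z d] R r by (simp add: w qn_norm field_simps)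
  then have c: "norm c <= ?c" by (rule real_le_rsqrt)
  have "(norm (c*.z+d))^2 <= r * R"       unfolding qn_norm[symmetric] using r by (intro order_trans[OF Qf_bounds(2) mult_left_mono[OF R[unfolded w]]]) auto
  then have "norm (c*.z+d) <= ?d" by (rule real_le_rsqrt)
  then have "norm d <= ?d+norm (c*.z)" using norm_triangle_ineq4[of "c*.z+d" "c*.z"] by simp
  also have "norm (c*.z) <= ?c*norm z" unfolding norm_qmul using c by (intro mult_right_mono) auto
  finally show "c:Oo Int cball 0 ?c & d:Oo Int cball 0 (?d+?c*norm z)" using v c by simp
 qed
 then show ?thesis by (rule finite_subset) (intro finite_cartesian_product lat_finite[OF lat_O bounded_cball])
qed

lemma kleinian_SL2: "kleinian (SL2 Oo)"
proof
 let ?G = "SL2 Oo"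
 have G: "(a, b, c, d):?G \<longleftrightarrow> a:Oo & b:Oo & c:Oo & d:Oo & Det_sq (a, b, c, d) = 1" for a b c d
  by (simp add: SL2_def)
 show det: "Det_sq M = 1" if "M:?G" for M using that by (cases M) (simp add: G)
 show "M \<odot> N:?G" if MN: "M:?G" "N:?G" for M N
 proof -
  have "Det_sq (M \<odot> N) = 1" using det MN by (simp add: Det_sq_mmul)
  then show ?thesis using MN by (cases M; cases N) (simp add: G O_add O_mul)
 qed
 show "minv M:?G" if M: "M:?G" for M
 proof -
  have d: "Det_sq (minv M) = 1" using det M by (simp add: Det_sq_minv)
  obtain a b c d where m: "M = (a, b, c, d)" by (cases M) auto
  have o: "a:Oo" "b:Oo" "c:Oo" "d:Oo" using M m by (auto simp: G)
  have "minv M = madj M" using det[OF M] by (simp add: minv_def)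
  then show ?thesis using d o unfolding m by (auto simp: G intro!: O_diff O_mul O_cnj O_Ints O_integral)
 qed
 show "qmat_id:?G" "qmat_neg qmat_id:?G"
  using O_one O_zero O_neg[OF O_one] by (auto simp: G qmat_id_def qmat_neg_def Det_sq_def)
 have "?G <= Oo \<times> Oo \<times> Oo \<times> Oo" by (auto simp: SL2_def)
 then show "countable ?G" by (rule countable_subset) (intro countable_SIGMA lat_countable lat_O)
 show "finite {M:?G. ppair (act M w) <= R}" if w: "snd w > 0" for w R
 proof -
  let ?V = "{v:Oo \<times> Oo. Qf w v <= R}"
  have "{M:?G. ppair (act M w) <= R} <= (%((a, b), (c, d)). (a, b, c, d)) ` (?V \<times> ?V)"
  proof
   fix M assume "M:{M:?G. ppair (act M w) <= R}"
   then have M: "M:?G" "ppair (act M w) <= R" by auto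
   obtain a b c d where m: "M = (a, b, c, d)" by (cases M) auto
   have "Qf w (a, b)+Qf w (c, d) <= R"
    using M(2) Qf_act[OF det[OF M(1)] w] by (simp add: ppair_def m)
   then have "(a, b):?V" "(c, d):?V" using M(1) Qf_nonneg[of "snd w" "fst w"] w m by (auto simp: G add_increasing intro: order_trans[rotated])
   then show "M:(%((a, b), (c, d)). (a, b, c, d)) ` (?V \<times> ?V)"
    unfolding m by (intro image_eqI[of _ _ "((a, b), (c, d))"]) auto
  qed
  then show ?thesis by (rule finite_subset) (simp add: Qf_finite[OF w])
 qed
qed

section \<open>Ideal classes and their automorphism groups\<close>

definition AutK :: "quat set => quat set" where "AutK K = {a. (*.) a ` K = K}"

text \<open>Left multiplication of K by a nonzero element of A leaves the set of candidates
  unchanged, so the choice is constant on classes (\<open>rep_left\<close>).\<close>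

definition rep :: "quat set => quat set" where
 "rep K = (SOME K'. rideal K' & (EX a:A. a ~= 0 & K' = (*.) a ` K))"

definition Reps :: "quat set set" where "Reps = rep ` Collect rideal"

lemma image_qmul: "(*.) a ` (*.) b ` K = (*.) (a*.b) ` K"
 by (simp add: image_image qmul_assoc)

lemma AutK_norm:
 assumes K: "rideal K" and a: "a:AutK K"
 shows "a:A" "qn a = 1"
proof -
 obtain x where x: "x:K" "x ~= 0" using K unfolding rideal_def by blast
 have ax: "a*.x:K" using a x unfolding AutK_def by blast
 have "a = (a*.x)*.qinv x" using x by (simp add: qmul_assoc)
 then show aA: "a:A" using A_mul rideal_A[OF K] ax x A_inv by metis
 have "x:(*.) a ` K" using a x unfolding AutK_def by blast
 then have "a ~= 0" using x by auto
 then have "NI K = qn a*NI K" using NI_left[OF K aA] a by (simp add: AutK_def)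
 then show "qn a = 1" using NI_pos[OF K] by simp
qed

lemma card_AutK:
 assumes K: "rideal K"
 shows "finite (AutK K)" "card (AutK K) > 0"
proof -
 obtain x where x: "x:K" "x ~= 0" using K unfolding rideal_def by blast
 have "(%a. a*.x) ` AutK K <= K Int cball 0 (norm x)"
 proof (intro image_subsetI IntI)
  fix a assume a: "a:AutK K"
  show "a*.x:K" using a x unfolding AutK_def by blast
  have "norm a = 1" using AutK_norm(2)[OF K a] by (simp add: qn_norm abs_square_eq_1)
  then show "a*.x:cball 0 (norm x)" by (simp add: norm_qmul)
 qed
 moreover have "inj_on (%a. a*.x) (AutK K)" using x by (auto simp: inj_on_def qmul_right_cancel)
 ultimately show "finite (AutK K)" using lat_finite[OF lat_rideal[OF K] bounded_cball] inj_on_finite by blast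
 moreover have "qone:AutK K" by (simp add: AutK_def)
 ultimately show "card (AutK K) > 0" by (auto simp: card_gt_0_iff)
qed

lemma rep_props:
 assumes K: "rideal K"
 shows "rideal (rep K)" "EX a:A. a ~= 0 & rep K = (*.) a ` K"
proof -
 have "rideal K & (EX a:A. a ~= 0 & K = (*.) a ` K)" using K A_one by (auto intro!: bexI[of _ qone])
 then have "rideal (rep K) & (EX a:A. a ~= 0 & rep K = (*.) a ` K)"
  unfolding rep_def by (rule someI)
 then show "rideal (rep K)" "EX a:A. a ~= 0 & rep K = (*.) a ` K" by simp_all
qed

lemma rep_left:
 assumes "a:A" "a ~= 0"
 shows "rep ((*.) a ` K) = rep K"
proof -
 have "(EX b:A. b ~= 0 & K' = (*.) b ` (*.) a ` K) \<longleftrightarrow> (EX b:A. b ~= 0 & K' = (*.) b ` K)" for K'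
 proof
  assume "EX b:A. b ~= 0 & K' = (*.) b ` (*.) a ` K"
  then obtain b where "b:A" "b ~= 0" "K' = (*.) (b*.a) ` K" unfolding image_qmul by blast
  then show "EX b:A. b ~= 0 & K' = (*.) b ` K" using assms A_mul by (intro bexI[of _ "b*.a"]) auto
 next
  assume "EX b:A. b ~= 0 & K' = (*.) b ` K"
  then obtain b where b: "b:A" "b ~= 0" "K' = (*.) b ` K" by blast
  then show "EX b:A. b ~= 0 & K' = (*.) b ` (*.) a ` K"
   unfolding image_qmul using assms A_mul A_inv by (intro bexI[of _ "b*.qinv a"]) (auto simp: qmul_assoc)
 qed
 then show ?thesis unfolding rep_def by simp
qed

lemma Reps_props:
 assumes "K:Reps"
 shows "rideal K" "rep K = K"
proof -
 obtain K0 where K0: "rideal K0" "K = rep K0" using assms unfolding Reps_def by blast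
 then show "rideal K" "rep K = K" using rep_props[OF K0(1)] rep_left by metis+
qed

lemma colon_A: "rideal K ==> rideal I ==> y:colon K I ==> y:A"
proof -
 assume KI: "rideal K" "rideal I" "y:colon K I"
 obtain x where x: "x:I" "x ~= 0" using KI(2) unfolding rideal_def by blast
 have "y = (y*.x)*.qinv x" using x by (simp add: qmul_assoc)
 then show "y:A" using A_mul[OF rideal_A[OF KI(1)] A_inv[OF rideal_A[OF KI(2)]]] x KI(3) unfolding colon_def by (metis (no_types, lifting) mem_Collect_eq)
qed

text \<open>Minkowski's theorem in the multiplier lattice from K to O gives a nonzero y such that y
  K is integral of norm at most C, and finitely many ideals have such a norm.\<close>

lemma finite_Reps: "finite Reps"
proof -
 \<comment> \<open>A ball of radius s, with s^4 the covolume of the multiplier lattice, gives |y| <=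
   2 s, hence n(y) <= 4 s^2 = 4 sqrt(covol O)/N(K).\<close>
 define C where "C = 4 * sqrt (covol Oo)"
 have co: "covol Oo > 0" using covol_pos[OF lat_O] .
 have "EX n<=nat \<lfloor>C\<rfloor>. K:rep ` ideals n" if K': "K:Reps" for K
 proof -
  note K = Reps_props[OF K']
  let ?L = "colon Oo K"
  note L = lat_colon[OF rideal_O K(1)]
  obtain B where B: "fdom ?L B" using fdom_exists[OF L] by blast
  define s where "s = sqrt (sqrt (covol Oo)/NI K)"
  have s2: "s^2 = sqrt (covol Oo)/NI K" "s > 0" unfolding s_def using co NI_pos[OF K(1)] by simp_all
  have "s^4 = (s^2)^2" by simp
  then have s4: "s^4 = covol ?L" unfolding covol_colon[OF rideal_O K(1)] s2 using co by (simp add: power_divide)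
  have "pi^2 >= 3^2" using pi_ge_three by (intro power_mono) auto
  then have "covol ?L < pi^2/2*covol ?L" using covol_pos[OF L] by simp
  then have "emeasure lborel B < emeasure lborel (ball (0::quat) s)"
   using s2(2) covol_pos[OF L] unfolding emeasure_fdom[OF L B] by (simp add: emeasure_ball_quat s4 ennreal_less_iff)
  then obtain k l x where kl: "k:?L" "l:?L" "k ~= l" "x-k:ball 0 s" "x-l:ball 0 s"
   using minkowski[OF B lat_countable[OF L], of "ball 0 s"] by auto
  define y where "y = k-l"
  have y: "y:?L" "y ~= 0" unfolding y_def using kl lat_diff[OF L] by auto
  have "norm y <= norm (x-l)+norm (x-k)" unfolding y_def using norm_triangle_ineq4[of "x-l" "x-k"] by simp
  then have "norm y <= 2 * s" using kl by simp
  then have "(norm y)^2 <= (2 * s)^2" by (intro power_mono) auto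
  then have ny: "qn y*NI K <= C" using NI_pos[OF K(1)] by (simp add: qn_norm power_mult_distrib s2 C_def field_simps)
  have yA: "y:A" using colon_A[OF rideal_O K(1) y(1)] .
  let ?J = "(*.) y ` K"
  have J: "rideal ?J" "?J <= Oo" using rideal_left[OF K(1) yA y(2)] y(1) by (auto simp: colon_def)
  obtain n :: nat where n: "NI ?J = real n" using NI_integral[OF J] by blast
  have "real n <= C" using ny n NI_left[OF K(1) yA y(2)] by simp
  then have "n <= nat \<lfloor>C\<rfloor>" by linarith
  moreover have "?J:ideals n" using J n by (simp add: ideals_def)
  moreover have "K = rep ?J" using rep_left[OF yA y(2)] K(2) by simp
  ultimately show ?thesis by blast
 qed
 then have "Reps <= (UN n<=nat \<lfloor>C\<rfloor>. rep ` ideals n)" by blast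
 then show ?thesis by (rule finite_subset) (simp add: finite_ideals)
qed

definition Ids :: "quat set set" where "Ids = {I. rideal I & I <= Oo}"

lemma countable_Ids: "countable Ids"
proof -
 have "Ids = (UN n. ideals n)" unfolding Ids_def ideals_def using NI_integral by (auto; blast)
 then show ?thesis by (simp add: countable_finite finite_ideals)
qed

section \<open>Rows of bounded form value, sorted by ideal and by class of the complement\<close>

definition VT :: "quat \<times> real => real => (quat \<times> quat) set" where
 "VT w T = {v:Oo \<times> Oo. v ~= 0 & Qf w v <= T}"

lemma finite_VT: "snd w > 0 ==> finite (VT w T)"
 using Qf_finite[of w T] unfolding VT_def by (rule rev_finite_subset) auto

definition MM :: real where "MM = (SUM K:Reps. 1/real (card (AutK K)))"

text \<open>Scaling to determinant one; \<open>Det_sq\<close> is homogeneous of degree four, hence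
  the fourth root.\<close>

definition norm1 :: "qmat => qmat" where "norm1 h = mscale (1/sqrt (sqrt (Det_sq h))) h"

lemma Det_sq_norm1: "Det_sq h ~= 0 ==> Det_sq (norm1 h) = 1"
proof -
 assume D: "Det_sq h ~= 0"
 have "sqrt (sqrt (Det_sq h))^4 = (sqrt (sqrt (Det_sq h))^2)^2" by simp
 then have "sqrt (sqrt (Det_sq h))^4 = Det_sq h" using Det_sq_nonneg[of h] by simp
 then show ?thesis unfolding norm1_def Det_sq_scale using D by (simp add: power_divide)
qed

lemma norm1_mmul: "Det_sq t = 1 ==> norm1 (t \<odot> h) = t \<odot> norm1 h" "Det_sq t = 1 ==> norm1 (h \<odot> t) = norm1 h \<odot> t"
 by (simp_all add: norm1_def Det_sq_mmul)

lemma snd_act_norm1: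
 assumes "Det_sq h ~= 0" "snd w > 0"
 shows "snd (act (norm1 h) w) = sqrt (Det_sq h)/Qf w (mrow2 h)"
proof -
 have "Qf w (mrow2 (mscale t h)) = t^2*Qf w (mrow2 h)" for t
 proof (cases h; cases w)
  fix a b c d z r assume hw: "h = (a, b, c, d)" "w = (z, r)"
  have "(t*R c)*.z+t*R d = t*R (c*.z+d)" by (simp add: scaleR_add_right)
  then have "Qf w (mrow2 (mscale t h)) = (t^2*qn (c*.z+d)+r^2*(t^2*qn c))/r"
   unfolding hw Qf_def by simp
  also have "... = t^2*Qf w (mrow2 h)" unfolding hw Qf_def by (simp add: distrib_left mult.left_commute)
  finally show ?thesis .
 qed
 then show ?thesis using Det_sq_nonneg[of h] unfolding snd_act[OF assms(2)] norm1_def by (simp add: power_divide)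
qed

lemma act_upper: "snd w > 0 ==> fst (act (a, b, 0, qone) w) = a*.fst w+b"
 by (cases w) (simp add: act_def)

text \<open>The frames with the row of h differ from h by some a in \<open>AutK K\<close> and some b
  in the multiplier lattice. Since b translates the horizontal coordinate of the image point, asking
  that coordinate to lie in a domain B selects one b for each a.\<close>

lemma card_frame_fibre:
 assumes K: "rideal K" and I: "rideal I" and h: "h:Frames K I" and w: "snd w > 0" and B: "fdom (colon K I) B"
 shows "card {h':Frames K I. mrow2 h' = mrow2 h & fst (act (norm1 h') w):B} = card (AutK K)" (is "card ?S = _")
  and "finite {h':Frames K I. mrow2 h' = mrow2 h & fst (act (norm1 h') w):B}"
proof -
 define z where "z = fst (act (norm1 h) w)"
 define be where "be a = (THE b. b:colon K I & a*.z+b:B)" for a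
 have ex: "EX! b. b:colon K I & a*.z+b:B" for a using B unfolding fdom_def by blast
 have be: "be a:colon K I" "a*.z+be a:B" for a using theI'[OF ex[of a]] unfolding be_def by blast+
 have det: "Det_sq h ~= 0" using h by (simp add: Frames_def)
 have fa: "fst (act (norm1 ((a, b, 0, qone) \<odot> h)) w) = a*.z+b" if "qn a = 1" for a b
 proof -
  have t: "Det_sq (a, b, 0, qone) = 1" using that by (simp add: Det_sq_upper)
  show ?thesis unfolding norm1_mmul(1)[OF t] act_mmul[OF t Det_sq_norm1[OF det] w] z_def
   by (rule act_upper) (simp add: act_H5 Det_sq_norm1[OF det] w)
 qed
 let ?f = "%a. (a, be a, 0, qone) \<odot> h"
 have "inj_on ?f (AutK K)"
 proof (rule inj_onI)
  fix a a' assume "?f a = ?f a'"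
  then have "?f a \<odot> minv h = ?f a' \<odot> minv h" by simp
  then show "a = a'" unfolding mmul_assoc minv_right[OF det] by simp
 qed
 moreover have "?f ` AutK K = ?S"
 proof
  show "?f ` AutK K <= ?S"
  proof (intro image_subsetI CollectI conjI)
   fix a assume a: "a:AutK K"
   note n = AutK_norm[OF K a]
   show "?f a:Frames K I"
    by (rule frames_left[OF h _ upper_image[OF K _ be(1)]]) (use n a in \<open>auto simp: Det_sq_upper AutK_def\<close>)
   show "mrow2 (?f a) = mrow2 h" by (cases h) simp
   show "fst (act (norm1 (?f a)) w):B" unfolding fa[OF n(2)] by (rule be(2))
  qed
  show "?S <= ?f ` AutK K"
  proof
   fix h' assume h': "h':?S"
   then obtain a b where ab: "h' = (a, b, 0, qone) \<odot> h" "(*.) a ` K = K" "b:colon K I" using row_change[OF K K I h, of h'] by auto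
   have a: "a:AutK K" using ab by (simp add: AutK_def)
   have "a*.z+b:B" unfolding fa[OF AutK_norm(2)[OF K a], symmetric] using h' unfolding ab(1) by simp
   then have "b = be a" using ex[of a] be[of a] ab(3) by blast
   then show "h':?f ` AutK K" using a ab(1) by blast
  qed
 qed
 ultimately show "card ?S = card (AutK K)" "finite ?S"
  using card_image[of ?f "AutK K"] finite_imageI[OF card_AutK(1)[OF K], of ?f] by simp_all
qed

lemma frame_count:
 assumes K: "rideal K" and I: "rideal I" "I <= Oo" and w: "snd w > 0" and B: "fdom (colon K I) B"
 shows "csum (Frames K I) (%h. of_bool (Qf w (mrow2 h) <= T & fst (act (norm1 h) w):B)) =
  ennreal (real (card (AutK K))*real (card {v:VT w T. EX h:Frames K I. mrow2 h = v}))" (is "_ = ennreal (_*real (card ?V))")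
proof -
 let ?S = "%v. {h':Frames K I. mrow2 h' = v & fst (act (norm1 h') w):B}"
 let ?U = "{h:Frames K I. Qf w (mrow2 h) <= T & fst (act (norm1 h) w):B}"
 have fV: "finite ?V" using finite_VT[OF w] by simp
 have S: "card (?S v) = card (AutK K)" "finite (?S v)" if "v:?V" for v
  using that card_frame_fibre[OF K I(1) _ w B] by auto
 have "mrow2 h:VT w T" if "h:Frames K I" "Qf w (mrow2 h) <= T" for h
 proof -
  obtain a b c d where h: "h = (a, b, c, d)" by (cases h) auto
  have "c:I" "d:I" using mvec_O_image[of a b c d K I] that(1) by (auto simp: Frames_def h)
  then show ?thesis using that I(2) mrow2_nonzero[of h] by (auto simp: VT_def h Frames_def)
 qed
 then have U: "?U = (UN v:?V. ?S v)" by (intro set_eqI iffI) (fastforce, auto simp: VT_def)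
 have "card ?U = (SUM v:?V. card (?S v))" unfolding U by (rule card_UN_disjoint[OF fV]) (use S in auto)
 also have "... = card ?V*card (AutK K)" using S(1) by simp
 finally have "card ?U = card ?V*card (AutK K)" .
 moreover have "finite ?U" unfolding U using fV S(2) by (rule finite_UN_I)
 moreover have "csum (Frames K I) (%h. of_bool (Qf w (mrow2 h) <= T & fst (act (norm1 h) w):B)) =
  csum (Frames K I) (%h. indicator ?U h)"
  by (intro nn_integral_cong) (auto simp: indicator_def)
 moreover have "... = emeasure (count_space (Frames K I)) ?U" by (rule nn_integral_indicator) auto
 ultimately show ?thesis by (subst (asm) emeasure_count_space_finite) (auto simp: ennreal_of_nat_eq_real_of_nat mult.commute)
qed

text \<open>A row determines I as the ideal it spans, and by \<open>row_change\<close> it determines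
  K up to left multiplication, hence exactly one representative.\<close>

lemma VT_partition:
 assumes w: "snd w > 0"
 shows "ennreal (card (VT w T)) = csum Ids (%I. ennreal (SUM K:Reps. real (card {v:VT w T. EX h:Frames K I. mrow2 h = v})))"
proof -
 note fin = finite_VT[OF w, of T]
 have "(SUM K:Reps. card {v:VT w T. EX h:Frames K I. mrow2 h = v}) = card {v:VT w T. rowspan v = I}" if I: "I:Ids" for I
 proof -
  have Ir: "rideal I" using I by (simp add: Ids_def)
  have "{v:VT w T. rowspan v = I} = (UN K:Reps. {v:VT w T. EX h:Frames K I. mrow2 h = v})"
  proof (intro set_eqI iffI)
   fix v assume "v:{v:VT w T. rowspan v = I}"
   then have v: "v:VT w T" "rowspan v = I" by auto
   obtain c d where cd: "v = (c, d)" by (cases v)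
   obtain K0 h0 where K0: "rideal K0" "h0:Frames K0 I" "mrow2 h0 = v"
    using frame_exists[of c d] v unfolding cd VT_def by auto
   obtain a where a: "a:A" "a ~= 0" "rep K0 = (*.) a ` K0" using rep_props(2)[OF K0(1)] by blast
   have "mvec (a, 0, 0, qone) ` (K0 \<times> I) = rep K0 \<times> I"
    by (rule upper_image[OF rep_props(1)[OF K0(1)]]) (use a rideal_zero[OF rep_props(1)[OF K0(1)]] in \<open>auto simp: colon_def\<close>)
   then have "(a, 0, 0, qone) \<odot> h0:Frames (rep K0) I" using frames_left[OF K0(2)] a by (simp add: Det_sq_upper)
   moreover have "mrow2 ((a, 0, 0, qone) \<odot> h0) = v" using K0(3) by (cases h0) auto
   moreover have "rep K0:Reps" using K0(1) by (simp add: Reps_def)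
   ultimately show "v:(UN K:Reps. {v:VT w T. EX h:Frames K I. mrow2 h = v})" using v(1) by blast
  next
   fix v assume "v:(UN K:Reps. {v:VT w T. EX h:Frames K I. mrow2 h = v})"
   then obtain K h where "K:Reps" "v:VT w T" "h:Frames K I" "mrow2 h = v" by auto
   then show "v:{v:VT w T. rowspan v = I}" using frames_rowspan[of K h I] Reps_props(1) by blast
  qed
  moreover have "{v:VT w T. EX h:Frames K I. mrow2 h = v} Int {v:VT w T. EX h:Frames K' I. mrow2 h = v} = {}"
   if K: "K:Reps" "K':Reps" "K ~= K'" for K K'
  proof (rule ccontr)
   assume "~ ?thesis"
   then obtain v h h' where "h:Frames K I" "mrow2 h = v" "h':Frames K' I" "mrow2 h' = v" by blast
   then have h: "h:Frames K I" "h':Frames K' I" "mrow2 h = mrow2 h'" by auto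
   obtain a where a: "(*.) a ` K = K'" using row_change[OF Reps_props(1)[OF K(1)] Reps_props(1)[OF K(2)] Ir h] by blast
   obtain x where x: "x:K" "x ~= 0" using Reps_props(1)[OF K(1)] unfolding rideal_def by blast
   have "a*.x:K'" using a x by blast
   then have "(a*.x)*.qinv x:A" using A_mul rideal_A Reps_props(1) K x A_inv by metis
   then have "a:A" using x by (simp add: qmul_assoc)
   moreover have "a ~= 0" using a Reps_props(1)[OF K(2)] unfolding rideal_def by auto
   ultimately have "rep K' = rep K" using rep_left a by blast
   then show False using Reps_props(2) K by simp
  qed
  ultimately show ?thesis using fin by (subst card_UN_disjoint[OF finite_Reps, symmetric]) auto
 qed
 then have "csum Ids (%I. ennreal (SUM K:Reps. real (card {v:VT w T. EX h:Frames K I. mrow2 h = v}))) =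
   csum Ids (%I. (SUM v:VT w T. of_bool (rowspan v = I)))"
  by (intro nn_integral_cong) (simp add: fin ennreal_of_nat_eq_real_of_nat Int_def flip: of_nat_sum)
 also have "... = (SUM v:VT w T. csum Ids (%I. of_bool (rowspan v = I)))" by (rule nn_integral_sum) simp
 also have "... = (SUM v:VT w T. 1)"
 proof (rule sum.cong[OF refl])
  fix v assume "v:VT w T"
  then have "rowspan v:Ids" using rideal_rowspan[of "fst v" "snd v"] by (auto simp: VT_def Ids_def)
  then show "csum Ids (%I. of_bool (rowspan v = I)) = (1::ennreal)" by (intro nn_integral_count_space_unique) auto
 qed
 finally show ?thesis by (simp add: ennreal_of_nat_eq_real_of_nat)
qed

end

lemma nn_integral_power5_tail:
 assumes "a > (0::real)"
 shows "nnint lborel (%r. of_bool (a <= r)*(ennreal (1/r^5)*indicator {0<..} r)) = ennreal (1/(4*a^4))"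
proof -
 have "nnint lborel (%r. of_bool (a <= r)*(ennreal (1/r^5)*indicator {0<..} r)) =
   nnint lborel (%r. ennreal (1/r^5)*indicator {a..} r)"
  using assms by (intro nn_integral_cong) (auto simp: indicator_def)
 also have "... = ennreal (0-(- (1/(4*a^4))))"
 proof (rule nn_integral_FTC_atLeast)
  fix x assume "a <= x"
  then have x: "x > 0" using assms by simp
  show "((%x. - (1/(4*x^4))) has_real_derivative 1/x^5) (at x)"
   using x by (auto intro!: derivative_eq_intros simp: field_simps eval_nat_numeral)
  show "0 <= 1/x^5" using x by simp
 next
  show "((%x. - (1/(4*x^4))) \<longlongrightarrow> (0::real)) at_top" by real_asymp
 qed measurable
 finally show ?thesis by simp
qed

lemma borel_measurable_count_sum:
 assumes S: "countable S" and f: "!!i. i:S ==> f i:borel_measurable M"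
 shows "(%x. csum S (%i. f i x)):borel_measurable M"
proof (rule sigma_finite_measure.borel_measurable_nn_integral[OF sigma_finite_measure_count_space_countable[OF S]])
 have "(%(i, x). f i x):borel_measurable (count_space S \<Otimes>\<^sub>M M)"
  using f by (intro measurable_pair_measure_countable1[OF S]) simp
 from measurable_pair_swap[OF this] show "case_prod (%x i. f i x):borel_measurable (M \<Otimes>\<^sub>M count_space S)"
  by (simp add: case_prod_beta')
qed

context max_order
begin

interpretation SL: kleinian "SL2 Oo" by (rule kleinian_SL2)

definition ZZ :: ennreal where "ZZ = csum Ids (%I. ennreal (1/NI I^4))"

lemma frames_nonempty: "rideal K ==> rideal I ==> EX h. h:Frames K I"
 using sim_free unfolding sim_def Frames_def by auto

text \<open>The frames form one orbit under SL2(O), so the sum unfolds to twice the volume of the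
  region over B of height at least \<open>sqrt (NI K*NI I)/T\<close>. The powers of N(K) in this
  height and in the covolume of \<open>colon K I\<close> cancel, leaving N(I)^(-4).\<close>

lemma frame_unfolding:
 assumes F: "fund_domain (SL2 Oo) F" and K: "rideal K" and I: "rideal I" and B: "fdom (colon K I) B" and T: "T > 0"
 shows "(%w. csum (Frames K I) (%h. of_bool (Qf w (mrow2 h) <= T & fst (act (norm1 h) w):B))):borel_measurable borel"
  and "nnint hyp_measure (%w. indicator F w*csum (Frames K I) (%h. of_bool (Qf w (mrow2 h) <= T & fst (act (norm1 h) w):B)))
   = ennreal (covol Oo*T^4/2*(1/NI I^4))"
proof -
 let ?G = "SL2 Oo" and ?\<delta> = "NI K*NI I"
 have Bb [measurable]: "B:sets borel" using B by (simp add: fdom_def)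
 obtain h0 where h0: "h0:Frames K I" using frames_nonempty[OF K I] by blast
 note bij = bij_frames[OF K I h0]
 have fst_m: "fst:borel_measurable (borel :: (quat \<times> real) measure)"
  by (intro borel_measurable_continuous_onI continuous_on_fst continuous_on_id)
 have snd_m: "snd:borel_measurable (borel :: (quat \<times> real) measure)"
  by (intro borel_measurable_continuous_onI continuous_on_snd continuous_on_id)
 have cF: "countable (Frames K I)" using SL.count bij_betw_imp_surj_on[OF bij] by (metis countable_image)
 show "(%w. csum (Frames K I) (%h. of_bool (Qf w (mrow2 h) <= T & fst (act (norm1 h) w):B))):borel_measurable borel"
 proof (rule borel_measurable_count_sum[OF cF])
  fix h
  from measurable_compose[OF measurable_act fst_m]
  have [measurable]: "(%w. fst (act (norm1 h) w)):borel_measurable borel" .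
  show "(%w. of_bool (Qf w (mrow2 h) <= T & fst (act (norm1 h) w):B)):borel_measurable borel" by measurable
 qed
 have d: "?\<delta> > 0" using NI_pos[OF K] NI_pos[OF I] by simp
 define f :: "quat \<times> real => ennreal" where "f w = of_bool (sqrt ?\<delta> <= T * snd w)*indicator B (fst w)" for w
 have [measurable]: "(%w. indicator B (fst w) :: ennreal):borel_measurable (borel :: (quat \<times> real) measure)"
  using measurable_compose[OF fst_m borel_measurable_indicator[OF Bb]] .
 have fm [measurable]: "f:borel_measurable borel" unfolding f_def[abs_def] using snd_m by measurable
 have det: "Det_sq h ~= 0" "Det_sq h = ?\<delta>" if "h:Frames K I" for h
  using that Det_sq_frame[OF K I that] by (simp_all add: Frames_def)
 have eq: "of_bool (Qf w (mrow2 h) <= T & fst (act (norm1 h) w):B) = f (act (norm1 h) w)"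
  if h: "h:Frames K I" and w: "snd w > 0" for h w
 proof -
  have Q: "Qf w (mrow2 h) > 0" using Qf_pos[of "snd w" _ "fst w"] w mrow2_nonzero[OF det(1)[OF h]] by simp
  have "sqrt ?\<delta> <= T * snd (act (norm1 h) w) \<longleftrightarrow> Qf w (mrow2 h) <= T"
   unfolding snd_act_norm1[OF det(1)[OF h] w] det(2)[OF h] using Q d
   by (simp add: field_simps)
  then show ?thesis by (simp add: f_def indicator_def)
 qed
 have inner: "csum (Frames K I) (%h. of_bool (Qf w (mrow2 h) <= T & fst (act (norm1 h) w):B)) =
  csum ?G (%g. f (act (norm1 h0) (act g w)))" if w: "snd w > 0" for w
 proof -
  have "csum (Frames K I) (%h. of_bool (Qf w (mrow2 h) <= T & fst (act (norm1 h) w):B)) =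
   csum (Frames K I) (%h. f (act (norm1 h) w))" by (intro nn_integral_cong) (simp add: eq w)
  also have "... = csum ?G (%g. f (act (norm1 (h0 \<odot> g)) w))"
   by (rule nn_integral_bij_count_space[OF bij, symmetric])
  also have "... = csum ?G (%g. f (act (norm1 h0) (act g w)))"
   by (intro nn_integral_cong) (simp add: norm1_mmul SL.det act_mmul[OF Det_sq_norm1[OF det(1)[OF h0]] _ w])
  finally show ?thesis .
 qed
 have "nnint hyp_measure (%w. indicator F w*csum (Frames K I) (%h. of_bool (Qf w (mrow2 h) <= T & fst (act (norm1 h) w):B)))
  = nnint hyp_measure (%w. indicator F w*csum ?G (%g. f (act (norm1 h0) (act g w))))"
  by (rule nn_integral_hyp_cong) (simp add: inner)
 also have "... = 2*nnint hyp_measure (%w. f (act (norm1 h0) w))" by (rule SL.orbit_unfolding[OF F]) measurable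
 also have "nnint hyp_measure (%w. f (act (norm1 h0) w)) = nnint hyp_measure (%w. f w)"
  by (rule nn_integral_act[OF Det_sq_norm1[OF det(1)[OF h0]] fm])
 also have "... = nnint lborel (%z. indicator B z*ennreal (1/(4*(sqrt ?\<delta>/T)^4)))"
  unfolding nn_integral_hyp[OF fm]
 proof (rule nn_integral_cong)
  fix z
  have "nnint lborel (%r. f (z, r)*(ennreal (1/r^5)*indicator {0<..} r)) =
   nnint lborel (%r. indicator B z*(of_bool (sqrt ?\<delta>/T <= r)*(ennreal (1/r^5)*indicator {0<..} r)))"
   by (intro nn_integral_cong) (simp add: f_def pos_divide_le_eq T mult.commute mult.left_commute)
  also have "... = indicator B z*nnint lborel (%r. of_bool (sqrt ?\<delta>/T <= r)*(ennreal (1/r^5)*indicator {0<..} r))"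
   by (rule nn_integral_cmult) measurable
  finally show "nnint lborel (%r. f (z, r)*(ennreal (1/r^5)*indicator {0<..} r)) = indicator B z*ennreal (1/(4*(sqrt ?\<delta>/T)^4))"
   using nn_integral_power5_tail[of "sqrt ?\<delta>/T"] d T by simp
 qed
 also have "... = ennreal (covol (colon K I))*ennreal (1/(4*(sqrt ?\<delta>/T)^4))"
  using emeasure_fdom[OF lat_colon[OF K I] B] by (subst nn_integral_multc) auto
 also have "2 * ... = ennreal (2*(covol (colon K I)*(1/(4*(sqrt ?\<delta>/T)^4))))"
 proof -
  have "2*(ennreal x*ennreal y) = ennreal (2*(x*y))" if "x >= 0" "y >= 0" for x y
   using that by (simp add: ennreal_mult)
  then show ?thesis using covol_pos[OF lat_colon[OF K I]] T by (metis (no_types, lifting) d divide_nonneg_nonneg less_imp_le mult_nonneg_nonneg real_sqrt_ge_zero zero_le_numeral zero_le_one zero_le_power)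
 qed
 also have "2*(covol (colon K I)*(1/(4*(sqrt ?\<delta>/T)^4))) = covol Oo*T^4/2*(1/NI I^4)"
 proof -
  have "sqrt ?\<delta>^4 = (sqrt ?\<delta>^2)^2" by simp
  also have "... = ?\<delta>^2" using d by simp
  finally have "sqrt ?\<delta>^4 = NI K^2*NI I^2" by (simp add: power_mult_distrib)
  moreover have "NI I^4 = NI I^2*NI I^2" by simp
  ultimately show ?thesis unfolding covol_colon[OF K I] power_divide
   using NI_pos[OF K] NI_pos[OF I] T by (simp add: field_simps)
 qed
 finally show "nnint hyp_measure (%w. indicator F w*csum (Frames K I) (%h. of_bool (Qf w (mrow2 h) <= T & fst (act (norm1 h) w):B)))
   = ennreal (covol Oo*T^4/2*(1/NI I^4))" .
qed

theorem unfolded_count: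
 assumes F: "fund_domain (SL2 Oo) F" and T: "T > 0"
 shows "nnint hyp_measure (%w. indicator F w*ennreal (card (VT w T))) = ennreal (covol Oo*T^4/2*MM)*ZZ"
proof -
 define B where "B K I = (SOME B. fdom (colon K I) B)" for K I
 have B: "fdom (colon K I) (B K I)" if "rideal K" "rideal I" for K I
  unfolding B_def using fdom_exists[OF lat_colon[OF that]] by (rule someI_ex)
 define c where "c K = 1/real (card (AutK K))" for K
 define J where "J K I w = csum (Frames K I) (%h. of_bool (Qf w (mrow2 h) <= T & fst (act (norm1 h) w):B K I))" for K I w
 have Ids: "rideal I" "I <= Oo" if "I:Ids" for I using that by (auto simp: Ids_def)
 have [measurable]: "F:sets borel" using F by (simp add: fund_domain_def)
 have Jm: "J K I:borel_measurable borel" if "K:Reps" "I:Ids" for K I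
  unfolding J_def[abs_def] using frame_unfolding(1)[OF F Reps_props(1)[OF that(1)] Ids(1)[OF that(2)] B T] that Ids Reps_props by blast
 have co: "covol Oo > 0" by (rule covol_pos[OF lat_O])
 have "nnint hyp_measure (%w. indicator F w*ennreal (card (VT w T))) =
  nnint hyp_measure (%w. csum Ids (%I. (SUM K:Reps. ennreal (c K)*(indicator F w*J K I w))))"
 proof (rule nn_integral_hyp_cong)
  fix z :: quat and r :: real assume r: "r > 0"
  let ?w = "(z, r)"
  have "ennreal (SUM K:Reps. real (card {v:VT ?w T. EX h:Frames K I. mrow2 h = v})) = (SUM K:Reps. ennreal (c K)*J K I ?w)"
   if I: "I:Ids" for I
  proof -
   have "ennreal (real (card {v:VT ?w T. EX h:Frames K I. mrow2 h = v})) = ennreal (c K)*J K I ?w" if K: "K:Reps" for K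
    unfolding J_def frame_count[OF Reps_props(1)[OF K] Ids[OF I] _ B[OF Reps_props(1)[OF K] Ids(1)[OF I]], of ?w T, simplified, OF r] c_def
    using card_AutK[OF Reps_props(1)[OF K]] by (subst ennreal_mult[symmetric]) auto
   then show ?thesis by (simp flip: sum_ennreal)
  qed
  then have "csum Ids (%I. (SUM K:Reps. ennreal (c K)*J K I ?w)) =
   csum Ids (%I. ennreal (SUM K:Reps. real (card {v:VT ?w T. EX h:Frames K I. mrow2 h = v})))"
   by (intro nn_integral_cong) simp
  then have "csum Ids (%I. (SUM K:Reps. ennreal (c K)*J K I ?w)) = ennreal (card (VT ?w T))"
   using VT_partition[of ?w T] r by simp
  then show "indicator F ?w*ennreal (card (VT ?w T)) = csum Ids (%I. (SUM K:Reps. ennreal (c K)*(indicator F ?w*J K I ?w)))"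
   by (cases "?w:F") auto
 qed
 also have "... = csum Ids (%I. nnint hyp_measure (%w. (SUM K:Reps. ennreal (c K)*(indicator F w*J K I w))))"
  by (rule nn_integral_count_space_nn_integral[OF countable_Ids]) (use Jm in measurable)
 also have "... = csum Ids (%I. ennreal (covol Oo*T^4/2*MM)*ennreal (1/NI I^4))"
 proof (rule nn_integral_cong)
  fix I assume "I:space (count_space Ids)"
  then have I: "I:Ids" by simp
  have "nnint hyp_measure (%w. (SUM K:Reps. ennreal (c K)*(indicator F w*J K I w))) =
   (SUM K:Reps. nnint hyp_measure (%w. ennreal (c K)*(indicator F w*J K I w)))"
   by (rule nn_integral_sum) (use Jm[OF _ I] in measurable)
  also have "... = (SUM K:Reps. ennreal (c K)*nnint hyp_measure (%w. indicator F w*J K I w))"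
   by (intro sum.cong refl nn_integral_cmult) (use Jm[OF _ I] in measurable)
  also have "... = (SUM K:Reps. ennreal (c K)*ennreal (covol Oo*T^4/2*(1/NI I^4)))"
   unfolding J_def using frame_unfolding(2)[OF F Reps_props(1) Ids(1)[OF I] B[OF Reps_props(1) Ids(1)[OF I]] T]
   by (intro sum.cong refl) simp
  also have "... = ennreal (SUM K:Reps. c K)*ennreal (covol Oo*T^4/2*(1/NI I^4))"
   by (simp add: sum_distrib_right[symmetric] c_def)
  also have "... = ennreal (covol Oo*T^4/2*MM)*ennreal (1/NI I^4)"
   using co by (simp add: MM_def c_def sum_nonneg mult_ac flip: ennreal_mult)
  finally show "nnint hyp_measure (%w. (SUM K:Reps. ennreal (c K)*(indicator F w*J K I w))) =
   ennreal (covol Oo*T^4/2*MM)*ennreal (1/NI I^4)" .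
 qed
 also have "... = ennreal (covol Oo*T^4/2*MM)*ZZ" unfolding ZZ_def by (rule nn_integral_cmult) simp
 finally show ?thesis .
qed

end

section \<open>Lattice points in large balls\<close>

text \<open>The domain lies within \<rho> of the origin, so counts in balls and volumes of balls
  control each other after the radius is shifted by \<rho>.\<close>

lemma lattice_count_ball:
 fixes L :: "'a::euclidean_space set"
 assumes B: "fdom L B" "B <= cball 0 \<rho>" and L: "countable L" and fin: "!!R. finite (L Int cball 0 R)"
  and v: "emeasure lborel B = ennreal v" "v > 0" and R: "R >= 0" "\<rho> >= 0"
 shows "real (card (L Int cball 0 R)) * v <= unit_ball_vol (real DIM('a))*(R+\<rho>)^DIM('a)"
  and "unit_ball_vol (real DIM('a)) * R^DIM('a) <= real (card (L Int cball 0 (R+\<rho>))) * v"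
proof -
 let ?\<omega> = "unit_ball_vol (real DIM('a))" and ?N = "%R. card (L Int cball 0 R)"
 have vol: "ennreal (?\<omega>*r^DIM('a)) = nnint lborel (%x. indicator B x*csum L (%l. indicator (cball 0 r) (x-l)))" if "r >= 0" for r
  using lat_mean[OF B(1) L, of "indicator (cball 0 r)"] emeasure_cball[OF that, of "0::'a"]
  by (simp add: borel_measurable_indicator borel_closed)
 have inner: "csum L (%l. indicator (cball 0 r) (x-l)) = ennreal (card {l:L. x-l:cball 0 r})"
  and fin': "finite {l:L. x-l:cball 0 r}" if x: "x:B" for x r
 proof -
  have "{l:L. x-l:cball 0 r} <= L Int cball 0 (r+norm x)"
  proof
   fix l assume l: "l:{l:L. x-l:cball 0 r}"
   then have "norm (x-l) <= r" by simp
   then have "norm l <= r+norm x" using norm_triangle_ineq4[of x "x-l"] by simp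
   then show "l:L Int cball 0 (r+norm x)" using l by simp
  qed
  then show f: "finite {l:L. x-l:cball 0 r}" using fin by (rule finite_subset)
  have "csum L (%l. indicator (cball 0 r) (x-l)) = csum L (%l. indicator {l:L. x-l:cball 0 r} l)"
   by (intro nn_integral_cong) (auto simp: indicator_def)
  also have "... = emeasure (count_space L) {l:L. x-l:cball 0 r}" by (intro nn_integral_indicator) auto
  finally show "csum L (%l. indicator (cball 0 r) (x-l)) = ennreal (card {l:L. x-l:cball 0 r})"
   using f by (simp add: emeasure_count_space ennreal_of_nat_eq_real_of_nat)
 qed
 have const: "nnint lborel (%x. indicator B x*ennreal c) = ennreal (c * v)" if "c >= 0" for c
  using B that v by (subst nn_integral_multc) (auto simp: fdom_def ennreal_mult mult.commute)
 have bB: "norm x <= \<rho>" if "x:B" for x using B(2) that by auto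
 have "ennreal (?N R * v) <= ennreal (?\<omega>*(R+\<rho>)^DIM('a))"
  unfolding vol[of "R+\<rho>", OF add_nonneg_nonneg[OF R]] const[OF of_nat_0_le_iff, symmetric]
 proof (rule nn_integral_mono)
  fix x
  show "indicator B x*ennreal (?N R) <= indicator B x*csum L (%l. indicator (cball 0 (R+\<rho>)) (x-l))"
  proof (cases "x:B")
   case True
   have "L Int cball 0 R <= {l:L. x-l:cball 0 (R+\<rho>)}"
   proof
    fix l assume l: "l:L Int cball 0 R"
    then have "norm (x-l) <= R+\<rho>" using bB[OF True] norm_triangle_ineq4[of x l] by simp
    then show "l:{l:L. x-l:cball 0 (R+\<rho>)}" using l by simp
   qed
   then have "?N R <= card {l:L. x-l:cball 0 (R+\<rho>)}" by (rule card_mono[OF fin'[OF True]])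
   then show ?thesis unfolding inner[OF True] by (intro mult_left_mono ennreal_leI) auto
  qed simp
 qed
 then show "real (?N R) * v <= ?\<omega>*(R+\<rho>)^DIM('a)" using R by (subst (asm) ennreal_le_iff) auto
 have "ennreal (?\<omega> * R^DIM('a)) <= ennreal (?N (R+\<rho>) * v)"
  unfolding vol[OF R(1)] const[OF of_nat_0_le_iff, symmetric]
 proof (rule nn_integral_mono)
  fix x
  show "indicator B x*csum L (%l. indicator (cball 0 R) (x-l)) <= indicator B x*ennreal (?N (R+\<rho>))"
  proof (cases "x:B")
   case True
   have "{l:L. x-l:cball 0 R} <= L Int cball 0 (R+\<rho>)"
   proof
    fix l assume l: "l:{l:L. x-l:cball 0 R}"
    then have "norm l <= R+\<rho>" using bB[OF True] norm_triangle_ineq4[of x "x-l"] by simp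
    then show "l:L Int cball 0 (R+\<rho>)" using l by simp
   qed
   then have "card {l:L. x-l:cball 0 R} <= ?N (R+\<rho>)" by (rule card_mono[OF fin])
   then show ?thesis unfolding inner[OF True] by (intro mult_left_mono ennreal_leI) auto
  qed simp
 qed
 then show "?\<omega> * R^DIM('a) <= real (?N (R+\<rho>)) * v" using v by (subst (asm) ennreal_le_iff) auto
qed

lemma lattice_count_asymptotics:
 fixes L :: "'a::euclidean_space set"
 assumes B: "fdom L B" and L: "countable L" and fin: "!!R. finite (L Int cball 0 R)"
  and v: "emeasure lborel B = ennreal v" "v > 0"
 shows "((%R. real (card (L Int cball 0 R))/R^DIM('a)) \<longlongrightarrow> unit_ball_vol (real DIM('a))/v) at_top"
proof -
 let ?\<omega> = "unit_ball_vol (real DIM('a))" and ?N = "%R. card (L Int cball 0 R)"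
 obtain b where b: "b > 0" "!!x. x:B ==> norm x <= b" using B unfolding fdom_def bounded_pos by blast
 have Bb: "B <= cball 0 b" using b by auto
 note bd = lattice_count_ball[OF B Bb L fin v]
 have lim: "((%R. ?\<omega>/v * (1+c/R)^DIM('a)) \<longlongrightarrow> ?\<omega>/v * 1^DIM('a)) at_top" for c
 proof -
  have "((%R. 1+c/R) \<longlongrightarrow> 1) at_top" by real_asymp
  then show ?thesis by (intro tendsto_intros)
 qed
 show ?thesis
 proof (rule real_tendsto_sandwich)
  show "\<forall>\<^sub>F R in at_top. ?\<omega>/v * (1+- b/R)^DIM('a) <= real (?N R)/R^DIM('a)"
   using eventually_ge_at_top[of b]
  proof eventually_elim
   case (elim R)
   then have R: "R > 0" "R-b >= 0" using b by auto
   have "?\<omega>*(R-b)^DIM('a) <= real (?N R) * v" using bd(2)[OF R(2)] b by simp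
   moreover have "1+- b/R = (R-b)/R" using R by (simp add: field_simps)
   ultimately show ?case using R v by (simp add: power_divide field_simps)
  qed
  show "\<forall>\<^sub>F R in at_top. real (?N R)/R^DIM('a) <= ?\<omega>/v * (1+b/R)^DIM('a)"
   using eventually_ge_at_top[of 1]
  proof eventually_elim
   case (elim R)
   then have R: "R > 0" by auto
   have "real (?N R) * v <= ?\<omega>*(R+b)^DIM('a)" using bd(1)[of R] R b by simp
   moreover have "1+b/R = (R+b)/R" using R by (simp add: field_simps)
   ultimately show ?case using R v by (simp add: power_divide field_simps)
  qed
 qed (use lim[of b] lim[of "- b"] in simp_all)
qed

text \<open>Balls of radius 1/2 around the points cover no place more often than the number of
  points in the unit ball. The bound refers to a count at a fixed radius and to no other quantity of
  the lattice; this is what makes the domination integrable over the fundamental domain.\<close>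

lemma lattice_count_bound:
 fixes L :: "'a::euclidean_space set"
 assumes L: "!!x y. x:L ==> y:L ==> x-y:L" and fin: "!!R. finite (L Int cball 0 R)" and R: "R >= 1"
 shows "real (card (L Int cball 0 R)) <= real (card (L Int cball 0 1))*(3 * R)^DIM('a)"
proof -
 let ?\<omega> = "unit_ball_vol (real DIM('a))" and ?N = "%R. card (L Int cball 0 R)"
 have "ennreal (?N R*(?\<omega>*(1/2)^DIM('a))) = (SUM l:L Int cball 0 R. emeasure lborel (cball l (1/2)))"
  by (simp add: emeasure_cball ennreal_of_nat_eq_real_of_nat ennreal_mult)
 also have "... = nnint lborel (%x. (SUM l:L Int cball 0 R. indicator (cball l (1/2)) x))"
  by (subst nn_integral_sum) (auto intro!: borel_measurable_indicator borel_closed)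
 also have "... <= nnint lborel (%x. ennreal (?N 1)*indicator (cball 0 (R+1/2)) (x::'a))"
 proof (rule nn_integral_mono)
  fix x :: 'a
  let ?P = "{l:L Int cball 0 R. x:cball l (1/2)}"
  have "(SUM l:L Int cball 0 R. indicator (cball l (1/2)) x) = ennreal (card ?P)"
   using fin[of R] by (simp add: indicator_def sum.If_cases Int_def ennreal_of_nat_eq_real_of_nat)
  also have "... <= ennreal (?N 1)*indicator (cball 0 (R+1/2)) x"
  proof (cases "?P = {}")
   case False
   then obtain l0 where l0: "l0:L" "norm l0 <= R" "dist l0 x <= 1/2" by auto
   have "(%l. l-l0) ` ?P <= L Int cball 0 1"
   proof (intro image_subsetI)
    fix l assume l: "l:?P"
    then have "dist l l0 <= 1" using l0(3) dist_triangle2[of l l0 x] by simp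
    then show "l-l0:L Int cball 0 1" using L[of l l0] l l0(1) by (simp add: dist_norm norm_minus_commute)
   qed
   then have "card ?P <= ?N 1" using fin by (intro card_inj_on_le[of "%l. l-l0"]) auto
   moreover have "norm x <= R+1/2"
    using l0 norm_triangle_ineq4[of l0 "l0-x"] by (simp add: dist_norm)
   ultimately show ?thesis by (simp add: ennreal_leI)
  next
   case True
   show ?thesis unfolding True by simp
  qed
  finally show "(SUM l:L Int cball 0 R. indicator (cball l (1/2)) x) <= ennreal (?N 1)*indicator (cball 0 (R+1/2)) x" .
 qed
 also have "... = ennreal (?N 1*(?\<omega>*(R+1/2)^DIM('a)))"
  using R by (subst nn_integral_cmult) (simp_all add: emeasure_cball ennreal_mult borel_measurable_indicator borel_closed)
 finally have "?N R*(?\<omega>*(1/2)^DIM('a)) <= ?N 1*(?\<omega>*(R+1/2)^DIM('a))"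
  using R by (subst (asm) ennreal_le_iff) auto
 then have "?N R*(1/2)^DIM('a) <= ?N 1*(R+1/2)^DIM('a)" by (simp add: mult.left_commute[of _ ?\<omega>])
 then have "?N R*((1/2)^DIM('a)*2^DIM('a)) <= ?N 1*((R+1/2)^DIM('a)*2^DIM('a))"
  unfolding mult.assoc[symmetric] by (rule mult_right_mono) simp
 then have "?N R <= ?N 1*(2*(R+1/2))^DIM('a)" unfolding power_mult_distrib[symmetric] by (simp add: mult.commute)
 also have "... <= ?N 1*(3 * R)^DIM('a)" using R by (intro mult_left_mono power_mono) auto
 finally show ?thesis .
qed

context max_order
begin

text \<open>\<open>Qf\<close> is the squared Euclidean norm on the image of O^2 under f. The factors
  sqrt r and 1/sqrt r cancel in the covolume, which therefore does not depend on the point; the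
  successor accounts for the zero row.\<close>

lemma VT_lattice:
 assumes r: "r > 0"
 shows "EX L :: (quat \<times> quat) set. EX B. fdom L B & countable L & (ALL x:L. ALL y:L. x-y:L) & (ALL R. finite (L Int cball 0 R)) &
  emeasure lborel B = ennreal (covol Oo^2) & (ALL T>=0. card (L Int cball 0 (sqrt T)) = Suc (card (VT (z, r) T)))"
proof -
 define L1 L2 where "L1 = (*R) (sqrt r) ` Oo" and "L2 = (*R) (1/sqrt r) ` Oo"
 have s: "sqrt r ~= 0" "1/sqrt r ~= 0" using r by auto
 note l1 = lat_scale[OF lat_O s(1), folded L1_def] and l2 = lat_scale[OF lat_O s(2), folded L2_def]
 obtain B1 B2 where B: "fdom L1 B1" "fdom L2 B2" using fdom_exists l1(1) l2(1) by meson
 define L where "L = {(x, (1/r)*R (x*.z)+j) | x j. x:L1 & j:L2}"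
 define f where "f v = (sqrt r*R fst v, (1/sqrt r)*R (fst v *. z+snd v))" for v
 have rr: "sqrt r/r = 1/sqrt r" using r by (simp add: field_simps)
 have fL: "L = f ` (Oo \<times> Oo)"
 proof -
  have "L = (%(x, j). (x, (1/r)*R (x*.z)+j)) ` (L1 \<times> L2)" unfolding L_def by auto
  also have "L1 \<times> L2 = (%v. (sqrt r*R fst v, (1/sqrt r)*R snd v)) ` (Oo \<times> Oo)"
   unfolding L1_def L2_def by (auto simp: image_iff)
  also have "(%(x, j). (x, (1/r)*R (x*.z)+j)) ` ... = f ` (Oo \<times> Oo)"
   unfolding image_image f_def by (simp add: rr scaleR_add_right)
  finally show ?thesis .
 qed
 have inj: "inj f" using s by (auto simp: inj_on_def f_def prod_eq_iff)
 have nf: "norm (f v)^2 = Qf (z, r) v" for v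
 proof -
  have "norm (f v)^2 = r*qn (fst v)+(1/r)*qn (fst v *. z+snd v)"
   unfolding f_def norm_Pair using r by (simp add: qn_norm power_mult_distrib power_divide)
  then show ?thesis using r by (cases v) (simp add: Qf_def field_simps power2_eq_square)
 qed
 have fdiff: "f v-f w = f (v-w)" for v w by (simp add: f_def qring)
 have im: "L Int cball 0 (sqrt T) = f ` {v:Oo \<times> Oo. Qf (z, r) v <= T}" if "T >= 0" for T
 proof -
  have "norm (f v) <= sqrt T \<longleftrightarrow> Qf (z, r) v <= T" for v
   unfolding nf[symmetric] using that by (metis norm_ge_zero real_sqrt_le_iff real_sqrt_unique)
  then show ?thesis unfolding fL by auto
 qed
 have fin: "finite (L Int cball 0 R)" for R
 proof -
  have "finite (L Int cball 0 (sqrt (R^2)))" unfolding im[OF zero_le_power2] using Qf_finite[of "(z, r)" "R^2"] r by simp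
  then show ?thesis by (rule rev_finite_subset) auto
 qed
 have "card (L Int cball 0 (sqrt T)) = Suc (card (VT (z, r) T))" if T: "T >= 0" for T
 proof -
  have "{v:Oo \<times> Oo. Qf (z, r) v <= T} = insert 0 (VT (z, r) T)"
   using T O_zero by (auto simp: VT_def Qf_def zero_prod_def)
  moreover have "0 ~: VT (z, r) T" by (simp add: VT_def)
  ultimately show ?thesis unfolding im[OF T] using finite_VT[of "(z, r)" T] r
   by (subst card_image[OF inj_on_subset[OF inj subset_UNIV]]) simp
 qed
 moreover have "emeasure lborel (B1 \<times> B2) = ennreal (covol Oo^2)"
 proof -
  have "emeasure lborel (B1 \<times> B2) = ennreal (covol L1)*ennreal (covol L2)"
   using B emeasure_fdom[OF l1(1) B(1)] emeasure_fdom[OF l2(1) B(2)] by (subst emeasure_Times) (auto simp: fdom_def)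
  also have "... = ennreal (covol L1*covol L2)" using covol_pos[OF l1(1)] covol_pos[OF l2(1)] by (simp add: ennreal_mult)
  also have "covol L1*covol L2 = covol Oo^2" unfolding l1(2) l2(2) using r by (simp add: power_divide power2_eq_square)
  finally show ?thesis .
 qed
 moreover have "x-y:L" if "x:L" "y:L" for x y
 proof -
  obtain v w where v: "v:Oo \<times> Oo" "w:Oo \<times> Oo" "x = f v" "y = f w" using \<open>x : L\<close> \<open>y : L\<close> unfolding fL by blast
  then have "v-w:Oo \<times> Oo" using O_diff by (auto simp: mem_Times_iff)
  then show ?thesis unfolding v fdiff fL by (rule imageI)
 qed
 moreover have "fdom L (B1 \<times> B2)" unfolding L_def by (rule fdom_shear[OF B])
 moreover have "countable L" unfolding fL using lat_countable[OF lat_O] by simp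
 ultimately show ?thesis using fin by blast
qed

text \<open>pi^4/24 is the volume of the unit ball in dimension eight, and the radius sqrt T turns
  eighth powers into T^4. The factor 6561 = 3^8 comes from \<open>lattice_count_bound\<close>, and
  the summand 1 is the zero row.\<close>

lemma VT_asymptotics:
 assumes "snd w > 0"
 shows "(%n. real (card (VT w (real n)))/real n^4) \<longlonglongrightarrow> pi^4/(24*covol Oo^2)"
  and "T >= 1 ==> real (card (VT w T)) <= 6561*T^4*(1+real (card (VT w 1)))"
proof -
 obtain z r where w: "w = (z, r)" "r > 0" using assms by (cases w) auto
 obtain L :: "(quat \<times> quat) set" and B where L: "fdom L B" "countable L" "!!x y. x:L ==> y:L ==> x-y:L"
   "!!R. finite (L Int cball 0 R)" "emeasure lborel B = ennreal (covol Oo^2)"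
  and N: "!!T. T >= 0 ==> card (L Int cball 0 (sqrt T)) = Suc (card (VT (z, r) T))"
  using VT_lattice[OF w(2), of z] by blast
 have co: "covol Oo^2 > 0" using covol_pos[OF lat_O] by simp
 have D: "DIM(quat \<times> quat) = 8" by simp
 have p8: "sqrt T^8 = T^4" if "T >= 0" for T :: real
 proof -
  have "sqrt T^8 = (sqrt T^2)^4" by (simp flip: power_mult)
  then show ?thesis using that by simp
 qed
 have vol: "unit_ball_vol 8 = pi^4/24" by (simp add: eval_unit_ball_vol)
 have lim: "((%R. real (card (L Int cball 0 R))/R^8) \<longlongrightarrow> pi^4/24/covol Oo^2) at_top"
  using lattice_count_asymptotics[OF L(1,2,4,5) co] unfolding D by (simp add: vol)
 have "filterlim (%n. sqrt (real n)) at_top sequentially" by real_asymp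
 from filterlim_compose[OF lim this]
 have "(%n. real (Suc (card (VT w (real n))))/real n^4) \<longlonglongrightarrow> pi^4/24/covol Oo^2" using N p8 w by simp
 moreover have "(%n. 1/real n^4) \<longlonglongrightarrow> 0" by real_asymp
 ultimately have "(%n. real (Suc (card (VT w (real n))))/real n^4-1/real n^4) \<longlonglongrightarrow> pi^4/24/covol Oo^2-0"
  by (rule tendsto_diff)
 then show "(%n. real (card (VT w (real n)))/real n^4) \<longlonglongrightarrow> pi^4/(24*covol Oo^2)"
  by (simp add: diff_divide_distrib[symmetric] mult.commute)
 show "real (card (VT w T)) <= 6561*T^4*(1+real (card (VT w 1)))" if T: "T >= 1"
 proof -
  have "real (card (L Int cball 0 (sqrt T))) <= real (card (L Int cball 0 1))*(3 * sqrt T)^8"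
   using lattice_count_bound[OF L(3,4), of "sqrt T"] T unfolding D by simp
  then show ?thesis using N[of T] N[of 1] p8[of T] T w by (simp add: power_mult_distrib mult_ac)
 qed
qed

text \<open>Fatou's lemma gives an upper bound and with it the finiteness of the volume. This makes
  6561 (1_F + N 1) integrable, since N 1 has finite integral by the unfolded count, and dominated
  convergence turns the bound into an equality. The constant is covol/2 divided by pi^4/(24
  covol^2).\<close>

theorem volume_identity:
 assumes F: "fund_domain (SL2 Oo) F" and Z: "ZZ < \<infinity>"
 shows "emeasure hyp_measure F = ennreal (12*covol Oo^3/pi^4*MM)*ZZ"
proof -
 have [measurable]: "F:sets borel" using F by (simp add: fund_domain_def)
 define V where "V = Oo \<times> Oo - {0}"
 have cV: "countable V" unfolding V_def by (intro countable_Diff countable_SIGMA lat_countable lat_O)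
 define N where "N T w = csum V (%v. of_bool (Qf w v <= T))*indicator F w" for T w
 have Nm [measurable]: "N T:borel_measurable borel" for T
  unfolding N_def[abs_def] by (intro borel_measurable_times_ennreal borel_measurable_count_sum[OF cV]) measurable
 have N: "N T w = indicator F w*ennreal (card (VT w T))" if w: "snd w > 0" for w T
 proof -
  have "csum V (%v. of_bool (Qf w v <= T)) = csum V (%v. indicator (VT w T) v)"
   by (intro nn_integral_cong) (auto simp: V_def VT_def indicator_def)
  also have "... = emeasure (count_space V) (VT w T)" by (rule nn_integral_indicator) (auto simp: V_def VT_def)
  also have "... = ennreal (card (VT w T))"
   using finite_VT[OF w, of T] by (subst emeasure_count_space_finite) (auto simp: V_def VT_def ennreal_of_nat_eq_real_of_nat)
  finally show ?thesis by (simp add: N_def mult.commute)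
 qed
 define C where "C = ennreal (covol Oo/2*MM)*ZZ"
 have co: "covol Oo > 0" by (rule covol_pos[OF lat_O])
 have MM0: "MM >= 0" unfolding MM_def by (simp add: sum_nonneg)
 have Cfin: "C < \<infinity>" unfolding C_def using Z by (simp add: ennreal_mult_less_top)
 have intN: "nnint hyp_measure (%w. N T w) = ennreal (T^4)*C" if "T > 0" for T
 proof -
  have "nnint hyp_measure (%w. N T w) = ennreal (covol Oo*T^4/2*MM)*ZZ"
   unfolding unfolded_count[OF F that, symmetric] by (rule nn_integral_hyp_cong) (simp add: N)
  also have "ennreal (covol Oo*T^4/2*MM) = ennreal (T^4)*ennreal (covol Oo/2*MM)"
   using co MM0 by (simp add: ennreal_mult[symmetric] mult_ac)
  finally show ?thesis by (simp add: C_def mult.assoc)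
 qed
 define u where "u n w = ennreal (1/real (Suc n)^4)*N (real (Suc n)) w" for n w
 have um [measurable]: "u n:borel_measurable borel" for n unfolding u_def[abs_def] by measurable
 have intu: "nnint hyp_measure (%w. u n w) = C" for n
 proof -
  have "nnint hyp_measure (%w. u n w) = ennreal (1/real (Suc n)^4)*(ennreal (real (Suc n)^4)*C)"
   unfolding u_def by (subst nn_integral_cmult) (simp_all add: intN)
  also have "... = ennreal (1/real (Suc n)^4*real (Suc n)^4)*C" by (subst ennreal_mult) (simp_all only: mult.assoc zero_le_divide_1_iff zero_le_power of_nat_0_le_iff)
  also have "1/real (Suc n)^4*real (Suc n)^4 = 1" by simp
  finally show ?thesis by simp
 qed
 define c where "c = pi^4/(24*covol Oo^2)"
 have c: "c > 0" unfolding c_def using co by simp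
 have lim: "(%n. u n w) \<longlonglongrightarrow> ennreal c*indicator F w" if w: "snd w > 0" for w
 proof -
  have "u n w = ennreal (real (card (VT w (real (Suc n))))/real (Suc n)^4)*indicator F w" for n
  proof -
   have "ennreal (1/x)*ennreal y = ennreal (y/x)" if "x >= 0" "y >= 0" for x y
    using that by (simp add: ennreal_mult[symmetric])
   from this[of "real (Suc n)^4" "card (VT w (real (Suc n)))"] show ?thesis
    unfolding u_def N[OF w] by (cases "w:F") simp_all
  qed
  moreover have "(%n. ennreal (real (card (VT w (real (Suc n))))/real (Suc n)^4)) \<longlonglongrightarrow> ennreal c"
   using VT_asymptotics(1)[OF w] unfolding c_def by (intro tendsto_ennrealI) (rule LIMSEQ_Suc)
  ultimately show ?thesis by (cases "w:F") simp_all
 qed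
 have limAE: "AE w in hyp_measure. (%n. u n w) \<longlonglongrightarrow> ennreal c*indicator F w"
  using AE_hyp_pos by eventually_elim (rule lim)
 have Fc: "nnint hyp_measure (%w. ennreal c*indicator F w) = ennreal c*emeasure hyp_measure F"
  by (subst nn_integral_cmult) auto
 have "nnint hyp_measure (%w. ennreal c*indicator F w) = nnint hyp_measure (%w. liminf (%n. u n w))"
 proof (rule nn_integral_cong_AE)
  show "AE w in hyp_measure. ennreal c*indicator F w = liminf (%n. u n w)"
   using limAE by eventually_elim (simp add: lim_imp_Liminf)
 qed
 also have "... <= liminf (%n. nnint hyp_measure (%w. u n w))" by (rule nn_integral_liminf) measurable
 also have "... = C" unfolding intu by (simp add: Liminf_const)
 finally have le: "ennreal c*emeasure hyp_measure F <= C" unfolding Fc .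
 have Ffin: "emeasure hyp_measure F < \<infinity>"
 proof (rule ccontr)
  assume "~ ?thesis"
  then have "emeasure hyp_measure F = top" by (simp flip: less_top)
  then have "ennreal c*emeasure hyp_measure F = \<infinity>" using c by (simp add: ennreal_mult_eq_top_iff)
  then show False using le Cfin by simp
 qed
 have "(%n. nnint hyp_measure (%w. u n w)) \<longlonglongrightarrow> (nnint hyp_measure (%w. ennreal c*indicator F w))"
 proof (rule nn_integral_dominated_convergence[OF _ _ _ _ _ limAE])
  show "AE w in hyp_measure. u n w <= ennreal 6561*(indicator F w+N 1 w)" for n
   using AE_hyp_pos
  proof eventually_elim
   case (elim w)
   let ?T = "real (Suc n)"
   have "real (card (VT w ?T)) <= 6561*?T^4*(1+real (card (VT w 1)))" using VT_asymptotics(2)[OF elim, of ?T] by simp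
   then have "1/?T^4*real (card (VT w ?T)) <= 6561*(1+real (card (VT w 1)))" by (simp add: field_simps)
   then have "ennreal (1/?T^4*real (card (VT w ?T))) <= ennreal (6561*(1+real (card (VT w 1))))" by (rule ennreal_leI)
   then have "ennreal (1/?T^4)*ennreal (card (VT w ?T)) <= ennreal 6561*(1+ennreal (card (VT w 1)))"
    by (subst (asm) (1 2) ennreal_mult) simp_all
   then show ?case unfolding u_def N[OF elim] by (cases "w:F") auto
  qed
  have "nnint hyp_measure (%w. ennreal 6561*(indicator F w+N 1 w)) = ennreal 6561*(emeasure hyp_measure F+C)"
   using intN[of 1] by (simp add: nn_integral_cmult nn_integral_add)
  also have "... < \<infinity>" using Ffin Cfin by (simp add: ennreal_mult_less_top)
  finally show "nnint hyp_measure (%w. ennreal 6561*(indicator F w+N 1 w)) < \<infinity>" .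
 qed measurable
 then have eq: "ennreal c*emeasure hyp_measure F = C"
  unfolding intu Fc by (metis LIMSEQ_unique tendsto_const)
 have "emeasure hyp_measure F = ennreal (1/c)*(ennreal c*emeasure hyp_measure F)"
  using c by (simp add: mult.assoc[symmetric] ennreal_mult[symmetric])
 also have "... = ennreal (1/c*(covol Oo/2*MM))*ZZ"
  unfolding eq C_def using c co MM0 by (subst ennreal_mult) (simp_all add: mult.assoc)
 also have "1/c*(covol Oo/2*MM) = 12*covol Oo^3/pi^4*MM"
  unfolding c_def using co by (simp add: field_simps power2_eq_square power3_eq_cube)
 finally show ?thesis .
qed

end

section \<open>Zeta values and the number of ideals\<close>

text \<open>Euler's product for the sine at the imaginary point i x.\<close>

lemma sinh_product_formula: "(%n. pi*x*(PROD k=1..n. 1+x^2/real k^2)) \<longlonglongrightarrow> sinh (pi*x)"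
proof -
 have "(%n. Im (of_real pi*(\<i> * of_real x)*(PROD k=1..n. 1-(\<i> * of_real x)^2/of_nat k^2))) \<longlonglongrightarrow> Im (sin (of_real pi*(\<i> * of_real x)))"
  by (intro tendsto_Im sin_product_formula_complex)
 moreover have "(PROD k=1..n. 1-(\<i> * of_real x)^2/of_nat k^2) = complex_of_real (PROD k=1..n. 1+x^2/real k^2)" for n
  by (simp add: power_mult_distrib)
 moreover have "sin (of_real pi*(\<i> * of_real x)) = \<i>*complex_of_real (sinh (pi*x))"
  by (simp add: sin_i_times mult.left_commute[of _ \<i>] sinh_field_def exp_minus exp_of_real[symmetric])
 moreover have "Im (of_real pi*(\<i> * of_real x)*complex_of_real r) = pi*x*r" "Im (\<i>*complex_of_real r) = r" for r by simp_all
 ultimately show ?thesis by (simp only:)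
qed

lemma prod_one_minus_bounds:
 fixes a :: "nat => real"
 assumes "!!k. 0 <= a k & a k <= 1"
 shows "1-(SUM k=1..n. a k) <= (PROD k=1..n. 1-a k)" "(PROD k=1..n. 1-a k) <= exp (- (SUM k=1..n. a k))" "(PROD k=1..n. 1-a k) <= 1"
proof -
 show le1: "(PROD k=1..n. 1-a k) <= 1" for n using assms by (intro prod_le_1) auto
 show "1-(SUM k=1..n. a k) <= (PROD k=1..n. 1-a k)"
 proof (induction n)
  case (Suc n)
  have "(PROD k=1..n. 1-a k)*a (Suc n) <= 1*a (Suc n)" using le1 assms by (intro mult_right_mono) auto
  then show ?case using Suc by (simp add: algebra_simps)
 qed simp
 have "(PROD k=1..n. 1-a k) <= (PROD k=1..n. exp (- a k))"
  using assms by (intro prod_mono) (auto intro: order_trans[OF _ exp_ge_add_one_self[of "- a _"]])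
 then show "(PROD k=1..n. 1-a k) <= exp (- (SUM k=1..n. a k))" by (simp add: exp_sum sum_negf[symmetric])
qed

text \<open>Multiplying the products for sin and sinh gives sin(pi x) sinh(pi x)/(pi x)^2 as the
  product of the factors 1 - x^4/k^4. This product lies between 1 - x^4 Z and exp(-x^4 Z), and the
  expansion of the closed form at 0 identifies Z as pi^4/90.\<close>

lemma zeta4: "(%n. 1/real (Suc n)^4) sums (pi^4/90)"
proof -
 have "summable (%n. 1/real n^4)" using inverse_power_summable[of 4, where 'a=real] by (simp add: field_simps)
 then have s: "summable (%n. 1/real (Suc n)^4)" using summable_Suc_iff[of "%n. 1/real n^4"] by simp
 define Z where "Z = (\<Sum>n. 1/real (Suc n)^4)"
 have Z: "(%n. SUM k=1..n. 1/real k^4) \<longlonglongrightarrow> Z"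
  using summable_LIMSEQ[OF s] unfolding Z_def by (simp add: sum.shift_bounds_cl_Suc_ivl sum.atLeast1_atMost_eq)
 define g where "g x = sin (pi*x) * sinh (pi*x)/(pi^2*x^2)" for x :: real
 have b: "1-x^4*Z <= g x" "g x <= exp (- (x^4*Z))" if x: "0 < x" "x < 1" for x
 proof -
  have "(%n. (pi*x*(PROD k=1..n. 1-x^2/real k^2))*(pi*x*(PROD k=1..n. 1+x^2/real k^2))/(pi^2*x^2)) \<longlonglongrightarrow> g x"
   unfolding g_def by (intro tendsto_intros sin_product_formula_real sinh_product_formula) (use x in simp)
  moreover have "(pi*x*(PROD k=1..n. 1-x^2/real k^2))*(pi*x*(PROD k=1..n. 1+x^2/real k^2))/(pi^2*x^2)
    = (PROD k=1..n. 1-x^4/real k^4)" for n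
  proof -
   have "(1-x^2/real k^2)*(1+x^2/real k^2) = 1-x^4/real k^4" for k
    by (simp add: algebra_simps flip: power_add)
   then show ?thesis using x by (simp add: power2_eq_square flip: prod.distrib)
  qed
  ultimately have lim: "(%n. PROD k=1..n. 1-x^4/real k^4) \<longlonglongrightarrow> g x" by simp
  have "x^4/real k^4 <= 1" for k
   using x power_le_one[of x 4] by (cases "k = 0") (auto simp: divide_le_eq_1 intro: order_trans[of _ 1])
  then have a: "0 <= x^4/real k^4 & x^4/real k^4 <= 1" for k by simp
  have S: "(SUM k=1..n. x^4/real k^4) = x^4*(SUM k=1..n. 1/real k^4)" for n by (simp add: sum_distrib_left)
  note pb = prod_one_minus_bounds[of "%k. x^4/real k^4", OF a, unfolded S]
  note SZ = tendsto_mult[OF tendsto_const[of "x^4"] Z]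
  show "1-x^4*Z <= g x" by (rule LIMSEQ_le[OF tendsto_diff[OF tendsto_const SZ] lim]) (use pb in auto)
  show "g x <= exp (- (x^4*Z))" by (rule LIMSEQ_le[OF lim tendsto_exp[OF tendsto_minus[OF SZ]]]) (use pb in auto)
 qed
 have ev: "\<forall>\<^sub>F x in at_right 0. 0 < x & x < (1::real)" using eventually_at_right_real[of 0 "1::real"] by simp
 have gl: "((%x. (1-g x)/x^4) \<longlongrightarrow> pi^4/90) (at_right 0)"   proof -
  have "((%y::real. (1-sin y*((exp y-exp (- y))/2)/y^2)/y^4) \<longlongrightarrow> 1/90) (at_right 0)" by real_asymp
  moreover have "filterlim (%x. pi*x) (at_right 0) (at_right 0)"
   by real_asymp
  ultimately have "((%x. pi^4*((1-sin (pi*x)*((exp (pi*x)-exp (- (pi*x)))/2)/(pi*x)^2)/(pi*x)^4)) \<longlongrightarrow> pi^4*(1/90)) (at_right 0)"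
   by (intro tendsto_mult_left) (rule filterlim_compose)
  then show ?thesis unfolding g_def sinh_field_def by (simp add: power_mult_distrib)
 qed
 have "pi^4/90 <= Z"
 proof (rule tendsto_upperbound[OF gl])
  show "\<forall>\<^sub>F x in at_right 0. (1-g x)/x^4 <= Z" using ev by eventually_elim (use b(1) in \<open>simp add: field_simps\<close>)
 qed simp
 moreover have "Z <= pi^4/90"
 proof (rule tendsto_le[OF _ gl])
  show "((%x. (1-exp (- (x^4*Z)))/x^4) \<longlongrightarrow> Z) (at_right 0)" by real_asymp
  show "\<forall>\<^sub>F x in at_right 0. (1-exp (- (x^4*Z)))/x^4 <= (1-g x)/x^4"
   using ev by eventually_elim (use b(2) in \<open>simp add: divide_right_mono\<close>)
 qed simp
 ultimately have "Z = pi^4/90" by simp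
 then show ?thesis using summable_sums[OF s, folded Z_def] by metis
qed

lemma nn_integral_series:
 assumes "(%n. f (Suc n)) sums s" "!!n. f n >= 0"
 shows "csum {0<..} (%n. ennreal (f n)) = ennreal s"
proof -
 have "bij_betw Suc UNIV {0<..}" by (rule bij_betwI[of _ _ _ "%n. n-1"]) auto
 from nn_integral_bij_count_space[OF this, of "%n. ennreal (f n)"]
 have "csum {0<..} (%n. ennreal (f n)) = (\<Sum>n. ennreal (f (Suc n)))" by (simp add: nn_integral_count_space_nat)
 also have "... = ennreal s" by (rule suminf_ennreal_eq[OF assms(2) assms(1)])
 finally show ?thesis .
qed

section \<open>Sums over integers coprime to the discriminant\<close>

definition cop :: "nat => nat set" where "cop D = {d. d > 0 & coprime d D}"

lemma cop_split:
 assumes p: "prime p" and D: "coprime p D"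
 shows "cop D = cop (p*D) Un (*) p ` cop D" "cop (p*D) Int (*) p ` cop D = {}"
proof -
 have nd: "coprime d p \<longleftrightarrow> ~ p dvd d" for d
  using prime_imp_coprime[OF p, of d] not_prime_unit[of p] p by (auto simp: coprime_commute dest: coprime_common_divisor)
 have "d:(*) p ` cop D" if d: "d:cop D" "p dvd d" for d
 proof -
  obtain e where "d = p*e" using d(2) by blast
  then show ?thesis using d(1) unfolding cop_def by auto
 qed
 moreover have "p*d:cop D" if "d:cop D" for d using that D prime_gt_0_nat[OF p] unfolding cop_def by simp
 moreover have "cop (p*D) = {d:cop D. ~ p dvd d}" unfolding cop_def coprime_mult_right_iff nd by auto
 ultimately show "cop D = cop (p*D) Un (*) p ` cop D" "cop (p*D) Int (*) p ` cop D = {}" by auto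
qed

lemma zeta3_sums: "(%n. 1/real (Suc n)^3) sums zeta3"
proof -
 have "summable (%n. 1/real n^3)" using inverse_power_summable[of 3, where 'a=real] by (simp add: field_simps)
 then have "summable (%n. 1/real (Suc n)^3)" using summable_Suc_iff[of "%n. 1/real n^3"] by simp
 then show ?thesis unfolding zeta3_def by (rule summable_sums)
qed

lemma zeta3_nonneg: "zeta3 >= 0"
 unfolding zeta3_def by (rule suminf_nonneg[OF sums_summable[OF zeta3_sums]]) simp

text \<open>Adding a prime p to S removes the multiples of p, which \<open>cop_split\<close>
  identifies with p times the previous set; this costs the factor 1 - p^(-3).\<close>

lemma euler_factor_cubes:
 assumes "finite S" "!!p. p:S ==> prime p"
 shows "csum (cop (\<Prod>S)) (%d. ennreal (1/real d^3)) = ennreal (zeta3*(PROD p:S. 1-1/real p^3))"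
 using assms
proof (induction S)
 case empty
 have "cop 1 = {0<..}" by (auto simp: cop_def)
 then show ?case using nn_integral_series[of "%n. 1/real n^3", OF zeta3_sums] by simp
next
 case (insert p S)
 let ?D = "\<Prod>S" and ?E = "%X. csum X (%d. ennreal (1/real d^3))"
 have p: "prime p" "p > 1" using insert prime_gt_1_nat by auto
 have "coprime p ?D"
 proof (rule prod_coprime_right)
  fix q assume "q:S"
  then show "coprime p q" using insert(2) insert(4)[of q] primes_coprime[OF p(1), of q] by auto
 qed
 note sp = cop_split[OF p(1) this]
 define z where "z = zeta3*(PROD p:S. 1-1/real p^3)"
 have z: "?E (cop ?D) = ennreal z" unfolding z_def using insert by simp
 have z0: "z >= 0" unfolding z_def
 proof (intro mult_nonneg_nonneg zeta3_nonneg prod_nonneg ballI)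
  fix q assume "q:S"
  then have "real q >= 1" using insert(4)[of q] prime_ge_1_nat by auto
  then have "real q^3 >= 1" by (rule one_le_power)
  then show "0 <= 1-1/real q^3" by (simp add: divide_le_eq)
 qed
 have I: "?E X = (\<integral>\<^sup>+d\<in>X. ennreal (1/real d^3) \<partial>count_space UNIV)" for X
  by (cases "X = UNIV") (simp_all add: nn_integral_count_space_indicator)
 have bij: "bij_betw ((*) p) (cop ?D) ((*) p ` cop ?D)" using p by (auto simp: bij_betw_def inj_on_def)
 have "?E (cop ?D) = ?E (cop (p*?D))+?E ((*) p ` cop ?D)"
  using nn_integral_disjoint_pair_countspace[OF sp(2), of "%d. ennreal (1/real d^3)"]
  unfolding sp(1)[symmetric] I[symmetric] .
 also have "?E ((*) p ` cop ?D) = csum (cop ?D) (%d. ennreal (1/real p^3)*ennreal (1/real d^3))"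
  unfolding nn_integral_bij_count_space[OF bij, symmetric] by (simp add: ennreal_mult[symmetric] power_mult_distrib)
 also have "... = ennreal (z/real p^3)" using z z0 by (subst nn_integral_cmult) (simp_all add: ennreal_mult[symmetric])
 finally have "ennreal z = ?E (cop (p*?D))+ennreal (z/real p^3)" unfolding z .
 then have "?E (cop (p*?D)) = ennreal z-ennreal (z/real p^3)" by (simp add: ennreal_add_diff_cancel_right)
 also have "... = ennreal (z-z/real p^3)" using z0 by (simp add: ennreal_minus)
 finally show ?case using insert by (simp add: z_def algebra_simps)
qed

context max_order
begin

lemma card_ideals_sum:
 assumes "n > 0"
 shows "of_nat (card (ideals n)) = csum {0<..} (%m. csum (cop DD) (%d. of_nat d * of_bool (d*m = n)))"
proof -
 have "csum {0<..} (%m. csum (cop DD) (%d. of_nat d * of_bool (d*m = n))) =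
  csum (cop DD) (%d. csum {0<..} (%m. of_nat d * of_bool (d*m = n)))"
  by (rule nn_integral_count_space_nn_integral) auto
 also have "... = csum (cop DD) (%d. of_nat d*indicator (cdiv n) d)"
 proof (rule nn_integral_cong)
  fix d assume "d:space (count_space (cop DD))"
  then have d: "d > 0" "coprime d DD" by (auto simp: cop_def)
  have "csum {0<..} (%m. of_bool (d*m = n)) = (indicator (cdiv n) d :: ennreal)"
  proof (cases "d dvd n")
   case True
   then obtain k where k: "n = d * k" by blast
   then have "EX! m. m:{0<..} & d*m = n" using d assms by (intro ex1I[of _ k]) auto
   then have "csum {0<..} (%m. of_bool (d*m = n)) = (1::ennreal)" by (rule nn_integral_count_space_unique)
   then show ?thesis using True d by (simp add: cdiv_def)
  next
   case False
   then have "of_bool (d*m = n) = (0::ennreal)" for m by auto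
   then show ?thesis using False by (simp add: cdiv_def)
  qed
  then show "csum {0<..} (%m. of_nat d * of_bool (d*m = n)) = of_nat d*indicator (cdiv n) d"
   by (simp add: nn_integral_cmult)
 qed
 also have "... = (SUM d:cdiv n. of_nat d)"
 proof (subst nn_integral_count_space'[of "cdiv n"])
  show "finite (cdiv n)" by (rule finite_subset[of _ "{..n}"]) (use assms in \<open>auto simp: cdiv_def dvd_imp_le\<close>)
  show "cdiv n <= cop DD" using assms by (auto simp: cdiv_def cop_def intro: Nat.gr0I)
 qed auto
 finally show ?thesis using card_ideals[OF assms] by simp
qed

text \<open>The number of ideals of norm n is a Dirichlet convolution over n = d m with weight d for
  d coprime to D. The weight g stays free because two instances are needed: x^(-4) for the zeta
  factor and the indicator of x <= X for the mass.\<close>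

lemma ideal_sum:
 "csum Ids (%I. g (NI I)) =
  csum {0<..} (%m. csum (cop DD) (%d. of_nat d*g (real (d*m))))"
proof -
 let ?P = "{0::nat<..}"
 have "csum Ids (%I. g (NI I)) = csum Ids (%I. csum ?P (%n. g (real n) * of_bool (NI I = real n)))"
 proof (rule nn_integral_cong)
  fix I assume "I:space (count_space Ids)"
  then obtain k :: nat where k: "k > 0" "NI I = real k" using NI_integral by (auto simp: Ids_def)
  have "csum ?P (%n. g (real n) * of_bool (NI I = real n)) = csum ?P (%n. g (NI I) * of_bool (NI I = real n))"
   by (intro nn_integral_cong) auto
  also have "... = g (NI I)*csum ?P (%n. of_bool (NI I = real n))" by (rule nn_integral_cmult) simp
  also have "csum ?P (%n. of_bool (NI I = real n)) = (1::ennreal)" using k by (intro nn_integral_count_space_unique) auto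
  finally show "g (NI I) = csum ?P (%n. g (real n) * of_bool (NI I = real n))" by simp
 qed
 also have "... = csum ?P (%n. csum Ids (%I. g (real n) * of_bool (NI I = real n)))"
  by (rule nn_integral_count_space_nn_integral) auto
 also have "... = csum ?P (%n. g (real n)*csum ?P (%m. csum (cop DD) (%d. of_nat d * of_bool (d*m = n))))"
 proof (rule nn_integral_cong)
  fix n assume "n:space (count_space ?P)"
  then have n: "n > 0" by simp
  have "csum Ids (%I. of_bool (NI I = real n)) = csum Ids (%I. indicator (ideals n) I)"
   by (intro nn_integral_cong) (auto simp: ideals_def Ids_def indicator_def)
  also have "... = of_nat (card (ideals n))"
  proof (subst nn_integral_indicator)
   have "ideals n <= Ids" by (auto simp: ideals_def Ids_def)
   then show "ideals n:sets (count_space Ids)" "emeasure (count_space Ids) (ideals n) = of_nat (card (ideals n))"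
    using finite_ideals[of n] by (simp_all add: emeasure_count_space_finite)
  qed
  finally show "csum Ids (%I. g (real n) * of_bool (NI I = real n)) =
   g (real n)*csum ?P (%m. csum (cop DD) (%d. of_nat d * of_bool (d*m = n)))"
   by (simp add: nn_integral_cmult card_ideals_sum[OF n])
 qed
 also have "... = csum ?P (%n. csum ?P (%m. csum (cop DD) (%d. g (real n)*(of_nat d * of_bool (d*m = n)))))"
  by (simp add: nn_integral_cmult)
 also have "... = csum ?P (%m. csum ?P (%n. csum (cop DD) (%d. g (real n)*(of_nat d * of_bool (d*m = n)))))"
  by (rule nn_integral_count_space_nn_integral) auto
 also have "... = csum ?P (%m. csum (cop DD) (%d. of_nat d*g (real (d*m))))"
 proof (rule nn_integral_cong)
  fix m assume "m:space (count_space ?P)"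
  then have m: "m > 0" by simp
  have "csum ?P (%n. csum (cop DD) (%d. g (real n)*(of_nat d * of_bool (d*m = n)))) =
   csum (cop DD) (%d. csum ?P (%n. g (real n)*(of_nat d * of_bool (d*m = n))))"
   by (rule nn_integral_count_space_nn_integral) auto
  also have "... = csum (cop DD) (%d. of_nat d*g (real (d*m)))"
  proof (rule nn_integral_cong)
   fix d assume "d:space (count_space (cop DD))"
   then have "csum ?P (%n. of_bool (d*m = n)) = (1::ennreal)"
    using m by (intro nn_integral_count_space_unique) (auto simp: cop_def)
   moreover have "csum ?P (%n. g (real n)*(of_nat d * of_bool (d*m = n))) =
    csum ?P (%n. of_nat d*g (real (d*m)) * of_bool (d*m = n))"
    by (intro nn_integral_cong) (auto simp: mult.commute)
   ultimately show "csum ?P (%n. g (real n)*(of_nat d * of_bool (d*m = n))) = of_nat d*g (real (d*m))"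
    by (simp add: nn_integral_cmult)
  qed
  finally show "csum ?P (%n. csum (cop DD) (%d. g (real n)*(of_nat d * of_bool (d*m = n)))) =
   csum (cop DD) (%d. of_nat d*g (real (d*m)))" .
 qed
 finally show ?thesis .
qed

theorem ZZ_eq: "ZZ = ennreal (pi^4/90*(zeta3*(PROD p:{p. ram p}. 1-1/real p^3)))"
proof -
 let ?E = "zeta3*(PROD p:{p. ram p}. 1-1/real p^3)"
 have E: "csum (cop DD) (%d. ennreal (1/real d^3)) = ennreal ?E"
  unfolding DD_def by (rule euler_factor_cubes[OF finite_ram]) (simp add: ram_prime)
 have "ZZ = csum {0<..} (%m. csum (cop DD) (%d. of_nat d*ennreal (1/real (d*m)^4)))"
  unfolding ZZ_def ideal_sum[of "%x. ennreal (1/x^4)"] ..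
 also have "... = csum {0<..} (%m. ennreal (1/real m^4)*ennreal ?E)"
  unfolding E[symmetric]
 proof (intro nn_integral_cong)
  fix m :: nat
  have "csum (cop DD) (%d. of_nat d*ennreal (1/real (d*m)^4)) =
   csum (cop DD) (%d. ennreal (1/real m^4)*ennreal (1/real d^3))"
  proof (rule nn_integral_cong)
   fix d assume "d:space (count_space (cop DD))"
   then have d: "d > 0" by (simp add: cop_def)
   have "of_nat d*ennreal (1/real (d*m)^4) = ennreal (real d*(1/real (d*m)^4))"
    by (simp add: ennreal_of_nat_eq_real_of_nat ennreal_mult[symmetric])
   also have "real d*(1/real (d*m)^4) = 1/real m^4*(1/real d^3)"
    using d by (simp add: power_mult_distrib field_simps eval_nat_numeral)
   also have "ennreal ... = ennreal (1/real m^4)*ennreal (1/real d^3)" by (rule ennreal_mult) auto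
   finally show "of_nat d*ennreal (1/real (d*m)^4) = ennreal (1/real m^4)*ennreal (1/real d^3)" .
  qed
  then show "csum (cop DD) (%d. of_nat d*ennreal (1/real (d*m)^4)) =
   ennreal (1/real m^4)*csum (cop DD) (%d. ennreal (1/real d^3))"
   by (simp add: nn_integral_cmult)
 qed
 also have "... = ennreal (pi^4/90)*ennreal ?E"
  using nn_integral_series[of "%n. 1/real n^4", OF zeta4] by (simp add: nn_integral_multc)
 also have "... = ennreal (pi^4/90*?E)" by (rule ennreal_mult'[symmetric]) simp
 finally show ?thesis .
qed

end

section \<open>The mass formula\<close>

definition cop_sum :: "nat => real => real" where
 "cop_sum D Y = (SUM d:{d:cop D. real d <= Y}. real d)"

lemma finite_cop: "finite {d:cop D. real d <= Y}"
 by (rule finite_subset[of _ "{..nat \<lfloor>Y\<rfloor>}"]) (auto simp: le_nat_iff le_floor_iff)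

lemma cop_sum_bounds:
 assumes "Y >= 0"
 shows "0 <= cop_sum D Y" "cop_sum D Y <= Y^2"
proof -
 show "0 <= cop_sum D Y" unfolding cop_sum_def by (rule sum_nonneg) simp
 have "{d:cop D. real d <= Y} <= {1..nat \<lfloor>Y\<rfloor>}" by (auto simp: cop_def le_nat_iff le_floor_iff)
 then have "card {d:cop D. real d <= Y} <= card {1..nat \<lfloor>Y\<rfloor>}" by (intro card_mono) auto
 then have c: "real (card {d:cop D. real d <= Y}) <= Y" using assms by (simp add: le_nat_iff le_floor_iff)
 have "cop_sum D Y <= real (card {d:cop D. real d <= Y})*Y" unfolding cop_sum_def by (rule sum_bounded_above) simp
 also have "... <= Y*Y" using c assms by (rule mult_right_mono)
 finally show "cop_sum D Y <= Y^2" by (simp add: power2_eq_square)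
qed

text \<open>Adding a prime p to S subtracts p times the sum up to Y/p, which contributes the factor
  1 - 1/p in the limit.\<close>

lemma cop_sum_asymptotics:
 assumes "finite S" "!!p. p:S ==> prime p"
 shows "((%Y. cop_sum (\<Prod>S) Y/Y^2) \<longlongrightarrow> 1/2*(PROD p:S. 1-1/real p)) at_top"
 using assms
proof (induction S)
 case empty
 have eq: "cop_sum 1 Y = of_int \<lfloor>Y\<rfloor>*(of_int \<lfloor>Y\<rfloor>+1)/2" if "Y >= 0" for Y
 proof -
  have "{d:cop 1. real d <= Y} = {1..nat \<lfloor>Y\<rfloor>}" using that by (auto simp: cop_def le_nat_iff le_floor_iff)
  moreover have "2*(SUM d=1..n. real d) = real n*(real n+1)" for n by (induction n) (auto simp: algebra_simps)
  ultimately show ?thesis unfolding cop_sum_def using that by (metis (no_types, lifting) nonzero_mult_div_cancel_left of_nat_nat zero_le_floor zero_neq_numeral)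
 qed
 have "((%Y::real. of_int \<lfloor>Y\<rfloor>*(of_int \<lfloor>Y\<rfloor>+1)/2/Y^2) \<longlongrightarrow> 1/2) at_top" by real_asymp
 moreover have "\<forall>\<^sub>F Y in at_top. of_int \<lfloor>Y\<rfloor>*(of_int \<lfloor>Y\<rfloor>+1)/2/Y^2 = cop_sum 1 Y/Y^2"
  using eventually_ge_at_top[of 0] by eventually_elim (subst eq, simp_all)
 ultimately show ?case using Lim_transform_eventually by auto
next
 case (insert p S)
 let ?D = "\<Prod>S"
 have p: "prime p" "p > 1" using insert prime_gt_1_nat by auto
 have cp: "coprime p ?D"
 proof (rule prod_coprime_right)
  fix q assume "q:S"
  then show "coprime p q" using insert(2) insert(4)[of q] primes_coprime[OF p(1), of q] by auto
 qed
 note sp = cop_split[OF p(1) cp]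
 have eq: "cop_sum (p*?D) Y = cop_sum ?D Y-real p*cop_sum ?D (Y/real p)" for Y
 proof -
  have "{d:cop ?D. real d <= Y} = {d:cop (p*?D). real d <= Y} Un (*) p ` {d:cop ?D. real d <= Y/real p}"
   using p by (subst sp(1)) (auto simp: field_simps)
  then have "cop_sum ?D Y = cop_sum (p*?D) Y+(SUM d:(*) p ` {d:cop ?D. real d <= Y/real p}. real d)"
   unfolding cop_sum_def using sp(2) by (simp only:) (subst sum.union_disjoint, auto simp: finite_cop)
  also have "(SUM d:(*) p ` {d:cop ?D. real d <= Y/real p}. real d) = real p*cop_sum ?D (Y/real p)"
   unfolding cop_sum_def using p by (subst sum.reindex) (auto simp: inj_on_def sum_distrib_left)
  finally show ?thesis by simp
 qed
 define c where "c = 1/2*(PROD p:S. 1-1/real p)"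
 have c: "((%Y. cop_sum ?D Y/Y^2) \<longlongrightarrow> c) at_top" unfolding c_def using insert by simp
 have "filterlim (%Y. Y/real p) at_top at_top" using p by real_asymp
 from filterlim_compose[OF c this]
 have "((%Y. cop_sum ?D Y/Y^2-1/real p*(cop_sum ?D (Y/real p)/(Y/real p)^2)) \<longlongrightarrow> c-1/real p*c) at_top"
  by (intro tendsto_intros c)
 moreover have "cop_sum ?D Y/Y^2-1/real p*(cop_sum ?D (Y/real p)/(Y/real p)^2) = cop_sum (p*?D) Y/Y^2" for Y
  unfolding eq using p by (simp add: diff_divide_distrib power_divide power2_eq_square)
 moreover have "c-1/real p*c = 1/2*(PROD p:insert p S. 1-1/real p)"
  unfolding c_def using insert by (simp add: algebra_simps)
 moreover have "\<Prod>(insert p S) = p*?D" using insert by simp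
 ultimately show ?case by (simp only:)
qed

context max_order
begin

section \<open>Ideals of bounded norm, counted in total and by class\<close>

definition ideals_upto :: "real => quat set set" where "ideals_upto X = {I:Ids. NI I <= X}"

lemma finite_ideals_upto: "finite (ideals_upto X)"
proof (rule finite_subset)
 show "ideals_upto X <= (UN n<=nat \<lfloor>X\<rfloor>. ideals n)"
 proof
  fix I assume I: "I:ideals_upto X"
  then obtain n :: nat where n: "NI I = real n" using NI_integral unfolding ideals_upto_def Ids_def by blast
  then have "n <= nat \<lfloor>X\<rfloor>" using I by (simp add: ideals_upto_def le_nat_iff le_floor_iff)
  then show "I:(UN n<=nat \<lfloor>X\<rfloor>. ideals n)" using I n by (auto simp: ideals_upto_def Ids_def ideals_def)
 qed
qed (simp add: finite_ideals)

lemma card_ideals_upto: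
 "ennreal (card (ideals_upto X)) = csum {0<..} (%m. ennreal (cop_sum DD (X/real m)))"
proof -
 have "ennreal (card (ideals_upto X)) = emeasure (count_space Ids) (ideals_upto X)"
  using finite_ideals_upto by (subst emeasure_count_space_finite) (auto simp: ideals_upto_def ennreal_of_nat_eq_real_of_nat)
 also have "... = csum Ids (%I. indicator (ideals_upto X) I)"
  by (rule nn_integral_indicator[symmetric]) (auto simp: ideals_upto_def)
 also have "... = csum Ids (%I. of_bool (NI I <= X))"
  by (intro nn_integral_cong) (auto simp: ideals_upto_def indicator_def)
 also have "... = csum {0<..} (%m. csum (cop DD) (%d. of_nat d * of_bool (real (d*m) <= X)))"
  by (rule ideal_sum)
 also have "... = csum {0<..} (%m. ennreal (cop_sum DD (X/real m)))"
 proof (rule nn_integral_cong)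
  fix m assume "m:space (count_space {0::nat<..})"
  then have m: "m > 0" by simp
  let ?S = "{d:cop DD. real d <= X/real m}"
  have "csum (cop DD) (%d. of_nat d * of_bool (real (d*m) <= X)) = (SUM d:?S. of_nat d * of_bool (real (d*m) <= X))"
   by (rule nn_integral_count_space'[OF finite_cop]) (use m in \<open>auto simp: field_simps\<close>)
  also have "... = (SUM d:?S. ennreal (real d))"
   using m by (intro sum.cong refl) (auto simp: field_simps ennreal_of_nat_eq_real_of_nat)
  also have "... = ennreal (cop_sum DD (X/real m))" unfolding cop_sum_def by (rule sum_ennreal) simp
  finally show "csum (cop DD) (%d. of_nat d * of_bool (real (d*m) <= X)) = ennreal (cop_sum DD (X/real m))" .
 qed
 finally show ?thesis .
qed

text \<open>Dominated convergence in m: \<open>cop_sum\<close> at Y is at most Y^2, so 1/m^2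
  dominates the normalised terms. The constant pi^2/12 is zeta(2)/2.\<close>

lemma ideals_upto_asymptotics:
 "(%n. real (card (ideals_upto (real n)))/real n^2) \<longlonglongrightarrow> pi^2/12*(PROD p:{p. ram p}. 1-1/real p)"
proof -
 define c where "c = 1/2*(PROD p:{p. ram p}. 1-1/real p)"
 have cl: "((%Y. cop_sum DD Y/Y^2) \<longlongrightarrow> c) at_top"
  unfolding c_def DD_def by (rule cop_sum_asymptotics[OF finite_ram]) (simp add: ram_prime)
 have "0 <= 1-1/real p" if "ram p" for p using ram_prime[OF that] prime_ge_1_nat[of p] by (simp add: divide_le_eq_1)
 then have c0: "c >= 0" unfolding c_def by (intro mult_nonneg_nonneg prod_nonneg) auto
 let ?u = "%n m. ennreal (cop_sum DD (real (Suc n)/real m)/real (Suc n)^2)"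
 have sq: "(%n. 1/real (Suc n)^2) sums (pi^2/6)" using inverse_squares_sums by (simp add: add.commute)
 have sqi: "csum {0<..} (%m. ennreal (a/real m^2)) = ennreal (a*(pi^2/6))" if "a >= 0" for a
  using sums_mult[OF sq, of a] that by (intro nn_integral_series) auto
 have "(%n. csum {0<..} (%m. ?u n m)) \<longlonglongrightarrow> (csum {0<..} (%m. ennreal (c/real m^2)))"
 proof (rule nn_integral_dominated_convergence[where w = "%m. ennreal (1/real m^2)"])
  show "AE m in count_space {0<..}. ?u n m <= ennreal (1/real m^2)" for n
  proof (rule AE_I2, rule ennreal_leI)
   fix m assume "m:space (count_space {0::nat<..})"
   then have m: "m > 0" by simp
   have "cop_sum DD (real (Suc n)/real m)/real (Suc n)^2 <= (real (Suc n)/real m)^2/real (Suc n)^2"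
    by (intro divide_right_mono cop_sum_bounds) auto
   also have "... = 1/real m^2" using m by (simp add: power_divide)
   finally show "cop_sum DD (real (Suc n)/real m)/real (Suc n)^2 <= 1/real m^2" .
  qed
  show "csum {0<..} (%m. ennreal (1/real m^2)) < \<infinity>" using sqi[of 1] by simp
  show "AE m in count_space {0<..}. (%n. ?u n m) \<longlonglongrightarrow> ennreal (c/real m^2)"
  proof (rule AE_I2, rule tendsto_ennrealI)
   fix m assume "m:space (count_space {0::nat<..})"
   then have m: "m > 0" by simp
   have "filterlim (%n. real (Suc n)/real m) at_top sequentially" using m by real_asymp
   from tendsto_divide[OF filterlim_compose[OF cl this] tendsto_const[of "real m^2"]]
   show "(%n. cop_sum DD (real (Suc n)/real m)/real (Suc n)^2) \<longlonglongrightarrow> c/real m^2"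
    using m by (simp add: power_divide)
  qed
 qed auto
 moreover have "csum {0<..} (%m. ?u n m) = ennreal (real (card (ideals_upto (real (Suc n))))/real (Suc n)^2)" for n
 proof -
  have "?u n m = ennreal (1/real (Suc n)^2)*ennreal (cop_sum DD (real (Suc n)/real m))" for m
   by (subst ennreal_mult[symmetric]) (auto simp: cop_sum_bounds)
  then have "csum {0<..} (%m. ?u n m) = ennreal (1/real (Suc n)^2)*ennreal (card (ideals_upto (real (Suc n))))"
   unfolding card_ideals_upto by (subst nn_integral_cmult[symmetric]) auto
  then show ?thesis by (simp add: ennreal_mult[symmetric])
 qed
 ultimately have "(%n. ennreal (real (card (ideals_upto (real (Suc n))))/real (Suc n)^2)) \<longlonglongrightarrow> ennreal (c*(pi^2/6))"
  using sqi[OF c0] by simp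
 then have "(%n. real (card (ideals_upto (real (Suc n))))/real (Suc n)^2) \<longlonglongrightarrow> c*(pi^2/6)"
  by (rule tendsto_ennrealD) (use c0 in \<open>auto intro!: mult_nonneg_nonneg always_eventually\<close>)
 then have "(%n. real (card (ideals_upto (real n)))/real n^2) \<longlonglongrightarrow> c*(pi^2/6)" by (rule LIMSEQ_imp_Suc)
 then show ?thesis by (simp add: c_def mult_ac)
qed

text \<open>The map x to x K sends the nonzero multipliers from K to O onto the integral ideals in
  the class of K, and its fibres are torsors under \<open>AutK K\<close>. The successor accounts for
  x = 0.\<close>

lemma card_ideals_upto_class:
 assumes K: "K:Reps" and X: "X >= 0"
 shows "Suc (card (AutK K)*card {I:ideals_upto X. rep I = K}) = card (colon Oo K Int cball 0 (sqrt (X/NI K)))"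
proof -
 note Kr = Reps_props[OF K]
 note L = lat_colon[OF rideal_O Kr(1)]
 let ?R = "sqrt (X/NI K)"
 define P where "P = colon Oo K Int cball 0 ?R - {0}"
 let ?J = "{I:ideals_upto X. rep I = K}" and ?fib = "%I. {x:P. (*.) x ` K = I}"
 have NK: "NI K > 0" by (rule NI_pos[OF Kr(1)])
 have fin: "finite (colon Oo K Int cball 0 ?R)" by (rule lat_finite[OF L bounded_cball])
 have nx: "norm x <= ?R \<longleftrightarrow> qn x*NI K <= X" for x
 proof -
  have "norm x = sqrt (qn x)" by (simp add: qn_norm)
  then show ?thesis using NK by (simp add: pos_le_divide_eq)
 qed
 have JP: "(*.) x ` K:?J" if x: "x:P" for x
 proof -
  have x: "x:colon Oo K" "norm x <= ?R" "x ~= 0" using x by (auto simp: P_def)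
  have A: "x:A" using colon_A[OF rideal_O Kr(1) x(1)] .
  have "(*.) x ` K <= Oo" using x(1) by (auto simp: colon_def)
  then show ?thesis using rideal_left[OF Kr(1) A x(3)] NI_left[OF Kr(1) A x(3)] rep_left[OF A x(3)] Kr(2) x(2)
   by (simp add: ideals_upto_def Ids_def nx)
 qed
 have cf: "card (?fib I) = card (AutK K)" if I: "I:?J" for I
 proof -
  have Ir: "rideal I" "I <= Oo" "NI I <= X" "rep I = K" using I by (auto simp: ideals_upto_def Ids_def)
  obtain a where a: "a:A" "a ~= 0" "K = (*.) a ` I" using rep_props(2)[OF Ir(1)] Ir(4) by blast
  define x0 where "x0 = qinv a"
  have x0: "x0:A" "x0 ~= 0" "(*.) x0 ` K = I" unfolding x0_def a(3) image_qmul using a A_inv by auto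
  have mem: "x:P" if "x ~= 0" "(*.) x ` K = I" for x
  proof -
   have "x:colon Oo K" using that Ir(2) by (auto simp: colon_def)
   moreover from this have "qn x*NI K <= X" using NI_left[OF Kr(1) colon_A[OF rideal_O Kr(1)] that(1)] that(2) Ir(3) by simp
   ultimately show ?thesis using that(1) nx by (simp add: P_def)
  qed
  have "?fib I = (*.) x0 ` AutK K"
  proof (intro set_eqI iffI)
   fix x assume x: "x:?fib I"
   have "(*.) (qinv x0*.x) ` K = (*.) (qinv x0) ` (*.) x0 ` K" using x x0(3) by (simp add: image_qmul[symmetric])
   then have "qinv x0*.x:AutK K" unfolding image_qmul using x0(2) by (simp add: AutK_def)
   then show "x:(*.) x0 ` AutK K" using x0(2) by (intro image_eqI[of _ _ "qinv x0*.x"]) simp_all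
  next
   fix x assume "x:(*.) x0 ` AutK K"
   then obtain u where u: "x = x0*.u" "u:AutK K" by blast
   have "(*.) x ` K = I" using u x0(3) unfolding u(1) image_qmul[symmetric] by (simp add: AutK_def)
   moreover have "u ~= 0" using AutK_norm(2)[OF Kr(1) u(2)] by auto
   ultimately show "x:?fib I" using mem u(1) x0(2) by simp
  qed
  moreover have "inj_on ((*.) x0) (AutK K)" using x0(2) by (auto simp: inj_on_def qmul_left_cancel)
  ultimately show ?thesis by (simp add: card_image)
 qed
 have "P = (UN I:?J. ?fib I)" using JP by blast
 then have "card P = card (UN I:?J. ?fib I)" by simp
 also have "... = (SUM I:?J. card (?fib I))"
 proof (rule card_UN_disjoint)
  have "finite P" unfolding P_def using fin by simp
  then show "ALL I:?J. finite (?fib I)" by simp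
 qed (use finite_ideals_upto in auto)
 also have "... = card ?J*card (AutK K)" using cf by simp
 finally have "card P = card ?J*card (AutK K)" .
 moreover have "0:colon Oo K Int cball 0 ?R" using lat_zero[OF L] NK X by simp
 then have "Suc (card P) = card (colon Oo K Int cball 0 ?R)" unfolding P_def by (rule card_Suc_Diff1[OF fin])
 ultimately show ?thesis by (simp add: mult.commute)
qed

text \<open>The ideals of norm at most X are counted again class by class. A class contributes
  asymptotically pi^2 X^2/(2 covol O) divided by the order of \<open>AutK K\<close>, because
  \<open>NI K\<close> cancels between the covolume of the multiplier lattice and the radius;
  comparison with the total count then gives the sum over classes.\<close>

theorem MM_eq: "MM = (PROD p:{p. ram p}. real p-1)/24"
proof -
 have co: "covol Oo > 0" by (rule covol_pos[OF lat_O])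
 have "card (ideals_upto X) = (SUM K:Reps. card {I:ideals_upto X. rep I = K})" for X
 proof -
  have "ideals_upto X = (UN K:Reps. {I:ideals_upto X. rep I = K})" unfolding Reps_def ideals_upto_def Ids_def by blast
  then have "card (ideals_upto X) = card (UN K:Reps. {I:ideals_upto X. rep I = K})" by simp
  then show ?thesis using finite_ideals_upto finite_Reps by (subst (asm) card_UN_disjoint) auto
 qed
 moreover have "(%n. real (card {I:ideals_upto (real n). rep I = K})/real n^2) \<longlonglongrightarrow> 1/real (card (AutK K))*(pi^2/(2*covol Oo))"
  if K: "K:Reps" for K
 proof -
  note Kr = Reps_props[OF K]
  let ?L = "colon Oo K" and ?a = "real (card (AutK K))"
  note L = lat_colon[OF rideal_O Kr(1)]
  obtain B where B: "fdom ?L B" using fdom_exists[OF L] by blast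
  have NK: "NI K > 0" by (rule NI_pos[OF Kr(1)])
  have a: "?a > 0" using card_AutK[OF Kr(1)] by simp
  have "((%R. real (card (?L Int cball 0 R))/R^4) \<longlongrightarrow> pi^2/2/covol ?L) at_top"
   using lattice_count_asymptotics[OF B lat_countable[OF L] lat_finite[OF L bounded_cball] emeasure_fdom[OF L B] covol_pos[OF L]]
   by (simp add: unit_ball_vol_4)
  moreover have "filterlim (%n. sqrt (real n/NI K)) at_top sequentially" using NK by real_asymp
  ultimately have "(%n. real (card (?L Int cball 0 (sqrt (real n/NI K))))/sqrt (real n/NI K)^4) \<longlonglongrightarrow> pi^2/2/covol ?L"
   by (rule filterlim_compose)
  moreover have "sqrt (real n/NI K)^4 = real n^2/NI K^2" for n
  proof -
   have "sqrt (real n/NI K)^4 = (sqrt (real n/NI K)^2)^2" by simp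
   then show ?thesis using NK by (simp add: power_divide)
  qed
  ultimately have "(%n. real (Suc (card (AutK K)*card {I:ideals_upto (real n). rep I = K}))/(real n^2/NI K^2)) \<longlonglongrightarrow> pi^2/2/covol ?L"
   by (simp add: card_ideals_upto_class[OF K])
  moreover have "(%n. 1/(real n^2/NI K^2)) \<longlonglongrightarrow> 0" using NK by real_asymp
  ultimately have "(%n. real (Suc (card (AutK K)*card {I:ideals_upto (real n). rep I = K}))/(real n^2/NI K^2)-1/(real n^2/NI K^2)) \<longlonglongrightarrow> pi^2/2/covol ?L-0"
   by (rule tendsto_diff)
  then have "(%n. 1/(?a*NI K^2)*(real (Suc (card (AutK K)*card {I:ideals_upto (real n). rep I = K}))/(real n^2/NI K^2)-1/(real n^2/NI K^2)))
   \<longlonglongrightarrow> 1/(?a*NI K^2)*(pi^2/2/covol ?L-0)" by (intro tendsto_mult_left)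
  moreover have "1/(?a*NI K^2)*(real (Suc (card (AutK K)*m))/(real n^2/NI K^2)-1/(real n^2/NI K^2)) = real m/real n^2" for m n
   unfolding diff_divide_distrib[symmetric] using a NK by (simp add: field_simps)
  moreover have "1/(?a*NI K^2)*(pi^2/2/covol ?L-0) = 1/?a*(pi^2/(2*covol Oo))"
   unfolding covol_colon[OF rideal_O Kr(1)] using NK co by (simp add: field_simps)
  ultimately show ?thesis by (simp only:)
 qed
 then have "(%n. SUM K:Reps. real (card {I:ideals_upto (real n). rep I = K})/real n^2) \<longlonglongrightarrow> (SUM K:Reps. 1/real (card (AutK K))*(pi^2/(2*covol Oo)))"
  by (rule tendsto_sum)
 ultimately have "(%n. real (card (ideals_upto (real n)))/real n^2) \<longlonglongrightarrow> MM*(pi^2/(2*covol Oo))"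
  by (simp add: MM_def sum_distrib_right sum_divide_distrib)
 from LIMSEQ_unique[OF this ideals_upto_asymptotics]
 have "MM*(pi^2/(2*(real DD/4))) = pi^2/12*(PROD p:{p. ram p}. 1-1/real p)" unfolding covol_O .
 then have "MM = real DD*(PROD p:{p. ram p}. 1-1/real p)/24" using DD_pos by (simp add: field_simps)
 also have "real DD*(PROD p:{p. ram p}. 1-1/real p) = (PROD p:{p. ram p}. real p*(1-1/real p))"
  unfolding DD_def by (simp add: prod.distrib)
 also have "... = (PROD p:{p. ram p}. real p-1)"
  using ram_prime prime_gt_0_nat by (intro prod.cong refl) (auto simp: field_simps)
 finally show ?thesis .
qed

end

theorem theorem6:
  fixes A Oo :: "quat set"
  assumes "definite_quat_alg A"
    and "is_maximal_order A Oo"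
  shows "(\<exists>F. fund_domain (SL2 Oo) F) \<and>
         (\<forall>F. fund_domain (SL2 Oo) F \<longrightarrow>
            emeasure hyp_measure F =
              ennreal (zeta3 * (\<Prod>p\<in>{p::nat. prime p \<and> ramified A p}.
                          (real p ^ 3 - 1) * (real p - 1)) / 11520))"
proof -
 interpret max_order A Oo using assms by unfold_locales
 interpret SL: kleinian "SL2 Oo" by (rule kleinian_SL2)
 have S: "{p::nat. prime p & ramified A p} = {p. ram p}" using ram_iff_ramified by auto
 let ?P = "PROD p:{p. ram p}. 1-1/real p^3" and ?M = "PROD p:{p. ram p}. real p-1"
 have Z: "ZZ < \<infinity>" unfolding ZZ_eq by simp
 have "real DD^3*?P = (PROD p:{p. ram p}. real p^3*(1-1/real p^3))"
  unfolding DD_def by (simp add: prod.distrib prod_power_distrib)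
 also have "... = (PROD p:{p. ram p}. real p^3-1)"
  using ram_prime prime_gt_0_nat by (intro prod.cong refl) (auto simp: field_simps)
 finally have D: "real DD^3*?P = (PROD p:{p. ram p}. real p^3-1)" .
 have M: "?M >= 0" using ram_prime prime_ge_1_nat by (intro prod_nonneg) auto
 have "emeasure hyp_measure F = ennreal (zeta3*(PROD p:{p. ram p}. (real p^3-1)*(real p-1))/11520)"
  if F: "fund_domain (SL2 Oo) F" for F
 proof -
  have "emeasure hyp_measure F = ennreal (12*covol Oo^3/pi^4*MM*(pi^4/90*(zeta3*?P)))"
   unfolding volume_identity[OF F Z] ZZ_eq using covol_pos[OF lat_O] M by (intro ennreal_mult'[symmetric]) (simp add: MM_eq)
  \<comment> \<open>With covol O = D/4 the denominator is 64 * 24 * 90 / 12 = 11520; the factor D^3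
    will turn each 1 - p^(-3) into p^3 - 1.\<close>
  also have "12*covol Oo^3/pi^4*MM*(pi^4/90*(zeta3*?P)) = zeta3*((real DD^3*?P)*?M)/11520"
   unfolding MM_eq covol_O by (simp add: power_divide)
  also have "(real DD^3*?P)*?M = (PROD p:{p. ram p}. (real p^3-1)*(real p-1))"
   unfolding D by (simp add: prod.distrib)
  finally show ?thesis .
 qed
 then show ?thesis using SL.dirichlet_fund_domain unfolding S by blast
qed

end
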